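(* Let $\mathbf Y=\{Y_n\}_{n\ge 0}$ be a branching process in i.i.d. random environment with one immigrant in each generation (BPIRE) whose random offspring generating function is geometric with probability 1, i.e. $F(s)=\frac{1}{1+e^{X}(1-s)}$ with $X=\log m(F)$, and which is weakly subcritical: $-\infty<\mathbf E[X]<0$ and there is a number $0<\beta<1$ such that $\mathbf E[Xe^{\beta X}]=0$. Let $\gamma:=\mathbf E[e^{\beta X}]$ and let $\mathbb P$ be the measure under which the environment is i.i.d. with law tilted by $\gamma^{-1}e^{\beta X}$. Assume that with respect to $\mathbb P$ the distribution of $X$ is nonlattice and belongs to the domain of attraction of a two-sided stable law with index $\alpha\in(1,2]$, and let $c_n=n^{1/\alpha}l_1(n)$ (with $l_1$ slowly varying) be an increasing sequence of positive numbers such that $S_n/c_n$ converges in distribution under $\mathbb P$ to this stable law. Let $\mathcal A_i(n)$, $0\le i\le n-1$, be the event that only the $(i,n)$-clan survives in $\mathbf Y$ at moment $n$. Then: 1) for any fixed $N\in\{1,2,\dots\}$ the limit $\lim_{n\to\infty}\mathbf P(\mathcal A_{n-N}(n))=:r_N$ exists and $r_N\in(0,\infty)$; 2) for any fixed $i$ there exists a constant $R_i\in(0,\infty)$ such that $$\lim_{n-i\to\infty}\gamma^{-(n-i)}(n-i)\,c_{n-i}\,\mathbf P(\mathcal A_i(n))=R_i ;$$ 3) there exists a constant $R\in(0,\infty)$ such that $$\lim_{\min(i,n-i)\to\infty}\gamma^{-(n-i)}(n-i)\,c_{n-i}\,\mathbf P(\mathcal A_i(n))=R .$$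
   Context: Setting. $\Delta$ is the space of probability measures on $\mathbb N_0=\{0,1,2,\dots\}$ with the total variation metric (a Polish space). $F$ is a random element of $\Delta$ and $F_1,F_2,\dots$ are independent copies of $F$ (the random environment). For a measure $F$ write $F(s)=\sum_{j\ge0}F(\{j\})s^j$ for its generating function, $m(F)=\sum_{j\ge1}jF(\{j\})$, $X=\log m(F)$. "Geometric with probability 1" means $F(s)=\frac{q}{1-ps}$ with random $p,q\in(0,1)$, $p+q=1$, so that $m(F)=p/q=e^X$ and $F(s)=\frac1{1+e^X(1-s)}$. The associated random walk is $S_0=0$, $S_n=X_1+\dots+X_n$, $X_n=\log m(F_n)$. The BPIRE $\mathbf Y=\{Y_n,\ n\ge0\}$: $Y_0=1$ and, given the environment $F_i=f_i$, $i\ge1$, $\mathbf Y$ is a Markov chain in which, given $Y_{n-1}=y_{n-1}$, $Y_n$ is distributed as $\xi_{n1}+\dots+\xi_{ny_{n-1}}+1$, where $\xi_{n1},\xi_{n2},\dots$ are i.i.d. with distribution $f_n$. That is, the individuals of generation $n-1$ first reproduce independently according to $f_n$, and afterwards one immigrant enters generation $n$. The single individual at time $0$ is regarded as the immigrant of generation $0$. The $(i,n)$-clan is the set of individuals alive at generation $n$ that are descendants of the immigrant which entered the population at generation $i$. Put $Y_n^-:=\xi_{n1}+\dots+\xi_{nY_{n-1}}$ (the population at time $n$ just before the immigrant of generation $n$ arrives). $\mathcal A_i(n)$ is the event that $Y_n^->0$ and all these $Y_n^-$ individuals belong to the $(i,n)$-clan. Change of measure. $\mathbb P$ (with expectation $\mathbb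 E$) is defined by $\mathbb E[\psi(F_1,\dots,F_n,Y_0,\dots,Y_n)]:=\gamma^{-n}\mathbf E[\psi(F_1,\dots,F_n,Y_0,\dots,Y_n)e^{\beta S_n}]$ for all $n$ and bounded measurable $\psi$. Under $\mathbb P$ the $X_n$ are i.i.d. with $\mathbb E[X]=\gamma^{-1}\mathbf E[Xe^{\beta X}]=0$ (which is why no centering is needed in the convergence of $S_n/c_n$). A two-sided stable law is one not concentrated on a half-line. Nonlattice means not concentrated on any set $a+h\mathbb Z$, $h>0$. *)

theory Defs
  imports "HOL-Probability.Probability"
begin

text \<open>
  The space of probability measures on the nonnegative integers. The evaluations
  \<open>f \<mapsto> f {j}\<close> generate the Borel sets of the total variation metric, so the latter are
  exactly the measurable sets of the following space.
\<close>

abbreviation offspring_laws :: "nat measure measure" where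
  "offspring_laws \<equiv> prob_algebra (count_space UNIV)"

definition gen_fun :: "nat measure \<Rightarrow> real \<Rightarrow> real" where
  "gen_fun f s = (\<Sum>j. measure f {j} * s ^ j)"

definition mean_offspring :: "nat measure \<Rightarrow> real" where
  "mean_offspring f = (\<Sum>j. real j * measure f {j})"

definition geometric_law :: "nat measure \<Rightarrow> bool" where
  "geometric_law f \<longleftrightarrow>
     (\<exists>p q. 0 < p \<and> p < 1 \<and> 0 < q \<and> q < 1 \<and> p + q = 1 \<and>
        (\<forall>s\<in>{0..1}. gen_fun f s = q / (1 - p * s)))"

text \<open>
  The environment is \<open>F 1, F 2, \<dots>\<close>, and \<open>\<xi> n j\<close> (for \<open>n, j \<ge> 1\<close>) is the number of children, in
  generation \<open>n\<close>, of the \<open>j\<close>-th individual of generation \<open>n - 1\<close>. The values \<open>F 0\<close>, \<open>\<xi> 0 j\<close> and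
  \<open>\<xi> n 0\<close> play no role. The last axiom says that, given the whole environment, the \<open>\<xi> n j\<close>
  are independent and \<open>\<xi> n j\<close> has distribution \<open>F n\<close>.
\<close>

definition env_seq :: "(nat \<Rightarrow> 'w \<Rightarrow> nat measure) \<Rightarrow> 'w \<Rightarrow> nat \<Rightarrow> nat measure" where
  "env_seq F \<omega> = (\<lambda>n\<in>{1..}. F n \<omega>)"

definition env_algebra :: "'w measure \<Rightarrow> (nat \<Rightarrow> 'w \<Rightarrow> nat measure) \<Rightarrow> 'w measure" where
  "env_algebra M F = vimage_algebra (space M) (env_seq F) (PiM {1..} (\<lambda>_. offspring_laws))"

locale bpire = prob_space M
  for M :: "'w measure" +
  fixes F :: "nat \<Rightarrow> 'w \<Rightarrow> nat measure"
    and \<xi> :: "nat \<Rightarrow> nat \<Rightarrow> 'w \<Rightarrow> nat"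
  assumes env_indep: "indep_vars (\<lambda>_. offspring_laws) F {1..}"
    and env_ident: "\<And>n. n \<ge> 1 \<Longrightarrow> distr M offspring_laws (F n) = distr M offspring_laws (F 1)"
    and offspring_measurable:
      "\<And>n j. n \<ge> 1 \<Longrightarrow> j \<ge> 1 \<Longrightarrow> \<xi> n j \<in> measurable M (count_space UNIV)"
    and offspring_given_env:
      "\<And>J k. finite J \<Longrightarrow> J \<subseteq> {1..} \<times> {1..} \<Longrightarrow>
         AE \<omega> in M.
           real_cond_exp M (env_algebra M F)
             (indicator {\<omega>' \<in> space M. \<forall>(n, j)\<in>J. \<xi> n j \<omega>' = k n j}) \<omega>
           = (\<Prod>(n, j)\<in>J. measure (F n \<omega>) {k n j})"

text \<open>
  A generation is represented by the list of its individuals, each one given by its clan label,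
  that is, by the generation in which the immigrant it descends from entered the population.
  In the following, \<open>x n j\<close> is the value of \<open>\<xi> n j\<close>.
\<close>

definition reproduce :: "(nat \<Rightarrow> nat) \<Rightarrow> nat list \<Rightarrow> nat list" where
  "reproduce y ls = concat (map (\<lambda>(j, l). replicate (y j) l) (List.enumerate 1 ls))"

primrec generation :: "(nat \<Rightarrow> nat \<Rightarrow> nat) \<Rightarrow> nat \<Rightarrow> nat list" where
  "generation x 0 = [0]"
| "generation x (Suc n) = reproduce (x (Suc n)) (generation x n) @ [Suc n]"

text \<open>Generation \<open>n \<ge> 1\<close> just before the immigrant of generation \<open>n\<close> arrives.\<close>

definition pre_generation :: "(nat \<Rightarrow> nat \<Rightarrow> nat) \<Rightarrow> nat \<Rightarrow> nat list" where
  "pre_generation x n = reproduce (x n) (generation x (n - 1))"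

definition Y :: "(nat \<Rightarrow> nat \<Rightarrow> 'w \<Rightarrow> nat) \<Rightarrow> nat \<Rightarrow> 'w \<Rightarrow> nat" where
  "Y \<xi> n \<omega> = length (generation (\<lambda>n j. \<xi> n j \<omega>) n)"

definition Y_minus :: "(nat \<Rightarrow> nat \<Rightarrow> 'w \<Rightarrow> nat) \<Rightarrow> nat \<Rightarrow> 'w \<Rightarrow> nat" where
  "Y_minus \<xi> n \<omega> = length (pre_generation (\<lambda>n j. \<xi> n j \<omega>) n)"

lemma length_reproduce: "length (reproduce y ls) = (\<Sum>j=1..length ls. y j)"
proof -
  have "length (concat (map (\<lambda>(j, l). replicate (y j) l) (List.enumerate a ls)))
          = (\<Sum>j=a..<a + length ls. y j)" for a
  proof (induction ls arbitrary: a)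
    case (Cons l ls)
    have "{a..<a + length (l # ls)} = insert a {Suc a..<Suc a + length ls}"
      by auto
    then show ?case using Cons[of "Suc a"] by simp
  qed simp
  moreover have "{1..<1 + length ls} = {1..length ls}" by auto
  ultimately show ?thesis unfolding reproduce_def by metis
qed

lemma Y_0: "Y \<xi> 0 \<omega> = 1"
  by (simp add: Y_def)

lemma Y_minus_eq: "n \<ge> 1 \<Longrightarrow> Y_minus \<xi> n \<omega> = (\<Sum>j=1..Y \<xi> (n - 1) \<omega>. \<xi> n j \<omega>)"
  by (simp add: Y_minus_def Y_def pre_generation_def length_reproduce)

lemma Y_rec: "n \<ge> 1 \<Longrightarrow> Y \<xi> n \<omega> = (\<Sum>j=1..Y \<xi> (n - 1) \<omega>. \<xi> n j \<omega>) + 1"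
  by (cases n) (simp_all add: Y_def length_reproduce)

definition only_clan_survives ::
    "'w measure \<Rightarrow> (nat \<Rightarrow> nat \<Rightarrow> 'w \<Rightarrow> nat) \<Rightarrow> nat \<Rightarrow> nat \<Rightarrow> 'w set" where
  "only_clan_survives M \<xi> i n =
     {\<omega> \<in> space M. Y_minus \<xi> n \<omega> > 0 \<and>
        (\<forall>l \<in> set (pre_generation (\<lambda>n j. \<xi> n j \<omega>) n). l = i)}"

definition X :: "(nat \<Rightarrow> 'w \<Rightarrow> nat measure) \<Rightarrow> nat \<Rightarrow> 'w \<Rightarrow> real" where
  "X F n \<omega> = ln (mean_offspring (F n \<omega>))"

definition S :: "(nat \<Rightarrow> 'w \<Rightarrow> nat measure) \<Rightarrow> nat \<Rightarrow> 'w \<Rightarrow> real" where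
  "S F n \<omega> = (\<Sum>k=1..n. X F k \<omega>)"

text \<open>
  The tilted measure is determined by its values on functionals of the first \<open>n\<close> generations, for
  every \<open>n\<close>; on these it has density \<open>\<gamma>\<^sup>-\<^sup>n exp (\<beta> S\<^sub>n)\<close> with respect to the original
  measure. On an arbitrary underlying probability space there need not be one measure with all
  these restrictions, hence the parameter \<open>n\<close>.
\<close>

definition tilted ::
    "'w measure \<Rightarrow> (nat \<Rightarrow> 'w \<Rightarrow> nat measure) \<Rightarrow> real \<Rightarrow> real \<Rightarrow> nat \<Rightarrow> 'w measure" where
  "tilted M F \<beta> \<gamma> n = density M (\<lambda>\<omega>. ennreal (exp (\<beta> * S F n \<omega>) / \<gamma> ^ n))"

definition nonlattice :: "real measure \<Rightarrow> bool" where
  "nonlattice \<nu> \<longleftrightarrow> \<not> (\<exists>a h. h > 0 \<and> (AE x in \<nu>. x \<in> {a + h * of_int k | k. True}))"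

definition stable_law :: "real \<Rightarrow> real measure \<Rightarrow> bool" where
  "stable_law \<alpha> \<mu> \<longleftrightarrow>
     real_distribution \<mu> \<and> \<not> (\<exists>a. AE x in \<mu>. x = a) \<and>
     (\<forall>a>0. \<forall>b>0. \<exists>d.
        distr (\<mu> \<Otimes>\<^sub>M \<mu>) borel (\<lambda>(x, y). a * x + b * y)
        = distr \<mu> borel (\<lambda>x. (a powr \<alpha> + b powr \<alpha>) powr (1 / \<alpha>) * x + d))"

definition two_sided :: "real measure \<Rightarrow> bool" where
  "two_sided \<mu> \<longleftrightarrow> \<not> (\<exists>a. AE x in \<mu>. x \<ge> a) \<and> \<not> (\<exists>a. AE x in \<mu>. x \<le> a)"

definition in_domain_of_attraction :: "real measure \<Rightarrow> real measure \<Rightarrow> bool" where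
  "in_domain_of_attraction \<nu> \<mu> \<longleftrightarrow>
     (\<exists>a b. (\<forall>n. a n > 0) \<and>
        weak_conv_m (\<lambda>n. distr (PiM {..<n} (\<lambda>_. \<nu>)) borel
                           (\<lambda>x. ((\<Sum>k<n. x k) - b n) / a n)) \<mu>)"

definition slowly_varying :: "(real \<Rightarrow> real) \<Rightarrow> bool" where
  "slowly_varying l \<longleftrightarrow>
     l \<in> borel_measurable borel \<and> (\<forall>\<^sub>F x in at_top. l x > 0) \<and>
     (\<forall>t>0. ((\<lambda>x. l (t * x) / l x) \<longlongrightarrow> 1) at_top)"

end

theory Submission
  imports Defs
begin

text \<open>
  For geometric offspring the extinction probability \<open>F\<^sub>k\<^sub>,\<^sub>n(0)\<close> of the clan founded at time \<open>k\<close> satisfies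
  \<open>1 / (1 - F\<^sub>k\<^sub>,\<^sub>n(0)) = \<Sum>\<^sub>j exp (S\<^sub>k - S\<^sub>j)\<close>, and the product over the clans telescopes. Reading the
  environment backwards from time \<open>n\<close> gives, with \<open>m = n - i\<close>,
  \<open>P(A\<^sub>i(n)) = E [exp T\<^sub>m / (A\<^sub>m (A\<^sub>m + V\<^sub>i exp T\<^sub>m))]\<close>, where \<open>T\<close> is a random walk, \<open>A\<^sub>m = \<Sum>\<^sub>j\<^sub><\<^sub>m exp T\<^sub>j\<close>
  and \<open>V\<^sub>i\<close> is independent of \<open>T\<close> and converges in law to an a.s. finite exponential functional.
  After the change of measure the walk is centred and attracted to a two-sided stable law, and the
  functional is only charged by paths whose maximum stays bounded. Spitzer's identity and the local limit
  theorem show that the walk killed above a level has a measure of order \<open>1 / (n c\<^sub>n)\<close> on each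
  compact set. By the summability of this sequence the functional is determined, up to a small
  error, by the first and the last few steps of the path, which gives the limit for a fixed value of
  \<open>V\<^sub>i\<close>. Monotonicity and a Lipschitz estimate in \<open>V\<^sub>i\<close> then allow averaging over \<open>V\<^sub>i\<close>.
\<close>

abbreviation (input) limseq :: "(nat => 'a::topological_space) => 'a => bool" ("((_)/ ----> (_))" [60, 60] 60)
  where "f ----> l == f \<longlonglongrightarrow> l"
abbreviation (input) "bmeas == borel_measurable"
abbreviation (input) "en == ennreal"
abbreviation (input) "cor == complex_of_real"

lemma nn_integral_nat_split:
 fixes N :: "'a => nat"
 assumes N [measurable]: "N \<in> measurable M (count_space UNIV)" and f: "!!y. f y \<in> bmeas M"
 shows "(\<integral>\<^sup>+om. f (N om) om \<partial>M) = (\<Sum>n. \<integral>\<^sup>+om. of_bool (N om = n) * f n om \<partial>M)"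
proof -
 note [measurable] = f
 have "f (N om) om = (\<Sum>n. of_bool (N om = n) * f n om)" for om
  by (subst suminf_finite[of "{N om}"]) auto
 then have "(\<integral>\<^sup>+om. f (N om) om \<partial>M) = (\<integral>\<^sup>+om. (\<Sum>n. of_bool (N om = n) * f n om) \<partial>M)" by simp
 also have "... = (\<Sum>n. \<integral>\<^sup>+om. of_bool (N om = n) * f n om \<partial>M)"
 proof (rule nn_integral_suminf)
  fix n :: nat
  have [measurable]: "(%y. of_bool (y = n) :: ennreal) \<in> bmeas (count_space UNIV)" by simp
  show "(%om. of_bool (N om = n) * f n om) \<in> bmeas M" by measurable
 qed
 finally show ?thesis .
qed

lemma nn_integral_eq_on_values:
 fixes Yv :: "'a => 'c::countable"
 assumes Y: "Yv \<in> measurable M (count_space UNIV)"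
  and f: "!!y. f y \<in> bmeas M" "!!y. g y \<in> bmeas M"
  and eq: "!!y. (\<integral>\<^sup>+om. of_bool (Yv om = y) * f y om \<partial>M) = (\<integral>\<^sup>+om. of_bool (Yv om = y) * g y om \<partial>M)"
 shows "(\<integral>\<^sup>+om. f (Yv om) om \<partial>M) = (\<integral>\<^sup>+om. g (Yv om) om \<partial>M)"
proof -
 have eqn: "(\<integral>\<^sup>+om. of_bool (to_nat (Yv om) = n) * f (from_nat n) om \<partial>M) = (\<integral>\<^sup>+om. of_bool (to_nat (Yv om) = n) * g (from_nat n) om \<partial>M)" for n
 proof (cases "\<exists>y::'c. to_nat y = n")
  case True
  then obtain y :: 'c where y: "n = to_nat y" by auto
  show ?thesis unfolding y using eq[of y] by simp
 next
  case False
  then have "to_nat (Yv om) ~= n" for om by auto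
  then show ?thesis by simp
 qed
 have N: "(%om. to_nat (Yv om)) \<in> measurable M (count_space UNIV)" using Y by (rule measurable_compose) simp
 show ?thesis
  using nn_integral_nat_split[OF N, of "%n. f (from_nat n)"] nn_integral_nat_split[OF N, of "%n. g (from_nat n)"] f eqn by simp
qed

lemma reproduce_Cons: "reproduce y (l # ls) = replicate (y 1) l @ reproduce (%j. y (Suc j)) ls"
proof -
 have "concat (map (%(j, l). replicate (y j) l) (List.enumerate (Suc a) ls))
   = concat (map (%(j, l). replicate (y (Suc j)) l) (List.enumerate a ls))" for a
  by (induction ls arbitrary: a) auto
 then show ?thesis by (simp add: reproduce_def)
qed

lemma reproduce_Nil [simp]: "reproduce y [] = []" by (simp add: reproduce_def)

lemma reproduce_cong: "(!!j. j \<in> {1..length ls} ==> y j = y' j) ==> reproduce y ls = reproduce y' ls"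
proof (induction ls arbitrary: y y')
 case (Cons l ls)
 have "reproduce (%j. y (Suc j)) ls = reproduce (%j. y' (Suc j)) ls" by (rule Cons.IH) (use Cons.prems in auto)
 then show ?case using Cons.prems[of 1] by (simp add: reproduce_Cons)
qed simp

lemma prod_list_reproduce:
 fixes s :: "nat => 'a::comm_monoid_mult"
 shows "prod_list (map s (reproduce y ls)) = (\<Prod>j=1..length ls. s (ls ! (j-1))^y j)"
proof (induction ls arbitrary: y)
 case (Cons l ls)
 have "(\<Prod>j=1..length (l # ls). s ((l # ls) ! (j-1))^y j)
   = s l^y 1*(\<Prod>j\<in>{Suc 1..Suc (length ls)}. s ((l # ls) ! (j-1))^y j)"
  by (subst prod.atLeast_Suc_atMost) auto
 also have "(\<Prod>j\<in>{Suc 1..Suc (length ls)}. s ((l # ls) ! (j-1))^y j) = (\<Prod>j=1..length ls. s (ls ! (j-1))^y (Suc j))"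
  unfolding prod.shift_bounds_cl_Suc_ivl by (intro prod.cong) (auto simp: nth_Cons')
 finally show ?case by (simp add: reproduce_Cons Cons.IH prod_list_replicate)
qed simp

lemma prod_list_nth: "prod_list (map s ls) = (\<Prod>j=1..length ls. s (ls ! (j-1)))" for s :: "nat => 'a::comm_monoid_mult"
proof -
 have "prod_list (map s ls) = (\<Prod>j<length ls. s (ls ! j))" by (simp add: prod.list_conv_set_nth lessThan_atLeast0)
 also have "... = (\<Prod>j=1..length ls. s (ls ! (j-1)))"
  by (rule prod.reindex_bij_witness[of _ "%j. j-1" Suc]) auto
 finally show ?thesis .
qed

definition prob_law :: "nat measure => bool" where "prob_law f \<longleftrightarrow> prob_space f \<and> sets f = UNIV"

lemma prob_law_space: "f \<in> space offspring_laws ==> prob_law f"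
 by (auto simp: prob_law_def space_prob_algebra)

lemma prob_law_sums: assumes "prob_law f" shows "(%j. measure f {j}) sums 1"
proof -
 interpret prob_space f using assms by (simp add: prob_law_def)
 have sp: "space f = UNIV" using assms sets.top[of f] sets.sets_into_space by (auto simp: prob_law_def)
 have "(%j. measure f {j}) sums measure f (\<Union>j. {j})"
  by (intro finite_measure_UNION) (use assms in \<open>auto simp: prob_law_def disjoint_family_on_def\<close>)
 then show ?thesis using prob_space sp by simp
qed

lemma gen_fun_sums:
 assumes f: "prob_law f" and s: "0<=s" "s<=1"
 shows "(%j. measure f {j} * s^j) sums gen_fun f s" "0<=gen_fun f s" "gen_fun f s<=1"
proof -
 have b: "norm (measure f {j} * s^j)<=measure f {j}" for j
  using s mult_left_mono[OF power_le_one[of s j], of "measure f {j}"] by (simp add: abs_mult)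
 have sm: "summable (%j. measure f {j} * s^j)"
  by (rule summable_comparison_test[OF _ sums_summable[OF prob_law_sums[OF f]]]) (use b in auto)
 then show "(%j. measure f {j} * s^j) sums gen_fun f s" by (simp add: gen_fun_def summable_sums)
 show "0<=gen_fun f s" unfolding gen_fun_def using s by (intro suminf_nonneg sm) auto
 have "gen_fun f s<=(\<Sum>j. measure f {j})" unfolding gen_fun_def
  by (rule suminf_le[OF _ sm sums_summable[OF prob_law_sums[OF f]]]) (use b in \<open>auto simp: abs_le_iff\<close>)
 then show "gen_fun f s<=1" using sums_unique[OF prob_law_sums[OF f]] by simp
qed

lemma gen_fun_1: "prob_law f ==> gen_fun f 1 = 1"
 using gen_fun_sums(1)[of f 1] prob_law_sums[of f] by (auto dest: sums_unique2)

context bpire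
begin

abbreviation "env \<equiv> env_algebra M F"

lemma F_measurable: "n>=1 ==> F n \<in> measurable M offspring_laws"
 using env_indep by (auto simp: indep_vars_def2)

lemma env_seq_measurable: "env_seq F \<in> measurable M (PiM {1..} (%_. offspring_laws))"
 unfolding env_seq_def by (rule measurable_restrict) (use F_measurable in auto)

lemma F_env_measurable: assumes "n>=1" shows "F n \<in> measurable env offspring_laws"
proof -
 have e: "env_seq F \<in> measurable env (PiM {1..} (%_. offspring_laws))"
  unfolding env_algebra_def
  by (rule measurable_vimage_algebra1) (use measurable_space[OF env_seq_measurable] in auto)
 have "(%om. env_seq F om n) \<in> measurable env offspring_laws"
  by (rule measurable_compose[OF e measurable_component_singleton]) (use assms in auto)
 then show ?thesis using assms by (simp add: env_seq_def)
qed

lemma subalg_env: "subalgebra M env"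
 unfolding subalgebra_def env_algebra_def
 using env_seq_measurable by (auto simp: sets_vimage_algebra2 measurable_space dest: measurable_sets)

lemma env_M: "H \<in> bmeas env ==> H \<in> bmeas M"
 by (rule measurable_from_subalg[OF subalg_env])

lemma F_prob_law: "n>=1 ==> om \<in> space M ==> prob_law (F n om)"
 by (rule prob_law_space) (rule measurable_space[OF F_measurable])

lemma measure_F_measurable: assumes "n>=1" shows "(%om. measure (F n om) {j}) \<in> bmeas env"
proof -
 have "(%f. measure f {j}) \<in> bmeas (subprob_algebra (count_space UNIV))" by (rule measurable_measure_subprob_algebra) simp
 moreover have "F n \<in> measurable env (subprob_algebra (count_space UNIV))"
  by (rule measurable_prob_algebraD[OF F_env_measurable[OF assms]])
 ultimately show ?thesis by (rule measurable_compose_rev)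
qed

lemma gen_fun_measurable:
 assumes "n>=1" and [measurable]: "s \<in> bmeas env"
 shows "(%om. gen_fun (F n om) (s om)) \<in> bmeas env"
proof -
 note [measurable] = measure_F_measurable[OF assms(1)]
 show ?thesis unfolding gen_fun_def by measurable
qed

definition ind :: "(nat \<times> nat) set => (nat => nat => nat) => 'w => ennreal" where
 "ind J k om = of_bool (\<forall>(n, j)\<in>J. \<xi> n j om = k n j)"

definition fpr :: "(nat \<times> nat) set => (nat => nat => nat) => 'w => ennreal" where
 "fpr J k om = (\<Prod>(n, j)\<in>J. en (measure (F n om) {k n j}))"

lemma ind_measurable:
 assumes "finite J" "J \<subseteq> {1..} \<times> {1..}"
 shows "ind J k \<in> bmeas M"
proof -
 have "(%om. \<Prod>p\<in>J. of_bool (\<xi> (fst p) (snd p) om = k (fst p) (snd p)) :: ennreal) \<in> bmeas M"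
 proof (rule borel_measurable_prod_ennreal)
  fix p assume "p \<in> J"
  then have [measurable]: "\<xi> (fst p) (snd p) \<in> measurable M (count_space UNIV)" using assms by (intro offspring_measurable) auto
  have [measurable]: "(%y. of_bool (y = k (fst p) (snd p)) :: ennreal) \<in> bmeas (count_space UNIV)" by simp
  show "(%om. of_bool (\<xi> (fst p) (snd p) om = k (fst p) (snd p)) :: ennreal) \<in> bmeas M" by measurable
 qed
 moreover have "(\<Prod>p\<in>J. of_bool (\<xi> (fst p) (snd p) om = k (fst p) (snd p)) :: ennreal) = ind J k om" for om
  using assms(1) unfolding ind_def by induction (auto simp: case_prod_beta)
 ultimately show ?thesis by simp
qed

lemma fpr_measurable: "J \<subseteq> {1..} \<times> {1..} ==> fpr J k \<in> bmeas env"
 unfolding fpr_def case_prod_beta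
 by (intro borel_measurable_prod_ennreal measurable_compose[OF measure_F_measurable measurable_ennreal]) auto

lemma offspring_base:
 assumes H: "H \<in> bmeas env" and J: "finite J" "J \<subseteq> {1..} \<times> {1..}"
 shows "(\<integral>\<^sup>+om. H om * ind J k om \<partial>M) = (\<integral>\<^sup>+om. H om * fpr J k om \<partial>M)"
proof -
 interpret finite_measure_subalgebra M env by unfold_locales (rule subalg_env)
 define B where "B = {om' \<in> space M. \<forall>(n, j)\<in>J. \<xi> n j om' = k n j}"
 have indB: "ind J k om = en (indicator B om)" if "om \<in> space M" for om using that by (auto simp: ind_def B_def)
 have "(%om. ind J k om) -` {1} \<inter> space M \<in> sets M" using ind_measurable[OF J] by (intro measurable_sets) auto
 also have "(%om. ind J k om) -` {1} \<inter> space M = B" by (auto simp: ind_def B_def)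
 finally have [measurable]: "B \<in> sets M" .
 have 1: "AE om in M. nn_cond_exp M env (%om. en (- indicator B om)) om = 0"
 proof -
  have "(%om. en (- indicator B om)) = (%_. 0)" by (auto simp: indicator_def ennreal_neg)
  then show ?thesis using nn_cond_exp_F_meas[of "%_. 0"] by auto
 qed
 have 2: "AE om in M. nn_cond_exp M env (%om. en (indicator B om)) om <= nn_cond_exp M env (%_. 1) om"
  by (rule nn_cond_exp_mono) (auto simp: indicator_def)
 have 3: "AE om in M. nn_cond_exp M env (%_. 1) om = 1" using nn_cond_exp_F_meas[of "%_. 1"] by auto
 have 4: "AE om in M. nn_cond_exp M env (%om. en (indicator B om)) om = fpr J k om"
  using 1 2 3 offspring_given_env[OF J, of k]
 proof eventually_elim
  case (elim om)
  have "nn_cond_exp M env (%om. en (indicator B om)) om < \<top>" using elim(2,3) by (auto intro: le_less_trans)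
  then have "nn_cond_exp M env (%om. en (indicator B om)) om = en (enn2real (nn_cond_exp M env (%om. en (indicator B om)) om))" by simp
  also have "enn2real (nn_cond_exp M env (%om. en (indicator B om)) om) = (\<Prod>(n, j)\<in>J. measure (F n om) {k n j})"
   using elim(1,4) by (simp add: real_cond_exp_def B_def)
  also have "ennreal ... = fpr J k om" unfolding fpr_def case_prod_beta by (subst prod_ennreal) auto
  finally show ?case .
 qed
 have "(\<integral>\<^sup>+om. H om * ind J k om \<partial>M) = (\<integral>\<^sup>+om. H om * en (indicator B om) \<partial>M)"
  by (intro nn_integral_cong) (simp add: indB)
 also have "... = (\<integral>\<^sup>+om. H om * nn_cond_exp M env (%om. en (indicator B om)) om \<partial>M)"
  by (rule nn_cond_exp_intg[symmetric]) (use H in auto)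
 also have "... = (\<integral>\<^sup>+om. H om * fpr J k om \<partial>M)"
  by (intro nn_integral_cong_AE, use 4 in eventually_elim) simp
 finally show ?thesis .
qed

abbreviation "gen k om \<equiv> generation (%n j. \<xi> n j om) k"
abbreviation "xrow n r om \<equiv> map (%j. \<xi> n j om) [1..<Suc r]"

lemma xrow_measurable: assumes "n>=1" shows "xrow n r \<in> measurable M (count_space UNIV)"
proof (induction r)
 case (Suc r)
 have "(%om. (%x om. (%y om. x @ [y]) (\<xi> n (Suc r) om) om) (xrow n r om) om) \<in> measurable M (count_space UNIV)"
  by (rule measurable_compose_countable[OF measurable_compose_countable[OF _ offspring_measurable] Suc]) (use assms in auto)
 then show ?case by simp
qed simp

lemma reproduce_xrow: "reproduce (%j. \<xi> n j om) ls = reproduce (%j. xrow n (length ls) om ! (j-1)) ls"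
 by (rule reproduce_cong) (auto simp: nth_append simp del: upt_Suc)

lemma gen_measurable: "gen k \<in> measurable M (count_space UNIV)"
proof (induction k)
 case (Suc k)
 have "(%om. (%ls om. (%y om. reproduce (%j. y ! (j-1)) ls @ [Suc k]) (xrow (Suc k) (length ls) om) om) (gen k om) om) \<in> measurable M (count_space UNIV)"
  by (rule measurable_compose_countable[OF measurable_compose_countable[OF _ xrow_measurable] Suc]) auto
 then show ?case unfolding generation.simps reproduce_xrow .
qed simp

lemma of_bool_measurable: "Yv \<in> measurable M (count_space UNIV) ==> (%om. of_bool (Yv om = y) :: ennreal) \<in> bmeas M"
 by (rule measurable_compose[of Yv M "count_space UNIV" "%x. of_bool (x = y)"]) auto

lemma past_indep_future:
 assumes H: "H \<in> bmeas env" and J: "finite J" "J \<subseteq> {Suc k..} \<times> {1..}"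
 shows "(\<integral>\<^sup>+om. H om * of_bool (gen k om = ls) * ind J ka om \<partial>M) = (\<integral>\<^sup>+om. H om * of_bool (gen k om = ls) * fpr J ka om \<partial>M)"
 using H J
proof (induction k arbitrary: H J ls ka)
 case 0
 have "J \<subseteq> {1..} \<times> {1..}" using 0 by auto
 from offspring_base[OF 0(1,2) this, of ka] show ?case by (cases "ls = [0]") auto
next
 case (Suc k)
 define Yv where "Yv om = (gen k om, xrow (Suc k) (length (gen k om)) om)" for om
 define g where "g ls y = reproduce (%j. y ! (j-1)) ls @ [Suc k]" for ls y
 have gen: "gen (Suc k) om = g (fst (Yv om)) (snd (Yv om))" for om
  unfolding generation.simps reproduce_xrow Yv_def g_def fst_conv snd_conv ..
 have Yv: "Yv \<in> measurable M (count_space UNIV)"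
 proof -
  have "(%om. (%ls om. (%y om. (ls, y)) (xrow (Suc k) (length ls) om) om) (gen k om) om) \<in> measurable M (count_space UNIV)"
   by (rule measurable_compose_countable[OF measurable_compose_countable[OF _ xrow_measurable] gen_measurable]) auto
  then show ?thesis by (simp add: Yv_def[abs_def])
 qed
 have J1: "J \<subseteq> {1..} \<times> {1..}" using Suc.prems by auto
 note [measurable] = env_M[OF Suc.prems(1)] ind_measurable[OF Suc.prems(2) J1] env_M[OF fpr_measurable[OF J1]]
 have "(\<integral>\<^sup>+om. H om * of_bool (g (fst (Yv om)) (snd (Yv om)) = ls) * ind J ka om \<partial>M)
   = (\<integral>\<^sup>+om. H om * of_bool (g (fst (Yv om)) (snd (Yv om)) = ls) * fpr J ka om \<partial>M)"
 proof (rule nn_integral_eq_on_values[OF Yv, where f = "%z om. H om * of_bool (g (fst z) (snd z) = ls) * ind J ka om"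
    and g = "%z om. H om * of_bool (g (fst z) (snd z) = ls) * fpr J ka om"])
  fix z :: "nat list \<times> nat list"
  obtain l0 y where z: "z = (l0, y)" by (cases z)
  define J0 where "J0 = {Suc k} \<times> {1..length l0}"
  define ka0 where "ka0 = (%(n::nat) j::nat. y ! (j-1))"
  define ka1 where "ka1 = (%n j. if n = Suc k then y ! (j-1) else ka n j)"
  have J0: "finite J0" "J0 \<subseteq> {Suc k..} \<times> {1..}" "finite (J \<union> J0)" "J \<union> J0 \<subseteq> {Suc k..} \<times> {1..}" "J \<inter> J0 = {}"
   using Suc.prems by (auto simp: J0_def)
  have eqv: "of_bool (Yv om = z) = of_bool (length y = length l0)*(of_bool (gen k om = l0) * ind J0 ka0 om)" for om
  proof -
   have "xrow (Suc k) (length l0) om = y \<longleftrightarrow> length y = length l0 \<and> (\<forall>j\<in>{1..length l0}. \<xi> (Suc k) j om = y ! (j-1))"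
   proof
    assume "length y = length l0 \<and> (\<forall>j\<in>{1..length l0}. \<xi> (Suc k) j om = y ! (j-1))"
    then show "xrow (Suc k) (length l0) om = y" by (intro nth_equalityI) (auto simp del: upt_Suc)
   next
    assume "xrow (Suc k) (length l0) om = y"
    then show "length y = length l0 \<and> (\<forall>j\<in>{1..length l0}. \<xi> (Suc k) j om = y ! (j-1))"
     by (auto simp del: upt_Suc)
   qed
   then show ?thesis by (auto simp: z Yv_def ind_def J0_def ka0_def simp del: upt_Suc)
  qed
  have n0: "ka1 n j = ka n j" if "(n, j) \<in> J" for n j using that Suc.prems(3) by (auto simp: ka1_def)
  have n1: "ka1 n j = ka0 n j" if "(n, j) \<in> J0" for n j using that by (auto simp: ka1_def J0_def ka0_def)
  have ii: "ind J0 ka0 om * ind J ka om = ind (J \<union> J0) ka1 om" for om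
  proof -
   have "(\<forall>(n, j)\<in>J. \<xi> n j om = ka1 n j) = (\<forall>(n, j)\<in>J. \<xi> n j om = ka n j)"
    "(\<forall>(n, j)\<in>J0. \<xi> n j om = ka1 n j) = (\<forall>(n, j)\<in>J0. \<xi> n j om = ka0 n j)"
    by (intro ball_cong; use n0 n1 in auto)+
   then show ?thesis by (simp add: ind_def ball_Un)
  qed
  have ff: "fpr (J \<union> J0) ka1 om = fpr J ka om * fpr J0 ka0 om" for om
   unfolding fpr_def prod.union_disjoint[OF Suc.prems(2) J0(1,5)] using n0 n1
   by (intro arg_cong2[where f = "(*)"] prod.cong) auto
  let ?b = "of_bool (length y = length l0) * of_bool (g l0 y = ls) :: ennreal"
  have Hf: "(%om. H om * fpr J ka om) \<in> bmeas env"
   using Suc.prems(1) fpr_measurable[OF J1] by (rule borel_measurable_times_ennreal)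
  have "(\<integral>\<^sup>+om. of_bool (Yv om = z)*(H om * of_bool (g (fst z) (snd z) = ls) * ind J ka om) \<partial>M)
   = (\<integral>\<^sup>+om. ?b*(H om * of_bool (gen k om = l0) * ind (J \<union> J0) ka1 om) \<partial>M)"
   unfolding eqv ii[symmetric] by (simp only: z fst_conv snd_conv ac_simps)
  also have "... = ?b*(\<integral>\<^sup>+om. H om * of_bool (gen k om = l0) * ind (J \<union> J0) ka1 om \<partial>M)"
   by (auto simp: of_bool_def)
  also have "... = ?b*(\<integral>\<^sup>+om. H om * of_bool (gen k om = l0) * fpr (J \<union> J0) ka1 om \<partial>M)"
   by (subst Suc.IH[OF Suc.prems(1) J0(3,4)]) simp
  also have "... = ?b*(\<integral>\<^sup>+om. (H om * fpr J ka om) * of_bool (gen k om = l0) * fpr J0 ka0 om \<partial>M)"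
   unfolding ff by (simp add: ac_simps)
  also have "... = ?b*(\<integral>\<^sup>+om. (H om * fpr J ka om) * of_bool (gen k om = l0) * ind J0 ka0 om \<partial>M)"
   by (subst Suc.IH[OF Hf J0(1,2)]) simp
  also have "... = (\<integral>\<^sup>+om. ?b*((H om * fpr J ka om) * of_bool (gen k om = l0) * ind J0 ka0 om) \<partial>M)"
   by (auto simp: of_bool_def)
  also have "... = (\<integral>\<^sup>+om. of_bool (Yv om = z)*(H om * of_bool (g (fst z) (snd z) = ls) * fpr J ka om) \<partial>M)"
   unfolding eqv by (simp only: z fst_conv snd_conv ac_simps)
  finally show "(\<integral>\<^sup>+om. of_bool (Yv om = z)*(H om * of_bool (g (fst z) (snd z) = ls) * ind J ka om) \<partial>M)
   = (\<integral>\<^sup>+om. of_bool (Yv om = z)*(H om * of_bool (g (fst z) (snd z) = ls) * fpr J ka om) \<partial>M)" .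
 qed measurable
 then show ?case unfolding gen .
qed

lemma gen_fun_step:
 assumes "H \<in> bmeas env" and "finite J" "J \<subseteq> {Suc k..} \<times> {1..}" "J \<inter> {Suc k} \<times> {1..r} = {}"
  and s: "!!j. s j \<in> bmeas env" "!!j om. om \<in> space M ==> 0<=s j om" "!!j om. om \<in> space M ==> s j om <= 1"
 shows "(\<integral>\<^sup>+om. H om * of_bool (gen k om = ls) * ind J ka om*(\<Prod>j=1..r. en (s j om)^\<xi> (Suc k) j om) \<partial>M)
  = (\<integral>\<^sup>+om. H om * of_bool (gen k om = ls) * fpr J ka om*(\<Prod>j=1..r. en (gen_fun (F (Suc k) om) (s j om))) \<partial>M)"
 using assms(1-4)
proof (induction r arbitrary: H J ka)
 case 0
 then show ?case using past_indep_future[of H J k] by simp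
next
 case (Suc r)
 let ?p = "(Suc k, Suc r)"
 let ?P = "%om. \<Prod>j=1..r. en (s j om)^\<xi> (Suc k) j om" and ?Q = "%om. \<Prod>j=1..r. en (gen_fun (F (Suc k) om) (s j om))"
 define ka' where "ka' y n j = (if (n, j) = ?p then y else ka n j)" for y n j
 have J1: "J \<subseteq> {1..} \<times> {1..}" using Suc.prems by auto
 have p: "?p \<notin> J" using Suc.prems by auto
 have xi: "\<xi> (Suc k) j \<in> measurable M (count_space UNIV)" if "j>=1" for j using that by (intro offspring_measurable) auto
 note [measurable] = env_M[OF Suc.prems(1)] ind_measurable[OF Suc.prems(2) J1] env_M[OF fpr_measurable[OF J1]] env_M[OF s(1)]
  of_bool_measurable[OF gen_measurable] env_M[OF gen_fun_measurable[OF _ s(1)]]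
 have [measurable]: "?P \<in> bmeas M"
 proof (rule borel_measurable_prod_ennreal)
  fix j assume "j \<in> {1..r}"
  then show "(%om. en (s j om)^\<xi> (Suc k) j om) \<in> bmeas M"
   by (intro measurable_compose_countable[where f = "%y om. en (s j om)^y" and g = "\<xi> (Suc k) j"] xi) auto
 qed
 have ii: "of_bool (\<xi> (Suc k) (Suc r) om = y) * ind J ka om = ind (insert ?p J) (ka' y) om" for y om
 proof -
  have a: "(\<forall>(n, j)\<in>J. \<xi> n j om = ka' y n j) = (\<forall>(n, j)\<in>J. \<xi> n j om = ka n j)"
   by (rule ball_cong) (use p in \<open>auto simp: ka'_def\<close>)
  have b: "ka' y (Suc k) (Suc r) = y" by (simp add: ka'_def)
  show ?thesis by (simp add: ind_def a b)
 qed
 have ff: "fpr (insert ?p J) (ka' y) om = en (measure (F (Suc k) om) {y}) * fpr J ka om" for y om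
  unfolding fpr_def prod.insert[OF Suc.prems(2) p] using p by (intro arg_cong2[where f = "(*)"] prod.cong) (auto simp: ka'_def)
 have "(\<integral>\<^sup>+om. H om * of_bool (gen k om = ls) * ind J ka om*(?P om * en (s (Suc r) om)^\<xi> (Suc k) (Suc r) om) \<partial>M)
  = (\<Sum>y. \<integral>\<^sup>+om. of_bool (\<xi> (Suc k) (Suc r) om = y)*(H om * of_bool (gen k om = ls) * ind J ka om*(?P om * en (s (Suc r) om)^y)) \<partial>M)"
  by (rule nn_integral_nat_split[OF xi, where f = "%y om. H om * of_bool (gen k om = ls) * ind J ka om*(?P om * en (s (Suc r) om)^y)"]) (simp, measurable)
 also have "... = (\<Sum>y. \<integral>\<^sup>+om. (H om * en (s (Suc r) om)^y) * of_bool (gen k om = ls) * ind (insert ?p J) (ka' y) om*?P om \<partial>M)"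
  unfolding ii[symmetric] by (simp add: ac_simps)
 also have "... = (\<Sum>y. \<integral>\<^sup>+om. (H om * en (s (Suc r) om)^y) * of_bool (gen k om = ls) * fpr (insert ?p J) (ka' y) om*?Q om \<partial>M)"
 proof (intro arg_cong[where f = suminf] ext Suc.IH)
  fix y
  note [measurable] = Suc.prems(1) s(1)
  show "(%om. H om * en (s (Suc r) om)^y) \<in> bmeas env" by measurable
 qed (use Suc.prems in auto)
 also have "... = (\<integral>\<^sup>+om. (\<Sum>y. (H om * of_bool (gen k om = ls) * fpr J ka om*?Q om)*(en (measure (F (Suc k) om) {y}) * en (s (Suc r) om)^y)) \<partial>M)"
  unfolding ff using env_M[OF measure_F_measurable[of "Suc k"]] by (subst nn_integral_suminf) (auto simp: ac_simps)
 also have "... = (\<integral>\<^sup>+om. (H om * of_bool (gen k om = ls) * fpr J ka om*?Q om) * en (gen_fun (F (Suc k) om) (s (Suc r) om)) \<partial>M)"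
 proof (intro nn_integral_cong)
  fix om assume w: "om \<in> space M"
  have "(\<Sum>y. en (measure (F (Suc k) om) {y}) * en (s (Suc r) om)^y) = (\<Sum>y. en (measure (F (Suc k) om) {y} * s (Suc r) om^y))"
   using s(2)[OF w] by (simp add: ennreal_mult ennreal_power)
  also have "... = en (gen_fun (F (Suc k) om) (s (Suc r) om))"
   using gen_fun_sums(1,2)[OF F_prob_law[OF _ w, of "Suc k"] s(2,3)[OF w], of "Suc r"] s(2)[OF w]
   by (intro sums_unique[symmetric] sums_ennreal[THEN iffD2]) auto
  finally show "(\<Sum>y. (H om * of_bool (gen k om = ls) * fpr J ka om*?Q om)*(en (measure (F (Suc k) om) {y}) * en (s (Suc r) om)^y))
    = (H om * of_bool (gen k om = ls) * fpr J ka om*?Q om) * en (gen_fun (F (Suc k) om) (s (Suc r) om))"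
   by simp
 qed
 finally show ?case by (simp add: ac_simps)
qed

end

lemma powser_unique:
 fixes d :: "nat => real"
 assumes b: "!!j. \<bar>d j\<bar> <= 2" and z: "!!s. 0 < s ==> s < 1 ==> (%j. d j * s^j) sums 0"
 shows "d n = 0"
proof (induction n rule: less_induct)
 case (less N)
 have bound: "\<bar>d N\<bar> <= 2 * s/(1-s)" if s: "0 < s" "s < 1" for s
 proof -
  have "(%j. d (j+N) * s^(j+N)) sums (0-(\<Sum>j<N. d j * s^j))" using z[OF s] sums_iff_shift[of "%j. d j * s^j" N] by simp
  then have "(%j. d (j+N) * s^(j+N)) sums 0" using less by simp
  then have "(%j. d (j+N) * s^(j+N)/s^N) sums (0/s^N)" by (rule sums_divide)
  then have s0: "(%j. d (j+N) * s^j) sums 0" using s by (simp add: power_add)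
  have "(%j. d (Suc j+N) * s^Suc j) sums (0-d N)" using s0 by (subst sums_Suc_iff) simp
  moreover have g: "(%j. 2 * s * s^j) sums (2 * s*(1/(1-s)))" using s by (intro sums_mult geometric_sums) auto
  moreover have "norm (d (Suc j+N) * s^Suc j)<=2 * s * s^j" for j
  proof -
   have "norm (d (Suc j+N) * s^Suc j) = \<bar>d (Suc j+N)\<bar> * s^Suc j" using s by (simp add: abs_mult)
   also have "... <= 2 * s^Suc j" using b s by (intro mult_right_mono) auto
   finally show ?thesis by simp
  qed
  ultimately have "norm (0-d N)<=2 * s*(1/(1-s))"
   using norm_suminf_le[of "%j. d (Suc j+N) * s^Suc j" "%j. 2 * s * s^j"] by (simp add: sums_iff)
  then show ?thesis by simp
 qed
 have "\<bar>d N\<bar> <= 0"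
 proof (rule tendsto_lowerbound)
  have "((%s::real. 2 * s/(1-s)) \<longlongrightarrow> 2*0/(1-0)) (at_right 0)" by (intro tendsto_intros) auto
  then show "((%s::real. 2 * s/(1-s)) \<longlongrightarrow> 0) (at_right 0)" by simp
  show "eventually (%s. \<bar>d N\<bar> <= 2 * s/(1-s)) (at_right 0)"
   using eventually_at_right_real[OF zero_less_one] by eventually_elim (auto intro: bound)
 qed simp
 then show ?case by simp
qed

definition geo :: "nat measure => bool" where
 "geo f \<longleftrightarrow> 0 < measure f {0} \<and> measure f {0} < 1 \<and> (\<forall>j. measure f {j} = measure f {0}*(1-measure f {0})^j)"

lemma geometric_law_geo:
 assumes f: "prob_law f" and g: "geometric_law f"
 shows "geo f"
proof -
 obtain p q where pq: "0 < p" "p < 1" "0 < q" "q < 1" "p+q = 1" "!!s. 0<=s ==> s<=1 ==> gen_fun f s = q/(1-p * s)"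
  using g by (auto simp: geometric_law_def)
 interpret prob_space f using f by (simp add: prob_law_def)
 have "measure f {n}-q * p^n = 0" for n
 proof (rule powser_unique)
  fix j
  have "p^j<=1" using pq by (intro power_le_one) auto
  then have "q * p^j<=1*1" by (intro mult_mono) (use pq in auto)
  moreover have "0<=q * p^j" using pq by simp
  ultimately
  show "\<bar>measure f {j}-q * p^j\<bar> <= 2" using prob_le_1[of "{j}"] measure_nonneg[of f "{j}"] by linarith
 next
  fix s :: real assume s: "0 < s" "s < 1"
  have "p * s < 1*1" using pq s by (intro mult_strict_mono) auto
  then have "(%j. q*(p * s)^j) sums (q*(1/(1-p * s)))" using pq s by (intro sums_mult geometric_sums) (auto simp: abs_mult)
  from sums_diff[OF gen_fun_sums(1)[OF f, of s] this] s pq(6)[of s]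
  show "(%j. (measure f {j}-q * p^j) * s^j) sums 0" by (simp add: power_mult_distrib left_diff_distrib mult.assoc)
 qed
 then have m: "measure f {n} = q * p^n" for n by (metis eq_iff_diff_eq_0)
 have "measure f {0} = q" "p = 1-q" using m[of 0] pq(5) by auto
 then show ?thesis unfolding geo_def using pq(3,4) m by (intro conjI allI) simp_all
qed

lemma geo_facts:
 assumes "geo f"
 shows "mean_offspring f > 0" "0<=s ==> s<=1 ==> gen_fun f s = 1/(1+mean_offspring f*(1-s))"
proof -
 define q where "q = measure f {0}"
 define p where "p = 1-q"
 have m: "measure f {j} = q * p^j" for j using assms unfolding geo_def q_def p_def by blast
 have q0: "0 < q" "q < 1" using assms unfolding geo_def q_def by blast+
 then have q: "0 < q" "q < 1" "0 < p" "p < 1" "q = 1-p" by (auto simp: p_def)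
 have "(%j. q * p*(of_nat (Suc j) * p^j)) sums (q * p*(1/(1-p)\<^sup>2))" using q by (intro sums_mult geometric_deriv_sums) auto
 then have "(%j. real (Suc j) * measure f {Suc j}) sums (p/q)"
  using q by (simp add: m ac_simps power2_eq_square)
 then have "(%j. real j * measure f {j}) sums (p/q)" by (rule sums_Suc_imp[rotated]) simp
 then have mean: "mean_offspring f = p/q" unfolding mean_offspring_def by (rule sums_unique[symmetric])
 then show "mean_offspring f > 0" using q by simp
 assume s: "0<=s" "s<=1"
 have "p * s<=p*1" using q s by (intro mult_left_mono) auto
 then have ps: "p * s < 1" using q by linarith
 have "(%j. q*(p * s)^j) sums (q*(1/(1-p * s)))" using q s ps by (intro sums_mult geometric_sums) (auto simp: abs_mult)
 then have "gen_fun f s = q/(1-p * s)" unfolding gen_fun_def m by (simp add: power_mult_distrib ac_simps sums_iff)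
 also have "... = 1/(1+mean_offspring f*(1-s))"
 proof -
  have "1+p/q*(1-s) = (1-p * s)/q" using q by (simp add: field_simps)
  then show ?thesis by (simp add: mean)
 qed
 finally show "gen_fun f s = 1/(1+mean_offspring f*(1-s))" .
qed

context bpire
begin

lemma AE_geo:
 assumes "AE om in M. geometric_law (F 1 om)"
 shows "AE om in M. \<forall>n\<ge>1. geo (F n om)"
proof -
 have mm [measurable]: "(%f. measure f {j}) \<in> bmeas offspring_laws" for j
 proof -
  have "(%f. measure f {j}) \<in> bmeas (subprob_algebra (count_space UNIV))" by (rule measurable_measure_subprob_algebra) simp
  then show ?thesis unfolding prob_algebra_def by (rule measurable_restrict_space1)
 qed
 have geoM: "Measurable.pred offspring_laws geo" unfolding geo_def[abs_def] by measurable
 have "AE om in M. geo (F 1 om)" using assms AE_space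
  by eventually_elim (rule geometric_law_geo[OF F_prob_law], auto)
 then have "AE f in distr M offspring_laws (F 1). geo f"
  by (subst AE_distr_iff[OF F_measurable]) (use geoM in \<open>auto simp: pred_def\<close>)
 note g1 = this
 have "AE om in M. geo (F n om)" if n: "n>=1" for n
 proof -
  have "AE f in distr M offspring_laws (F n). geo f" by (subst env_ident[OF n]) (rule g1)
  then show ?thesis by (subst (asm) AE_distr_iff[OF F_measurable[OF n]]) (use geoM in \<open>auto simp: pred_def\<close>)
 qed
 then have "AE om in M. n>=1 --> geo (F n om)" for n by (cases "n>=1") auto
 then show ?thesis by (subst AE_all_countable) auto
qed

lemma clan_step:
 assumes H: "H \<in> bmeas env"
  and s: "!!j. s j \<in> bmeas env" "!!j om. om \<in> space M ==> 0<=s j om" "!!j om. om \<in> space M ==> s j om <= 1"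
 shows "(\<integral>\<^sup>+om. H om * prod_list (map (%l. en (s l om)) (reproduce (%j. \<xi> (Suc k) j om) (gen k om))) \<partial>M)
  = (\<integral>\<^sup>+om. H om * prod_list (map (%l. en (gen_fun (F (Suc k) om) (s l om))) (gen k om)) \<partial>M)"
proof (rule nn_integral_eq_on_values[OF gen_measurable,
   where f = "%ls om. H om * prod_list (map (%l. en (s l om)) (reproduce (%j. \<xi> (Suc k) j om) ls))"
    and g = "%ls om. H om * prod_list (map (%l. en (gen_fun (F (Suc k) om) (s l om))) ls)"])
 fix ls :: "nat list"
 note [measurable] = env_M[OF H] env_M[OF s(1)] env_M[OF gen_fun_measurable[OF _ s(1)]]
 have xi: "(%om. en (s l om)^\<xi> (Suc k) j om) \<in> bmeas M" if "j>=1" for j l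
  by (rule measurable_compose_countable[where f = "%y om. en (s l om)^y" and g = "\<xi> (Suc k) j"])
   (use that in \<open>auto intro: offspring_measurable\<close>)
 have [measurable]: "(%om. \<Prod>j=1..length ls. en (s (ls ! (j-1)) om)^\<xi> (Suc k) j om) \<in> bmeas M"
  by (rule borel_measurable_prod_ennreal) (rule xi, simp)
 have [measurable]: "(%om. \<Prod>j=1..length ls. en (gen_fun (F (Suc k) om) (s (ls ! (j-1)) om))) \<in> bmeas M"
  by (rule borel_measurable_prod_ennreal) auto
 show "(%om. H om * prod_list (map (%l. en (s l om)) (reproduce (%j. \<xi> (Suc k) j om) ls))) \<in> bmeas M"
  unfolding prod_list_reproduce by measurable
 show "(%om. H om * prod_list (map (%l. en (gen_fun (F (Suc k) om) (s l om))) ls)) \<in> bmeas M"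
  unfolding prod_list_nth by measurable
 show "(\<integral>\<^sup>+om. of_bool (gen k om = ls)*(H om * prod_list (map (%l. en (s l om)) (reproduce (%j. \<xi> (Suc k) j om) ls))) \<partial>M)
   = (\<integral>\<^sup>+om. of_bool (gen k om = ls)*(H om * prod_list (map (%l. en (gen_fun (F (Suc k) om) (s l om))) ls)) \<partial>M)"
  using gen_fun_step[OF H, where J = "{}" and k = k and r = "length ls" and ls = ls and ka = "%_ _. 0" and s = "%j. s (ls ! (j-1))", OF _ _ _ s]
  unfolding prod_list_reproduce prod_list_nth[where ls = ls] by (simp add: ind_def fpr_def mult.assoc mult.left_commute[of "of_bool _"])
qed

primrec itf :: "nat => nat => real => 'w => real" where
 "itf l 0 x om = x"
| "itf l (Suc k) x om = (if l<=k then itf l k (gen_fun (F (Suc k) om) x) om else x)"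

lemma clan_prod:
 assumes "H \<in> bmeas env"
  and "!!j. s j \<in> bmeas env" "!!j om. om \<in> space M ==> 0<=s j om" "!!j om. om \<in> space M ==> s j om <= 1"
 shows "(\<integral>\<^sup>+om. H om * prod_list (map (%l. en (s l om)) (gen k om)) \<partial>M)
  = (\<integral>\<^sup>+om. H om*(\<Prod>l\<le>k. en (itf l k (s l om) om)) \<partial>M)"
 using assms
proof (induction k arbitrary: H s)
 case (Suc k)
 note [measurable] = Suc.prems(1,2)
 have H': "(%om. H om * en (s (Suc k) om)) \<in> bmeas env" by measurable
 have "(\<integral>\<^sup>+om. H om * prod_list (map (%l. en (s l om)) (gen (Suc k) om)) \<partial>M)
   = (\<integral>\<^sup>+om. (H om * en (s (Suc k) om)) * prod_list (map (%l. en (s l om)) (reproduce (%j. \<xi> (Suc k) j om) (gen k om))) \<partial>M)"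
  by (simp add: ac_simps)
 also have "... = (\<integral>\<^sup>+om. (H om * en (s (Suc k) om)) * prod_list (map (%l. en (gen_fun (F (Suc k) om) (s l om))) (gen k om)) \<partial>M)"
  by (rule clan_step[OF H' Suc.prems(2-4)])
 also have "... = (\<integral>\<^sup>+om. (H om * en (s (Suc k) om))*(\<Prod>l\<le>k. en (itf l k (gen_fun (F (Suc k) om) (s l om)) om)) \<partial>M)"
  by (rule Suc.IH[OF H', of "%l om. gen_fun (F (Suc k) om) (s l om)"])
   (auto intro!: gen_fun_measurable gen_fun_sums(2,3) F_prob_law Suc.prems)
 also have "... = (\<integral>\<^sup>+om. H om*(\<Prod>l\<le>Suc k. en (itf l (Suc k) (s l om) om)) \<partial>M)"
  by (intro nn_integral_cong) (simp add: ac_simps)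
 finally show ?case .
qed simp

lemma prob_labels:
 assumes n: "n = Suc k"
 shows "emeasure M {om \<in> space M. \<forall>l\<in>set (pre_generation (%n j. \<xi> n j om) n). l \<in> A}
   = (\<integral>\<^sup>+om. (\<Prod>l<n. en (itf l n (indicator A l) om)) \<partial>M)"
  and "{om \<in> space M. \<forall>l\<in>set (pre_generation (%n j. \<xi> n j om) n). l \<in> A} \<in> sets M"
proof -
 let ?s = "%l om. indicat_real A l"
 let ?pre = "%om. reproduce (%j. \<xi> (Suc k) j om) (gen k om)"
 have pre: "pre_generation (%n j. \<xi> n j om) n = ?pre om" for om by (simp add: n pre_generation_def)
 have pi: "prod_list (map (%l. en (indicat_real A l)) ls) = of_bool (\<forall>l\<in>set ls. l \<in> A)" for ls :: "nat list"
  by (induction ls) (auto simp: indicator_def)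
 have "?pre = butlast \<circ> gen (Suc k)" by auto
 also have "... \<in> measurable M (count_space UNIV)" by (rule measurable_comp[OF gen_measurable]) simp
 finally have pm: "?pre \<in> measurable M (count_space UNIV)" .
 have "?pre -` {ls. \<forall>l\<in>set ls. l \<in> A} \<inter> space M \<in> sets M" by (rule measurable_sets[OF pm]) simp
 also have "?pre -` {ls. \<forall>l\<in>set ls. l \<in> A} \<inter> space M = {om \<in> space M. \<forall>l\<in>set (?pre om). l \<in> A}" by auto
 finally show sets: "{om \<in> space M. \<forall>l\<in>set (pre_generation (%n j. \<xi> n j om) n). l \<in> A} \<in> sets M" unfolding pre .
 have "emeasure M {om \<in> space M. \<forall>l\<in>set (?pre om). l \<in> A} = (\<integral>\<^sup>+om. indicator {om \<in> space M. \<forall>l\<in>set (?pre om). l \<in> A} om \<partial>M)"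
  using sets unfolding pre by simp
 also have "... = (\<integral>\<^sup>+om. 1 * prod_list (map (%l. en (?s l om)) (?pre om)) \<partial>M)"
  unfolding pi by (intro nn_integral_cong) (auto simp: indicator_def)
 also have "... = (\<integral>\<^sup>+om. 1 * prod_list (map (%l. en (gen_fun (F (Suc k) om) (?s l om))) (gen k om)) \<partial>M)"
  by (rule clan_step) auto
 also have "... = (\<integral>\<^sup>+om. 1*(\<Prod>l\<le>k. en (itf l k (gen_fun (F (Suc k) om) (?s l om)) om)) \<partial>M)"
  by (rule clan_prod) (auto intro!: gen_fun_measurable gen_fun_sums(2,3) F_prob_law)
 also have "... = (\<integral>\<^sup>+om. (\<Prod>l<n. en (itf l n (indicator A l) om)) \<partial>M)"
  by (intro nn_integral_cong) (auto simp: n lessThan_Suc_atMost intro!: prod.cong)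
 finally show "emeasure M {om \<in> space M. \<forall>l\<in>set (pre_generation (%n j. \<xi> n j om) n). l \<in> A}
   = (\<integral>\<^sup>+om. (\<Prod>l<n. en (itf l n (indicator A l) om)) \<partial>M)" unfolding pre .
qed

lemma itf_1: "om \<in> space M ==> itf l k 1 om = 1"
 by (induction k) (auto simp: gen_fun_1 F_prob_law)

lemma exp_X: "geo (F n om) ==> exp (X F n om) = mean_offspring (F n om)"
 using geo_facts(1) by (simp add: X_def)

lemma S_Suc: "S F (Suc k) om = S F k om+X F (Suc k) om" by (simp add: S_def)

lemma itf_formula:
 assumes geo: "!!n. n>=1 ==> geo (F n om)" and x: "0<=x" "x < 1" and l: "l<=k"
 shows "itf l k x om < 1 \<and> 1/(1-itf l k x om) = (\<Sum>j=l..<k. exp (S F l om - S F j om))+exp (S F l om - S F k om)/(1-x)"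
 using x l
proof (induction k arbitrary: x)
 case (Suc k)
 show ?case
 proof (cases "l<=k")
  case True
  define m where "m = exp (X F (Suc k) om)"
  define y where "y = gen_fun (F (Suc k) om) x"
  have m: "m > 0" by (simp add: m_def)
  have y: "y = 1/(1+m*(1-x))" unfolding y_def m_def using geo_facts(2)[OF geo, of "Suc k" x] Suc.prems exp_X[OF geo, of "Suc k"] by simp
  have mx: "m*(1-x) > 0" using m Suc.prems by simp
  then have y01: "0<=y" "y < 1" by (auto simp: y)
  have "1-y = m*(1-x)/(1+m*(1-x))" using mx by (simp add: y field_simps)
  then have "1/(1-y) = (1+m*(1-x))/(m*(1-x))" by simp
  also have "... = 1+1/m/(1-x)" using mx m Suc.prems by (simp add: add_divide_distrib)
  finally have "1/(1-y) = 1+1/m/(1-x)" .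
  moreover have "1/m = exp (- X F (Suc k) om)" by (simp add: m_def exp_minus field_simps)
  ultimately have inv: "1/(1-y) = 1+exp (- X F (Suc k) om)/(1-x)" by simp
  have "exp (S F l om - S F k om)/(1-y) = exp (S F l om - S F k om)*(1/(1-y))" by simp
  also have "... = exp (S F l om - S F k om)+exp (S F l om - S F (Suc k) om)/(1-x)"
   unfolding inv by (simp add: S_Suc distrib_left exp_diff exp_add exp_minus divide_inverse)
  finally show ?thesis using Suc.IH[OF y01 True] True by (simp add: y_def[symmetric] atLeastLessThanSuc)
 next
  case False
  then have "l = Suc k" using Suc.prems by simp
  then show ?thesis using Suc.prems by simp
 qed
qed (use x in simp)

definition Bs :: "nat => nat => 'w => real" where "Bs n l om = (\<Sum>j=l..n. exp (- S F j om))"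

lemma Bs_pos: "l<=n ==> Bs n l om > 0"
 unfolding Bs_def by (intro sum_pos) auto

lemma Bs_rec: "l < n ==> Bs n l om = exp (- S F l om)+Bs n (Suc l) om"
 unfolding Bs_def by (simp add: sum.atLeast_Suc_atMost)

lemma itf_0:
 assumes geo: "!!n. n>=1 ==> geo (F n om)" and l: "l < n"
 shows "itf l n 0 om = Bs n (Suc l) om/Bs n l om"
proof -
 have n: "{l..n} = insert n {l..<n}" using l by auto
 have f: "itf l n 0 om < 1" "1/(1-itf l n 0 om) = exp (S F l om) * Bs n l om"
  using itf_formula[OF geo, of 0 l n] l by (auto simp: Bs_def n exp_diff exp_minus divide_inverse sum_distrib_left distrib_left)
 have "1-itf l n 0 om = 1/(1/(1-itf l n 0 om))" by simp
 also have "... = 1/(exp (S F l om) * Bs n l om)" unfolding f(2) ..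
 finally have "1-itf l n 0 om = 1/(exp (S F l om) * Bs n l om)" .
 then have "itf l n 0 om = 1-exp (- S F l om)/Bs n l om" by (simp add: exp_minus divide_inverse)
 also have "... = Bs n (Suc l) om/Bs n l om" using Bs_rec[OF l, of om] Bs_pos[of l n om] l by (simp add: field_simps)
 finally show ?thesis .
qed

lemma prob_only_clan:
 assumes geo: "AE om in M. geometric_law (F 1 om)" and i: "i < n"
 shows "emeasure M (only_clan_survives M \<xi> i n)
  = (\<integral>\<^sup>+om. en (exp (- S F i om - S F n om)/(Bs n 0 om * Bs n (Suc i) om)) \<partial>M)"
  "only_clan_survives M \<xi> i n \<in> sets M"
proof -
 obtain k where k: "n = Suc k" using i by (cases n) auto
 define L where "L A = {om \<in> space M. \<forall>l\<in>set (pre_generation (%n j. \<xi> n j om) n). l \<in> A}" for A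
 note L = prob_labels[OF k, folded L_def]
 have eq: "only_clan_survives M \<xi> i n = L {i}-L {}"
  by (auto simp: only_clan_survives_def L_def Y_minus_def)
 show "only_clan_survives M \<xi> i n \<in> sets M" unfolding eq using L(2) by auto
 have sub: "L {} \<subseteq> L {i}" by (auto simp: L_def)
 define D where "D om = exp (- S F i om - S F n om)/(Bs n 0 om * Bs n (Suc i) om)" for om
 have D0: "D om >= 0" for om unfolding D_def using Bs_pos[of 0 n om] Bs_pos[of "Suc i" n om] i by simp
 have key: "AE om in M. (\<Prod>l<n. en (itf l n (indicator {i} l) om)) = (\<Prod>l<n. en (itf l n (indicator {} l) om))+en (D om)"
  using AE_geo[OF geo] AE_space
 proof eventually_elim
  case (elim om)
  then have g: "!!n. n>=1 ==> geo (F n om)" by auto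
  let ?B = "%l. Bs n l om"
  have q: "itf l n 0 om = ?B (Suc l)/?B l" if "l < n" for l by (rule itf_0[OF g that])
  have tele: "m<=n ==> (\<Prod>l<m. ?B (Suc l)/?B l) = ?B m/?B 0" for m
  proof (induction m)
   case 0
   then show ?case using Bs_pos[of 0 n om] by simp
  next
   case (Suc m)
   then show ?case using Bs_pos[of m n om] by simp
  qed
  have Bn: "?B n = exp (- S F n om)" by (simp add: Bs_def)
  have pos: "?B 0 > 0" "?B i > 0" "?B (Suc i) > 0" "?B n > 0" using Bs_pos i by auto
  have p0: "(\<Prod>l<n. itf l n (indicator {} l) om) = ?B n/?B 0" using tele[of n] q by simp
  have "(\<Prod>l<n. itf l n (indicator {i} l) om) = (\<Prod>l\<in>{..<n} - {i}. ?B (Suc l)/?B l)"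
   using i by (subst prod.remove[of _ i]) (auto simp: itf_1[OF elim(2)] q intro!: prod.cong)
  moreover have "(\<Prod>l<n. ?B (Suc l)/?B l) = ?B (Suc i)/?B i*(\<Prod>l\<in>{..<n} - {i}. ?B (Suc l)/?B l)"
   using i by (subst prod.remove[of _ i]) auto
  ultimately have "?B n/?B 0 = ?B (Suc i)/?B i*(\<Prod>l<n. itf l n (indicator {i} l) om)" using tele[of n] by simp
  then have "(\<Prod>l<n. itf l n (indicator {i} l) om) = ?B n/?B 0*(?B i/?B (Suc i))" using pos by (simp add: field_simps)
  also have "... = ?B n/?B 0+exp (- S F n om) * exp (- S F i om)/(?B 0*?B (Suc i))"
   using pos by (subst Bs_rec[OF i]) (simp add: Bn field_simps)
  also have "exp (- S F n om) * exp (- S F i om)/(?B 0*?B (Suc i)) = D om" by (simp add: D_def exp_add[symmetric])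
  finally have "(\<Prod>l<n. itf l n (indicator {i} l) om) = (\<Prod>l<n. itf l n (indicator {} l) om)+D om" unfolding p0 .
  moreover have "itf l n (indicator {i} l) om >= 0" "itf l n (indicator {} l) om >= 0" if "l < n" for l
   using q[OF that] Bs_pos[of l n om] Bs_pos[of "Suc l" n om] that itf_1[OF elim(2), of l n] by (auto simp: indicator_def)
  ultimately show ?case using D0[of om] prod_nonneg[of "{..<n}" "%l. itf l n (indicator {} l) om"]
   by (subst prod_ennreal, simp, subst prod_ennreal, simp) simp
 qed
 have "emeasure M (L {i}) = (\<integral>\<^sup>+om. (\<Prod>l<n. en (itf l n (indicator {} l) om))+en (D om) \<partial>M)"
  unfolding L(1) by (rule nn_integral_cong_AE[OF key])
 also have "... = emeasure M (L {})+(\<integral>\<^sup>+om. en (D om) \<partial>M)"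
 proof (subst nn_integral_add)
  have gm: "(%om. itf l m (s om) om) \<in> bmeas env" if "s \<in> bmeas env" for l m s
   using that
  proof (induction m arbitrary: s)
   case (Suc m)
   then show ?case using gen_fun_measurable[of "Suc m" s] by (cases "l<=m") auto
  qed simp
  show "(%om. \<Prod>l<n. en (itf l n (indicator {} l) om)) \<in> bmeas M"
   by (intro borel_measurable_prod_ennreal measurable_compose[OF env_M[OF gm] measurable_ennreal]) auto
  have [measurable]: "X F j \<in> bmeas M" if "j>=1" for j
   unfolding X_def[abs_def] mean_offspring_def using env_M[OF measure_F_measurable[OF that]] by measurable
  have [measurable]: "S F j \<in> bmeas M" for j unfolding S_def[abs_def] by (rule borel_measurable_sum) auto
  show "(%om. en (D om)) \<in> bmeas M" unfolding D_def Bs_def by measurable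
 qed (simp add: L(1))
 finally have e: "emeasure M (L {i}) = emeasure M (L {})+(\<integral>\<^sup>+om. en (D om) \<partial>M)" .
 have "emeasure M (L {i}-L {}) = emeasure M (L {i})-emeasure M (L {})" by (rule emeasure_Diff) (use L(2) sub in auto)
 also have "... = (\<integral>\<^sup>+om. en (D om) \<partial>M)" unfolding e by (rule ennreal_add_diff_cancel_left) simp
 finally show "emeasure M (only_clan_survives M \<xi> i n)
  = (\<integral>\<^sup>+om. en (exp (- S F i om - S F n om)/(Bs n 0 om * Bs n (Suc i) om)) \<partial>M)" unfolding eq D_def .
qed

end

locale norming =
 fixes c :: "nat => real" and a :: real
 assumes c_pos: "!!n. n>=1 ==> c n > 0"
  and c_mono: "!!m n. 1<=m ==> m<=n ==> c m<=c n"
  and c_ratio: "!!k. k>=1 ==> (%n. c (k * n) / c n) ----> real k powr a"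
  and a: "0 < a" "a < 1"
begin

lemma c_double: "\<exists>D\<ge>1. \<forall>n\<ge>1. c (2 * n)<=D * c n"
proof -
 have "Bseq (%n. c (2 * n) / c n)"
  using c_ratio[of 2] by (intro convergent_imp_Bseq convergentI) auto
 then obtain K where K: "K > 0" "!!n. \<bar>c (2 * n) / c n\<bar> <= K" by (auto simp: Bseq_def)
 have "c (2 * n)<=max 1 K * c n" if "n>=1" for n
 proof -
  have "c (2 * n) / c n<=max 1 K" using K(2)[of n] by linarith
  then show ?thesis using c_pos[OF that] by (simp add: field_simps)
 qed
 then show ?thesis by (intro exI[of _ "max 1 K"]) auto
qed

definition Dbl :: real where "Dbl = (SOME D. D>=1 \<and> (\<forall>n\<ge>1. c (2 * n)<=D * c n))"

lemma Dbl: "Dbl>=1" "!!n. n>=1 ==> c (2 * n)<=Dbl * c n"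
 using someI_ex[OF c_double] unfolding Dbl_def by auto

lemma c_half: "1<=m ==> n<=2 * m ==> 1<=n ==> c n<=Dbl * c m"
 using c_mono[of n "2 * m"] Dbl(2)[of m] by linarith

definition w :: "nat => real" where "w n = (if n = 0 then 1 / c 1 else 1/(real n * c n))"

lemma w_pos: "w n > 0"
 using c_pos[of n] c_pos[of 1] by (auto simp: w_def)

lemma w_neq_0 [simp]: "w n ~= 0"
 using w_pos[of n] by simp

lemma w_eq: "n>=1 ==> w n = 1/(real n * c n)" by (simp add: w_def)

lemma w_antimono: "m<=n ==> w n<=w m"
proof (cases "m = 0")
 case True
 show ?thesis
 proof (cases "n = 0")
  case False
  then have "1 * c 1<=real n * c n" using c_mono[of 1 n] c_pos[of 1] by (intro mult_mono) auto
  then show ?thesis using True False c_pos[of 1] by (simp add: w_def frac_le)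
 qed (use True in simp)
next
 case False
 assume "m<=n"
 then have "real m * c m<=real n * c n" using False c_mono[of m n] c_pos[of m] by (intro mult_mono) auto
 then show ?thesis using False \<open>m \<le> n\<close> c_pos[of m] by (simp add: w_def frac_le)
qed

lemma w_half: "n<=2 * m ==> w m<=2 * Dbl * w n"
proof (cases "n = 0")
 case True
 have "w m<=w 0" by (rule w_antimono) simp
 also have "... <= 2 * Dbl * w 0" using Dbl(1) w_pos[of 0] by simp
 finally show ?thesis using True by simp
next
 case False
 assume n: "n<=2 * m"
 with False have m: "m>=1" by simp
 have "real n * c n<=(2 * real m)*(Dbl * c m)"
  using c_half[of m n] c_pos[of n] False n m by (intro mult_mono) auto
 then show ?thesis using m False c_pos[of m] c_pos[of n] Dbl(1)
  by (simp add: w_def field_simps)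
qed

lemma ratio2: "(%k. c (2^Suc k) / c (2^k)) ----> 2 powr a"
proof -
 have "filterlim (%k. (2::nat)^k) at_top sequentially"
  by (rule filterlim_subseq) (simp add: strict_mono_def)
 from filterlim_compose[OF c_ratio[of 2] this] show ?thesis by simp
qed

lemma summable_inverse_c: "summable (%k. 1 / c (2^k))"
proof -
 define r where "r = 2 powr (a/2)"
 have r: "1 < r" "r < 2 powr a" using a by (auto simp: r_def intro!: powr_less_mono)
 have "eventually (%k. c (2^Suc k) / c (2^k) > r) sequentially"
  using ratio2 r(2) by (rule order_tendstoD)
 then obtain N where N: "!!k. k>=N ==> c (2^Suc k) / c (2^k) > r"
  by (auto simp: eventually_sequentially)
 show ?thesis
 proof (rule summable_ratio_test[of "1/r" N])
  show "1/r < 1" using r by simp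
  fix n assume "n>=N"
  from N[OF this] show "norm (1 / c (2^Suc n))<=1/r * norm (1 / c (2^n))"
   using c_pos[of "2^n"] c_pos[of "2^Suc n"] r by (simp add: field_simps)
 qed
qed

lemma summable_w: "summable w"
proof -
 have "summable (%n. 2^n * w (2^n))"
  using summable_inverse_c by (simp add: w_def)
 then show ?thesis
  using condensation_test[of w] w_antimono w_pos by (auto simp: less_imp_le)
qed

lemma inverse_c_0: "(%n. 1 / c n) ----> 0"
proof (rule LIMSEQ_I)
 fix r :: real assume "r > 0"
 have "(%k. 1 / c (2^k)) ----> 0" by (rule summable_LIMSEQ_zero[OF summable_inverse_c])
 from LIMSEQ_D[OF this \<open>r > 0\<close>] obtain k where k: "1 / c (2^k) < r"
  using c_pos[of "2^k" for k] by (auto simp: less_imp_le)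
 show "\<exists>no. \<forall>n\<ge>no. norm (1 / c n-0) < r"
 proof (intro exI[of _ "2^k"] allI impI)
  fix n :: nat assume n: "n>=2^k"
  then have "n>=1" using one_le_power[of "2::nat" k] by linarith
  moreover have "1 / c n<=1 / c (2^k)"
   using c_mono[OF _ n] c_pos[of "2^k"] by (intro frac_le) auto
  ultimately show "norm (1 / c n-0) < r" using k c_pos[of n] by simp
 qed
qed

lemma c_at_top: "filterlim c at_top sequentially"
proof -
 have "filterlim (%n. inverse (1 / c n)) at_top sequentially"
  using inverse_c_0 by (rule filterlim_inverse_at_top)
   (auto intro!: eventually_sequentiallyI[of 1] c_pos)
 then show ?thesis by simp
qed

lemma tannery:
 fixes f :: "nat => nat => real"
 assumes "!!k. (%n. f k n) ----> b k" "!!k n. \<bar>f k n\<bar> <= M k" "summable M"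
 shows "(%n. \<Sum>k. f k n) ----> (\<Sum>k. b k)" "summable b"
proof -
 have "eventually (%(k,n). norm (f k n)<=M k) (at_top \<times>\<^sub>F sequentially)"
  using assms(2) by (intro always_eventually) auto
 from tannerys_theorem[OF assms(1) this assms(3)]
 show "(%n. \<Sum>k. f k n) ----> (\<Sum>k. b k)" "summable b"
  by (auto intro: summable_norm_cancel)
qed

lemma cesaro_inverse_c: "(%n. (\<Sum>k=1..n. 1 / c k)/real n) ----> 0"
proof -
 let ?f = "%k n. if 1<=k \<and> k<=n then real k/real n * w k else 0"
 have "(%n. \<Sum>k. ?f k n) ----> (\<Sum>k. 0)"
 proof (rule tannery(1)[OF _ _ summable_w])
  fix k
  show "(%n. ?f k n) ----> 0"
  proof (rule tendsto_sandwich[OF _ _ tendsto_const])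
   show "eventually (%n. 0<=?f k n) sequentially" using w_pos by (auto simp: less_imp_le)
   show "eventually (%n. ?f k n<=real k * w k*(1/real n)) sequentially" using w_pos by (auto simp: less_imp_le)
   show "(%n. real k * w k*(1/real n)) ----> 0"
    by (intro tendsto_mult_right_zero lim_1_over_n)
  qed
 next
  fix k n
  have "real k/real n * w k<=1 * w k" if "1<=k" "k<=n"
   using that w_pos[of k] by (intro mult_right_mono) auto
  then show "\<bar>?f k n\<bar> <= w k" using w_pos[of k] by auto
 qed
 moreover have "(\<Sum>k. ?f k n) = (\<Sum>k=1..n. 1 / c k)/real n" for n
 proof -
  have "(\<Sum>k. ?f k n) = (\<Sum>k=1..n. ?f k n)" by (rule suminf_finite) auto
  also have "... = (\<Sum>k=1..n. 1 / c k/real n)"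
   by (intro sum.cong refl) (auto simp: w_def)
  finally show ?thesis by (simp add: sum_divide_distrib)
 qed
 ultimately show ?thesis by simp
qed

lemma renewal_bounded:
 assumes u: "!!n. u n>=0" and "C>=0"
  and rec: "!!n. n>=1 ==> real n * u n<=(\<Sum>j<n. C / c (n-j) * u j)"
 shows "\<exists>B. \<forall>N. (\<Sum>n\<le>N. u n)<=B"
proof -
 define t where "t j k = (if 1<=k then C/(c k * real (j+k)) else 0)" for j k
 have t0: "t j k>=0" for j k using c_pos[of k] \<open>C \<ge> 0\<close> by (auto simp: t_def)
 have tw: "t j k<=C * w k" for j k
 proof (cases "k>=1")
  case True
  have "C/(c k * real (j+k))<=C/(c k * real k)"
   using True c_pos[OF True] \<open>C \<ge> 0\<close> by (intro divide_left_mono mult_left_mono mult_pos_pos) auto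
  with True show ?thesis by (simp add: t_def w_def mult.commute)
 qed (use w_pos[of k] \<open>C \<ge> 0\<close> in \<open>simp add: t_def\<close>)
 have sumt: "summable (t j)" for j
  by (rule summable_comparison_test'[OF summable_mult[OF summable_w, of C], of 0]) (use t0 tw in auto)
 have "(%j. \<Sum>k. t j k) ----> (\<Sum>k. 0)"
 proof (rule tannery(1)[where f = "%k j. t j k"])
  show "summable (%k. C * w k)" by (intro summable_mult summable_w)
  show "\<bar>t j k\<bar> <= C * w k" for j k using t0 tw by simp
  fix k
  show "(%j. t j k) ----> 0"
  proof (cases "k>=1")
   case True
   have "(%j. C / c k*(1/real (j+k))) ----> 0"
    by (intro tendsto_mult_right_zero LIMSEQ_ignore_initial_segment[OF lim_1_over_n, of k])
   with True show ?thesis by (simp add: t_def)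
  qed (simp add: t_def)
 qed
 then have "eventually (%j. (\<Sum>k. t j k) < 1/2) sequentially" by (intro order_tendstoD) auto
 then obtain J where J: "!!j. j>=J ==> (\<Sum>k. t j k) < 1/2" by (auto simp: eventually_sequentially)
 define E where "E = u 0+(\<Sum>j<J. u j*(\<Sum>k. t j k))"
 have "(\<Sum>n\<le>N. u n)<=2 * E" for N
 proof -
  have un: "u n<=(\<Sum>j<n. t j (n-j) * u j)" if "n>=1" for n
  proof -
   have "u n<=(\<Sum>j<n. C / c (n-j) * u j)/real n" using rec[OF that] that by (simp add: field_simps)
   also have "... = (\<Sum>j<n. t j (n-j) * u j)"
    unfolding sum_divide_distrib by (intro sum.cong refl) (auto simp: t_def)
   finally show ?thesis .
  qed
  have "(\<Sum>n\<le>N. u n) = u 0+(\<Sum>n=1..N. u n)"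
   by (simp add: atMost_atLeast0 sum.atLeast_Suc_atMost)
  also have "(\<Sum>n=1..N. u n)<=(\<Sum>n=1..N. \<Sum>j<n. t j (n-j) * u j)"
   by (intro sum_mono un) auto
  also have "... = (\<Sum>(n, j)\<in>(SIGMA n:{1..N}. {..<n}). t j (n-j) * u j)"
   by (subst sum.Sigma) auto
  also have "... = (\<Sum>(j, k)\<in>(SIGMA j:{..<N}. {1..N-j}). t j k * u j)"
   by (rule sum.reindex_bij_witness[of _ "%(j, k). (j+k, j)" "%(n, j). (j, n-j)"]) auto
  also have "... = (\<Sum>j<N. \<Sum>k=1..N-j. t j k * u j)"
   by (subst sum.Sigma) auto
  also have "... = (\<Sum>j<N. u j*(\<Sum>k=1..N-j. t j k))"
   by (simp add: sum_distrib_left mult.commute)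
  also have "... <= (\<Sum>j<N. u j*(\<Sum>k. t j k))"
   by (intro sum_mono mult_left_mono sum_le_suminf sumt t0 u) auto
  also have "... <= (\<Sum>j<N. (if j < J then u j*(\<Sum>k. t j k) else 0)+u j/2)"
  proof (intro sum_mono)
   fix j
   show "u j*(\<Sum>k. t j k)<=(if j < J then u j*(\<Sum>k. t j k) else 0)+u j/2"
    using J[of j] u[of j] mult_left_mono[of "\<Sum>k. t j k" "1/2" "u j"] by auto
  qed
  also have "... = (\<Sum>j\<in>{..<N} \<inter> {..<J}. u j*(\<Sum>k. t j k))+(\<Sum>j<N. u j)/2"
   by (simp add: sum.distrib sum.If_cases sum_divide_distrib Collect_conj_eq lessThan_def)
  also have "... <= (\<Sum>j<J. u j*(\<Sum>k. t j k))+(\<Sum>j\<le>N. u j)/2"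
   by (intro add_mono divide_right_mono sum_mono2)
     (auto intro!: mult_nonneg_nonneg u suminf_nonneg sumt t0)
  finally show ?thesis by (simp add: E_def)
 qed
 then show ?thesis by blast
qed

lemma renewal_bound:
 assumes u: "!!n. u n>=0" and "C>=0"
  and rec: "!!n. n>=1 ==> real n * u n<=(\<Sum>j<n. C / c (n-j) * u j)"
 shows "\<exists>B>0. \<forall>n. u n<=B * w n"
proof -
 obtain s where s: "!!N. (\<Sum>n\<le>N. u n)<=s" using renewal_bounded[OF assms] by auto
 have "s>=0" using s[of 0] u[of 0] by simp
 have "(%n. 2 * Dbl * C*((\<Sum>k=1..n. 1 / c k)/real n)) ----> 0"
  by (intro tendsto_mult_right_zero cesaro_inverse_c)
 then have "eventually (%n. 2 * Dbl * C*((\<Sum>k=1..n. 1 / c k)/real n) < 1/2) sequentially"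
  by (intro order_tendstoD) auto
 then obtain n0 where n0: "!!n. n>=n0 ==> 2 * Dbl * C*((\<Sum>k=1..n. 1 / c k)/real n) < 1/2"
  by (auto simp: eventually_sequentially)
 define B where "B = 1+(\<Sum>n\<le>n0. u n/w n)+2 * C * Dbl * s"
 have "(\<Sum>n\<le>n0. u n/w n)>=0" using u w_pos by (intro sum_nonneg) (auto simp: less_imp_le)
 moreover have "C * Dbl * s>=0" using \<open>C \<ge> 0\<close> Dbl(1) \<open>s \<ge> 0\<close> by simp
 ultimately have B: "B>=1" "2*(C * Dbl * s)<=B" by (simp_all add: B_def)
 have "u n<=B * w n" for n
 proof (induction n rule: less_induct)
  case (less n)
  show ?case
  proof (cases "n<=n0")
   case True
   have "u n/w n<=(\<Sum>n\<le>n0. u n/w n)"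
    using True u w_pos by (intro member_le_sum) (auto simp: less_imp_le)
   also have "... <= B" using \<open>C * Dbl * s \<ge> 0\<close> by (simp add: B_def)
   finally show ?thesis using w_pos[of n] by (simp add: field_simps)
  next
   case False
   then have n: "n>=n0" "n>=1" by auto
   have cn: "c n > 0" using c_pos n by auto
   have tm: "C / c (n-j) * u j<=C * Dbl / c n * u j+(if n<=2 * j then C / c (n-j)*(B*(2 * Dbl * w n)) else 0)"
    if j: "j < n" for j
   proof (cases "n<=2 * j")
    case True
    have "c (n-j) > 0" using j by (intro c_pos) auto
    have "u j<=B * w j" by (rule less.IH[OF j])
    also have "... <= B*(2 * Dbl * w n)" using B w_half[OF True] by (intro mult_left_mono) auto
    finally have "C / c (n-j) * u j<=C / c (n-j)*(B*(2 * Dbl * w n))"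
     using \<open>C \<ge> 0\<close> \<open>c (n - j) > 0\<close> by (intro mult_left_mono) auto
    moreover have "C * Dbl / c n * u j>=0" using \<open>C \<ge> 0\<close> Dbl(1) cn u[of j] by simp
    ultimately show ?thesis using True by simp
   next
    case False
    have "c n<=Dbl * c (n-j)" using False j n by (intro c_half) auto
    moreover have "c (n-j) > 0" using j by (intro c_pos) auto
    ultimately have "C * Dbl/(Dbl * c (n-j))<=C * Dbl / c n"
     using \<open>C \<ge> 0\<close> cn Dbl(1) by (intro divide_left_mono) auto
    then have "C / c (n-j)<=C * Dbl / c n" using Dbl(1) by simp
    from mult_right_mono[OF this u[of j]] show ?thesis using False by simp
   qed
   have "real n * u n<=(\<Sum>j<n. C / c (n-j) * u j)" using rec n by auto
   also have "... <= (\<Sum>j<n. C * Dbl / c n * u j+(if n<=2 * j then C / c (n-j)*(B*(2 * Dbl * w n)) else 0))"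
    by (intro sum_mono tm) auto
   also have "... = C * Dbl / c n*(\<Sum>j<n. u j)+(\<Sum>j<n. (if n<=2 * j then C / c (n-j)*(B*(2 * Dbl * w n)) else 0))"
    by (simp add: sum.distrib sum_distrib_left)
   also have "... <= C * Dbl / c n * s+(\<Sum>j<n. C / c (n-j)*(B*(2 * Dbl * w n)))"
   proof (intro add_mono mult_left_mono sum_mono)
    show "(\<Sum>j<n. u j)<=s"
    proof -
     have "(\<Sum>j<n. u j)<=(\<Sum>j\<le>n. u j)" using u by (intro sum_mono2) auto
     then show ?thesis using s[of n] by simp
    qed
    show "0<=C * Dbl / c n" using \<open>C \<ge> 0\<close> Dbl(1) cn by simp
    show "(if n<=2 * j then C / c (n-j)*(B*(2 * Dbl * w n)) else 0)<=C / c (n-j)*(B*(2 * Dbl * w n))"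
     if "j \<in> {..<n}" for j
    proof -
     have "c (n-j) > 0" using that by (intro c_pos) auto
     then have "0<=C / c (n-j)*(B*(2 * Dbl * w n))"
      using \<open>C \<ge> 0\<close> B(1) Dbl(1) w_pos[of n] by (intro mult_nonneg_nonneg divide_nonneg_pos) auto
     then show ?thesis by simp
    qed
   qed
   also have "(\<Sum>j<n. C / c (n-j)*(B*(2 * Dbl * w n))) = B * w n*(2 * Dbl * C*(\<Sum>k=1..n. 1 / c k))"
   proof -
    have "(\<Sum>j<n. 1 / c (n-j)) = (\<Sum>k=1..n. 1 / c k)"
     by (rule sum.reindex_bij_witness[of _ "%k. n-k" "%j. n-j"]) auto
    moreover have "(\<Sum>j<n. C / c (n-j)*(B*(2 * Dbl * w n))) = B * w n*(2 * Dbl * C*(\<Sum>j<n. 1 / c (n-j)))"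
     unfolding sum_distrib_left by (intro sum.cong refl) simp
    ultimately show ?thesis by simp
   qed
   also have "... <= B * w n*(real n/2)"
   proof (intro mult_left_mono)
    show "2 * Dbl * C*(\<Sum>k=1..n. 1 / c k)<=real n/2"
     using n0[OF n(1)] n(2) by (simp add: field_simps)
    show "0<=B * w n" using B w_pos[of n] by simp
   qed
   finally have "u n<=C * Dbl * s/(real n * c n)+B * w n/2"
    using n(2) cn by (simp add: field_simps)
   also have "C * Dbl * s/(real n * c n)<=B/2 * w n"
    using B(2) n(2) cn by (simp add: w_eq field_simps)
   finally show ?thesis by simp
  qed
 qed
 then show ?thesis using B(1) by (intro exI[of _ B]) auto
qed

lemma spitzer_limit:
 fixes V :: "nat => nat => real"
 assumes lim: "!!j. (%n. V n j) ----> v j"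
  and bd: "!!n j. j < n ==> \<bar>V n j\<bar> <= C*(c n / c (n-j)) * w j" and "C>=0"
 shows "(%n. \<Sum>j<n. V n j) ----> (\<Sum>j. v j)" "summable v"
proof -
 define f where "f j n = (if 2 * j < n then V n j else 0)" for j n
 have f: "\<bar>f j n\<bar> <= C * Dbl * w j" for j n
 proof (cases "2 * j < n")
  case True
  have "c n<=Dbl * c (n-j)" using True by (intro c_half) auto
  then have "c n / c (n-j)<=Dbl" using c_pos[of "n-j"] True by (simp add: field_simps)
  then have "C*(c n / c (n-j)) * w j<=C * Dbl * w j"
   using \<open>C \<ge> 0\<close> w_pos[of j] by (intro mult_right_mono mult_left_mono) auto
  then show ?thesis using bd[of j n] True by (simp add: f_def)
 qed (use \<open>C \<ge> 0\<close> Dbl(1) w_pos[of j] in \<open>simp add: f_def\<close>)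
 have fl: "(%n. f j n) ----> v j" for j
 proof -
  have "eventually (%n. f j n = V n j) sequentially"
   by (auto simp: f_def intro!: eventually_sequentiallyI[of "Suc (2 * j)"])
  from tendsto_cong[OF this] show ?thesis using lim by simp
 qed
 have sw: "summable (%j. C * Dbl * w j)" by (intro summable_mult summable_w)
 note T = tannery[OF fl f sw]
 show "summable v" by (rule T(2))
 have sf: "(\<Sum>j. f j n) = (\<Sum>j<n. f j n)" for n
  by (rule suminf_finite) (auto simp: f_def)
 have "(%n. (\<Sum>j<n. V n j)-(\<Sum>j<n. f j n)) ----> 0"
 proof (rule Lim_null_comparison)
  show "(%n. 2 * Dbl * C*((\<Sum>k=1..n. 1 / c k)/real n)) ----> 0"
   by (intro tendsto_mult_right_zero cesaro_inverse_c)
  show "eventually (%n. norm ((\<Sum>j<n. V n j)-(\<Sum>j<n. f j n))<=2 * Dbl * C*((\<Sum>k=1..n. 1 / c k)/real n)) sequentially"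
  proof (intro eventually_sequentiallyI[of 1])
   fix n :: nat assume n: "n>=1"
   have cn: "c n > 0" using c_pos n by auto
   have "norm ((\<Sum>j<n. V n j)-(\<Sum>j<n. f j n))<=(\<Sum>j<n. \<bar>V n j-f j n\<bar>)"
    by (simp add: sum_subtractf[symmetric] sum_abs)
   also have "... <= (\<Sum>j<n. 2 * Dbl * C/real n*(1 / c (n-j)))"
   proof (intro sum_mono)
    fix j assume "j \<in> {..<n}"
    then have j: "j < n" by simp
    have cj: "c (n-j) > 0" using c_pos j by auto
    show "\<bar>V n j-f j n\<bar> <= 2 * Dbl * C/real n*(1 / c (n-j))"
    proof (cases "2 * j < n")
     case False
     have "\<bar>V n j\<bar> <= C*(c n / c (n-j)) * w j" by (rule bd[OF j])
     also have "... <= C*(c n / c (n-j))*(2 * Dbl * w n)"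
      using False \<open>C \<ge> 0\<close> cn cj by (intro mult_left_mono w_half) auto
     also have "... = 2 * Dbl * C/real n*(1 / c (n-j))"
      using n cn cj by (simp add: w_eq field_simps)
     finally show ?thesis using False by (simp add: f_def)
    qed (use \<open>C \<ge> 0\<close> Dbl(1) cj in \<open>simp add: f_def\<close>)
   qed
   also have "... = 2 * Dbl * C/real n*(\<Sum>j<n. 1 / c (n-j))" by (simp add: sum_distrib_left)
   also have "(\<Sum>j<n. 1 / c (n-j)) = (\<Sum>k=1..n. 1 / c k)"
    by (rule sum.reindex_bij_witness[of _ "%k. n-k" "%j. n-j"]) auto
   finally show "norm ((\<Sum>j<n. V n j)-(\<Sum>j<n. f j n))<=2 * Dbl * C*((\<Sum>k=1..n. 1 / c k)/real n)"
    by simp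
  qed
 qed
 from tendsto_add[OF this T(1)] show "(%n. \<Sum>j<n. V n j) ----> (\<Sum>j. v j)" by (simp add: sf)
qed

lemma w_conv: "k<=n ==> w k * w (n-k)<=2 * Dbl * w n*(w k+w (n-k))"
proof (cases "2 * k<=n")
 case True
 have "w k * w (n-k)<=w k*(2 * Dbl * w n)"
  using True w_pos[of k] by (intro mult_left_mono w_half) auto
 also have "... <= 2 * Dbl * w n*(w k+w (n-k))"
  using w_pos[of n] w_pos[of "n-k"] Dbl(1) by (simp add: algebra_simps)
 finally show ?thesis .
next
 case False
 have "w k * w (n-k)<=(2 * Dbl * w n) * w (n-k)"
  using False w_pos[of "n-k"] by (intro mult_right_mono w_half) auto
 also have "... <= 2 * Dbl * w n*(w k+w (n-k))"
  using w_pos[of n] w_pos[of k] Dbl(1) by (simp add: algebra_simps)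
 finally show ?thesis .
qed

lemma w_conv_sum:
 "(\<Sum>k=l..n-l. w k * w (n-k))<=4 * Dbl * w n*(\<Sum>k. w (k+l))"
proof (cases "l<=n-l")
 case True
 then have ln: "n-l<=n" "2 * l<=n \<or> l = 0" by auto
 have "(\<Sum>k=l..n-l. w k * w (n-k))<=(\<Sum>k=l..n-l. 2 * Dbl * w n*(w k+w (n-k)))"
  using ln by (intro sum_mono w_conv) auto
 also have "... = 2 * Dbl * w n*((\<Sum>k=l..n-l. w k)+(\<Sum>k=l..n-l. w (n-k)))"
  by (simp only: sum_distrib_left[symmetric] sum.distrib)
 also have "(\<Sum>k=l..n-l. w (n-k)) = (\<Sum>k=l..n-l. w k)"
  by (rule sum.reindex_bij_witness[of _ "%k. n-k" "%k. n-k"]) (use True in auto)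
 also have "(\<Sum>k=l..n-l. w k) = (\<Sum>k=0..n-l-l. w (k+l))"
  by (rule sum.reindex_bij_witness[of _ "%k. k+l" "%k. k-l"]) (use True in auto)
 also have "2 * Dbl * w n*(... + ...)<=2 * Dbl * w n*((\<Sum>k. w (k+l))+(\<Sum>k. w (k+l)))"
  using summable_w w_pos Dbl(1)
  by (intro mult_left_mono add_mono sum_le_suminf) (auto simp: less_imp_le summable_iff_shift)
 finally show ?thesis by simp
next
 case False
 then have "(\<Sum>k=l..n-l. w k * w (n-k)) = 0" by simp
 also have "... <= 4 * Dbl * w n*(\<Sum>k. w (k+l))"
  using summable_w w_pos Dbl(1) by (intro mult_nonneg_nonneg suminf_nonneg) (auto simp: less_imp_le summable_iff_shift)
 finally show ?thesis .
qed

lemma conv_limit: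
 fixes U :: "nat => nat => real"
 assumes bd: "!!k j. \<bar>U k j\<bar> <= C * w k * w j" and "C>=0"
  and l1: "!!k. (%n. U k (n-k)/w n) ----> A k"
  and l2: "!!j. (%n. U (n-j) j/w n) ----> B j"
 shows "(%n. (\<Sum>k\<le>n. U k (n-k))/w n) ----> (\<Sum>k. A k)+(\<Sum>j. B j)"
proof -
 define f where "f k n = (if 2 * k < n then U k (n-k)/w n else 0)" for k n
 define g where "g j n = (if 2 * j<=n then U (n-j) j/w n else 0)" for j n
 have *: "\<bar>U k j\<bar>/w n<=2 * Dbl * C * w k" if "n<=2 * j" for k j n
 proof -
  have "\<bar>U k j\<bar> <= C * w k*(2 * Dbl * w n)"
   using bd[of k j] w_half[OF that] \<open>C \<ge> 0\<close> w_pos[of k]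
   by (meson mult_left_mono mult_nonneg_nonneg less_imp_le order_trans)
  then show ?thesis using w_pos[of n] by (simp add: field_simps)
 qed
 have **: "\<bar>U k j\<bar>/w n<=2 * Dbl * C * w j" if "n<=2 * k" for k j n
 proof -
  have "\<bar>U k j\<bar> <= C * w j * w k" using bd[of k j] by (simp add: ac_simps)
  also have "... <= C * w j*(2 * Dbl * w n)"
   using w_half[OF that] \<open>C \<ge> 0\<close> w_pos[of j] by (intro mult_left_mono) auto
  finally show ?thesis using w_pos[of n] by (simp add: field_simps)
 qed
 have nn: "0<=2 * Dbl * C * w k" for k using \<open>C \<ge> 0\<close> Dbl(1) w_pos[of k] by simp
 have f: "\<bar>f k n\<bar> <= 2 * Dbl * C * w k" for k n
  using *[of n "n-k" k] nn[of k] w_pos[of n] by (auto simp: f_def)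
 have g: "\<bar>g k n\<bar> <= 2 * Dbl * C * w k" for k n
  using **[of n "n-k" k] nn[of k] w_pos[of n] by (auto simp: g_def)
 have fl: "(%n. f k n) ----> A k" for k
 proof -
  have "eventually (%n. f k n = U k (n-k)/w n) sequentially"
   by (auto simp: f_def intro!: eventually_sequentiallyI[of "Suc (2 * k)"])
  from tendsto_cong[OF this] show ?thesis using l1 by simp
 qed
 have gl: "(%n. g k n) ----> B k" for k
 proof -
  have "eventually (%n. g k n = U (n-k) k/w n) sequentially"
   by (auto simp: g_def intro!: eventually_sequentiallyI[of "2 * k"])
  from tendsto_cong[OF this] show ?thesis using l2 by simp
 qed
 have sw: "summable (%j. 2 * Dbl * C * w j)" by (intro summable_mult summable_w)
 have "(\<Sum>k\<le>n. U k (n-k))/w n = (\<Sum>k. f k n)+(\<Sum>k. g k n)" for n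
 proof -
  have "(\<Sum>k. f k n) = (\<Sum>k\<le>n. f k n)" by (rule suminf_finite) (auto simp: f_def)
  moreover have "(\<Sum>k. g k n) = (\<Sum>k\<le>n. g k n)" by (rule suminf_finite) (auto simp: g_def)
  moreover have "(\<Sum>k\<le>n. g k n) = (\<Sum>k\<le>n. g (n-k) n)"
   by (rule sum.reindex_bij_witness[of _ "%k. n-k" "%k. n-k"]) auto
  moreover have "(\<Sum>k\<le>n. f k n)+(\<Sum>k\<le>n. g (n-k) n) = (\<Sum>k\<le>n. U k (n-k)/w n)"
   unfolding sum.distrib[symmetric] by (intro sum.cong refl) (auto simp: f_def g_def)
  ultimately show ?thesis by (simp add: sum_divide_distrib)
 qed
 then show ?thesis using tendsto_add[OF tannery(1)[OF fl f sw] tannery(1)[OF gl g sw]] by simp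
qed

lemma c_Suc_ratio: "(%n. c (Suc n) / c n) ----> 1"
proof (rule order_tendstoI)
 fix e :: real assume "e < 1"
 show "eventually (%n. e < c (Suc n) / c n) sequentially"
 proof (intro eventually_sequentiallyI[of 1])
  fix n :: nat assume "n>=1"
  then have "1<=c (Suc n) / c n" using c_mono[of n "Suc n"] c_pos[of n] by simp
  then show "e < c (Suc n) / c n" using \<open>e < 1\<close> by simp
 qed
next
 fix e :: real assume "1 < e"
 have "(%m. (1+1/real m) powr a) ----> (1+0) powr a"
  by (intro tendsto_intros lim_1_over_n) auto
 then have "eventually (%m. (1+1/real m) powr a < e) sequentially"
  using \<open>1 < e\<close> by (intro order_tendstoD) auto
 then obtain N where N: "!!m. m>=N ==> (1+1/real m) powr a < e"
  by (auto simp: eventually_sequentially)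
 define m where "m = max N 1"
 have m: "m>=1" "(1+1/real m) powr a < e" using N[of m] by (auto simp: m_def)
 have "(%q. (c ((m+1) * q) / c q)/(c (m * q) / c q)) ----> real (m+1) powr a/real m powr a"
  using m by (intro tendsto_divide c_ratio) auto
 also have "real (m+1) powr a/real m powr a = (1+1/real m) powr a"
  using m by (simp add: powr_divide[symmetric] field_simps)
 finally have "eventually (%q. (c ((m+1) * q) / c q)/(c (m * q) / c q) < e) sequentially"
  using m by (intro order_tendstoD)
 then obtain q0 where q0: "!!q. q>=q0 ==> (c ((m+1) * q) / c q)/(c (m * q) / c q) < e"
  by (auto simp: eventually_sequentially)
 show "eventually (%n. c (Suc n) / c n < e) sequentially"
 proof (intro eventually_sequentiallyI[of "m*(q0+m+1)"])
  fix n assume n: "n>=m*(q0+m+1)"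
  define q where "q = n div m"
  have q: "q>=q0" "q>=m" "q>=1"
   using n m div_le_mono[OF n, of m] by (auto simp: q_def)
  have "n mod m < m" using m by simp
  moreover have nq: "n = m * q+n mod m" by (simp add: q_def)
  ultimately have "Suc n<=m * q+m" by linarith
  also have "... <= (m+1) * q" using q by simp
  finally have "c (Suc n)<=c ((m+1) * q)" by (intro c_mono) auto
  moreover have mq: "1<=m * q" using m(1) q(3) by (simp add: Suc_leI)
  then have "c (m * q)<=c n" using nq by (intro c_mono) auto
  ultimately have "c (Suc n) / c n<=c ((m+1) * q) / c (m * q)"
   using c_pos[OF mq] c_pos[of "(m+1) * q"] q by (intro frac_le) auto
  also have "... = (c ((m+1) * q) / c q)/(c (m * q) / c q)" using c_pos[OF q(3)] by simp
  also have "... < e" by (rule q0[OF q(1)])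
  finally show "c (Suc n) / c n < e" .
 qed
qed

lemma w_Suc_ratio: "(%n. w (Suc n)/w n) ----> 1"
proof -
 have "(%n. (real n/real (Suc n)) * inverse (c (Suc n) / c n)) ----> 1 * inverse 1"
  by (intro tendsto_intros c_Suc_ratio LIMSEQ_n_over_Suc_n) auto
 moreover have "eventually (%n. (real n/real (Suc n)) * inverse (c (Suc n) / c n) = w (Suc n)/w n) sequentially"
  by (intro eventually_sequentiallyI[of 1]) (auto simp: w_def field_simps)
 ultimately show ?thesis by (auto simp: tendsto_cong)
qed

lemma w_shift_ratio: "(%n. w (n+l)/w n) ----> 1"
proof (induction l)
 case 0
 have "w n/w n = 1" for n using w_pos[of n] by simp
 then show ?case by simp
next
 case (Suc l)
 have "(%n. w (Suc (n+l))/w (n+l)*(w (n+l)/w n)) ----> 1*1"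
  by (intro tendsto_mult Suc LIMSEQ_ignore_initial_segment[OF w_Suc_ratio])
 moreover have "w (Suc (n+l))/w (n+l)*(w (n+l)/w n) = w (n+Suc l)/w n" for n
  using w_pos[of "n+l"] by simp
 ultimately show ?case by simp
qed

lemma c_potter: "\<exists>k0\<ge>1. \<forall>k\<ge>k0. \<forall>n\<ge>k. c n<=2*(real n/real k) * c k"
proof -
 have "2 powr a < 2 powr 1" using a by (intro powr_less_mono) auto
 then have "eventually (%n. c (2 * n) / c n < 2) sequentially"
  using c_ratio[of 2] by (intro order_tendstoD) auto
 then obtain k0 where k0: "!!n. n>=k0 ==> c (2 * n) / c n < 2" by (auto simp: eventually_sequentially)
 have pow: "c (2^j * k)<=2^j * c k" if k: "k>=max k0 1" for j k
 proof (induction j)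
  case (Suc j)
  have "k<=2^j * k" using one_le_power[of "2::nat" j] by simp
  then have "2^j * k>=k0" "2^j * k>=1" using k by linarith+
  from k0[OF this(1)] c_pos[OF this(2)] have "c (2*(2^j * k))<=2 * c (2^j * k)"
   by (simp add: field_simps)
  with Suc show ?case by (simp add: mult.assoc)
 qed simp
 have "c n<=2*(real n/real k) * c k" if k: "k>=max k0 1" and n: "n>=k" for k n
 proof -
  have "\<exists>j. n < 2^Suc j * k"
  proof -
   have "n < 2^n" by (rule less_exp)
   also have "... <= 2^Suc n * k" using k by simp
   finally show ?thesis by blast
  qed
  define j where "j = (LEAST j. n < 2^Suc j * k)"
  have j1: "n < 2^Suc j * k" unfolding j_def by (rule LeastI_ex) fact
  have j2: "2^j * k<=n"
  proof (cases j)
   case (Suc i)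
   then have "\<not> n < 2^Suc i * k" using not_less_Least[of i "%j. n < 2^Suc j * k"] by (simp add: j_def)
   then show ?thesis using Suc by simp
  qed (use n in simp)
  have "c n<=c (2^Suc j * k)" using j1 n k by (intro c_mono) auto
  also have "... <= 2^Suc j * c k" by (rule pow[OF k])
  also have "(2::real)^Suc j<=2*(real n/real k)"
  proof -
   have "real (2^j * k)<=real n" using j2 by (simp only: of_nat_le_iff)
   then show ?thesis using k by (simp add: field_simps)
  qed
  finally show ?thesis using c_pos[of k] k by (simp add: mult_right_mono)
 qed
 then show ?thesis by (intro exI[of _ "max k0 1"]) auto
qed

end

definition act :: "real measure => (real => ennreal) => real => ennreal" where
 "act m f x = (\<integral>\<^sup>+y. f (x+y) \<partial>m)"

definition fin_borel :: "real measure => bool" where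
 "fin_borel m \<longleftrightarrow> finite_measure m \<and> sets m = sets borel"

definition bdd_fun :: "(real => ennreal) => bool" where
 "bdd_fun f \<longleftrightarrow> f \<in> bmeas borel \<and> (\<exists>C<\<top>. \<forall>x. f x<=C)"

lemma bdd_fun_measurable: "bdd_fun f ==> f \<in> bmeas borel"
 by (simp add: bdd_fun_def)

lemma act_measurable [measurable]:
 assumes "fin_borel m" and [measurable]: "f \<in> bmeas borel"
 shows "act m f \<in> bmeas borel"
proof -
 interpret finite_measure m using assms by (simp add: fin_borel_def)
 have [measurable_cong]: "sets m = sets borel" using assms by (simp add: fin_borel_def)
 show ?thesis unfolding act_def by measurable
qed

lemma act_commute:
 assumes "fin_borel m" "fin_borel m'" and [measurable]: "f \<in> bmeas borel"
 shows "act m (act m' f) x = act m' (act m f) x"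
proof -
 interpret m: finite_measure m using assms by (simp add: fin_borel_def)
 interpret m': finite_measure m' using assms by (simp add: fin_borel_def)
 interpret pair_sigma_finite m m' ..
 have [measurable_cong]: "sets m = sets borel" "sets m' = sets borel"
  using assms by (simp_all add: fin_borel_def)
 have "act m (act m' f) x = (\<integral>\<^sup>+y. \<integral>\<^sup>+z. f (x+y+z) \<partial>m' \<partial>m)" by (simp add: act_def)
 also have "... = (\<integral>\<^sup>+z. \<integral>\<^sup>+y. f (x+y+z) \<partial>m \<partial>m')"
  by (rule Fubini'[symmetric]) measurable
 also have "... = act m' (act m f) x" by (simp add: act_def ac_simps)
 finally show ?thesis .
qed

lemma act_shift: "act m f x = act m (%y. f (x+y)) 0"
 by (simp add: act_def)

lemma act_add:
 assumes "fin_borel m" and [measurable]: "f \<in> bmeas borel" "g \<in> bmeas borel"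
 shows "act m (%x. f x+g x) x = act m f x+act m g x"
proof -
 have [measurable_cong]: "sets m = sets borel" using assms by (simp add: fin_borel_def)
 show ?thesis unfolding act_def by (rule nn_integral_add) measurable
qed

lemma act_sum:
 assumes "fin_borel m" "!!i. i \<in> I ==> f i \<in> bmeas borel"
 shows "act m (%x. \<Sum>i\<in>I. f i x) x = (\<Sum>i\<in>I. act m (f i) x)"
proof -
 have [measurable_cong]: "sets m = sets borel" using assms by (simp add: fin_borel_def)
 show ?thesis unfolding act_def
 proof (rule nn_integral_sum)
  fix i assume "i \<in> I"
  note assms(2)[OF this, measurable]
  show "(%y. f i (x+y)) \<in> bmeas m" by measurable
 qed
qed

lemma act_cmult:
 assumes "fin_borel m" and [measurable]: "f \<in> bmeas borel"
 shows "act m (%x. c * f x) x = c * act m f x"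
proof -
 have [measurable_cong]: "sets m = sets borel" using assms by (simp add: fin_borel_def)
 show ?thesis unfolding act_def by (rule nn_integral_cmult) measurable
qed

lemma act_mono: "(!!y. f y<=g y) ==> act m f x<=act m g x"
 by (simp add: act_def nn_integral_mono)

lemma bdd_fun_act:
 assumes "fin_borel m" "bdd_fun f"
 shows "bdd_fun (act m f)"
proof -
 from assms obtain C where C: "C < \<top>" "!!x. f x<=C" by (auto simp: bdd_fun_def)
 interpret finite_measure m using assms by (simp add: fin_borel_def)
 have "act m f x<=C * emeasure m (space m)" for x
  unfolding act_def using nn_integral_mono[of m "%y. f (x+y)" "%_. C"] C by simp
 moreover have "C * emeasure m (space m) < \<top>"
  using C(1) emeasure_finite[of "space m"]
  unfolding ennreal_mult_less_top by (simp add: less_top[symmetric])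
 ultimately show ?thesis using assms act_measurable by (auto simp: bdd_fun_def)
qed

lemma bdd_fun_finite: "bdd_fun f ==> f x < \<top>"
 by (auto simp: bdd_fun_def intro: le_less_trans)

lemma bdd_fun_shift: "bdd_fun f ==> bdd_fun (%y. f (x+y))"
 by (auto simp: bdd_fun_def)

lemma bdd_fun_indicator_mult:
 assumes "bdd_fun f" "A \<in> sets borel"
 shows "bdd_fun (%y. indicator A y * f y)"
proof -
 from assms obtain C where C: "C < \<top>" "!!x. f x<=C" by (auto simp: bdd_fun_def)
 have "indicator A x * f x<=C" for x using C by (auto split: split_indicator)
 with assms C show ?thesis by (auto simp: bdd_fun_def)
qed

primrec kill :: "real measure => real set => nat => real measure" where
 "kill \<nu> Sd 0 = return borel 0"
| "kill \<nu> Sd (Suc n) = density (kill \<nu> Sd n \<star> \<nu>) (indicator Sd)"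

definition leave :: "real measure => real set => nat => real measure" where
 "leave \<nu> Sd n = density (kill \<nu> Sd n \<star> \<nu>) (indicator (- Sd))"

definition on :: "real set => real measure => real measure" where
 "on Sd m = density m (indicator Sd)"

lemma fin_borel_density:
 assumes "fin_borel m" "Sd \<in> sets borel"
 shows "fin_borel (density m (indicator Sd))"
proof -
 interpret finite_measure m using assms by (simp add: fin_borel_def)
 have Sd: "Sd \<in> sets m" using assms by (simp add: fin_borel_def)
 have "emeasure (density m (indicator Sd)) (space m) = emeasure m (Sd \<inter> space m)"
  using Sd by (intro emeasure_restricted) auto
 then have "finite_measure (density m (indicator Sd))"
  by (intro finite_measureI) simp
 then show ?thesis using assms by (simp add: fin_borel_def)
qed

lemma fin_borel_on: "fin_borel m ==> Sd \<in> sets borel ==> fin_borel (on Sd m)"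
 unfolding on_def by (rule fin_borel_density)

lemma fin_borel_convolution: "fin_borel m ==> fin_borel m' ==> fin_borel (m \<star> m')"
 by (simp add: fin_borel_def convolution_finite)

lemma act_on:
 assumes "fin_borel m" and [measurable]: "Sd \<in> sets borel" "f \<in> bmeas borel"
 shows "act (on Sd m) f x = (\<integral>\<^sup>+y. indicator Sd y * f (x+y) \<partial>m)"
proof -
 have [measurable_cong]: "sets m = sets borel" using assms by (simp add: fin_borel_def)
 show ?thesis unfolding act_def on_def by (subst nn_integral_density) (auto)
qed

lemma act_on_split:
 assumes "fin_borel m" and [measurable]: "Sd \<in> sets borel" "f \<in> bmeas borel"
 shows "act m f x = act (on Sd m) f x+act (on (- Sd) m) f x"
proof -
 have [measurable_cong]: "sets m = sets borel" using assms by (simp add: fin_borel_def)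
 have "act m f x = (\<integral>\<^sup>+y. indicator Sd y * f (x+y)+indicator (- Sd) y * f (x+y) \<partial>m)"
  unfolding act_def by (intro nn_integral_cong) (auto split: split_indicator)
 then show ?thesis using assms by (subst (asm) nn_integral_add) (auto simp: act_on)
qed

lemma act_convolution:
 assumes "fin_borel m" "fin_borel m'" and [measurable]: "f \<in> bmeas borel"
 shows "act (m \<star> m') f x = act m (act m' f) x"
 using assms unfolding act_def fin_borel_def
 by (subst nn_integral_convolution) (auto simp: ac_simps)

lemma act_return: "f \<in> bmeas borel ==> act (return borel 0) f x = f x"
 by (simp add: act_def nn_integral_return)

lemma act_AE_cong:
 assumes "AE y in m. f (x+y) = g (x+y)"
 shows "act m f x = act m g x"
 unfolding act_def using assms by (rule nn_integral_cong_AE)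

lemma act_AE_0:
 assumes "AE y in m. f (x+y) = 0"
 shows "act m f x = 0"
proof -
 have "act m f x = act m (%_. 0) x" using assms by (intro act_AE_cong) simp
 then show ?thesis by (simp add: act_def)
qed

locale walk = real_distribution \<nu> for \<nu> :: "real measure"
begin

lemma fin_nu [simp, intro]: "fin_borel \<nu>"
 by (simp add: fin_borel_def finite_measure_axioms)

lemma fin_kill [simp, intro]: "Sd \<in> sets borel ==> fin_borel (kill \<nu> Sd n)"
proof (induction n)
 case 0
 have "prob_space (return borel (0::real))" by (rule prob_space_return) simp
 then show ?case by (simp add: fin_borel_def prob_space_def)
next
 case (Suc n)
 then show ?case by (auto intro!: fin_borel_density fin_borel_convolution)
qed

lemma fin_leave [simp, intro]: "Sd \<in> sets borel ==> fin_borel (leave \<nu> Sd n)"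
 unfolding leave_def by (intro fin_borel_density fin_borel_convolution fin_kill fin_nu) auto

lemma act_kill_Suc:
 assumes [measurable]: "Sd \<in> sets borel" "f \<in> bmeas borel"
 shows "act (kill \<nu> Sd (Suc n)) f 0 = act (kill \<nu> Sd n) (act \<nu> (%x. indicator Sd x * f x)) 0"
proof -
 have "act (kill \<nu> Sd (Suc n)) f 0 = act (on Sd (kill \<nu> Sd n \<star> \<nu>)) f 0" by (simp add: on_def)
 also have "... = act (kill \<nu> Sd n \<star> \<nu>) (%x. indicator Sd x * f x) 0"
  by (subst act_on) (auto intro!: fin_borel_convolution simp: act_def)
 also have "... = act (kill \<nu> Sd n) (act \<nu> (%x. indicator Sd x * f x)) 0"
  by (subst act_convolution) auto
 finally show ?thesis .
qed

lemma act_kill_leave: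
 assumes [measurable]: "Sd \<in> sets borel" "f \<in> bmeas borel"
 shows "act \<nu> (act (kill \<nu> Sd n) f) x = act (kill \<nu> Sd (Suc n)) f x+act (leave \<nu> Sd n) f x"
proof -
 have "act \<nu> (act (kill \<nu> Sd n) f) x = act (kill \<nu> Sd n \<star> \<nu>) f x"
  by (subst act_convolution) (auto intro: act_commute)
 also have "... = act (on Sd (kill \<nu> Sd n \<star> \<nu>)) f x+act (on (- Sd) (kill \<nu> Sd n \<star> \<nu>)) f x"
  by (rule act_on_split) (auto intro!: fin_borel_convolution)
 finally show ?thesis by (simp add: on_def leave_def)
qed

lemma AE_kill_Suc: "Sd \<in> sets borel ==> AE x in kill \<nu> Sd (Suc n). x \<in> Sd"
 by (subst kill.simps, subst AE_density) (auto simp: indicator_def)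

lemma AE_leave: "Sd \<in> sets borel ==> AE x in leave \<nu> Sd n. x \<notin> Sd"
 unfolding leave_def by (subst AE_density) (auto simp: indicator_def)

lemma AE_kill_0: "AE x in kill \<nu> Sd 0. x = 0"
 by (subst kill.simps, subst AE_return) (auto simp: pred_def)

abbreviation "p \<equiv> kill \<nu> {..0}"
abbreviation "q \<equiv> kill \<nu> {0<..}"
abbreviation "nu \<equiv> kill \<nu> UNIV"

lemma AE_p: "AE x in p n. x<=0"
 using AE_kill_Suc[of "{..0}"] AE_kill_0[of "{..0}"] by (cases n) (auto simp del: kill.simps)

lemma AE_q: "AE x in q n. x>=0"
proof (cases n)
 case (Suc k)
 have "AE x in q n. x \<in> {0<..}" unfolding Suc by (rule AE_kill_Suc) simp
 then show ?thesis by eventually_elim simp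
qed (use AE_kill_0[of "{0<..}"] in \<open>auto simp del: kill.simps\<close>)

lemma AE_q_Suc: "AE x in q (Suc n). x > 0"
 using AE_kill_Suc[of "{0<..}" n] by (simp del: kill.simps)

lemma AE_leave_p: "AE x in leave \<nu> {..0} n. x > 0"
 using AE_leave[of "{..0}" n] by (simp add: not_le)

lemma AE_leave_q: "AE x in leave \<nu> {0<..} n. x<=0"
 using AE_leave[of "{0<..}" n] by (simp add: not_less)

lemma act_pos_0:
 assumes a: "AE x in a. x > 0" and b: "AE x in b. x>=0" and f: "!!x. x > 0 ==> f x = 0"
 shows "act a (act b f) 0 = 0"
proof (rule act_AE_0, use a in eventually_elim)
 fix x :: real assume "x > 0"
 show "act b f (0+x) = 0"
  by (rule act_AE_0, use b in eventually_elim) (use \<open>x > 0\<close> in \<open>auto intro: f\<close>)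
qed

lemma act_nonpos_0:
 assumes a: "AE x in a. x<=0" and b: "AE x in b. x<=0" and f: "!!x. x<=0 ==> f x = 0"
 shows "act a (act b f) 0 = 0"
proof (rule act_AE_0, use a in eventually_elim)
 fix x :: real assume "x<=0"
 show "act b f (0+x) = 0"
  by (rule act_AE_0, use b in eventually_elim) (use \<open>x \<le> 0\<close> in \<open>auto intro: f\<close>)
qed

definition pq :: "nat => (real => ennreal) => ennreal" where
 "pq n f = (\<Sum>k\<le>n. act (p k) (act (q (n-k)) f) 0)"

lemma pq_step1:
 assumes [measurable]: "f \<in> bmeas borel"
 shows "pq n (act \<nu> f)+act (q (Suc n)) f 0
  = pq (Suc n) f+(\<Sum>k\<le>n. act (leave \<nu> {..0} k) (act (q (n-k)) f) 0)"
proof -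
 have "act (p k) (act (q j) (act \<nu> f)) 0
   = act (p (Suc k)) (act (q j) f) 0+act (leave \<nu> {..0} k) (act (q j) f) 0" for k j
 proof -
  have "act (p k) (act (q j) (act \<nu> f)) 0 = act (p k) (act \<nu> (act (q j) f)) 0"
   unfolding act_def[of "p k"] by (intro nn_integral_cong act_commute) auto
  also have "... = act \<nu> (act (p k) (act (q j) f)) 0"
   by (intro act_commute) auto
  also have "... = act (p (Suc k)) (act (q j) f) 0+act (leave \<nu> {..0} k) (act (q j) f) 0"
   by (rule act_kill_leave) auto
  finally show ?thesis .
 qed
 then have "pq n (act \<nu> f) = (\<Sum>k\<le>n. act (p (Suc k)) (act (q (n-k)) f) 0)
   + (\<Sum>k\<le>n. act (leave \<nu> {..0} k) (act (q (n-k)) f) 0)"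
  by (simp add: pq_def sum.distrib del: kill.simps)
 moreover have "pq (Suc n) f
   = act (q (Suc n)) f 0+(\<Sum>k\<le>n. act (p (Suc k)) (act (q (n-k)) f) 0)"
 proof -
  have "act (p 0) (act (q (Suc n)) f) 0 = act (q (Suc n)) f 0"
   by (simp add: act_return del: kill.simps(2))
  then show ?thesis unfolding pq_def
   by (subst sum.atMost_Suc_shift) (simp del: kill.simps)
 qed
 ultimately show ?thesis by (simp add: ac_simps del: kill.simps)
qed

lemma pq_step2:
 assumes [measurable]: "f \<in> bmeas borel"
 shows "pq n (act \<nu> f)+act (p (Suc n)) f 0
  = pq (Suc n) f+(\<Sum>k\<le>n. act (p k) (act (leave \<nu> {0<..} (n-k)) f) 0)"
proof -
 have "act (p k) (act (q j) (act \<nu> f)) 0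
   = act (p k) (act (q (Suc j)) f) 0+act (p k) (act (leave \<nu> {0<..} j) f) 0" for k j
 proof -
  have "act (p k) (act (q j) (act \<nu> f)) 0 = act (p k) (act \<nu> (act (q j) f)) 0"
   unfolding act_def[of "p k"] by (intro nn_integral_cong act_commute) auto
  also have "... = act (p k) (%x. act (q (Suc j)) f x+act (leave \<nu> {0<..} j) f x) 0"
   unfolding act_def[of "p k"] by (intro nn_integral_cong act_kill_leave) auto
  also have "... = act (p k) (act (q (Suc j)) f) 0+act (p k) (act (leave \<nu> {0<..} j) f) 0"
   by (intro act_add) (auto simp del: kill.simps)
  finally show ?thesis .
 qed
 then have "pq n (act \<nu> f) = (\<Sum>k\<le>n. act (p k) (act (q (Suc (n-k))) f) 0)
   + (\<Sum>k\<le>n. act (p k) (act (leave \<nu> {0<..} (n-k)) f) 0)"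
  by (simp add: pq_def sum.distrib del: kill.simps)
 moreover have "pq (Suc n) f
   = act (p (Suc n)) f 0+(\<Sum>k\<le>n. act (p k) (act (q (Suc (n-k))) f) 0)"
 proof -
  have "act (p (Suc n)) (act (q 0) f) 0 = act (p (Suc n)) f 0"
   unfolding act_def[of "p (Suc n)"] by (intro nn_integral_cong) (simp add: act_return)
  moreover have "(\<Sum>k\<le>n. act (p k) (act (q (Suc n-k)) f) 0)
    = (\<Sum>k\<le>n. act (p k) (act (q (Suc (n-k))) f) 0)"
   by (intro sum.cong) (auto simp: Suc_diff_le simp del: kill.simps)
  ultimately show ?thesis unfolding pq_def by (simp del: kill.simps)
 qed
 ultimately show ?thesis by (simp add: ac_simps del: kill.simps)
qed

lemma pq_add:
 assumes [measurable]: "f \<in> bmeas borel" "g \<in> bmeas borel"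
 shows "pq n (%x. f x+g x) = pq n f+pq n g"
proof -
 have "act (p k) (act (q j) (%x. f x+g x)) 0 = act (p k) (act (q j) f) 0+act (p k) (act (q j) g) 0" for k j
 proof -
  have "act (p k) (act (q j) (%x. f x+g x)) 0 = act (p k) (%x. act (q j) f x+act (q j) g x) 0"
   unfolding act_def[of "p k"] by (intro nn_integral_cong act_add) auto
  then show ?thesis by (simp add: act_add)
 qed
 then show ?thesis by (simp add: pq_def sum.distrib)
qed

lemma pq_finite: "bdd_fun f ==> pq n f < \<top>"
 unfolding pq_def by (auto simp: less_top intro!: bdd_fun_finite[of "act m f" for m f] bdd_fun_act)

lemma pq_Suc_nonpos:
 assumes f: "bdd_fun f"
 shows "pq n (act \<nu> (%x. indicator {..0} x * f x)) = pq (Suc n) (%x. indicator {..0} x * f x)"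
proof -
 let ?f = "%x. indicator {..0} x * f x"
 have [measurable]: "f \<in> bmeas borel" using f by (rule bdd_fun_measurable)
 have "act (q (Suc n)) ?f 0 = 0"
  by (rule act_AE_0, use AE_q_Suc[of n] in eventually_elim) (simp split: split_indicator)
 moreover have "act (leave \<nu> {..0} k) (act (q (n-k)) ?f) 0 = 0" for k
  by (rule act_pos_0[OF AE_leave_p AE_q]) simp
 ultimately show ?thesis using pq_step1[of ?f n] by (simp del: kill.simps)
qed

lemma pq_Suc_pos:
 assumes f: "bdd_fun f"
 shows "pq n (act \<nu> (%x. indicator {0<..} x * f x)) = pq (Suc n) (%x. indicator {0<..} x * f x)"
proof -
 let ?f = "%x. indicator {0<..} x * f x"
 have [measurable]: "f \<in> bmeas borel" using f by (rule bdd_fun_measurable)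
 have "act (p (Suc n)) ?f 0 = 0"
  by (rule act_AE_0, use AE_p[of "Suc n"] in eventually_elim) (simp split: split_indicator)
 moreover have "act (p k) (act (leave \<nu> {0<..} (n-k)) ?f) 0 = 0" for k
  by (rule act_nonpos_0[OF AE_p AE_leave_q]) simp
 ultimately show ?thesis using pq_step2[of ?f n] by (simp del: kill.simps)
qed

lemma pq_eq_nu:
 assumes f: "bdd_fun f"
 shows "pq n f = act (nu n) f 0"
 using f
proof (induction n arbitrary: f)
 case 0
 then have [measurable]: "f \<in> bmeas borel" by (rule bdd_fun_measurable)
 have "act (return borel 0) f = f" by (simp add: act_return fun_eq_iff)
 then show ?case by (simp add: pq_def act_return)
next
 case (Suc n)
 have [measurable]: "f \<in> bmeas borel" using Suc.prems by (rule bdd_fun_measurable)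
 let ?f = "%x. indicator {..0} x * f x" and ?g = "%x. indicator {0<..} x * f x"
 have fg: "f = (%x. ?f x+?g x)" by (auto split: split_indicator)
 have "pq (Suc n) f = pq (Suc n) ?f+pq (Suc n) ?g"
  by (subst fg, subst pq_add) auto
 also have "... = pq n (act \<nu> ?f)+pq n (act \<nu> ?g)"
  using pq_Suc_nonpos[OF Suc.prems] pq_Suc_pos[OF Suc.prems] by simp
 also have "... = pq n (%x. act \<nu> ?f x+act \<nu> ?g x)" by (subst pq_add) auto
 also have "(%x. act \<nu> ?f x+act \<nu> ?g x) = act \<nu> f"
  by (subst (3) fg) (auto simp: act_add)
 also have "pq n (act \<nu> f) = act (nu n) (act \<nu> f) 0"
  using Suc by (simp add: bdd_fun_act)
 also have "... = act (nu (Suc n)) f 0" by (subst act_kill_Suc) auto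
 finally show ?case .
qed

text \<open>The first weak descent of the walk, followed by the remaining path: the weak descending
 ladder structure of \<^term>\<open>p\<close>.\<close>

lemma p_renewal:
 assumes f: "bdd_fun f"
 shows "act (p (Suc n)) f x = (\<Sum>k\<le>n. act (leave \<nu> {0<..} k) (act (p (n-k)) f) x)"
proof -
 have *: "act (p (Suc n)) f 0 = (\<Sum>k\<le>n. act (p k) (act (leave \<nu> {0<..} (n-k)) f) 0)"
  if f: "bdd_fun f" for f
 proof -
  have [measurable]: "f \<in> bmeas borel" using f by (rule bdd_fun_measurable)
  let ?f = "%x. indicator {..0} x * f x"
  have b: "bdd_fun ?f" by (rule bdd_fun_indicator_mult[OF f]) simp
  have "act (p (Suc n)) ?f 0 = (\<Sum>k\<le>n. act (p k) (act (leave \<nu> {0<..} (n-k)) ?f) 0)"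
   using pq_step2[of ?f n] pq_Suc_nonpos[OF f, of n] pq_finite[OF b, of "Suc n"]
   by (auto simp del: kill.simps)
  moreover have "act (p (Suc n)) ?f 0 = act (p (Suc n)) f 0"
   by (rule act_AE_cong, use AE_p[of "Suc n"] in eventually_elim) (simp split: split_indicator)
  moreover have "act (p k) (act (leave \<nu> {0<..} j) ?f) 0 = act (p k) (act (leave \<nu> {0<..} j) f) 0" for k j
  proof (rule act_AE_cong, use AE_p[of k] in eventually_elim)
   fix x :: real assume "x<=0"
   show "act (leave \<nu> {0<..} j) ?f (0+x) = act (leave \<nu> {0<..} j) f (0+x)"
    by (rule act_AE_cong, use AE_leave_q[of j] in eventually_elim)
      (use \<open>x \<le> 0\<close> in \<open>simp split: split_indicator\<close>)
  qed
  ultimately show ?thesis by simp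
 qed
 have [measurable]: "f \<in> bmeas borel" using f by (rule bdd_fun_measurable)
 have "act (p (Suc n)) f x = (\<Sum>k\<le>n. act (p k) (act (leave \<nu> {0<..} (n-k)) (%y. f (x+y))) 0)"
  unfolding act_shift[of _ f x] by (rule *) (rule bdd_fun_shift[OF f])
 also have "... = (\<Sum>k\<le>n. act (p k) (act (leave \<nu> {0<..} (n-k)) f) x)"
  by (simp add: act_def add.assoc)
 also have "... = (\<Sum>k\<le>n. act (leave \<nu> {0<..} (n-k)) (act (p k) f) x)"
  by (intro sum.cong refl act_commute) auto
 also have "... = (\<Sum>k\<le>n. act (leave \<nu> {0<..} k) (act (p (n-k)) f) x)"
  by (rule sum.reindex_bij_witness[of _ "%k. n-k" "%k. n-k"]) auto
 finally show ?thesis .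
qed

lemma nu_add:
 assumes "bdd_fun f"
 shows "act (nu (i+j)) f x = act (nu i) (act (nu j) f) x"
proof -
 have nuS: "act (nu (Suc n)) f x = act (nu n) (act \<nu> f) x" if [measurable]: "f \<in> bmeas borel" for n f x
  unfolding act_shift[of _ f x] act_shift[of _ "act \<nu> f" x]
  by (subst act_kill_Suc) (auto simp: act_def ac_simps)
 have [measurable]: "f \<in> bmeas borel" using assms by (rule bdd_fun_measurable)
 have "f \<in> bmeas borel ==> act (nu (i+j)) f x = act (nu i) (act (nu j) f) x" for f
 proof (induction j arbitrary: f)
  case 0
  then have "act (nu 0) f = f" by (simp add: act_return fun_eq_iff)
  then show ?case by simp
 next
  case (Suc j)
  have "act (nu (Suc j)) f = act (nu j) (act \<nu> f)" using Suc.prems by (simp add: nuS fun_eq_iff del: kill.simps)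
  then show ?case using Suc.IH[of "act \<nu> f"] Suc.prems by (simp add: nuS del: kill.simps)
 qed
 then show ?thesis by simp
qed

lemma nu_eq_pq:
 assumes f: "bdd_fun f"
 shows "act (nu n) f x = (\<Sum>i\<le>n. act (p i) (act (q (n-i)) f) x)"
 using pq_eq_nu[OF bdd_fun_shift[OF f, of x], of n]
 by (simp add: act_shift[of _ f x, symmetric] pq_def) (simp add: act_def add.assoc)

lemma sum_triangle:
 fixes h :: "nat => nat => 'c::comm_monoid_add"
 shows "(\<Sum>j=1..n. \<Sum>i\<le>n-j. h j i) = (\<Sum>k\<le>n. \<Sum>j=1..k. h j (k-j))"
proof -
 have "(\<Sum>j=1..n. \<Sum>i\<le>n-j. h j i) = (\<Sum>(j, i)\<in>(SIGMA j:{1..n}. {..n-j}). h j i)"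
  by (subst sum.Sigma) auto
 also have "... = (\<Sum>(k, j)\<in>(SIGMA k:{..n}. {1..k}). h j (k-j))"
  by (rule sum.reindex_bij_witness[of _ "%(k, j). (j, k-j)" "%(j, i). (i+j, j)"]) auto
 also have "... = (\<Sum>k\<le>n. \<Sum>j=1..k. h j (k-j))"
  by (subst sum.Sigma) auto
 finally show ?thesis .
qed

lemma spitzer_step:
 fixes P Q A :: "nat => real measure"
 assumes f: "bdd_fun f" and fin: "!!n. fin_borel (P n)" "!!n. fin_borel (Q n)" "!!n. fin_borel (A n)"
  and Q0: "!!f. f \<in> bmeas borel ==> act (Q 0) f = f"
  and IH: "!!k f. k < n ==> bdd_fun f ==>
    of_nat k * act (P k) f 0 = (\<Sum>j=1..k. act (A j) (act (P (k-j)) f) 0)"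
 obtains Z where "Z < \<top>"
  "(\<Sum>k\<le>n. of_nat k * act (P k) (act (Q (n-k)) f) 0) = of_nat n * act (P n) f 0+Z"
  "(\<Sum>j=1..n. \<Sum>i\<le>n-j. act (A j) (act (P i) (act (Q (n-j-i)) f)) 0)
   = (\<Sum>j=1..n. act (A j) (act (P (n-j)) f) 0)+Z"
proof
 let ?a = "%j i l. act (A j) (act (P i) (act (Q l) f)) 0"
 let ?Z = "\<Sum>k<n. \<Sum>j=1..k. ?a j (k-j) (n-k)"
 have [measurable]: "f \<in> bmeas borel" using f by (rule bdd_fun_measurable)
 show "?Z < \<top>"
  using f fin by (auto simp: less_top intro!: bdd_fun_finite[of "act m f" for m f] bdd_fun_act)
 have split: "(\<Sum>k\<le>n. g k) = g n+(\<Sum>k<n. g k)" for g :: "nat => ennreal"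
  by (simp add: lessThan_Suc_atMost[symmetric] add.commute)
 have "(\<Sum>k<n. of_nat k * act (P k) (act (Q (n-k)) f) 0) = ?Z"
  using f fin by (intro sum.cong refl IH) (auto intro!: bdd_fun_act)
 then show "(\<Sum>k\<le>n. of_nat k * act (P k) (act (Q (n-k)) f) 0) = of_nat n * act (P n) f 0+?Z"
  by (subst split) (simp add: Q0)
 have "(\<Sum>j=1..n. \<Sum>i\<le>n-j. ?a j i (n-j-i)) = (\<Sum>k\<le>n. \<Sum>j=1..k. ?a j (k-j) (n-j-(k-j)))"
  by (rule sum_triangle)
 also have "... = (\<Sum>k\<le>n. \<Sum>j=1..k. ?a j (k-j) (n-k))" by (intro sum.cong) auto
 also have "... = (\<Sum>j=1..n. ?a j (n-j) 0)+?Z" by (subst split) simp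
 finally show "(\<Sum>j=1..n. \<Sum>i\<le>n-j. ?a j i (n-j-i)) = (\<Sum>j=1..n. act (A j) (act (P (n-j)) f) 0)+?Z"
  by (simp add: Q0)
qed

lemma fin_on_nu [simp, intro]: "Sd \<in> sets borel ==> fin_borel (on Sd (nu k))"
 by (intro fin_borel_on fin_kill) auto

text \<open>Wendel's form of the Spitzer identity. Both sides of the two identities are supported on
 complementary half lines, so it suffices to prove the sum of the two identities; this is the
 identity \<open>n \<nu>\<^sub>n = \<Sum>\<^sub>k \<nu>\<^sub>k * \<nu>\<^bsub>n-k\<^esub>\<close> rewritten by means of \<open>\<nu>\<^sub>n = \<Sum>\<^sub>k p\<^sub>k * q\<^bsub>n-k\<^esub>\<close>.\<close>

lemma spitzer:
 assumes f: "bdd_fun f"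
 shows "of_nat n * act (p n) f 0 = (\<Sum>k=1..n. act (on {..0} (nu k)) (act (p (n-k)) f) 0)"
  and "of_nat n * act (q n) f 0 = (\<Sum>k=1..n. act (on {0<..} (nu k)) (act (q (n-k)) f) 0)"
proof -
 let ?A = "%k. on {..0} (nu k)" and ?B = "%k. on {0<..} (nu k)"
 have "\<forall>f. bdd_fun f -->
   of_nat n * act (p n) f 0 = (\<Sum>k=1..n. act (?A k) (act (p (n-k)) f) 0) \<and>
   of_nat n * act (q n) f 0 = (\<Sum>k=1..n. act (?B k) (act (q (n-k)) f) 0)"
 proof (induction n rule: less_induct)
  case (less n)
  show ?case
  proof (cases "n = 0")
   case False
   have *: "of_nat n * act (p n) f 0 + of_nat n * act (q n) f 0
     = (\<Sum>k=1..n. act (?A k) (act (p (n-k)) f) 0)+(\<Sum>k=1..n. act (?B k) (act (q (n-k)) f) 0)"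
    if f: "bdd_fun f" for f
   proof -
    have [measurable]: "f \<in> bmeas borel" using f by (rule bdd_fun_measurable)
    have k0: "act (kill \<nu> Sd 0) f = f" if "f \<in> bmeas borel" for f Sd
     using that by (simp add: act_return fun_eq_iff)
    obtain Z where Z: "Z < \<top>"
     "(\<Sum>k\<le>n. of_nat k * act (p k) (act (q (n-k)) f) 0) = of_nat n * act (p n) f 0+Z"
     "(\<Sum>j=1..n. \<Sum>i\<le>n-j. act (?A j) (act (p i) (act (q (n-j-i)) f)) 0)
      = (\<Sum>j=1..n. act (?A j) (act (p (n-j)) f) 0)+Z"
    proof (rule spitzer_step[where P = p and Q = q and A = ?A and n = n, OF f _ _ _ k0])
     fix k f assume "k < n" "bdd_fun f"
     then show "of_nat k * act (p k) f 0 = (\<Sum>j=1..k. act (?A j) (act (p (k-j)) f) 0)"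
      using less.IH by blast
    qed (auto intro: that)
    obtain Z' where Z': "Z' < \<top>"
     "(\<Sum>k\<le>n. of_nat k * act (q k) (act (p (n-k)) f) 0) = of_nat n * act (q n) f 0+Z'"
     "(\<Sum>j=1..n. \<Sum>i\<le>n-j. act (?B j) (act (q i) (act (p (n-j-i)) f)) 0)
      = (\<Sum>j=1..n. act (?B j) (act (q (n-j)) f) 0)+Z'"
    proof (rule spitzer_step[where P = q and Q = p and A = ?B and n = n, OF f _ _ _ k0])
     fix k f assume "k < n" "bdd_fun f"
     then show "of_nat k * act (q k) f 0 = (\<Sum>j=1..k. act (?B j) (act (q (k-j)) f) 0)"
      using less.IH by blast
    qed (auto intro: that)
    have "of_nat n * act (nu n) f 0
      = (\<Sum>k\<le>n. of_nat k * act (p k) (act (q (n-k)) f) 0)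
      + (\<Sum>k\<le>n. of_nat (n-k) * act (p k) (act (q (n-k)) f) 0)"
     unfolding nu_eq_pq[OF f] sum_distrib_left sum.distrib[symmetric]
     by (intro sum.cong refl) (simp add: distrib_right[symmetric] of_nat_add[symmetric] del: of_nat_add)
    also have "(\<Sum>k\<le>n. of_nat (n-k) * act (p k) (act (q (n-k)) f) 0)
      = (\<Sum>k\<le>n. of_nat k * act (p (n-k)) (act (q k) f) 0)"
     by (rule sum.reindex_bij_witness[of _ "%k. n-k" "%k. n-k"]) auto
    also have "... = (\<Sum>k\<le>n. of_nat k * act (q k) (act (p (n-k)) f) 0)"
     by (intro sum.cong refl arg_cong2[where f = "(*)"] act_commute) auto
    finally have lhs: "of_nat n * act (nu n) f 0
      = (of_nat n * act (p n) f 0 + of_nat n * act (q n) f 0)+(Z+Z')"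
     unfolding Z Z' by (simp add: ac_simps)
    have "of_nat n * act (nu n) f 0 = (\<Sum>j=1..n. act (nu j) (act (nu (n-j)) f) 0)"
     by (subst sum.cong[OF refl, where h = "%_. act (nu n) f 0"])
       (auto simp: nu_add[OF f, symmetric] simp del: kill.simps)
    also have "... = (\<Sum>j=1..n. act (?A j) (act (nu (n-j)) f) 0)
       + (\<Sum>j=1..n. act (?B j) (act (nu (n-j)) f) 0)"
    proof -
     have "act (nu j) (act (nu (n-j)) f) 0
       = act (?A j) (act (nu (n-j)) f) 0+act (?B j) (act (nu (n-j)) f) 0" for j
     proof -
      have "- {..0::real} = {0<..}" by auto
      then show ?thesis using act_on_split[of "nu j" "{..0}" "act (nu (n-j)) f" 0] by auto
     qed
     then show ?thesis by (simp add: sum.distrib)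
    qed
    also have "(\<Sum>j=1..n. act (?A j) (act (nu (n-j)) f) 0)
      = (\<Sum>j=1..n. \<Sum>i\<le>n-j. act (?A j) (act (p i) (act (q (n-j-i)) f)) 0)"
    proof (intro sum.cong refl)
     fix j
     have "act (nu (n-j)) f = (%x. \<Sum>i\<le>n-j. act (p i) (act (q (n-j-i)) f) x)"
      using nu_eq_pq[OF f] by auto
     then show "act (?A j) (act (nu (n-j)) f) 0 = (\<Sum>i\<le>n-j. act (?A j) (act (p i) (act (q (n-j-i)) f)) 0)"
      by (simp add: act_sum)
    qed
    also have "(\<Sum>j=1..n. act (?B j) (act (nu (n-j)) f) 0)
      = (\<Sum>j=1..n. \<Sum>i\<le>n-j. act (?B j) (act (q i) (act (p (n-j-i)) f)) 0)"
    proof (intro sum.cong refl)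
     fix j
     have "act (nu (n-j)) f x = (\<Sum>i\<le>n-j. act (q i) (act (p (n-j-i)) f) x)" for x
     proof -
      have "act (nu (n-j)) f x = (\<Sum>i\<le>n-j. act (q (n-j-i)) (act (p i) f) x)"
       unfolding nu_eq_pq[OF f] by (intro sum.cong refl act_commute) auto
      also have "... = (\<Sum>i\<le>n-j. act (q i) (act (p (n-j-i)) f) x)"
       by (rule sum.reindex_bij_witness[of _ "%k. n-j-k" "%k. n-j-k"])
         (auto simp del: diff_diff_left)
      finally show ?thesis .
     qed
     then have "act (nu (n-j)) f = (%x. \<Sum>i\<le>n-j. act (q i) (act (p (n-j-i)) f) x)"
      by auto
     then show "act (?B j) (act (nu (n-j)) f) 0 = (\<Sum>i\<le>n-j. act (?B j) (act (q i) (act (p (n-j-i)) f)) 0)"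
      by (simp add: act_sum)
    qed
    finally have "of_nat n * act (nu n) f 0
      = ((\<Sum>j=1..n. act (?A j) (act (p (n-j)) f) 0)+(\<Sum>j=1..n. act (?B j) (act (q (n-j)) f) 0))+(Z+Z')"
     unfolding Z Z' by (simp add: ac_simps)
    with lhs have "(Z+Z')+(of_nat n * act (p n) f 0 + of_nat n * act (q n) f 0) = (Z+Z')
      + ((\<Sum>j=1..n. act (?A j) (act (p (n-j)) f) 0)+(\<Sum>j=1..n. act (?B j) (act (q (n-j)) f) 0))"
     by (simp only: add.commute[of "Z+Z'"])
    moreover have "Z+Z' ~= \<top>" using Z(1) Z'(1) by auto
    ultimately show ?thesis by (simp only: ennreal_add_left_cancel infinity_ennreal_def) blast
   qed
   have AE_on: "AE x in on Sd (nu j). x \<in> Sd" if "Sd \<in> sets borel" for Sd j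
   proof -
    have [measurable_cong]: "sets (nu j) = sets borel" using fin_kill[of UNIV j] by (simp add: fin_borel_def)
    show ?thesis unfolding on_def using that by (subst AE_density) (auto simp: indicator_def)
   qed
   have A: "AE x in ?A j. x<=0" "AE x in ?B j. x > 0" for j
    using AE_on[of "{..0}" j] AE_on[of "{0<..}" j] by simp_all
   obtain n' where n: "n = Suc n'" using False by (cases n) auto
   show ?thesis
   proof (intro allI impI conjI)
    fix f assume f: "bdd_fun f"
    have [measurable]: "f \<in> bmeas borel" using f by (rule bdd_fun_measurable)
    let ?f = "%x. indicator {..0} x * f x" and ?g = "%x. indicator {0<..} x * f x"
    have ff: "bdd_fun ?f" and gg: "bdd_fun ?g" by (auto intro!: bdd_fun_indicator_mult[OF f])
    have "act (q n) ?f 0 = 0"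
     by (rule act_AE_0, use AE_q_Suc[of n'] in \<open>unfold n, eventually_elim\<close>) (simp split: split_indicator)
    moreover have "act (?B j) (act (q k) ?f) 0 = 0" for j k
     by (rule act_pos_0[OF A(2) AE_q]) simp
    moreover have "act (p n) ?f 0 = act (p n) f 0"
     by (rule act_AE_cong, use AE_p[of n] in eventually_elim) (simp split: split_indicator)
    moreover have "act (?A j) (act (p k) ?f) 0 = act (?A j) (act (p k) f) 0" for j k
    proof (rule act_AE_cong, use A(1) in eventually_elim)
     fix x :: real assume "x<=0"
     show "act (p k) ?f (0+x) = act (p k) f (0+x)"
      by (rule act_AE_cong, use AE_p[of k] in eventually_elim)
        (use \<open>x \<le> 0\<close> in \<open>simp split: split_indicator\<close>)
    qed
    ultimately show "of_nat n * act (p n) f 0 = (\<Sum>k=1..n. act (?A k) (act (p (n-k)) f) 0)"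
     using *[OF ff] by simp
    have "act (p n) ?g 0 = 0"
     by (rule act_AE_0, use AE_p[of n] in eventually_elim) (simp split: split_indicator)
    moreover have "act (?A j) (act (p k) ?g) 0 = 0" for j k
     by (rule act_nonpos_0[OF A(1) AE_p]) simp
    moreover have "act (q n) ?g 0 = act (q n) f 0"
     by (rule act_AE_cong, use AE_q_Suc[of n'] in \<open>unfold n, eventually_elim\<close>) (simp split: split_indicator)
    moreover have "act (?B j) (act (q k) ?g) 0 = act (?B j) (act (q k) f) 0" for j k
    proof (rule act_AE_cong, use A(2) in eventually_elim)
     fix x :: real assume "0 < x"
     show "act (q k) ?g (0+x) = act (q k) f (0+x)"
      by (rule act_AE_cong, use AE_q[of k] in eventually_elim)
        (use \<open>0 < x\<close> in \<open>simp split: split_indicator\<close>)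
    qed
    ultimately show "of_nat n * act (q n) f 0 = (\<Sum>k=1..n. act (?B k) (act (q (n-k)) f) 0)"
     using *[OF gg] by simp
   qed
  qed simp
 qed
 then show "of_nat n * act (p n) f 0 = (\<Sum>k=1..n. act (on {..0} (nu k)) (act (p (n-k)) f) 0)"
  and "of_nat n * act (q n) f 0 = (\<Sum>k=1..n. act (on {0<..} (nu k)) (act (q (n-k)) f) 0)"
  using f by blast+
qed

definition R :: "real => (real => ennreal) => real => ennreal" where
 "R ka f = act \<nu> (%y. indicator {..ka} y * f y)"

lemma R_measurable [measurable]: "f \<in> bmeas borel ==> R ka f \<in> bmeas borel"
 unfolding R_def by measurable

lemma R_pow_measurable [measurable]:
 "f \<in> bmeas borel ==> (R ka^^n) f \<in> bmeas borel"
 by (induction n) auto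

lemma act_p_eq_R_pow:
 assumes "f \<in> bmeas borel"
 shows "act (p n) f 0 = (R 0^^n) f 0"
 using assms
proof (induction n arbitrary: f)
 case (Suc n)
 then have "act (p (Suc n)) f 0 = act (p n) (R 0 f) 0" unfolding R_def by (intro act_kill_Suc) auto
 then show ?case using Suc by (simp add: funpow_swap1 del: kill.simps)
qed (simp add: act_return)

text \<open>Decomposition of a path of the walk below level 0 at its maximum.\<close>

lemma R_pow_eq:
 assumes f: "bdd_fun f" and "y<=0"
 shows "(R 0^^n) f y = (\<Sum>k\<le>n. act (q k) (%w. indicator {..0} w * act (p (n-k)) f w) y)"
 using \<open>y \<le> 0\<close>
proof (induction n arbitrary: y)
 case 0
 have [measurable]: "f \<in> bmeas borel" using f by (rule bdd_fun_measurable)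
 from 0 show ?case by (simp add: act_return)
next
 case (Suc n)
 have [measurable]: "f \<in> bmeas borel" using f by (rule bdd_fun_measurable)
 define G where "G j w = indicator {..0} w * act (p j) f w" for j w
 have [measurable]: "G j \<in> bmeas borel" for j unfolding G_def by measurable
 have "(R 0^^Suc n) f y = act \<nu> (%w. indicator {..0} w*(R 0^^n) f w) y" by (simp add: R_def)
 also have "(%w. indicator {..0} w*(R 0^^n) f w) = (%w. \<Sum>k\<le>n. act (q k) (G (n-k)) w)"
 proof
  fix w :: real
  show "indicator {..0} w*(R 0^^n) f w = (\<Sum>k\<le>n. act (q k) (G (n-k)) w)"
  proof (cases "w<=0")
   case False
   have "act (q k) (G j) w = 0" for k j
    by (rule act_AE_0, use AE_q[of k] in eventually_elim) (use False in \<open>auto simp: G_def\<close>)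
   with False show ?thesis by simp
  qed (simp add: Suc.IH G_def[abs_def])
 qed
 also have "act \<nu> (%w. \<Sum>k\<le>n. act (q k) (G (n-k)) w) y = (\<Sum>k\<le>n. act \<nu> (act (q k) (G (n-k))) y)"
  by (rule act_sum) auto
 also have "... = (\<Sum>k\<le>n. act (q (Suc k)) (G (n-k)) y)+(\<Sum>k\<le>n. act (leave \<nu> {0<..} k) (G (n-k)) y)"
  unfolding sum.distrib[symmetric] by (intro sum.cong refl act_kill_leave) auto
 also have "(\<Sum>k\<le>n. act (leave \<nu> {0<..} k) (G (n-k)) y)
   = (\<Sum>k\<le>n. act (leave \<nu> {0<..} k) (act (p (n-k)) f) y)"
  by (intro sum.cong refl act_AE_cong, use AE_leave_q in eventually_elim) (use Suc.prems in \<open>auto simp: G_def\<close>)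
 also have "... = act (p (Suc n)) f y" by (rule p_renewal[OF f, symmetric])
 also have "... = act (q 0) (G (Suc n)) y" using Suc.prems by (simp add: act_return G_def del: kill.simps(2))
 also have "(\<Sum>k\<le>n. act (q (Suc k)) (G (n-k)) y)+act (q 0) (G (Suc n)) y
   = (\<Sum>k\<le>Suc n. act (q k) (G (Suc n-k)) y)"
  by (subst sum.atMost_Suc_shift) (simp add: add.commute del: kill.simps)
 finally show ?case unfolding G_def .
qed

end

lemma char_cos_eq_1:
 assumes "real_distribution m" "cmod (char m t) = 1"
 shows "\<exists>th. AE x in m. cos (t * x-th) = 1"
proof -
 interpret real_distribution m by fact
 obtain th where th: "char m t = iexp th"
  using assms(2) by (metis cis_conv_exp complex_norm_eq_1_exp)
 have int: "integrable m (%x. iexp (t * x-th))"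
  by (rule integrable_const_bound[of _ 1]) (auto simp del: of_real_mult of_real_diff)
 have "(CLINT x|m. iexp (t * x-th)) = (CLINT x|m. iexp (t * x) * iexp (- th))"
  by (intro Bochner_Integration.integral_cong refl) (simp add: exp_add[symmetric] algebra_simps)
 also have "... = char m t * iexp (- th)" by (simp add: char_def)
 also have "... = 1" by (simp add: th exp_add[symmetric])
 finally have "Re (CLINT x|m. iexp (t * x-th)) = 1" by simp
 then have "(\<integral>x. Re (iexp (t * x-th)) \<partial>m) = 1" using int by (simp only: integral_Re)
 then have "(\<integral>x. cos (t * x-th) \<partial>m) = 1" by (simp only: Re_exp) simp
 moreover have ic: "integrable m (%x. cos (t * x-th))"
  by (rule integrable_const_bound[of _ 1]) auto
 ultimately have "(\<integral>x. 1-cos (t * x-th) \<partial>m) = 0"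
  by (subst Bochner_Integration.integral_diff) (auto simp: prob_space[simplified])
 then have "AE x in m. 1-cos (t * x-th) = 0"
  using ic by (subst (asm) integral_nonneg_eq_0_iff_AE) auto
 then show ?thesis by (intro exI[of _ th]) (auto elim: eventually_mono)
qed

lemma char_uminus: "char m (- t) = cnj (char m t)"
proof -
 have "cnj (char m t) = (CLINT x|m. cnj (iexp (t * x)))" unfolding char_def by (rule Bochner_Integration.integral_cnj[symmetric])
 also have "... = char m (- t)" unfolding char_def by (simp add: exp_cnj)
 finally show ?thesis by simp
qed

lemma weak_conv_char_moving:
 assumes M: "!!n. real_distribution (M n)" "real_distribution m" "weak_conv_m M m" and v: "v ----> v0"
 shows "(%n. char (M n) (v n)) ----> char m v0"
proof -
 obtain \<Omega> :: "real measure" and Y_seq Y where *: "prob_space \<Omega>" "!!n. Y_seq n \<in> measurable \<Omega> borel"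
  "!!n. distr \<Omega> borel (Y_seq n) = M n" "Y \<in> measurable \<Omega> lborel" "distr \<Omega> borel Y = m"
  "!!x. x \<in> space \<Omega> ==> (%n. Y_seq n x) ----> Y x"
  using Skorohod[OF M] by blast
 interpret prob_space \<Omega> by fact
 have Y[measurable]: "Y \<in> bmeas \<Omega>" using *(4) by simp
 note *(2)[measurable]
 have "(%n. CLINT x|\<Omega>. iexp (v n * Y_seq n x)) ----> (CLINT x|\<Omega>. iexp (v0 * Y x))"
 proof (rule integral_dominated_convergence[where w = "%_. 1"])
  show "AE x in \<Omega>. (%n. iexp (v n * Y_seq n x)) ----> iexp (v0 * Y x)"
   using *(6) v by (intro AE_I2 tendsto_intros) auto
 qed (auto simp del: of_real_mult)
 moreover have "char (M n) (v n) = (CLINT x|\<Omega>. iexp (v n * Y_seq n x))" for n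
  unfolding char_def *(3)[symmetric] by (subst integral_distr) auto
 moreover have "char m v0 = (CLINT x|\<Omega>. iexp (v0 * Y x))"
  unfolding char_def *(5)[symmetric] by (subst integral_distr) auto
 ultimately show ?thesis by simp
qed

lemma char_convolution:
 assumes "real_distribution m" "real_distribution m'"
 shows "char (m \<star> m') t = char m t * char m' t"
proof -
 interpret m: real_distribution m by fact
 interpret m': real_distribution m' by fact
 interpret pair_prob_space m m' ..
 have int: "integrable (m \<Otimes>\<^sub>M m') (%z. iexp (t*(fst z+snd z)))"
  by (rule integrable_const_bound[of _ 1]) (auto simp del: of_real_mult of_real_add)
 have "char (m \<star> m') t = (CLINT z|(m \<Otimes>\<^sub>M m'). iexp (t*(fst z+snd z)))"
  unfolding char_def convolution_def by (subst integral_distr) (auto simp: case_prod_beta)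
 also have "... = (CLINT x|m. CLINT y|m'. iexp (t*(x+y)))"
  using integral_fst'[OF int] by simp
 also have "... = (CLINT x|m. CLINT y|m'. iexp (t * x) * iexp (t * y))"
  by (simp add: exp_add[symmetric] distrib_left)
 also have "... = char m t * char m' t" by (simp add: char_def)
 finally show ?thesis .
qed

lemma weak_conv_m_subseq: "weak_conv_m M m ==> strict_mono r ==> weak_conv_m (%n. M (r n)) m"
 unfolding weak_conv_m_def weak_conv_def
 using LIMSEQ_subseq_LIMSEQ by (fastforce simp: comp_def)

context walk
begin

lemma nu_Suc: "nu (Suc n) = (nu n \<star> \<nu>)"
proof -
 have "indicator UNIV = (%_::real. 1 :: ennreal)" by auto
 then show ?thesis by (simp add: density_1)
qed

lemma nu_distribution: "real_distribution (nu n)"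
proof (induction n)
 case 0
 then show ?case by (simp add: real_distribution_def real_distribution_axioms_def prob_space_return)
next
 case (Suc n)
 interpret n: real_distribution "nu n" by fact
 interpret pair_prob_space "nu n" \<nu> ..
 have "prob_space (nu n \<star> \<nu>)" unfolding convolution_def by (rule prob_space_distr) simp
 then show ?case unfolding nu_Suc by (simp add: real_distribution_def real_distribution_axioms_def)
qed

lemma char_nu: "char (nu n) t = char \<nu> t^n"
proof (induction n)
 case 0
 show ?case by (simp add: char_def integral_return)
next
 case (Suc n)
 have "real_distribution \<nu>" by unfold_locales
 then show ?case unfolding nu_Suc by (subst char_convolution) (auto intro: nu_distribution simp: Suc)
qed

end

locale attracted = walk \<nu> + norming c a + mu: real_distribution \<mu>
 for \<nu> c a and \<mu> :: "real measure" +
 assumes nonlattice: "nonlattice \<nu>"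
  and two_sided: "two_sided \<mu>"
  and conv: "weak_conv_m (%n. distr (nu n) borel (%x. x / c n)) \<mu>"
begin

abbreviation "\<phi> \<equiv> char \<nu>"
abbreviation "\<psi> \<equiv> char \<mu>"

lemma scaled_distribution: "real_distribution (distr (nu n) borel (%x. x / c n))"
proof -
 interpret n: real_distribution "nu n" by (rule nu_distribution)
 show ?thesis by (simp add: real_distribution_def real_distribution_axioms_def n.prob_space_distr)
qed

lemma char_scaled: "char (distr (nu n) borel (%x. x / c n)) v = \<phi> (v / c n)^n"
proof -
 interpret n: real_distribution "nu n" by (rule nu_distribution)
 have "char (distr (nu n) borel (%x. x / c n)) v = char (nu n) (v / c n)"
  unfolding char_def by (subst integral_distr) auto
 then show ?thesis by (simp add: char_nu)
qed

lemma phi_limit: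
 assumes "strict_mono r" "v ----> v0"
 shows "(%n. \<phi> (v n / c (r n))^r n) ----> \<psi> v0"
 using weak_conv_char_moving[OF scaled_distribution _ weak_conv_m_subseq[OF conv assms(1)] assms(2)]
  mu.real_distribution_axioms by (simp add: char_scaled)

lemma phi_limit': "(%n. \<phi> (v / c n)^n) ----> \<psi> v"
 using phi_limit[of "%n. n" "%_. v" v] by (simp add: strict_mono_def)

lemma stable: "k>=1 ==> \<psi> v^k = \<psi> (real k powr a * v)"
proof -
 assume k: "k>=1"
 have 1: "(%n. (\<phi> (v / c n)^n)^k) ----> \<psi> v^k"
  by (intro tendsto_power phi_limit')
 have 2: "(%n. \<phi> ((c (k * n) / c n * v) / c (k * n))^(k * n)) ----> \<psi> (real k powr a * v)"
  using k by (intro phi_limit tendsto_intros c_ratio) (auto simp: strict_mono_def)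
 have "eventually (%n. (\<phi> (v / c n)^n)^k = \<phi> ((c (k * n) / c n * v) / c (k * n))^(k * n)) sequentially"
 proof (intro eventually_sequentiallyI[of 1])
  fix n :: nat assume "n>=1"
  then have "c n > 0" "c (k * n) > 0" using k by (auto intro!: c_pos simp: Suc_leI)
  then show "(\<phi> (v / c n)^n)^k = \<phi> ((c (k * n) / c n * v) / c (k * n))^(k * n)"
   by (simp add: power_mult[symmetric] mult.commute)
 qed
 from LIMSEQ_unique[OF tendsto_cong[THEN iffD1, OF this 1] 2] show ?thesis .
qed

lemma cmod_phi_less_1: "t ~= 0 ==> cmod (\<phi> t) < 1"
proof (rule ccontr)
 assume t: "t ~= 0" and "\<not> cmod (\<phi> t) < 1"
 then have "cmod (\<phi> t) = 1" using cmod_char_le_1[of t] by linarith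
 from char_cos_eq_1[OF real_distribution_axioms this]
 obtain th where "AE x in \<nu>. cos (t * x-th) = 1" by blast
 then have "AE x in \<nu>. x \<in> {th/t+(2 * pi/\<bar>t\<bar>) * of_int k | k. True}"
 proof eventually_elim
  case (elim x)
  then obtain n :: int where n: "t * x-th = of_int n*2 * pi" by (auto simp: cos_one_2pi_int)
  then have "x = th/t+(2 * pi/\<bar>t\<bar>) * of_int (if t > 0 then n else-n)"
   using t by (auto simp: field_simps)
  then show ?case by blast
 qed
 moreover have "2 * pi/\<bar>t\<bar> > 0" using t by simp
 ultimately show False using nonlattice unfolding nonlattice_def by blast
qed

lemma cmod_chi_less_1: "t ~= 0 ==> cmod (\<psi> t) < 1"
proof (rule ccontr)
 assume t: "t ~= 0" and "\<not> cmod (\<psi> t) < 1"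
 then have one: "cmod (\<psi> t) = 1" using mu.cmod_char_le_1[of t] by linarith
 have rat: "cmod (\<psi> ((real j/real k) powr a * t)) = 1" if jk: "j>=1" "k>=1" for j k
 proof -
  let ?s = "t/real k powr a"
  have "cmod (\<psi> ?s)^k = cmod (\<psi> (real k powr a*?s))"
   using stable[OF jk(2), of ?s] by (simp add: norm_power[symmetric])
  also have "... = 1" using one jk by simp
  finally have "cmod (\<psi> ?s) = 1" using jk power_eq_iff_eq_base[of k "cmod (\<psi> ?s)" 1] by simp
  then have "cmod (\<psi> (real j powr a*?s)) = 1"
   using stable[OF jk(1), of ?s] by (metis norm_power power_one)
  then show ?thesis using jk by (simp add: powr_divide)
 qed
 have all: "cmod (\<psi> (s * t)) = 1" if s: "s > 0" for s
 proof -
  define z where "z = s powr (1/a)"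
  have z: "z > 0" using s by (simp add: z_def)
  define f where "f n = real (nat \<lceil>z * real (Suc n)\<rceil>)/real (Suc n)" for n
  have f: "f ----> z"
  proof (rule tendsto_sandwich)
   show "eventually (%n. z<=f n) sequentially"
   proof (intro always_eventually allI)
    fix n
    have "z * real (Suc n)<=real (nat \<lceil>z * real (Suc n)\<rceil>)" by linarith
    then show "z<=f n" by (simp add: f_def field_simps)
   qed
   show "eventually (%n. f n<=z+1/real (Suc n)) sequentially"
   proof (intro always_eventually allI)
    fix n
    have "0<=z * real (Suc n)" using z by simp
    then have "real (nat \<lceil>z * real (Suc n)\<rceil>)<=z * real (Suc n)+1" by linarith
    then have "f n<=(z * real (Suc n)+1)/real (Suc n)" unfolding f_def by (intro divide_right_mono) auto
    also have "... = z+1/real (Suc n)" by (simp add: field_simps)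
    finally show "f n<=z+1/real (Suc n)" .
   qed
   have "(%n. z+1/real (Suc n)) ----> z+0"
    by (intro tendsto_intros LIMSEQ_Suc[OF lim_1_over_n])
   then show "(%n. z+1/real (Suc n)) ----> z" by simp
  qed auto
  have "(%n. cmod (\<psi> (f n powr a * t))) ----> cmod (\<psi> (z powr a * t))"
   using z by (intro tendsto_norm isCont_tendsto_compose[OF mu.isCont_char] tendsto_intros f) auto
  moreover have "cmod (\<psi> (f n powr a * t)) = 1" for n
  proof -
   have "0 < z * real (Suc n)" using z by simp
   then have "nat \<lceil>z * real (Suc n)\<rceil> >= 1" by linarith
   then show ?thesis unfolding f_def by (intro rat) auto
  qed
  moreover have "z powr a = s" using s a by (simp add: z_def powr_powr)
  ultimately show ?thesis by (simp add: LIMSEQ_const_iff)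
 qed
 have ev: "cmod (\<psi> s) = 1" if "s > 0" for s
 proof (cases "t > 0")
  case True
  then show ?thesis using all[of "s/t"] that by simp
 next
  case False
  have "cmod (\<psi> (- s)) = cmod (\<psi> s)" by (simp add: char_uminus)
  moreover have "cmod (\<psi> (- s)) = 1" using all[of "- s/t"] t False that by (simp add: divide_pos_neg)
  ultimately show ?thesis by simp
 qed
 obtain \<sigma> :: real where \<sigma>: "\<sigma> > 0" "\<sigma> \<notin> \<rat>"
 proof -
  have "\<not> {0<..<1::real} \<subseteq> \<rat>"
   using countable_rat uncountable_open_interval[of 0 "1::real"] countable_subset by auto
  then obtain \<sigma> :: real where "0 < \<sigma>" "\<sigma> \<notin> \<rat>" by (auto simp: subset_iff)
  then show thesis by (rule that)
 qed
 obtain th1 where A1: "AE x in \<mu>. cos (1 * x-th1) = 1"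
  using char_cos_eq_1[OF mu.real_distribution_axioms ev[of 1]] by auto
 obtain th2 where A2: "AE x in \<mu>. cos (\<sigma> * x-th2) = 1"
  using char_cos_eq_1[OF mu.real_distribution_axioms ev[OF \<sigma>(1)]] by auto
 have uniq: "x = y" if x: "cos (1 * x-th1) = 1" "cos (\<sigma> * x-th2) = 1"
  and y: "cos (1 * y-th1) = 1" "cos (\<sigma> * y-th2) = 1" for x y
 proof (rule ccontr)
  assume "x ~= y"
  from x y obtain i1 i2 j1 j2 :: int where
   eq: "1 * x-th1 = of_int i1*2 * pi" "\<sigma> * x-th2 = of_int i2*2 * pi"
   "1 * y-th1 = of_int j1*2 * pi" "\<sigma> * y-th2 = of_int j2*2 * pi"
   unfolding cos_one_2pi_int by blast
  from eq have d1: "x-y = of_int (i1-j1)*2 * pi" by (simp add: algebra_simps)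
  from eq have d2: "\<sigma>*(x-y) = of_int (i2-j2)*2 * pi" by (simp add: algebra_simps)
  have "i1 ~= j1" using d1 \<open>x \<noteq> y\<close> by auto
  from d2 have "\<sigma> * of_int (i1-j1)*(2 * pi) = of_int (i2-j2)*(2 * pi)"
   unfolding d1 by (simp only: mult.assoc)
  then have "\<sigma> * of_int (i1-j1) = of_int (i2-j2)"
   using mult_right_cancel[of "2 * pi"] by (simp del: of_int_diff)
  then have "\<sigma> = of_int (i2-j2) / of_int (i1-j1)" using \<open>i1 \<noteq> j1\<close> by (simp add: field_simps)
  then have "\<sigma> \<in> \<rat>" by simp
  then show False using \<sigma>(2) by simp
 qed
 from A1 A2 have A: "AE x in \<mu>. cos (1 * x-th1) = 1 \<and> cos (\<sigma> * x-th2) = 1" by eventually_elim simp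
 have "\<exists>x. cos (1 * x-th1) = 1 \<and> cos (\<sigma> * x-th2) = 1"
  using eventually_happens[OF A] mu.ae_filter_bot by auto
 then obtain x0 where x0: "cos (1 * x0-th1) = 1" "cos (\<sigma> * x0-th2) = 1" by blast
 from A have "AE x in \<mu>. x>=x0" by eventually_elim (use uniq x0 in force)
 then show False using two_sided unfolding two_sided_def by blast
qed

lemma cmod_phi_uminus: "cmod (\<phi> (- s)) = cmod (\<phi> s)"
 by (simp add: char_uminus)

lemma phi_block: "\<exists>\<rho>>0. \<rho> < 1 \<and> (\<exists>k1. \<forall>k\<ge>k1. \<forall>v\<in>{1..2}. cmod (\<phi> (v / c k))^k<=\<rho>)"
proof -
 have cont: "continuous_on {1..2} (%v. cmod (\<psi> v))"
  by (intro continuous_on_norm continuous_at_imp_continuous_on ballI mu.isCont_char)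
 obtain vm where vm: "vm \<in> {1..2::real}" "!!v. v \<in> {1..2} ==> cmod (\<psi> v)<=cmod (\<psi> vm)"
  using continuous_attains_sup[OF _ _ cont] by auto
 define \<rho> where "\<rho> = (1 + cmod (\<psi> vm))/2"
 have \<rho>: "cmod (\<psi> vm) < \<rho>" "\<rho> < 1" "\<rho> > 0"
  using cmod_chi_less_1[of vm] vm(1) norm_ge_zero[of "\<psi> vm"] unfolding \<rho>_def by (simp_all add: add_pos_nonneg)
 have "eventually (%k. \<forall>v\<in>{1..2}. cmod (\<phi> (v / c k))^k<=\<rho>) sequentially"
 proof (rule ccontr)
  assume "\<not> eventually (%k. \<forall>v\<in>{1..2}. cmod (\<phi> (v / c k))^k<=\<rho>) sequentially"
  from not_eventually_sequentiallyD[OF this] obtain r :: "nat => nat" where r: "strict_mono r"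
   "\<forall>n. \<not> (\<forall>v\<in>{1..2}. cmod (\<phi> (v / c (r n)))^r n<=\<rho>)" by blast
  then have "\<forall>n. \<exists>v. v \<in> {1..2} \<and> cmod (\<phi> (v / c (r n)))^r n > \<rho>" by (meson not_le)
  then obtain v where v: "!!n. v n \<in> {1..2}" "!!n. cmod (\<phi> (v n / c (r n)))^r n > \<rho>" by metis
  have "seq_compact {1..2::real}" using compact_imp_seq_compact[OF compact_Icc] .
  then obtain l q where q: "l \<in> {1..2}" "strict_mono q" "(v \<circ> q) ----> l"
   using v(1) unfolding seq_compact_def by blast
  have "(%n. \<phi> ((v \<circ> q) n / c ((r \<circ> q) n))^(r \<circ> q) n) ----> \<psi> l"
   using r(1) q by (intro phi_limit strict_mono_o)
  then have "(%n. cmod (\<phi> ((v \<circ> q) n / c ((r \<circ> q) n))^(r \<circ> q) n)) ----> cmod (\<psi> l)"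
   by (rule tendsto_norm)
  then have "\<rho> <= cmod (\<psi> l)"
   by (rule LIMSEQ_le_const) (use v(2) in \<open>auto simp: norm_power less_imp_le\<close>)
  then show False using vm(2)[OF q(1)] \<rho>(1) by simp
 qed
 then show ?thesis using \<rho> by (auto simp: eventually_sequentially)
qed

lemma phi_bound:
 "\<exists>\<delta>>0. \<exists>b>0. \<forall>n\<ge>1. \<forall>t. 1<=\<bar>t\<bar> --> \<bar>t\<bar> <= \<delta> * c n --> cmod (\<phi> (t / c n))^n<=exp (- b*\<bar>t\<bar>)"
proof -
 obtain \<rho> k1 where \<rho>: "0 < \<rho>" "\<rho> < 1" and k1: "!!k v. k>=k1 ==> v \<in> {1..2} ==> cmod (\<phi> (v / c k))^k<=\<rho>"
  using phi_block by blast
 obtain k0 where k0: "k0>=1" "!!k n. k>=k0 ==> n>=k ==> c n<=2*(real n/real k) * c k"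
  using c_potter by blast
 have "eventually (%n. c (Suc n) / c n < 2) sequentially"
  using c_Suc_ratio by (rule order_tendstoD) simp
 then obtain k2 where k2: "!!k. k>=k2 ==> c (Suc k) / c k < 2" by (auto simp: eventually_sequentially)
 define K where "K = k0+k1+k2+1"
 define \<delta> where "\<delta> = 1/(2 * c K)"
 define b where "b = - ln \<rho>/4"
 have cK: "c K > 0" by (rule c_pos) (simp add: K_def)
 have pos: "cmod (\<phi> (t / c n))^n<=exp (- b * t)" if n: "n>=1" and t: "1<=t" "t<=\<delta> * c n" for n t
 proof -
  define s where "s = t / c n"
  have cn: "c n > 0" using c_pos n by simp
  have s: "s > 0" "s<=\<delta>" using t cn by (auto simp: s_def field_simps)
  have cKs: "c K < 1/s" using s cK by (simp add: \<delta>_def field_simps)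
  have ex: "c n>=1/s" using t cn by (simp add: s_def field_simps)
  define k where "k = (LEAST k. k>=1 \<and> c k>=1/s)"
  have k: "k>=1" "c k>=1/s" using LeastI[of "%k. k>=1 \<and> c k>=1/s" n] n ex by (auto simp: k_def)
  have kn: "k<=n" unfolding k_def by (rule Least_le) (use n ex in auto)
  have kK: "k > K"
  proof (rule ccontr)
   assume "\<not> k > K"
   then have "c k<=c K" using k by (intro c_mono) auto
   then show False using k cKs by simp
  qed
  then obtain k' where k': "k = Suc k'" "k'>=K" by (cases k) auto
  have k'1: "k'>=1" using k' by (auto simp: K_def)
  have ck': "c k' < 1/s"
   using not_less_Least[of k' "%k. k>=1 \<and> c k>=1/s"] k' k'1 by (auto simp: k_def)
  have ck'0: "c k' > 0" using c_pos k'1 by simp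
  have "c k<=2 * c k'" using k2[of k'] k' ck'0 by (simp add: K_def field_simps)
  then have "c k * s<=2 * c k' * s" using s by (intro mult_right_mono) auto
  also have "... <= 2" using ck' s by (simp add: field_simps)
  finally have "c k * s \<in> {1..2}" using k s by (auto simp: field_simps)
  then have "cmod (\<phi> (c k * s / c k))^k<=\<rho>" using kK by (intro k1) (auto simp: K_def)
  then have phik: "cmod (\<phi> s)^k<=\<rho>" using c_pos[OF k(1)] by simp
  have "c n<=2*(real n/real k') * c k'" using k' kn by (intro k0) (auto simp: K_def)
  also have "... <= 2*(real n/real k')*(1/s)" using ck' by (intro mult_left_mono) auto
  finally have "c n * s<=2*(real n/real k')*(1/s) * s" using s by (intro mult_right_mono) auto
  also have "... = 2*(real n/real k')" using s by simp
  finally have "c n * s<=2*(real n/real k')" .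
  then have "t<=2*(real n/real k')" using cn by (simp add: s_def)
  also have "... <= 4*(real n/real k)" using k' k'1 n by (simp add: field_simps)
  finally have tn: "t/4<=real n/real k" by (simp add: mult.commute)
  show ?thesis
  proof (cases "\<phi> s = 0")
   case True
   then show ?thesis using n by (simp add: s_def zero_power)
  next
   case False
   then have p: "cmod (\<phi> s) > 0" by simp
   have "real k * ln (cmod (\<phi> s))<=ln \<rho>"
    using phik p \<rho> by (subst ln_realpow[symmetric]) (auto simp: ln_le_cancel_iff)
   then have "ln (cmod (\<phi> s))<=ln \<rho>/real k" using k by (simp add: field_simps)
   then have "real n * ln (cmod (\<phi> s))<=real n*(ln \<rho>/real k)" by (intro mult_left_mono) auto
   also have "... = (real n/real k) * ln \<rho>" by simp
   also have "... <= (t/4) * ln \<rho>" using tn \<rho> by (intro mult_right_mono_neg) auto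
   also have "... = - b * t" by (simp add: b_def)
   finally have "exp (real n * ln (cmod (\<phi> s)))<=exp (- b * t)" by simp
   then show ?thesis using p by (simp add: exp_of_nat_mult s_def)
  qed
 qed
 have "cmod (\<phi> (t / c n))^n<=exp (- b*\<bar>t\<bar>)" if "n>=1" "1<=\<bar>t\<bar>" "\<bar>t\<bar> <= \<delta> * c n" for n t
  using pos[OF that] cmod_phi_uminus[of "t / c n"] by (cases "t>=0") auto
 moreover have "\<delta> > 0" "b > 0" using cK \<rho> by (auto simp: \<delta>_def b_def)
 ultimately show ?thesis by blast
qed

definition dom :: "real => real => real" where
 "dom b v = (if \<bar>v\<bar> <= 1 then 1 else exp (- b*\<bar>v\<bar>))"

lemma dom_measurable [measurable]: "dom b \<in> bmeas borel"
 unfolding dom_def by measurable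

lemma integrable_exp_abs: "b > 0 ==> integrable lborel (%v::real. exp (- b*\<bar>v\<bar>))"
proof -
 assume b: "b > 0"
 have 1: "set_integrable lborel {0..} (%x. exp (- b * x))"
 proof -
  have "(%x. exp (- (x * b))) absolutely_integrable_on {0..}"
   by (rule nonnegative_absolutely_integrable_1)
     (use integrable_on_exp_minus_to_infinity[OF b, of 0] in \<open>auto simp: ac_simps\<close>)
  then have "set_integrable lebesgue {0..} (%x. exp (- b * x))" by (simp add: mult.commute)
  then show ?thesis unfolding set_integrable_def by (subst (asm) integrable_completion) auto
 qed
 have 2: "integrable lborel (%x. indicator {0..} x *\<^sub>R exp (- b * x))"
  using 1 unfolding set_integrable_def .
 have 3: "integrable lborel (%x. indicator {0..} (- x) *\<^sub>R exp (- b*(- x)))"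
  using lborel_integrable_real_affine[OF 2, of "-1" 0] by simp
 show ?thesis
  by (rule Bochner_Integration.integrable_bound[OF Bochner_Integration.integrable_add[OF 2 3]])
    (auto simp: indicator_def)
qed

lemma integrable_dom: "b > 0 ==> integrable lborel (dom b)"
proof -
 assume b: "b > 0"
 have "integrable lborel (%v::real. indicator {-1..1} v :: real)"
  by (rule integrable_real_indicator) (auto simp: emeasure_lborel_Icc_eq)
 from Bochner_Integration.integrable_add[OF this integrable_exp_abs[OF b]] show ?thesis
  by (rule Bochner_Integration.integrable_bound) (auto simp: dom_def indicator_def)
qed

lemma chi_bound: "\<exists>b>0. \<forall>v. cmod (\<psi> v)<=dom b v"
proof -
 obtain \<delta> b where b: "\<delta> > 0" "b > 0"
  "!!n t. n>=1 ==> 1<=\<bar>t\<bar> ==> \<bar>t\<bar> <= \<delta> * c n ==> cmod (\<phi> (t / c n))^n<=exp (- b*\<bar>t\<bar>)"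
  using phi_bound by blast
 have "cmod (\<psi> v)<=exp (- b*\<bar>v\<bar>)" if v: "\<bar>v\<bar> > 1" for v
 proof (rule LIMSEQ_le_const2)
  show "(%n. cmod (\<phi> (v / c n)^n)) ----> cmod (\<psi> v)" by (intro tendsto_norm phi_limit')
  have "eventually (%n. \<bar>v\<bar>/\<delta> <= c n) sequentially"
   using c_at_top by (simp add: filterlim_at_top)
  then have "eventually (%n. cmod (\<phi> (v / c n)^n)<=exp (- b*\<bar>v\<bar>)) sequentially"
   using eventually_ge_at_top[of 1]
   by eventually_elim (use b v in \<open>auto simp: norm_power field_simps intro!: b(3)\<close>)
  then show "\<exists>N. \<forall>n\<ge>N. cmod (\<phi> (v / c n)^n)<=exp (- b*\<bar>v\<bar>)" by (simp add: eventually_sequentially)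
 qed
 then show ?thesis using b(2) mu.cmod_char_le_1 by (intro exI[of _ b]) (auto simp: dom_def)
qed

lemma integrable_chi: "integrable lborel \<psi>"
proof -
 obtain b where "b > 0" "!!v. cmod (\<psi> v)<=dom b v" using chi_bound by blast
 moreover have "\<bar>dom b v\<bar> = dom b v" for v by (simp add: dom_def)
 ultimately show ?thesis by (intro Bochner_Integration.integrable_bound[OF integrable_dom]) auto
qed

end

definition tent :: "real => real" where "tent u = max 0 (1-\<bar>u\<bar>)"

definition fejer :: "real => real" where "fejer x = (sinc (x/2))\<^sup>2"

lemma tent_bounds: "0<=tent u" "tent u<=1" by (auto simp: tent_def)

lemma tent_eq_0: "\<bar>u\<bar> >= 1 ==> tent u = 0" by (auto simp: tent_def)

lemma isCont_tent: "isCont tent u" unfolding tent_def by (intro continuous_intros)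

lemma tent_measurable [measurable]: "tent \<in> bmeas borel" unfolding tent_def by measurable

lemma isCont_fejer: "isCont fejer x"
proof -
 have "isCont (%x. sinc (x/2)) x"
  by (rule isCont_o2[where g = sinc and f = "%x. x/2"]) (auto intro: isCont_sinc)
 then have "isCont (%x. (sinc (x/2))\<^sup>2) x" by (intro continuous_intros)
 then show ?thesis unfolding fejer_def[abs_def] .
qed

lemma fejer_measurable [measurable]: "fejer \<in> bmeas borel"
 by (intro borel_measurable_continuous_onI continuous_at_imp_continuous_on ballI isCont_fejer)

lemma fejer_square: "fejer x * x\<^sup>2 = 2*(1-cos x)"
proof -
 have "cos x = 1-2*(sin (x/2))\<^sup>2" using cos_double_sin[of "x/2"] by simp
 then show ?thesis by (auto simp: fejer_def power_divide)
qed

lemma fejer_bounds: "0<=fejer x" "fejer x<=1"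
proof -
 show "0<=fejer x" by (simp add: fejer_def)
 have "\<bar>sinc (x/2)\<bar> <= 1" using abs_sin_x_le_abs_x[of "x/2"] by (auto simp: abs_mult)
 then show "fejer x<=1" unfolding fejer_def by (rule abs_square_le_1[THEN iffD2])
qed

lemma fejer_le: "fejer x<=5 * inverse (1+x\<^sup>2)"
proof -
 have "fejer x*(1+x\<^sup>2)<=1+4"
  unfolding distrib_left fejer_square using fejer_bounds(2)[of x] cos_ge_minus_one[of x] by argo
 moreover have "0 < 1+x\<^sup>2" by (simp add: add_pos_nonneg)
 ultimately show ?thesis by (simp add: field_simps)
qed

lemma integrable_inverse_square: "integrable lborel (%x::real. inverse (1+x\<^sup>2))"
 using integrable_inverse_1_plus_square by (simp add: set_integrable_def)

lemma integrable_fejer: "integrable lborel fejer"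
 by (rule Bochner_Integration.integrable_bound[OF integrable_mult_right[OF integrable_inverse_square, of 5]])
   (use fejer_bounds fejer_le in \<open>auto simp: add_nonneg_nonneg\<close>)

lemma integrable_tent: "integrable lborel tent"
proof -
 have "integrable lborel (%v::real. indicator {-1..1} v :: real)"
  by (rule integrable_real_indicator) (auto simp: emeasure_lborel_Icc_eq)
 then show ?thesis
  by (rule Bochner_Integration.integrable_bound) (auto simp: tent_def indicator_def)
qed

lemma integrable_of_real_mult_iexp:
 assumes "integrable m (f :: real => real)" and "g \<in> bmeas m"
 shows "integrable m (%x. cor (f x) * iexp (g x))"
proof (rule Bochner_Integration.integrable_bound[OF assms(1)])
 show "(%x. cor (f x) * iexp (g x)) \<in> bmeas m"
  using assms by measurable
qed (auto simp: norm_mult)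

lemma fourier_half_tent:
 fixes x :: real
 assumes "x ~= 0"
 shows "(CLINT u|lborel. indicator {0..1} u *\<^sub>R (cor (1-u) * iexp (u * x)))
  = (1-iexp x)/x\<^sup>2+\<i>/x"
proof -
 let ?F = "%u::real. cor (1-u)*(iexp (u * x)/(\<i> * x))-iexp (u * x)/(x\<^sup>2 :: real)"
 have "(CLINT u|lborel. indicator {0..1} u *\<^sub>R (cor (1-u) * iexp (u * x))) = ?F 1-?F 0"
 proof (rule integral_FTC_Icc)
  fix u :: real
  have e: "((%u. iexp (u * x)) has_vector_derivative (\<i> * x * iexp (u * x))) (at u within {0..1})"
  proof -
   have "((%z. exp (\<i>*(z * x))) has_field_derivative (\<i> * x * exp (\<i>*(cor u * x)))) (at (cor u))"
    by (auto intro!: derivative_eq_intros)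
   from has_vector_derivative_real_field[OF this] show ?thesis by simp
  qed
  have "(?F has_vector_derivative (cor (1-u)*(\<i> * x * iexp (u * x)/(\<i> * x))
    + (- 1)*(iexp (u * x)/(\<i> * x))
    - \<i> * x * iexp (u * x)/(x\<^sup>2 :: real))) (at u within {0..1})"
   by (intro has_vector_derivative_diff has_vector_derivative_mult has_vector_derivative_divide e)
     (auto intro!: derivative_eq_intros)
  moreover have "cor (1-u)*(\<i> * x * iexp (u * x)/(\<i> * x))
    + (- 1)*(iexp (u * x)/(\<i> * x))-\<i> * x * iexp (u * x)/(x\<^sup>2 :: real)
   = cor (1-u) * iexp (u * x)"
   using assms by (simp add: field_simps power2_eq_square)
  ultimately show "(?F has_vector_derivative (cor (1-u) * iexp (u * x))) (at u within {0..1})"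
   by simp
 qed (auto intro!: continuous_intros)
 also have "... = (1-iexp x)/x\<^sup>2+\<i>/x"
  using assms by (simp add: field_simps)
 finally show ?thesis .
qed

lemma fourier_tent: "(CLINT u|lborel. tent u * iexp (u * x)) = fejer x"
proof -
 let ?h = "%x u. indicator {0..1} u *\<^sub>R (cor (1-u) * iexp (u * x))"
 have int: "integrable lborel (?h x)" for x
 proof -
  have "integrable lborel (%u::real. indicator {0..1} u*(1-u))"
  proof (rule Bochner_Integration.integrable_bound[where f = "%v::real. indicator {0..1} v :: real"])
   show "integrable lborel (%v::real. indicator {0..1} v :: real)"
    by (rule integrable_real_indicator) (auto simp: emeasure_lborel_Icc_eq)
  qed (auto simp: indicator_def)
  from integrable_of_real_mult_iexp[OF this, of "%u. u * x"]
  show ?thesis by (rule Bochner_Integration.integrable_bound) (auto simp: norm_mult indicator_def)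
 qed
 have refl: "integrable lborel (%u. ?h (- x) (- u))" "(CLINT u|lborel. ?h (- x) (- u)) = (CLINT u|lborel. ?h (- x) u)"
  using lborel_integrable_real_affine[OF int[of "- x"], of "- 1" 0]
   lborel_integral_real_affine[of "- 1" "?h (- x)" 0] by simp_all
 have "AE u in lborel. u ~= (0::real)" by (rule AE_lborel_singleton)
 then have "AE u in lborel. tent u * iexp (u * x) = ?h x u+?h (- x) (- u)"
  by eventually_elim (auto simp: tent_def indicator_def)
 then have "(CLINT u|lborel. tent u * iexp (u * x)) = (CLINT u|lborel. ?h x u+?h (- x) (- u))"
  by (intro integral_cong_AE) (auto intro!: borel_measurable_integrable[OF Bochner_Integration.integrable_add[OF int refl(1)]])
 also have "... = (CLINT u|lborel. ?h x u)+(CLINT u|lborel. ?h (- x) u)"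
  using int refl by simp
 also have "... = fejer x"
 proof (cases "x = 0")
  case False
  then have "(CLINT u|lborel. ?h x u)+(CLINT u|lborel. ?h (- x) u) = (2-(iexp x+iexp (- x)))/x\<^sup>2"
   by (subst (1 2) fourier_half_tent) (auto simp: field_simps)
  also have "iexp x+iexp (- x) = 2 * cos x"
   by (simp add: complex_eq_iff Re_exp Im_exp)
  also have "(2-cor (2 * cos x))/x\<^sup>2 = fejer x"
  proof -
   have "fejer x = (2-2 * cos x)/x\<^sup>2" using fejer_square[of x] False by (simp add: field_simps)
   then show ?thesis by simp
  qed
  finally show ?thesis .
 next
  case True
  have "(CLINT u|lborel. ?h 0 u) = cor (\<integral>u. indicator {0..1} u *\<^sub>R (1-u) \<partial>lborel)"
   by (subst integral_complex_of_real[symmetric]) (auto intro!: Bochner_Integration.integral_cong simp: scaleR_conv_of_real)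
  also have "(\<integral>u. indicator {0..1} u *\<^sub>R (1-u) \<partial>lborel) = (1-1\<^sup>2/2)-(0-0\<^sup>2/(2::real))"
   by (rule integral_FTC_Icc[where F = "%u. u-u\<^sup>2/2"])
     (auto intro!: derivative_eq_intros continuous_intros simp: has_real_derivative_iff_has_vector_derivative[symmetric])
  finally have "(CLINT u|lborel. ?h 0 u) = 1/2" by simp
  then show ?thesis using True by (simp add: fejer_def mult.commute)
 qed
 finally show ?thesis .
qed

lemma fubini_iexp:
 assumes "sigma_finite_measure m" and [measurable_cong]: "sets m = sets borel"
  and G: "integrable m (G :: real => complex)" and g: "integrable lborel (g :: real => complex)"
 shows "(CLINT x|m. G x*(CLINT u|lborel. g u * iexp (u * x)))
    = (CLINT u|lborel. g u*(CLINT x|m. G x * iexp (u * x)))"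
proof -
 interpret m: sigma_finite_measure m by fact
 interpret pair_sigma_finite m lborel ..
 have [measurable]: "G \<in> bmeas borel" "g \<in> bmeas borel"
  using borel_measurable_integrable[OF G] borel_measurable_integrable[OF g] by simp_all
 have int: "integrable (m \<Otimes>\<^sub>M lborel) (%(x, u). G x*(g u * iexp (u * x)))"
 proof (rule Fubini_integrable)
  have "integrable m (%x. norm (G x)*(\<integral>u. norm (g u) \<partial>lborel))"
   using G by (intro integrable_mult_left integrable_norm)
  then show "integrable m (%x. \<integral>u. norm (case (x, u) of (x, u) => G x*(g u * iexp (u * x))) \<partial>lborel)"
   by (simp add: norm_mult del: of_real_mult)
  show "AE x in m. integrable lborel (%u. case (x, u) of (x, u) => G x*(g u * iexp (u * x)))"
  proof (intro AE_I2)
   fix x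
   have "integrable lborel (%u. G x*(g u * iexp (u * x)))"
    by (rule Bochner_Integration.integrable_bound[OF integrable_mult_right[OF g, of "G x"]])
      (auto simp: norm_mult simp del: of_real_mult)
   then show "integrable lborel (%u. case (x, u) of (x, u) => G x*(g u * iexp (u * x)))" by simp
  qed
 qed measurable
 have "(CLINT x|m. G x*(CLINT u|lborel. g u * iexp (u * x)))
   = (CLINT x|m. CLINT u|lborel. G x*(g u * iexp (u * x)))" by simp
 also have "... = (CLINT u|lborel. CLINT x|m. G x*(g u * iexp (u * x)))"
  by (rule Fubini_integral[OF int, symmetric])
 also have "... = (CLINT u|lborel. CLINT x|m. g u*(G x * iexp (u * x)))"
  by (simp add: mult.left_commute del: integral_mult_right_zero integral_mult_left_zero)
 finally show ?thesis by simp
qed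

lemma gauss_fourier:
 assumes "n > 0"
 shows "(CLINT x|lborel. cor (exp (- (x/n)\<^sup>2/2)) * iexp (y * x))
   = n * sqrt (2 * pi) * exp (- (n * y)\<^sup>2/2)"
proof -
 have "(CLINT x|lborel. cor (exp (- (x/n)\<^sup>2/2)) * iexp (y * x))
   = \<bar>n\<bar> *\<^sub>R (CLINT x|lborel. cor (exp (- x\<^sup>2/2)) * iexp (n * y * x))"
  using assms by (subst lborel_integral_real_affine[of n _ 0]) (auto simp: ac_simps)
 also have "(CLINT x|lborel. cor (exp (- x\<^sup>2/2)) * iexp (n * y * x))
   = (CLINT x|lborel. sqrt (2 * pi)*(std_normal_density x *\<^sub>R iexp (n * y * x)))"
  by (intro Bochner_Integration.integral_cong refl)
    (simp add: std_normal_density_def scaleR_conv_of_real)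
 also have "... = sqrt (2 * pi)*(CLINT x|lborel. std_normal_density x *\<^sub>R iexp (n * y * x))"
  by (rule integral_mult_right_zero)
 also have "(CLINT x|lborel. std_normal_density x *\<^sub>R iexp (n * y * x)) = char std_normal_distribution (n * y)"
  unfolding char_def by (subst integral_density) auto
 also have "... = exp (- (n * y)\<^sup>2/2)" by (simp add: char_std_normal_distribution)
 finally show ?thesis using assms by (simp add: scaleR_conv_of_real)
qed

lemma integrable_gauss: "integrable lborel (%x::real. exp (- x\<^sup>2/2))"
proof -
 have "integrable lborel (%x. sqrt (2 * pi) * std_normal_density x)" by (intro integrable_mult_right) simp
 then show ?thesis by (simp add: std_normal_density_def)
qed

lemma integral_gauss: "(\<integral>x. exp (- (x::real)\<^sup>2/2) \<partial>lborel) = sqrt (2 * pi)"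
proof -
 have "(\<integral>x. sqrt (2 * pi) * std_normal_density x \<partial>lborel) = sqrt (2 * pi)"
  by (simp add: integral_normal_density)
 then show ?thesis by (simp add: std_normal_density_def)
qed

lemma fourier_fejer: "(CLINT x|lborel. fejer x * iexp (th * x)) = 2 * pi * tent th"
proof (rule LIMSEQ_unique)
 define E where "E n x = exp (- (x/real (Suc n))\<^sup>2/2)" for n x
 have E: "0<=E n x" "E n x<=1" for n x by (auto simp: E_def)
 have [measurable]: "E n \<in> bmeas borel" for n unfolding E_def by measurable
 show "(%n. CLINT x|lborel. cor (E n x)*(fejer x * iexp (th * x)))
   ----> (CLINT x|lborel. fejer x * iexp (th * x))"
 proof (rule integral_dominated_convergence[where w = fejer])
  show "AE x in lborel. (%n. cor (E n x)*(fejer x * iexp (th * x))) ----> fejer x * iexp (th * x)"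
  proof (intro AE_I2)
   fix x
   have "(%n. x*(1/real (Suc n))) ----> x*0"
    by (intro tendsto_intros LIMSEQ_Suc[OF lim_1_over_n])
   then have "(%n. E n x) ----> exp (- 0\<^sup>2/2)" unfolding E_def by (intro tendsto_intros) auto
   then have "(%n. cor (E n x)*(fejer x * iexp (th * x)))
     ----> cor (exp (- 0\<^sup>2/2))*(fejer x * iexp (th * x))"
    by (intro tendsto_intros)
   then show "(%n. cor (E n x)*(fejer x * iexp (th * x))) ----> fejer x * iexp (th * x)" by simp
  qed
  show "AE x in lborel. norm (cor (E n x)*(fejer x * iexp (th * x)))<=fejer x" for n
   using E fejer_bounds by (intro AE_I2) (auto simp: norm_mult mult_left_le_one_le simp del: of_real_mult)
 qed (auto simp: integrable_fejer simp del: of_real_mult)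
 have "(CLINT x|lborel. cor (E n x)*(fejer x * iexp (th * x)))
   = sqrt (2 * pi)*(CLINT z|lborel. cor (tent (z/real (Suc n)-th) * exp (- z\<^sup>2/2)))" for n
 proof -
  let ?N = "real (Suc n)"
  have intE: "integrable lborel (E n)"
   using lborel_integrable_real_affine[OF integrable_gauss, of "1/?N" 0] by (simp add: E_def[abs_def])
  have "(CLINT x|lborel. cor (E n x)*(fejer x * iexp (th * x)))
    = (CLINT x|lborel. (cor (E n x) * iexp (th * x))*(CLINT u|lborel. tent u * iexp (u * x)))"
   by (simp only: fourier_tent) (simp only: ac_simps)
  also have "... = (CLINT u|lborel. tent u*(CLINT x|lborel. (cor (E n x) * iexp (th * x)) * iexp (u * x)))"
  proof (rule fubini_iexp)
   show "integrable lborel (%x. cor (E n x) * iexp (th * x))"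
    by (rule integrable_of_real_mult_iexp[OF intE]) simp
  qed (auto simp: integrable_tent lborel.sigma_finite_measure_axioms)
  also have "... = (CLINT u|lborel. cor (tent u*(?N * sqrt (2 * pi) * exp (- (?N*(th+u))\<^sup>2/2))))"
  proof (intro Bochner_Integration.integral_cong refl)
   fix u
   have "(CLINT x|lborel. (cor (E n x) * iexp (th * x)) * iexp (u * x))
     = (CLINT x|lborel. cor (exp (- (x/?N)\<^sup>2/2)) * iexp ((th+u) * x))"
    by (intro Bochner_Integration.integral_cong refl) (simp add: E_def exp_add[symmetric] algebra_simps)
   also have "... = ?N * sqrt (2 * pi) * exp (- (?N*(th+u))\<^sup>2/2)" by (rule gauss_fourier) simp
   finally show "tent u*(CLINT x|lborel. (cor (E n x) * iexp (th * x)) * iexp (u * x))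
    = cor (tent u*(?N * sqrt (2 * pi) * exp (- (?N*(th+u))\<^sup>2/2)))" by simp
  qed
  also have "... = \<bar>1/?N\<bar> *\<^sub>R (CLINT z|lborel. cor (tent (- th+1/?N * z)
    * (?N * sqrt (2 * pi) * exp (- (?N*(th+(- th+1/?N * z)))\<^sup>2/2))))"
   by (rule lborel_integral_real_affine) simp
  also have "... = sqrt (2 * pi)*(CLINT z|lborel. cor (tent (z/?N-th) * exp (- z\<^sup>2/2)))"
  proof -
   have "(CLINT z|lborel. cor (tent (- th+1/?N * z)
     * (?N * sqrt (2 * pi) * exp (- (?N*(th+(- th+1/?N * z)))\<^sup>2/2))))
    = (CLINT z|lborel. (?N * sqrt (2 * pi)) * cor (tent (z/?N-th) * exp (- z\<^sup>2/2)))"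
   proof (intro Bochner_Integration.integral_cong refl)
    fix z
    have "?N*(th+(- th+1/?N * z)) = z" "- th+1/?N * z = z/?N-th" by (simp_all add: field_simps)
    then show "cor (tent (- th+1/?N * z)
     * (?N * sqrt (2 * pi) * exp (- (?N*(th+(- th+1/?N * z)))\<^sup>2/2)))
     = (?N * sqrt (2 * pi)) * cor (tent (z/?N-th) * exp (- z\<^sup>2/2))"
     by (simp only: of_real_mult ac_simps)
   qed
   also have "... = (?N * sqrt (2 * pi))*(CLINT z|lborel. cor (tent (z/?N-th) * exp (- z\<^sup>2/2)))"
    by (rule integral_mult_right_zero)
   finally show ?thesis by (simp add: scaleR_conv_of_real del: of_nat_Suc)
  qed
  finally show ?thesis .
 qed
 moreover have "(%n. CLINT z|lborel. cor (tent (z/real (Suc n)-th) * exp (- z\<^sup>2/2)))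
   ----> (CLINT z|lborel. cor (tent th * exp (- z\<^sup>2/2)))"
 proof (rule integral_dominated_convergence[where w = "%z. exp (- z\<^sup>2/2)"])
  show "AE z in lborel. (%n. cor (tent (z/real (Suc n)-th) * exp (- z\<^sup>2/2)))
    ----> cor (tent th * exp (- z\<^sup>2/2))"
  proof (intro AE_I2)
   fix z
   have "(%n. z*(1/real (Suc n))-th) ----> z*0-th"
    by (intro tendsto_intros LIMSEQ_Suc[OF lim_1_over_n])
   then have "(%n. tent (z*(1/real (Suc n))-th)) ----> tent (z*0-th)"
    by (rule isCont_tendsto_compose[OF isCont_tent])
   moreover have "tent (- th) = tent th" by (simp add: tent_def)
   ultimately show "(%n. cor (tent (z/real (Suc n)-th) * exp (- z\<^sup>2/2)))
    ----> cor (tent th * exp (- z\<^sup>2/2))" by (intro tendsto_intros) simp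
  qed
  show "AE z in lborel. norm (cor (tent (z/real (Suc n)-th) * exp (- z\<^sup>2/2)))<=exp (- z\<^sup>2/2)" for n
   using tent_bounds by (intro AE_I2) (simp add: norm_mult mult_left_le_one_le del: of_real_mult)
 qed (use integrable_gauss in auto)
 moreover have "(CLINT z|lborel. cor (tent th * exp (- z\<^sup>2/2))) = tent th * sqrt (2 * pi)"
  using integral_gauss by simp
 ultimately have "(%n. CLINT x|lborel. cor (E n x)*(fejer x * iexp (th * x)))
   ----> cor (sqrt (2 * pi)) * cor (tent th * sqrt (2 * pi))"
  by (simp only:) (rule tendsto_mult[OF tendsto_const])
 also have "cor (sqrt (2 * pi)) * cor (tent th * sqrt (2 * pi)) = 2 * pi * tent th"
 proof -
  have "sqrt (2 * pi)*(tent th * sqrt (2 * pi)) = tent th*(sqrt (2 * pi) * sqrt (2 * pi))" by (simp only: ac_simps)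
  also have "... = 2 * pi * tent th" by (simp add: real_sqrt_mult_self)
  finally show ?thesis by (simp only: of_real_mult[symmetric])
 qed
 finally show "(%n. CLINT x|lborel. cor (E n x)*(fejer x * iexp (th * x)))
   ----> 2 * pi * tent th" by simp
qed

context attracted
begin

lemma c_exp_0: "0<=\<rho> ==> \<rho> < 1 ==> (%n. c n*\<rho>^n) ----> 0"
proof -
 assume \<rho>: "0<=\<rho>" "\<rho> < 1"
 obtain k0 where k0: "k0>=1" "!!k n. k>=k0 ==> n>=k ==> c n<=2*(real n/real k) * c k"
  using c_potter by blast
 show ?thesis
 proof (rule Lim_null_comparison)
  show "eventually (%n. norm (c n*\<rho>^n)<=2/real k0 * c k0*(real n*\<rho>^n)) sequentially"
  proof (intro eventually_sequentiallyI[of k0])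
   fix n assume n: "n>=k0"
   have "c n > 0" using n k0(1) by (intro c_pos) auto
   moreover have "c n*\<rho>^n<=2*(real n/real k0) * c k0*\<rho>^n"
    using k0(2)[OF _ n] \<rho> by (intro mult_right_mono) auto
   ultimately show "norm (c n*\<rho>^n)<=2/real k0 * c k0*(real n*\<rho>^n)" using \<rho> by (simp add: ac_simps)
  qed
  show "(%n. 2/real k0 * c k0*(real n*\<rho>^n)) ----> 0"
   using \<rho> by (intro tendsto_mult_right_zero powser_times_n_limit_0) auto
 qed
qed

definition J :: "nat => real => complex" where
 "J k s = (CLINT v|lborel. \<psi> v^k * iexp (- (v * s)))"

lemma integrable_chi_power: "k>=1 ==> integrable lborel (%v. \<psi> v^k)"
proof (rule Bochner_Integration.integrable_bound[OF integrable_chi])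
 assume k: "k>=1"
 have "cmod (\<psi> v)^k<=cmod (\<psi> v)^1" for v
  using k mu.cmod_char_le_1[of v] by (intro power_decreasing) auto
 then show "AE v in lborel. norm (\<psi> v^k)<=norm (\<psi> v)" by (simp add: norm_power)
qed measurable

lemma integrable_chi_iexp:
 assumes "k>=1" shows "integrable lborel (%v. \<psi> v^k * iexp (- (v * s)))"
 by (rule Bochner_Integration.integrable_bound[OF integrable_chi_power[OF assms]])
   (auto simp: norm_mult simp del: of_real_mult)

lemma isCont_J: "k>=1 ==> isCont (J k) s"
 unfolding continuous_at_sequentially comp_def J_def
proof (intro allI impI)
 fix x assume k: "k>=1" and x: "x ----> s"
 show "(%n. CLINT v|lborel. \<psi> v^k * iexp (- (v * x n))) ----> (CLINT v|lborel. \<psi> v^k * iexp (- (v * s)))"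
 proof (rule integral_dominated_convergence[where w = "%v. norm (\<psi> v^k)"])
  show "integrable lborel (%v. norm (\<psi> v^k))" using integrable_chi_power[OF k] by simp
  show "AE v in lborel. (%n. \<psi> v^k * iexp (- (v * x n))) ----> \<psi> v^k * iexp (- (v * s))"
   using x by (intro AE_I2 tendsto_intros)
 qed (auto simp: norm_mult simp del: of_real_mult)
qed

lemma local_limit:
 fixes h :: "real => complex"
 assumes cont: "!!x. isCont h x" and bd: "!!x. cmod (h x)<=B" and supp: "!!x. \<bar>x\<bar> > A ==> h x = 0"
 shows "(%n. c n*(CLINT u|lborel. h u * iexp (- (u*(s * c n)))*\<phi> u^n)) ----> h 0 * J 1 s"
proof -
 have [measurable]: "h \<in> bmeas borel"
  using cont by (intro borel_measurable_continuous_onI continuous_at_imp_continuous_on ballI)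
 have B: "B>=0" using bd[of 0] norm_ge_zero order_trans by blast
 obtain \<delta> b where b: "\<delta> > 0" "b > 0"
  "!!n t. n>=1 ==> 1<=\<bar>t\<bar> ==> \<bar>t\<bar> <= \<delta> * c n ==> cmod (\<phi> (t / c n))^n<=exp (- b*\<bar>t\<bar>)"
  using phi_bound by blast
 define A' where "A' = max A \<delta>"
 obtain \<rho> where \<rho>: "0<=\<rho>" "\<rho> < 1" "!!u. \<delta> <= \<bar>u\<bar> ==> \<bar>u\<bar> <= A' ==> cmod (\<phi> u)<=\<rho>"
 proof -
  have cont: "continuous_on {\<delta>..A'} (%v. cmod (\<phi> v))"
   by (intro continuous_on_norm continuous_at_imp_continuous_on ballI isCont_char)
  have "{\<delta>..A'} ~= {}" by (simp add: A'_def)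
  then obtain vm where vm: "vm \<in> {\<delta>..A'}" "!!v. v \<in> {\<delta>..A'} ==> cmod (\<phi> v)<=cmod (\<phi> vm)"
   using continuous_attains_sup[OF _ _ cont] by auto
  show thesis
  proof (rule that[of "cmod (\<phi> vm)"])
   show "cmod (\<phi> vm) < 1" using vm b(1) by (intro cmod_phi_less_1) auto
   show "cmod (\<phi> u)<=cmod (\<phi> vm)" if "\<delta> <= \<bar>u\<bar>" "\<bar>u\<bar> <= A'" for u
    using vm(2)[of "\<bar>u\<bar>"] that cmod_phi_uminus[of u] by (cases "u>=0") auto
  qed simp
 qed
 define G where "G n v = h (v / c n) * iexp (- (v * s))*\<phi> (v / c n)^n" for n v
 define G1 where "G1 n v = (if \<bar>v\<bar> <= \<delta> * c n then G n v else 0)" for n v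
 define G2 where "G2 n v = (if \<bar>v\<bar> <= \<delta> * c n then 0 else G n v)" for n v
 have [measurable]: "G n \<in> bmeas borel" for n unfolding G_def by measurable
 have [measurable]: "G1 n \<in> bmeas borel" for n unfolding G1_def by measurable
 have [measurable]: "G2 n \<in> bmeas borel" for n unfolding G2_def by measurable
 have G1: "norm (G1 n v)<=B * dom b v" if "n>=1" for n v
 proof (cases "\<bar>v\<bar> <= \<delta> * c n")
  case True
  have "cmod (\<phi> (v / c n))^n<=dom b v"
   using b(3)[OF that _ True] cmod_char_le_1[of "v / c n"] by (auto simp: dom_def power_le_one)
  then have "cmod (h (v / c n)) * cmod (\<phi> (v / c n))^n<=B * dom b v"
   using bd B by (intro mult_mono) auto
  then show ?thesis using True by (simp add: G1_def G_def norm_mult norm_power del: of_real_mult)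
 qed (use B in \<open>simp add: G1_def dom_def\<close>)
 have G2: "norm (G2 n v)<=B*\<rho>^n * indicator {- A' * c n..A' * c n} v" if n: "n>=1" for n v
 proof -
  have cn: "c n > 0" using c_pos n by simp
  consider "\<bar>v\<bar> <= \<delta> * c n" | "\<bar>v\<bar> > \<delta> * c n" "\<bar>v\<bar> <= A' * c n" | "\<bar>v\<bar> > A' * c n" by linarith
  then show ?thesis
  proof cases
   case 2
   then have "\<delta> <= \<bar>v / c n\<bar>" "\<bar>v / c n\<bar> <= A'" using cn by (auto simp: field_simps abs_mult)
   then have "cmod (\<phi> (v / c n))^n<=\<rho>^n" by (intro power_mono \<rho>) auto
   then have "cmod (h (v / c n)) * cmod (\<phi> (v / c n))^n<=B*\<rho>^n"
    using bd B by (intro mult_mono) auto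
   moreover have "v \<in> {- A' * c n..A' * c n}" using 2(2) by (auto simp: abs_le_iff)
   ultimately show ?thesis using 2 by (simp add: G2_def G_def norm_mult norm_power del: of_real_mult)
  next
   case 3
   moreover have "A * c n<=A' * c n" using cn by (intro mult_right_mono) (auto simp: A'_def)
   ultimately have "A * c n < \<bar>v\<bar>" by linarith
   then have "\<bar>v / c n\<bar> > A" using cn by (simp add: field_simps)
   then show ?thesis using supp B \<rho> by (simp add: G2_def G_def)
  qed (use B \<rho> in \<open>simp add: G2_def\<close>)
 qed
 have ind: "integrable lborel (%v::real. indicator {- A' * c n..A' * c n} v :: real)" for n
  by (rule integrable_real_indicator) (auto simp: emeasure_lborel_Icc_eq)
 have iG1: "integrable lborel (G1 n)" if "n>=1" for n
  by (rule Bochner_Integration.integrable_bound[OF integrable_mult_right[OF integrable_dom[OF b(2)], of B]])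
    (use G1[OF that] in \<open>auto intro!: AE_I2 intro: order_trans abs_ge_self\<close>)
 have iG2: "integrable lborel (G2 n)" if "n>=1" for n
  by (rule Bochner_Integration.integrable_bound[OF integrable_mult_right[OF ind[of n], of "B*\<rho>^n"]])
    (use G2[OF that] in \<open>auto intro!: AE_I2 intro: order_trans abs_ge_self\<close>)
 have L1: "(%n. CLINT v|lborel. G1 (Suc n) v) ----> (CLINT v|lborel. h 0*(\<psi> v^1 * iexp (- (v * s))))"
 proof (rule integral_dominated_convergence[where w = "%v. B * dom b v"])
  show "integrable lborel (%v. B * dom b v)" by (intro integrable_mult_right integrable_dom b)
  show "AE v in lborel. norm (G1 (Suc n) v)<=B * dom b v" for n using G1 by simp
  show "AE v in lborel. (%n. G1 (Suc n) v) ----> h 0*(\<psi> v^1 * iexp (- (v * s)))"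
  proof (intro AE_I2 LIMSEQ_Suc)
   fix v
   have "(%n. v * (1 / c n)) ----> v * 0" by (intro tendsto_intros inverse_c_0)
   then have "(%n. h (v * (1 / c n))) ----> h (v * 0)" by (rule isCont_tendsto_compose[OF cont])
   then have "(%n. h (v / c n)) ----> h 0" by simp
   then have "(%n. G n v) ----> h 0 * iexp (- (v * s))*\<psi> v"
    unfolding G_def by (intro tendsto_intros phi_limit')
   moreover have "eventually (%n. \<bar>v\<bar>/\<delta> <= c n) sequentially"
    using c_at_top by (simp add: filterlim_at_top)
   then have "eventually (%n. G1 n v = G n v) sequentially"
    by eventually_elim (use b(1) in \<open>auto simp: G1_def field_simps\<close>)
   ultimately show "(%n. G1 n v) ----> h 0*(\<psi> v^1 * iexp (- (v * s)))"
    by (simp add: tendsto_cong ac_simps)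
  qed
 qed auto
 have L2: "(%n. CLINT v|lborel. G2 n v) ----> 0"
 proof (rule Lim_null_comparison)
  show "(%n. B*(2 * A')*(c n*\<rho>^n)) ----> 0"
   using \<rho> by (intro tendsto_mult_right_zero c_exp_0)
  show "eventually (%n. norm (CLINT v|lborel. G2 n v)<=B*(2 * A')*(c n*\<rho>^n)) sequentially"
  proof (intro eventually_sequentiallyI[of 1])
   fix n :: nat assume n: "n>=1"
   have "norm (CLINT v|lborel. G2 n v)<=(\<integral>v. norm (G2 n v) \<partial>lborel)" by (rule integral_norm_bound)
   also have "... <= (\<integral>v. B*\<rho>^n * indicator {- A' * c n..A' * c n} v \<partial>lborel)"
    using iG2[OF n] G2[OF n] ind[of n] by (intro integral_mono) auto
   also have "... = B*\<rho>^n * measure lborel {- A' * c n..A' * c n}" by simp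
   also have "measure lborel {- A' * c n..A' * c n} = 2 * A' * c n"
    using c_pos[OF n] b(1) by (subst measure_lborel_Icc) (auto simp: A'_def mult_le_0_iff)
   finally show "norm (CLINT v|lborel. G2 n v)<=B*(2 * A')*(c n*\<rho>^n)" by (simp add: ac_simps)
  qed
 qed
 have eq: "c n*(CLINT u|lborel. h u * iexp (- (u*(s * c n)))*\<phi> u^n)
   = (CLINT v|lborel. G1 n v)+(CLINT v|lborel. G2 n v)" if n: "n>=1" for n
 proof -
  have cn: "c n > 0" using c_pos n by simp
  have "(CLINT u|lborel. h u * iexp (- (u*(s * c n)))*\<phi> u^n)
   = \<bar>1 / c n\<bar> *\<^sub>R (CLINT v|lborel. h (0+1 / c n * v) * iexp (- ((0+1 / c n * v)*(s * c n)))*\<phi> (0+1 / c n * v)^n)"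
   using cn by (intro lborel_integral_real_affine) auto
  also have "(CLINT v|lborel. h (0+1 / c n * v) * iexp (- ((0+1 / c n * v)*(s * c n)))*\<phi> (0+1 / c n * v)^n)
   = (CLINT v|lborel. G n v)"
   using cn by (intro Bochner_Integration.integral_cong refl) (simp add: G_def)
  also have "... = (CLINT v|lborel. G1 n v+G2 n v)"
   by (intro Bochner_Integration.integral_cong refl) (simp add: G1_def G2_def)
  also have "... = (CLINT v|lborel. G1 n v)+(CLINT v|lborel. G2 n v)"
   using iG1[OF n] iG2[OF n] by (rule Bochner_Integration.integral_add)
  finally show ?thesis using cn by (simp add: scaleR_conv_of_real)
 qed
 have "(%n. (CLINT v|lborel. G1 (Suc n) v)+(CLINT v|lborel. G2 (Suc n) v))
  ----> (CLINT v|lborel. h 0*(\<psi> v^1 * iexp (- (v * s))))+0"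
  by (intro tendsto_add L1 LIMSEQ_Suc[OF L2])
 then have "(%n. c (Suc n)*(CLINT u|lborel. h u * iexp (- (u*(s * c (Suc n))))*\<phi> u^Suc n)) ----> h 0 * J 1 s"
  using eq[of "Suc n" for n] by (simp add: J_def del: power_Suc)
 then show ?thesis by (rule LIMSEQ_imp_Suc)
qed

lemma fejer_nu:
 "(CLINT x|nu n. cor (fejer (x-z)) * iexp (th * x))
  = (CLINT u|lborel. tent (u-th) * iexp (- ((u-th) * z))*\<phi> u^n)"
proof -
 interpret n: real_distribution "nu n" by (rule nu_distribution)
 have "(CLINT x|nu n. cor (fejer (x-z)) * iexp (th * x))
   = (CLINT x|nu n. iexp (th * x)*(CLINT u|lborel. (tent u * iexp (- (u * z))) * iexp (u * x)))"
 proof (intro Bochner_Integration.integral_cong refl)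
  fix x
  have "cor (fejer (x-z)) = (CLINT u|lborel. (tent u * iexp (- (u * z))) * iexp (u * x))"
   unfolding fourier_tent[symmetric]
   by (intro Bochner_Integration.integral_cong refl) (simp add: exp_add[symmetric] algebra_simps)
  then show "cor (fejer (x-z)) * iexp (th * x)
   = iexp (th * x)*(CLINT u|lborel. (tent u * iexp (- (u * z))) * iexp (u * x))"
   by (simp only: mult.commute)
 qed
 also have "... = (CLINT u|lborel. (tent u * iexp (- (u * z)))*(CLINT x|nu n. iexp (th * x) * iexp (u * x)))"
 proof (rule fubini_iexp)
  show "integrable (nu n) (%x. iexp (th * x))"
   by (rule n.integrable_const_bound[of _ 1]) (auto simp del: of_real_mult)
  show "integrable lborel (%u. tent u * iexp (- (u * z)))"
   by (rule integrable_of_real_mult_iexp[OF integrable_tent]) simp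
 qed (auto simp: n.sigma_finite_measure_axioms)
 also have "... = (CLINT u|lborel. (tent u * iexp (- (u * z)))*\<phi> (th+u)^n)"
 proof (intro Bochner_Integration.integral_cong refl arg_cong2[where f = "(*)"])
  fix u
  have "(CLINT x|nu n. iexp (th * x) * iexp (u * x)) = char (nu n) (th+u)"
   unfolding char_def by (intro Bochner_Integration.integral_cong refl) (simp add: exp_add[symmetric] algebra_simps)
  then show "(CLINT x|nu n. iexp (th * x) * iexp (u * x)) = \<phi> (th+u)^n" by (simp only: char_nu)
 qed
 also have "... = \<bar>1\<bar> *\<^sub>R (CLINT u|lborel. (tent (- th+1 * u) * iexp (- ((- th+1 * u) * z)))*\<phi> (th+(- th+1 * u))^n)"
  by (rule lborel_integral_real_affine) simp
 finally show ?thesis by (simp add: algebra_simps)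
qed

lemma fejer_limit:
 "(%n. c n*(CLINT x|nu n. cor (fejer (x-z)) * iexp (th * x))) ----> tent th * iexp (th * z) * J 1 0"
proof -
 let ?h = "%u. cor (tent (u-th)) * iexp (- ((u-th) * z))"
 have "(%n. c n*(CLINT u|lborel. ?h u * iexp (- (u*(0 * c n)))*\<phi> u^n)) ----> ?h 0 * J 1 0"
 proof (rule local_limit[where B = 1 and A = "1+\<bar>th\<bar>"])
  show "isCont ?h x" for x
   by (intro continuous_intros isCont_o2[OF _ isCont_tent])
  show "cmod (?h x)<=1" for x using tent_bounds by (simp add: norm_mult del: of_real_mult of_real_diff)
  show "?h x = 0" if "1+\<bar>th\<bar> < \<bar>x\<bar>" for x using that by (simp add: tent_eq_0)
 qed
 moreover have "tent (- th) = tent th" by (simp add: tent_def)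
 ultimately show ?thesis unfolding fejer_nu by simp
qed

lemma J1_nonneg: "Im (J 1 s) = 0" "Re (J 1 s)>=0"
proof -
 have lim: "(%n. c n*(CLINT u|lborel. cor (tent u) * iexp (- (u*(s * c n)))*\<phi> u^n))
   ----> cor (tent 0) * J 1 s"
 proof (rule local_limit[where B = 1 and A = 1])
  show "isCont (%u. cor (tent u)) x" for x by (intro continuous_intros isCont_tent)
  show "cmod (cor (tent x))<=1" for x using tent_bounds[of x] by simp
  show "cor (tent x) = 0" if "1 < \<bar>x\<bar>" for x using that by (simp add: tent_eq_0)
 qed
 have eq: "c n*(CLINT u|lborel. cor (tent u) * iexp (- (u*(s * c n)))*\<phi> u^n)
   = cor (c n*(\<integral>x. fejer (x-s * c n) \<partial>nu n))" for n
  using fejer_nu[of n "s * c n" 0] by simp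
 have lim': "(%n. cor (c n*(\<integral>x. fejer (x-s * c n) \<partial>nu n))) ----> J 1 s"
  using lim unfolding eq by (simp add: tent_def)
 have "(%n. Im (cor (c n*(\<integral>x. fejer (x-s * c n) \<partial>nu n)))) ----> Im (J 1 s)"
  using lim' by (rule tendsto_Im)
 then show "Im (J 1 s) = 0" by (simp add: LIMSEQ_const_iff)
 have "(%n. Re (cor (c n*(\<integral>x. fejer (x-s * c n) \<partial>nu n)))) ----> Re (J 1 s)"
  using lim' by (rule tendsto_Re)
 then show "Re (J 1 s)>=0"
 proof (rule LIMSEQ_le_const)
  show "\<exists>N. \<forall>n\<ge>N. 0<=Re (cor (c n*(\<integral>x. fejer (x-s * c n) \<partial>nu n)))"
   using c_pos fejer_bounds by (intro exI[of _ 1]) (auto intro!: mult_nonneg_nonneg integral_nonneg simp: less_imp_le)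
 qed
qed

end

lemma continuous_AE_zero:
 fixes f :: "real => real"
 assumes cont: "isCont f s" and ae: "AE x in lborel. f x = 0"
 shows "f s = 0"
proof (rule ccontr)
 assume ne: "f s ~= 0"
 have "eventually (%x. f x ~= 0) (at s)"
  using cont ne unfolding isCont_def by (rule tendsto_imp_eventually_ne)
 then obtain d where d: "d > 0" "!!x. x ~= s ==> dist x s < d ==> f x ~= 0"
  by (auto simp: eventually_at)
 have "AE x in lborel. x \<notin> {s<..<s+d}"
  using ae by eventually_elim (use d in \<open>force simp: dist_real_def\<close>)
 then have "{s<..<s+d} \<in> null_sets lborel" by (subst AE_iff_null_sets) auto
 then show False using d by (auto simp: null_sets_def)
qed

context attracted
begin

lemma J_real: "J 1 s = cor (Re (J 1 s))"
 using J1_nonneg by (simp add: complex_eq_iff)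

lemma J_convolve:
 assumes "k>=1" shows "(CLINT y|\<mu>. J k (s-y)) = J (Suc k) s"
proof -
 have "(CLINT y|\<mu>. J k (s-y)) = (CLINT y|\<mu>. 1*(CLINT v|lborel. (\<psi> v^k * iexp (- (v * s))) * iexp (v * y)))"
  unfolding J_def by (simp add: exp_add[symmetric] algebra_simps)
 also have "... = (CLINT v|lborel. (\<psi> v^k * iexp (- (v * s)))*(CLINT y|\<mu>. 1 * iexp (v * y)))"
  by (rule fubini_iexp) (auto simp: mu.sigma_finite_measure_axioms intro!: integrable_chi_iexp assms simp del: of_real_minus of_real_mult)
 also have "... = J (Suc k) s" unfolding J_def by (simp add: char_def ac_simps)
 finally show ?thesis .
qed

lemma J_bound: "k>=1 ==> cmod (J k s)<=(\<integral>v. norm (\<psi> v^k) \<partial>lborel)"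
 unfolding J_def by (rule order_trans[OF integral_norm_bound]) (simp add: norm_mult del: of_real_mult of_real_minus)

lemma J_measurable [measurable]: "k>=1 ==> J k \<in> bmeas borel"
 by (intro borel_measurable_continuous_onI continuous_at_imp_continuous_on ballI isCont_J)

lemma integral_tent: "(\<integral>u. tent u \<partial>lborel) = 1"
proof -
 have "cor (\<integral>u. tent u \<partial>lborel) = 1" using fourier_tent[of 0] by (simp add: fejer_def)
 then show ?thesis by (simp only: of_real_eq_1_iff)
qed

lemma fejer_J_limit:
 "(%n. CLINT s|lborel. (cor (fejer (s/real (Suc n))) * iexp (t * s)) * J 1 s) ----> 2 * pi*\<psi> t"
proof -
 have J': "J 1 s = (CLINT u|lborel. \<psi> (- u) * iexp (u * s))" for s
  unfolding J_def by (subst lborel_integral_real_affine[of "- 1" _ 0]) auto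
 have eq: "(CLINT s|lborel. (cor (fejer (s/real (Suc n))) * iexp (t * s)) * J 1 s)
   = (CLINT w|lborel. 2 * pi * tent w*\<psi> (t-w/real (Suc n)))" for n
 proof -
  let ?N = "real (Suc n)"
  have fN: "integrable lborel (%s. fejer (s/?N))"
   using lborel_integrable_real_affine[OF integrable_fejer, of "1/?N" 0] by simp
  have inner: "(CLINT s|lborel. (cor (fejer (s/?N)) * iexp (t * s)) * iexp (u * s)) = ?N*(2 * pi * tent (?N*(t+u)))" for u
  proof -
   have "(CLINT s|lborel. (cor (fejer (s/?N)) * iexp (t * s)) * iexp (u * s))
    = \<bar>?N\<bar> *\<^sub>R (CLINT x|lborel. (cor (fejer ((0+?N * x)/?N)) * iexp (t*(0+?N * x))) * iexp (u*(0+?N * x)))"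
    by (rule lborel_integral_real_affine) simp
   also have "(CLINT x|lborel. (cor (fejer ((0+?N * x)/?N)) * iexp (t*(0+?N * x))) * iexp (u*(0+?N * x)))
    = (CLINT x|lborel. fejer x * iexp ((?N*(t+u)) * x))"
    by (intro Bochner_Integration.integral_cong refl) (simp add: exp_add[symmetric] algebra_simps del: of_nat_Suc)
   finally show ?thesis unfolding fourier_fejer by (simp add: scaleR_conv_of_real del: of_nat_Suc)
  qed
  have "(CLINT s|lborel. (cor (fejer (s/?N)) * iexp (t * s)) * J 1 s)
    = (CLINT u|lborel. \<psi> (- u)*(CLINT s|lborel. (cor (fejer (s/?N)) * iexp (t * s)) * iexp (u * s)))"
   unfolding J'
  proof (rule fubini_iexp)
   show "integrable lborel (%s. cor (fejer (s/?N)) * iexp (t * s))"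
    by (rule integrable_of_real_mult_iexp[OF fN]) simp
   show "integrable lborel (%u. \<psi> (- u))"
    using lborel_integrable_real_affine[OF integrable_chi, of "- 1" 0] by simp
  qed (auto simp: lborel.sigma_finite_measure_axioms)
  also have "... = (CLINT u|lborel. \<psi> (- u)*(?N*(2 * pi * tent (?N*(t+u)))))" by (simp only: inner)
  also have "... = \<bar>1/?N\<bar> *\<^sub>R (CLINT w|lborel. \<psi> (- (- t+1/?N * w))*(?N*(2 * pi * tent (?N*(t+(- t+1/?N * w))))))"
   by (rule lborel_integral_real_affine) simp
  also have "(CLINT w|lborel. \<psi> (- (- t+1/?N * w))*(?N*(2 * pi * tent (?N*(t+(- t+1/?N * w))))))
    = (CLINT w|lborel. ?N*(2 * pi * tent w*\<psi> (t-w/?N)))"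
  proof (intro Bochner_Integration.integral_cong refl)
   fix w
   have "?N*(t+(- t+1/?N * w)) = w" "- (- t+1/?N * w) = t-w/?N" by (simp_all add: field_simps)
   then show "\<psi> (- (- t+1/?N * w))*(?N*(2 * pi * tent (?N*(t+(- t+1/?N * w)))))
    = ?N*(2 * pi * tent w*\<psi> (t-w/?N))" by (simp only: of_real_mult ac_simps)
  qed
  also have "... = ?N*(CLINT w|lborel. 2 * pi * tent w*\<psi> (t-w/?N))" by (rule integral_mult_right_zero)
  finally show ?thesis by (simp add: scaleR_conv_of_real del: of_nat_Suc)
 qed
 have "(%n. CLINT w|lborel. 2 * pi * tent w*\<psi> (t-w/real (Suc n))) ----> (CLINT w|lborel. 2 * pi * tent w*\<psi> t)"
 proof (rule integral_dominated_convergence[where w = "%w. 2 * pi * tent w"])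
  show "integrable lborel (%w. 2 * pi * tent w)" by (intro integrable_mult_right integrable_tent)
  show "AE w in lborel. (%n. 2 * pi * tent w*\<psi> (t-w/real (Suc n))) ----> 2 * pi * tent w*\<psi> t"
  proof (intro AE_I2 tendsto_intros)
   fix w
   have "(%n. t-w*(1/real (Suc n))) ----> t-w*0"
    by (intro tendsto_intros LIMSEQ_Suc[OF lim_1_over_n])
   then have "(%n. \<psi> (t-w*(1/real (Suc n)))) ----> \<psi> (t-w*0)"
    by (rule isCont_tendsto_compose[OF mu.isCont_char])
   then show "(%n. \<psi> (t-w/real (Suc n))) ----> \<psi> t" by simp
  qed
  show "AE w in lborel. norm (2 * pi * tent w*\<psi> (t-w/real (Suc n)))<=2 * pi * tent w" for n
   using tent_bounds mu.cmod_char_le_1 by (intro AE_I2) (simp add: norm_mult mult_left_le)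
 qed auto
 moreover have "(CLINT w|lborel. 2 * pi * tent w*\<psi> t) = 2 * pi*\<psi> t"
  by (simp add: integral_tent)
 ultimately show ?thesis unfolding eq by (simp only:)
qed

lemma fejer_scaled_limit: "(%n. fejer (s/real (Suc n))) ----> 1"
proof -
 have "(%n. s*(1/real (Suc n))) ----> s*0"
  by (intro tendsto_intros LIMSEQ_Suc[OF lim_1_over_n])
 then have "(%n. fejer (s*(1/real (Suc n)))) ----> fejer (s*0)"
  by (rule isCont_tendsto_compose[OF isCont_fejer])
 then show ?thesis by (simp add: fejer_def)
qed

definition j :: "real => real" where "j s = Re (J 1 s)"

lemma j_nonneg: "j s>=0" using J1_nonneg by (simp add: j_def)

lemma j_measurable [measurable]: "j \<in> bmeas borel"
 unfolding j_def using J_measurable[of 1] by measurable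

lemma isCont_j: "isCont j s"
 using isCont_J[of 1 s] unfolding isCont_def j_def by (auto intro: tendsto_Re)

lemma integrable_fejer_j: "integrable lborel (%s. fejer (s/real (Suc n)) * j s)"
proof -
 let ?N = "real (Suc n)" and ?B = "\<integral>v. norm (\<psi> v^1) \<partial>lborel"
 have "integrable lborel (%s. ?B * fejer (s/?N))"
  using lborel_integrable_real_affine[OF integrable_fejer, of "1/?N" 0] by (intro integrable_mult_right) simp
 then show ?thesis
 proof (rule Bochner_Integration.integrable_bound)
  have "\<bar>j s\<bar> <= ?B" for s
   using J_bound[of 1 s] abs_Re_le_cmod[of "J 1 s"] unfolding j_def by linarith
  then have "fejer (s/?N)*\<bar>j s\<bar> <= fejer (s/?N)*?B" for s
   using fejer_bounds by (intro mult_left_mono) auto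
  moreover have "?B>=0" by simp
  ultimately show "AE s in lborel. norm (fejer (s/?N) * j s)<=norm (?B * fejer (s/?N))"
   using fejer_bounds by (intro AE_I2) (simp add: abs_mult mult.commute)
 qed measurable
qed

lemma integrable_j: "integrable lborel j"
proof (rule integrableI_nonneg)
 have lim: "(%n. \<integral>s. fejer (s/real (Suc n)) * j s \<partial>lborel) ----> 2 * pi"
 proof -
  have "(%n. cor (\<integral>s. fejer (s/real (Suc n)) * j s \<partial>lborel)) ----> cor (2 * pi)"
   using fejer_J_limit[of 0] mu.char_zero
   by (simp add: J_real[folded j_def, simplified] integral_complex_of_real[symmetric] del: integral_complex_of_real of_nat_Suc)
  then show ?thesis using tendsto_of_real_iff by blast
 qed
 have "(\<integral>\<^sup>+s. en (j s) \<partial>lborel) = (\<integral>\<^sup>+s. liminf (%n. en (fejer (s/real (Suc n)) * j s)) \<partial>lborel)"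
 proof (intro nn_integral_cong)
  fix s
  have "(%n. en (fejer (s/real (Suc n)) * j s)) ----> en (1 * j s)"
   by (intro tendsto_ennrealI tendsto_intros fejer_scaled_limit)
  then show "en (j s) = liminf (%n. en (fejer (s/real (Suc n)) * j s))"
   by (simp add: lim_imp_Liminf)
 qed
 also have "... <= liminf (%n. \<integral>\<^sup>+s. en (fejer (s/real (Suc n)) * j s) \<partial>lborel)"
  by (rule nn_integral_liminf) measurable
 also have "... = liminf (%n. en (\<integral>s. fejer (s/real (Suc n)) * j s \<partial>lborel))"
  by (subst nn_integral_eq_integral[OF integrable_fejer_j]) (use j_nonneg fejer_bounds in auto)
 also have "... = en (2 * pi)"
  by (rule lim_imp_Liminf) (auto intro!: tendsto_ennrealI lim simp del: of_nat_Suc)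
 also have "... < \<infinity>" by simp
 finally show "(\<integral>\<^sup>+s. en (j s) \<partial>lborel) < \<infinity>" .
qed (auto simp: j_nonneg)

lemma fourier_j: "(CLINT s|lborel. cor (j s) * iexp (t * s)) = 2 * pi*\<psi> t"
proof (rule LIMSEQ_unique[OF _ fejer_J_limit[of t]])
 have "(%n. CLINT s|lborel. (cor (fejer (s/real (Suc n))) * iexp (t * s)) * cor (j s))
   ----> (CLINT s|lborel. cor (j s) * iexp (t * s))"
 proof (rule integral_dominated_convergence[where w = j])
  show "AE s in lborel. (%n. (cor (fejer (s/real (Suc n))) * iexp (t * s)) * cor (j s))
    ----> cor (j s) * iexp (t * s)"
  proof (intro AE_I2)
   fix s
   have "(%n. (cor (fejer (s/real (Suc n))) * iexp (t * s)) * cor (j s))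
    ----> (cor 1 * iexp (t * s)) * cor (j s)"
    by (intro tendsto_mult tendsto_const tendsto_of_real fejer_scaled_limit)
   then show "(%n. (cor (fejer (s/real (Suc n))) * iexp (t * s)) * cor (j s))
    ----> cor (j s) * iexp (t * s)" by (simp add: mult.commute)
  qed
  show "AE s in lborel. norm ((cor (fejer (s/real (Suc n))) * iexp (t * s)) * cor (j s))<=j s" for n
   using fejer_bounds j_nonneg by (intro AE_I2) (simp add: norm_mult mult_left_le_one_le del: of_real_mult of_nat_Suc)
 qed (auto simp: integrable_j simp del: of_real_mult)
 then show "(%n. CLINT s|lborel. (cor (fejer (s/real (Suc n))) * iexp (t * s)) * J 1 s)
   ----> (CLINT s|lborel. cor (j s) * iexp (t * s))"
  using J_real[folded j_def] by (simp only:)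
qed

lemma mu_density: "\<mu> = density lborel (%s. en (j s/(2 * pi)))"
proof (rule Levy_uniqueness[OF mu.real_distribution_axioms])
 have "cor (\<integral>s. j s \<partial>lborel) = 2 * pi"
  using fourier_j[of 0] mu.char_zero by (simp add: integral_complex_of_real)
 then have i1: "(\<integral>s. j s \<partial>lborel) = 2 * pi" using of_real_eq_iff by blast
 have "emeasure (density lborel (%s. en (j s/(2 * pi)))) UNIV = (\<integral>\<^sup>+s. en (j s/(2 * pi)) \<partial>lborel)"
  by (subst emeasure_density) auto
 also have "... = en (\<integral>s. j s/(2 * pi) \<partial>lborel)"
  by (rule nn_integral_eq_integral) (auto intro!: integrable_j AE_I2 simp: j_nonneg)
 also have "... = 1" by (simp add: i1)
 finally have "prob_space (density lborel (%s. en (j s/(2 * pi))))" by (intro prob_spaceI) simp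
 then show "real_distribution (density lborel (%s. en (j s/(2 * pi))))"
  by (simp add: real_distribution_def real_distribution_axioms_def)
 show "\<psi> = char (density lborel (%s. en (j s/(2 * pi))))"
 proof
  fix t
  have "char (density lborel (%s. en (j s/(2 * pi)))) t = (CLINT s|lborel. (j s/(2 * pi)) *\<^sub>R iexp (t * s))"
   unfolding char_def by (subst integral_density) (auto simp: j_nonneg simp del: of_real_mult)
  also have "... = (CLINT s|lborel. (1/(2 * pi))*(cor (j s) * iexp (t * s)))"
   by (simp add: scaleR_conv_of_real)
  also have "... = (1/(2 * pi))*(CLINT s|lborel. cor (j s) * iexp (t * s))"
   by (rule integral_mult_right_zero)
  also have "... = \<psi> t" using fourier_j[of t] by simp
  finally show "\<psi> t = char (density lborel (%s. en (j s/(2 * pi)))) t" by simp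
 qed
qed

lemma J_nonneg: "k>=1 ==> Im (J k s) = 0 \<and> Re (J k s)>=0"
proof (induction k arbitrary: s rule: nat_induct_at_least)
 case base
 show ?case using J1_nonneg by auto
next
 case (Suc k)
 have "J (Suc k) s = (CLINT y|\<mu>. cor (Re (J k (s-y))))"
  unfolding J_convolve[OF Suc.hyps, symmetric]
  by (intro Bochner_Integration.integral_cong refl) (use Suc.IH in \<open>simp add: complex_eq_iff\<close>)
 also have "... = cor (\<integral>y. Re (J k (s-y)) \<partial>\<mu>)" by (rule integral_complex_of_real)
 finally show ?case using Suc.IH by (simp add: integral_nonneg)
qed

lemma J_pos_add:
 assumes k: "k>=1" and s0: "Re (J k s0) > 0" and s1: "j s1 > 0"
 shows "Re (J (Suc k) (s0+s1)) > 0"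
proof (rule ccontr)
 let ?f = "%y. Re (J k (s0+s1-y))"
 have cf: "isCont ?f y" for y
 proof -
  have "isCont (%y. J k (s0+s1-y)) y" by (rule isCont_o2[OF _ isCont_J[OF k]]) (intro continuous_intros)
  then show ?thesis unfolding isCont_def by (rule tendsto_Re)
 qed
 have [measurable]: "?f \<in> bmeas borel"
  using cf by (intro borel_measurable_continuous_onI continuous_at_imp_continuous_on ballI)
 have int: "integrable \<mu> ?f"
  using J_bound[OF k] abs_Re_le_cmod
  by (intro mu.integrable_const_bound[of _ "\<integral>v. norm (\<psi> v^k) \<partial>lborel"]) (auto intro: order_trans)
 assume "\<not> Re (J (Suc k) (s0+s1)) > 0"
 then have "Re (J (Suc k) (s0+s1)) = 0" using J_nonneg[of "Suc k" "s0+s1"] by simp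
 moreover have "J (Suc k) (s0+s1) = cor (\<integral>y. ?f y \<partial>\<mu>)"
  unfolding J_convolve[OF k, symmetric] integral_complex_of_real[symmetric]
  by (intro Bochner_Integration.integral_cong refl) (use J_nonneg[OF k] in \<open>simp add: complex_eq_iff\<close>)
 ultimately have "(\<integral>y. ?f y \<partial>\<mu>) = 0" by simp
 then have "AE y in \<mu>. ?f y = 0"
  using int J_nonneg[OF k] by (subst (asm) integral_nonneg_eq_0_iff_AE) auto
 then have "AE y in lborel. j y*?f y = 0"
  by (subst (asm) mu_density, subst (asm) AE_density)
    (auto elim!: eventually_mono simp: zero_less_divide_iff order.strict_iff_order j_nonneg)
 then have "j s1*?f s1 = 0"
  by (rule continuous_AE_zero[rotated]) (intro continuous_intros isCont_j cf)
 then show False using s0 s1 by simp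
qed

lemma J_pos_mult:
 assumes "j s > 0" "k>=1"
 shows "Re (J k (real k * s)) > 0"
 using assms(2)
proof (induction k rule: nat_induct_at_least)
 case base
 show ?case using assms(1) by (simp add: j_def)
next
 case (Suc k)
 have "real (Suc k) * s = real k * s+s" by (simp add: algebra_simps)
 then show ?case using J_pos_add[OF Suc.hyps Suc.IH assms(1)] by simp
qed

lemma J_pos_mult_add:
 assumes "j s > 0" "j t > 0" "k>=1"
 shows "Re (J (k+i) (real k * s+real i * t)) > 0"
proof (induction i)
 case 0
 show ?case using J_pos_mult[OF assms(1,3)] by simp
next
 case (Suc i)
 have "real k * s+real (Suc i) * t = (real k * s+real i * t)+t" by (simp add: algebra_simps)
 moreover have "Re (J (Suc (k+i)) ((real k * s+real i * t)+t)) > 0"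
  using assms by (intro J_pos_add Suc.IH) auto
 ultimately show ?case by (simp only: add_Suc_right)
qed

lemma J_scale: "k>=1 ==> J 1 0 = real k powr a * J k 0"
proof -
 assume k: "k>=1"
 let ?r = "real k powr a"
 have r: "?r > 0" using k by simp
 have "J 1 0 = (CLINT v|lborel. \<psi> v)" by (simp add: J_def)
 also have "... = \<bar>?r\<bar> *\<^sub>R (CLINT v|lborel. \<psi> (0+?r * v))"
  using r by (intro lborel_integral_real_affine) auto
 also have "(CLINT v|lborel. \<psi> (0+?r * v)) = J k 0"
  using stable[OF k] by (simp add: J_def)
 finally show ?thesis using r by (simp add: scaleR_conv_of_real)
qed

text \<open>Here two-sidedness enters: the limit law charges both half lines, hence by strict stability
 (sums of independent copies) its density is positive at the origin.\<close>

lemma j0_pos: "j 0 > 0"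
proof -
 have AE_mu: "(AE x in \<mu>. P x) \<longleftrightarrow> (AE x in lborel. j x > 0 --> P x)" for P
  by (subst mu_density, subst AE_density) (auto simp: ennreal_less_zero_iff zero_less_divide_iff)
 obtain s1 where s1: "s1 < 0" "j s1 > 0"
 proof (rule ccontr)
  assume "\<not> thesis"
  then have "j s = 0" if "s < 0" for s using that j_nonneg[of s] \<open>\<And>s1. s1 < 0 \<Longrightarrow> 0 < j s1 \<Longrightarrow> thesis\<close> by force
  then have "AE x in \<mu>. x>=0" unfolding AE_mu by (intro AE_I2) (metis less_irrefl not_le)
  then show False using two_sided unfolding two_sided_def by blast
 qed
 obtain s2 where s2: "s2 > 0" "j s2 > 0"
 proof (rule ccontr)
  assume "\<not> thesis"
  then have "j s = 0" if "s > 0" for s using that j_nonneg[of s] \<open>\<And>s1. s1 > 0 \<Longrightarrow> 0 < j s1 \<Longrightarrow> thesis\<close> by force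
  then have "AE x in \<mu>. x<=0" unfolding AE_mu by (intro AE_I2) (metis less_irrefl not_le)
  then show False using two_sided unfolding two_sided_def by blast
 qed
 have "eventually (%s. j s > 0) (at s2)"
  using isCont_j[of s2] s2(2) unfolding isCont_def by (rule order_tendstoD)
 then obtain d where d: "d > 0" "!!s. s ~= s2 ==> dist s s2 < d ==> j s > 0" by (auto simp: eventually_at)
 have "s2/(- s1) < (s2+d)/(- s1)" using s1 d by (intro divide_strict_right_mono) auto
 then obtain r where r: "r \<in> \<rat>" "s2/(- s1) < r" "r < (s2+d)/(- s1)" using Rats_dense_in_real by blast
 have "s2 < r*(- s1)" "r*(- s1) < s2+d" using r s1 by (auto simp: field_simps)
 then have js: "j (r*(- s1)) > 0" by (intro d) (auto simp: dist_real_def)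
 have "r > 0" using r(2) s1 s2 by (smt (verit) divide_pos_pos)
 from r(1) obtain p' q' :: int where pq: "q' > 0" "r = of_int p' / of_int q'" by (rule Rats_cases') blast
 have "p' > 0" using \<open>r > 0\<close> pq by (simp add: zero_less_divide_iff)
 define i k where "i = nat p'" and "k = nat q'"
 have ik: "i>=1" "k>=1" "r = real i/real k" using \<open>p' > 0\<close> pq by (auto simp: i_def k_def)
 have "real i * s1+real k*(r*(- s1)) = 0" using ik by simp
 then have "Re (J (i+k) 0) > 0" using J_pos_mult_add[OF s1(2) js ik(1), of k] by (simp only:)
 moreover have "J 1 0 = real (i+k) powr a * J (i+k) 0" using ik by (intro J_scale) auto
 ultimately show ?thesis using ik by (simp add: j_def del: of_nat_add)
qed

definition g0 :: real where "g0 = j 0/(2 * pi)"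

lemma g0_pos: "g0 > 0" using j0_pos by (simp add: g0_def)

theorem local_limit_theorem:
 fixes h :: "real => real"
 assumes [measurable]: "h \<in> bmeas borel" and bd: "!!x. \<bar>h x\<bar> <= C * exp (- l*\<bar>x\<bar>)" and l: "l > 0"
  and D: "finite D" "!!x. x \<notin> D ==> isCont h x"
 shows "(%n. c n*(\<integral>x. h x \<partial>nu n)) ----> g0*(\<integral>x. h x \<partial>lborel)"
proof -
 define K where "K x = fejer x+fejer (x-1)" for x
 define ka where "ka = 2-2 * cos (1/2 :: real)"
 have [measurable]: "K \<in> bmeas borel" unfolding K_def by measurable
 have "cos (1/2 :: real) < cos 0" by (rule cos_monotone_0_pi) (use pi_gt3 in auto)
 then have ka: "ka > 0" by (simp add: ka_def)
 have Kka: "K x*(1+x\<^sup>2)>=ka" for x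
 proof -
  have "fejer x * x\<^sup>2<=fejer x*(2*(1+x\<^sup>2))" using fejer_bounds by (intro mult_left_mono) auto
  moreover have "(x-1)\<^sup>2<=2*(1+x\<^sup>2)"
   using zero_le_power2[of "x+1"] by (simp add: power2_eq_square algebra_simps)
  then have "fejer (x-1)*(x-1)\<^sup>2<=fejer (x-1)*(2*(1+x\<^sup>2))"
   using fejer_bounds by (intro mult_left_mono) auto
  ultimately have 1: "(1-cos x)+(1-cos (x-1))<=K x*(1+x\<^sup>2)"
   unfolding fejer_square by (simp add: K_def algebra_simps)
  have "cos x + cos (x-1) = 2 * cos (x-1/2) * cos (1/2)"
   using cos_plus_cos[of x "x-1"] by (simp add: field_simps)
  also have "... <= 2 * cos (1/2)"
  proof -
   have "cos (1/2 :: real) > 0" by (rule cos_gt_zero) (use pi_gt3 in auto)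
   then show ?thesis using cos_le_one[of "x-1/2"] mult_right_mono[of "cos (x-1/2)" 1 "cos (1/2)"] by simp
  qed
  finally show ?thesis using 1 by (simp add: ka_def)
 qed
 have sq: "1+x\<^sup>2 > 0" for x :: real by (simp add: add_pos_nonneg)
 have Kpos: "K x > 0" for x
  using Kka[of x] ka sq[of x] by (metis less_le_trans zero_less_mult_pos2)
 have Kle: "K x<=2" for x using fejer_bounds[of x] fejer_bounds[of "x-1"] by (simp add: K_def)
 have contK: "isCont K x" for x
 proof -
  have "isCont (%x. fejer (x-1)) x" by (rule isCont_o2[OF _ isCont_fejer]) (intro continuous_intros)
  then show ?thesis unfolding K_def[abs_def] by (intro continuous_add isCont_fejer)
 qed
 have intK: "integrable lborel K"
  unfolding K_def[abs_def] using lborel_integrable_real_affine[OF integrable_fejer, of 1 "- 1"] integrable_fejer by simp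
 have FK: "(CLINT x|lborel. K x * iexp (th * x)) = 2 * pi * tent th*(1+iexp th)" for th
 proof -
  have i: "integrable lborel (%x. fejer x * iexp (th * x))" "integrable lborel (%x. fejer (x-1) * iexp (th * x))"
   using lborel_integrable_real_affine[OF integrable_fejer, of 1 "- 1"]
   by (auto intro!: integrable_of_real_mult_iexp integrable_fejer simp del: of_real_mult)
  have "(CLINT x|lborel. fejer (x-1) * iexp (th * x))
    = \<bar>1\<bar> *\<^sub>R (CLINT x|lborel. fejer ((1+1 * x)-1) * iexp (th*(1+1 * x)))"
   by (rule lborel_integral_real_affine) simp
  also have "... = (CLINT x|lborel. iexp th*(fejer x * iexp (th * x)))"
   by (simp add: exp_add distrib_left ac_simps)
  also have "... = iexp th*(2 * pi * tent th)"
   by (subst integral_mult_right_zero) (simp only: fourier_fejer)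
  finally have 2: "(CLINT x|lborel. fejer (x-1) * iexp (th * x)) = iexp th*(2 * pi * tent th)" .
  have "(CLINT x|lborel. K x * iexp (th * x))
    = (CLINT x|lborel. fejer x * iexp (th * x)+fejer (x-1) * iexp (th * x))"
   by (simp only: K_def of_real_add distrib_right)
  also have "... = 2 * pi * tent th+iexp th*(2 * pi * tent th)"
   by (simp only: Bochner_Integration.integral_add[OF i] fourier_fejer 2)
  finally show ?thesis by (simp add: algebra_simps)
 qed
 have LK: "(%n. c n*(CLINT x|nu n. K x * iexp (th * x))) ----> tent th*(1+iexp th) * j 0" for th
 proof -
  have "(%n. c n*(CLINT x|nu n. cor (fejer (x-0)) * iexp (th * x))
    + c n*(CLINT x|nu n. cor (fejer (x-1)) * iexp (th * x)))
   ----> tent th * iexp (th*0) * J 1 0+tent th * iexp (th*1) * J 1 0"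
   by (intro tendsto_add fejer_limit)
  moreover have "c n*(CLINT x|nu n. cor (fejer (x-0)) * iexp (th * x))
    + c n*(CLINT x|nu n. cor (fejer (x-1)) * iexp (th * x))
    = c n*(CLINT x|nu n. K x * iexp (th * x))" for n
  proof -
   interpret n: real_distribution "nu n" by (rule nu_distribution)
   have i: "integrable (nu n) (%x. cor (fejer (x-z)) * iexp (th * x))" for z
    by (intro integrable_of_real_mult_iexp n.integrable_const_bound[of _ 1]) (use fejer_bounds in auto)
   show ?thesis unfolding distrib_left[symmetric] Bochner_Integration.integral_add[OF i i, symmetric]
    by (simp add: K_def distrib_right)
  qed
  moreover have "tent th * iexp (th*0) * J 1 0+tent th * iexp (th*1) * J 1 0 = tent th*(1+iexp th) * j 0"
   using J_real[of 0] by (simp add: j_def algebra_simps)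
  ultimately show ?thesis by simp
 qed
 define Z where "Z n = (\<integral>x. K x \<partial>nu n)" for n
 have iK: "integrable (nu n) K" for n
 proof -
  interpret n: real_distribution "nu n" by (rule nu_distribution)
  show ?thesis using Kpos Kle by (intro n.integrable_const_bound[of _ 2]) (auto simp: less_imp_le)
 qed
 have Zpos: "Z n > 0" for n
 proof -
  interpret n: real_distribution "nu n" by (rule nu_distribution)
  have "Z n ~= 0"
  proof
   assume "Z n = 0"
   then have "AE x in nu n. K x = 0"
    using iK Kpos by (subst (asm) Z_def, subst (asm) integral_nonneg_eq_0_iff_AE) (auto simp: less_imp_le)
   then have "AE x in nu n. False" by eventually_elim (use Kpos in \<open>auto simp: less_le\<close>)
   then show False by simp
  qed
  moreover have "Z n>=0" unfolding Z_def using Kpos by (intro Bochner_Integration.integral_nonneg) (auto simp: less_imp_le)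
  ultimately show ?thesis by simp
 qed
 have cZ: "(%n. c n * Z n) ----> 2 * j 0"
 proof -
  have "(%n. cor (c n * Z n)) ----> cor (2 * j 0)"
   using LK[of 0] by (simp add: Z_def tent_def)
  then show ?thesis using tendsto_of_real_iff by blast
 qed
 define m where "m n = density (nu n) (%x. en (K x/Z n))" for n
 define m\<^sub>0 where "m\<^sub>0 = density lborel (%x. en (K x/(4 * pi)))"
 have m: "real_distribution (m n)" for n
 proof -
  interpret n: real_distribution "nu n" by (rule nu_distribution)
  have "emeasure (m n) (space (m n)) = (\<integral>\<^sup>+x. en (K x/Z n) \<partial>nu n)"
   unfolding m_def by (subst emeasure_density) auto
  also have "... = en (\<integral>x. K x/Z n \<partial>nu n)"
   using iK Kpos Zpos by (intro nn_integral_eq_integral) (auto simp: less_imp_le intro!: AE_I2)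
  also have "... = 1" using Zpos[of n] by (simp add: Z_def[symmetric])
  finally have "prob_space (m n)" by (rule prob_spaceI)
  then show ?thesis by (simp add: real_distribution_def real_distribution_axioms_def m_def)
 qed
 have char_m: "char (m n) th = (CLINT x|nu n. K x * iexp (th * x))/Z n" for n th
 proof -
  interpret n: real_distribution "nu n" by (rule nu_distribution)
  have "char (m n) th = (CLINT x|nu n. (K x/Z n) *\<^sub>R iexp (th * x))"
   unfolding char_def m_def using Kpos Zpos[of n] by (subst integral_density) (auto simp: less_imp_le simp del: of_real_mult)
  also have "... = (CLINT x|nu n. K x * iexp (th * x)/Z n)" by (simp add: scaleR_conv_of_real)
  finally show ?thesis by simp
 qed
 have iK0: "(\<integral>x. K x \<partial>lborel) = 4 * pi"
 proof -
  have "cor (\<integral>x. K x \<partial>lborel) = cor (4 * pi)" using FK[of 0] by (simp add: tent_def)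
  then show ?thesis using of_real_eq_iff by blast
 qed
 have m0: "real_distribution m\<^sub>0"
 proof -
  have "emeasure m\<^sub>0 (space m\<^sub>0) = (\<integral>\<^sup>+x. en (K x/(4 * pi)) \<partial>lborel)"
   unfolding m\<^sub>0_def by (subst emeasure_density) auto
  also have "... = en (\<integral>x. K x/(4 * pi) \<partial>lborel)"
   using intK Kpos by (intro nn_integral_eq_integral) (auto simp: less_imp_le intro!: AE_I2)
  also have "... = 1" by (simp add: iK0)
  finally have "prob_space m\<^sub>0" by (rule prob_spaceI)
  then show ?thesis by (simp add: real_distribution_def real_distribution_axioms_def m\<^sub>0_def)
 qed
 have char_m0: "char m\<^sub>0 th = tent th*(1+iexp th)/2" for th
 proof -
  have "char m\<^sub>0 th = (CLINT x|lborel. (K x/(4 * pi)) *\<^sub>R iexp (th * x))"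
   unfolding char_def m\<^sub>0_def using Kpos by (subst integral_density) (auto simp: less_imp_le simp del: of_real_mult)
  also have "... = (CLINT x|lborel. K x * iexp (th * x)/(4 * pi))" by (simp add: scaleR_conv_of_real)
  also have "... = (2 * pi * tent th*(1+iexp th))/(4 * pi)"
   unfolding FK[symmetric] by (rule integral_divide_zero)
  finally show ?thesis by simp
 qed
 have weak: "weak_conv_m m m\<^sub>0"
 proof (rule levy_continuity[OF m m0])
  fix th
  have "(%n. c n*(CLINT x|nu n. K x * iexp (th * x)) / cor (c n * Z n))
    ----> tent th*(1+iexp th) * j 0 / cor (2 * j 0)"
   using j0_pos by (intro tendsto_divide LK tendsto_of_real cZ) auto
  moreover have "eventually (%n. c n*(CLINT x|nu n. K x * iexp (th * x)) / cor (c n * Z n) = char (m n) th) sequentially"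
   by (intro eventually_sequentiallyI[of 1]) (use c_pos in \<open>force simp: char_m\<close>)
  ultimately show "(%n. char (m n) th) ----> char m\<^sub>0 th"
   using j0_pos by (simp add: tendsto_cong char_m0)
 qed
 obtain C' where C': "!!x. \<bar>h x/K x\<bar> <= C'"
 proof -
  have "\<bar>h x/K x\<bar> <= \<bar>C\<bar>*(1+2/l\<^sup>2)/ka" for x
  proof -
   have e: "1+l*\<bar>x\<bar>+(l*\<bar>x\<bar>)\<^sup>2/2<=exp (l*\<bar>x\<bar>)" using l by (intro exp_lower_Taylor_quadratic) auto
   have "0<=l*\<bar>x\<bar>" using l by simp
   then have e1: "1<=exp (l*\<bar>x\<bar>)" and e2: "(l*\<bar>x\<bar>)\<^sup>2/2<=exp (l*\<bar>x\<bar>)"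
    using e zero_le_power2[of "l*\<bar>x\<bar>"] by linarith+
   from e2 have "x\<^sup>2<=2/l\<^sup>2 * exp (l*\<bar>x\<bar>)" using l by (simp add: power_mult_distrib field_simps)
   with e1 have "1+x\<^sup>2<=(1+2/l\<^sup>2) * exp (l*\<bar>x\<bar>)" unfolding distrib_right by linarith
   then have e3: "(1+x\<^sup>2) * exp (- l*\<bar>x\<bar>)<=1+2/l\<^sup>2" by (simp add: exp_minus field_simps)
   have "\<bar>h x\<bar>*ka <= \<bar>h x\<bar>*(K x*(1+x\<^sup>2))" using Kka by (intro mult_left_mono) auto
   also have "... <= (\<bar>C\<bar> * exp (- l*\<bar>x\<bar>))*(K x*(1+x\<^sup>2))"
   proof (intro mult_right_mono)
    show "\<bar>h x\<bar> <= \<bar>C\<bar> * exp (- l*\<bar>x\<bar>)"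
     using bd[of x] by (rule order_trans) (intro mult_right_mono, auto)
    show "0<=K x*(1+x\<^sup>2)" using Kka[of x] ka by linarith
   qed
   also have "... = \<bar>C\<bar> * K x*((1+x\<^sup>2) * exp (- l*\<bar>x\<bar>))" by (simp only: ac_simps)
   also have "... <= \<bar>C\<bar> * K x*(1+2/l\<^sup>2)" using e3 Kpos[of x] by (intro mult_left_mono) auto
   finally show ?thesis using Kpos[of x] ka by (simp add: abs_mult field_simps)
  qed
  then show thesis by (rule that)
 qed
 have "(%n. \<integral>x. h x/K x \<partial>m n) ----> (\<integral>x. h x/K x \<partial>m\<^sub>0)"
 proof (rule weak_conv_imp_bdd_ae_continuous_conv[OF m m0 weak, where B = C'])
  have "{x. \<not> isCont (%x. h x/K x) x} \<subseteq> D"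
  proof
   fix x assume "x \<in> {x. \<not> isCont (%x. h x/K x) x}"
   then have "\<not> isCont (%x. h x/K x) x" by simp
   then show "x \<in> D" using D(2)[of x] contK[of x] Kpos[of x] by (cases "x \<in> D") (auto intro!: continuous_intros)
  qed
  then have fin: "finite {x. \<not> isCont (%x. h x/K x) x}" using D(1) finite_subset by blast
  then have "{x. \<not> isCont (%x. h x/K x) x} \<in> null_sets lborel" by (rule finite_imp_null_set_lborel)
  then have "{x. \<not> isCont (%x. h x/K x) x} \<in> null_sets m\<^sub>0"
   unfolding m\<^sub>0_def by (subst null_sets_density_iff) (auto intro: AE_not_in elim!: eventually_mono dest: AE_not_in)
  then show "emeasure m\<^sub>0 {x. \<not> isCont (%x. h x/K x) x} = 0" by auto
  show "norm (h x/K x)<=C'" for x using C' by simp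
 qed measurable
 then have "(%n. (c n * Z n)*(\<integral>x. h x/K x \<partial>m n)) ----> (2 * j 0)*(\<integral>x. h x/K x \<partial>m\<^sub>0)"
  by (intro tendsto_mult cZ)
 moreover have "(c n * Z n)*(\<integral>x. h x/K x \<partial>m n) = c n*(\<integral>x. h x \<partial>nu n)" for n
 proof -
  interpret n: real_distribution "nu n" by (rule nu_distribution)
  have "(\<integral>x. h x/K x \<partial>m n) = (\<integral>x. (K x/Z n) *\<^sub>R (h x/K x) \<partial>nu n)"
   unfolding m_def using Kpos Zpos[of n] by (subst integral_density) (auto simp: less_imp_le)
  also have "... = (\<integral>x. h x/Z n \<partial>nu n)"
   using Kpos by (intro Bochner_Integration.integral_cong refl) (simp add: less_imp_neq[symmetric])
  finally show ?thesis using Zpos[of n] by simp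
 qed
 moreover have "(2 * j 0)*(\<integral>x. h x/K x \<partial>m\<^sub>0) = g0*(\<integral>x. h x \<partial>lborel)"
 proof -
  have "(\<integral>x. h x/K x \<partial>m\<^sub>0) = (\<integral>x. (K x/(4 * pi)) *\<^sub>R (h x/K x) \<partial>lborel)"
   unfolding m\<^sub>0_def using Kpos by (subst integral_density) (auto simp: less_imp_le)
  also have "... = (\<integral>x. h x/(4 * pi) \<partial>lborel)"
   using Kpos by (intro Bochner_Integration.integral_cong refl) (simp add: less_imp_neq[symmetric])
  finally show ?thesis by (simp add: g0_def)
 qed
 ultimately show ?thesis by simp
qed

end

lemma act_ennreal:
 assumes m: "fin_borel m" and [measurable]: "g \<in> bmeas borel" and g: "!!x. 0<=g x" "!!x. g x<=B"
 shows "act m (%x. en (g x)) x = en (\<integral>y. g (x+y) \<partial>m)" "integrable m (%y. g (x+y))"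
proof -
 interpret finite_measure m using m by (simp add: fin_borel_def)
 have [measurable_cong]: "sets m = sets borel" using m by (simp add: fin_borel_def)
 show int: "integrable m (%y. g (x+y))"
  using g by (intro integrable_const_bound[of _ B]) auto
 show "act m (%x. en (g x)) x = en (\<integral>y. g (x+y) \<partial>m)"
  unfolding act_def using g by (intro nn_integral_eq_integral int) auto
qed

lemma bdd_fun_ennreal: "g \<in> bmeas borel ==> (!!x. g x<=B) ==> bdd_fun (%x. en (g x))"
 unfolding bdd_fun_def by (auto intro!: exI[of _ "ennreal B"] ennreal_leI)

definition side :: "real set => bool" where "side Sd \<longleftrightarrow> Sd = {..0} \<or> Sd = {0<..}"

lemma side_sets [measurable_dest]: "side Sd ==> Sd \<in> sets borel"
 by (auto simp: side_def)

lemma side_abs_add: "side Sd ==> x \<in> Sd \<or> x = 0 ==> z \<in> Sd \<or> z = 0 ==> \<bar>x+z\<bar> = \<bar>x\<bar>+\<bar>z\<bar>"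
 by (auto simp: side_def)

context walk
begin

lemma sets_kill [simp, measurable_cong]: "sets (kill \<nu> Sd n) = sets borel"
 by (cases n) auto

lemma finite_measure_kill: "Sd \<in> sets borel ==> finite_measure (kill \<nu> Sd n)"
 using fin_kill[of Sd n] by (simp add: fin_borel_def)

lemma AE_kill_side:
 assumes "side Sd" shows "AE z in kill \<nu> Sd n. z \<in> Sd \<or> z = 0"
proof (cases n)
 case 0
 have "AE z in kill \<nu> Sd 0. z = 0" by (rule AE_kill_0)
 then show ?thesis unfolding 0 by eventually_elim simp
next
 case (Suc k)
 have "AE z in kill \<nu> Sd (Suc k). z \<in> Sd" using assms by (intro AE_kill_Suc side_sets)
 then show ?thesis unfolding Suc by eventually_elim simp
qed

definition hit :: "real set => (real => real) => nat => real => real" where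
 "hit Sd g k z = (\<integral>x. indicator Sd x * g (z+x) \<partial>nu k)"

lemma hit_facts:
 assumes Sd: "Sd \<in> sets borel" and [measurable]: "g \<in> bmeas borel" and g: "!!x. 0<=g x" "!!x. g x<=B"
 shows "act (on Sd (nu k)) (%x. en (g x)) z = en (hit Sd g k z)"
  "hit Sd g k \<in> bmeas borel" "0<=hit Sd g k z" "hit Sd g k z<=B"
proof -
 note Sd[measurable]
 interpret k: real_distribution "nu k" by (rule nu_distribution)
 have B: "B>=0" using g[of 0] by linarith
 have bnd: "indicator Sd x * g (z+x)<=B" for x z using g B by (auto split: split_indicator)
 have int: "integrable (nu k) (%x. indicator Sd x * g (z+x))" for z
  using g bnd by (intro k.integrable_const_bound[of _ B]) auto
 show "act (on Sd (nu k)) (%x. en (g x)) z = en (hit Sd g k z)"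
  unfolding hit_def using Sd g
  by (subst act_on) (auto simp: nn_integral_eq_integral[OF int, symmetric] ennreal_mult ennreal_indicator)
 show "hit Sd g k \<in> bmeas borel" unfolding hit_def by measurable
 show "0<=hit Sd g k z" unfolding hit_def using g by (intro Bochner_Integration.integral_nonneg) auto
 have "hit Sd g k z<=(\<integral>x. B \<partial>nu k)" unfolding hit_def using int bnd by (intro integral_mono) auto
 then show "hit Sd g k z<=B" using k.prob_space by simp
qed

lemma spitzer_real:
 assumes Sd: "side Sd" and [measurable]: "g \<in> bmeas borel" and g: "!!x. 0<=g x" "!!x. g x<=B"
 shows "real n*(\<integral>x. g x \<partial>kill \<nu> Sd n) = (\<Sum>j<n. \<integral>z. hit Sd g (n-j) z \<partial>kill \<nu> Sd j)"
proof -
 note Sd' = side_sets[OF Sd]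
 let ?f = "%x. en (g x)"
 have f: "bdd_fun ?f" by (rule bdd_fun_ennreal) (use g in auto)
 have "of_nat n * act (kill \<nu> Sd n) ?f 0 = (\<Sum>k=1..n. act (on Sd (nu k)) (act (kill \<nu> Sd (n-k)) ?f) 0)"
  using Sd spitzer[OF f, of n] unfolding side_def by auto
 also have "... = (\<Sum>j<n. act (on Sd (nu (n-j))) (act (kill \<nu> Sd j) ?f) 0)"
  by (rule sum.reindex_bij_witness[of _ "%j. n-j" "%k. n-k"]) auto
 also have "... = (\<Sum>j<n. act (kill \<nu> Sd j) (act (on Sd (nu (n-j))) ?f) 0)"
  using Sd' by (intro sum.cong refl act_commute) auto
 also have "... = (\<Sum>j<n. en (\<integral>z. hit Sd g (n-j) z \<partial>kill \<nu> Sd j))"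
 proof (intro sum.cong refl)
  fix j
  have "act (on Sd (nu (n-j))) ?f = (%z. en (hit Sd g (n-j) z))"
   using hit_facts(1)[OF Sd' _ g] by auto
  then show "act (kill \<nu> Sd j) (act (on Sd (nu (n-j))) ?f) 0 = en (\<integral>z. hit Sd g (n-j) z \<partial>kill \<nu> Sd j)"
   using act_ennreal(1)[OF fin_kill[OF Sd'] hit_facts(2)[OF Sd' _ g] hit_facts(3,4)[OF Sd' _ g], where x = 0]
   by simp
 qed
 also have "... = en (\<Sum>j<n. \<integral>z. hit Sd g (n-j) z \<partial>kill \<nu> Sd j)"
  using hit_facts(3)[OF Sd' _ g] by (intro sum_ennreal Bochner_Integration.integral_nonneg) auto
 also have "act (kill \<nu> Sd n) ?f 0 = en (\<integral>x. g x \<partial>kill \<nu> Sd n)"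
  using act_ennreal(1)[OF fin_kill[OF Sd'] _ g, where x = 0] by simp
 finally have "en (real n*(\<integral>x. g x \<partial>kill \<nu> Sd n)) = en (\<Sum>j<n. \<integral>z. hit Sd g (n-j) z \<partial>kill \<nu> Sd j)"
  using g by (simp add: ennreal_mult ennreal_of_nat_eq_real_of_nat)
 then show ?thesis
  using g hit_facts(3)[OF Sd' _ g]
  by (subst (asm) ennreal_inj) (auto intro!: sum_nonneg Bochner_Integration.integral_nonneg mult_nonneg_nonneg)
qed

end

context attracted
begin

abbreviation ex :: "real => real => real" where "ex l x \<equiv> exp (- l*\<bar>x\<bar>)"

definition lap :: "real set => real => nat => real" where
 "lap Sd l n = (\<integral>x. ex l x \<partial>kill \<nu> Sd n)"

lemma lap_nonneg: "0<=lap Sd l n"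
 unfolding lap_def by (intro Bochner_Integration.integral_nonneg) auto

lemma hit_ex_0_bound:
 assumes Sd: "side Sd" and l: "l > 0"
 shows "\<exists>C\<ge>0. \<forall>k\<ge>1. hit Sd (ex l) k 0<=C / c k"
proof -
 note Sd' = side_sets[OF Sd]
 have "(%n. c n*(\<integral>x. indicator Sd x * ex l x \<partial>nu n)) ----> g0*(\<integral>x. indicator Sd x * ex l x \<partial>lborel)"
 proof (rule local_limit_theorem[where C = 1 and l = l and D = "{0}"])
  fix x :: real assume x: "x \<notin> {0}"
  have "frontier Sd = {0}" using Sd by (auto simp: side_def)
  then have "isCont (indicator Sd :: real => real) x" using x by (simp add: isCont_indicator)
  then show "isCont (%x. indicator Sd x * ex l x) x" by (intro continuous_intros)
 qed (use Sd' l in \<open>auto split: split_indicator\<close>)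
 then have "Bseq (%n. c n * hit Sd (ex l) n 0)"
  by (intro convergent_imp_Bseq convergentI) (simp add: hit_def)
 then obtain K where K: "K > 0" "!!n. \<bar>c n * hit Sd (ex l) n 0\<bar> <= K" by (auto simp: Bseq_def)
 have "hit Sd (ex l) k 0<=K / c k" if "k>=1" for k
  using K(2)[of k] c_pos[OF that] by (simp add: field_simps abs_le_iff)
 then show ?thesis using K by (intro exI[of _ K]) auto
qed

lemma hit_ex:
 assumes Sd: "side Sd" and z: "z \<in> Sd \<or> z = 0"
 shows "hit Sd (ex l) k z = ex l z * hit Sd (ex l) k 0"
proof -
 have "hit Sd (ex l) k z = (\<integral>x. ex l z*(indicator Sd x * ex l (0+x)) \<partial>nu k)" unfolding hit_def
 proof (intro Bochner_Integration.integral_cong refl)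
  fix x
  show "indicator Sd x * ex l (z+x) = ex l z*(indicator Sd x * ex l (0+x))"
  proof (cases "x \<in> Sd")
   case True
   then have "\<bar>z+x\<bar> = \<bar>z\<bar>+\<bar>x\<bar>" using side_abs_add[OF Sd z] by auto
   then have "ex l (z+x) = ex l z * ex l x" by (simp add: exp_add[symmetric] algebra_simps)
   then show ?thesis by simp
  qed simp
 qed
 then show ?thesis by (simp add: hit_def)
qed

lemma lap_bound:
 assumes Sd: "side Sd" and l: "l > 0"
 shows "\<exists>B>0. \<forall>n. lap Sd l n<=B * w n"
proof -
 note Sd' = side_sets[OF Sd]
 obtain C where C: "C>=0" "!!k. k>=1 ==> hit Sd (ex l) k 0<=C / c k" using hit_ex_0_bound[OF Sd l] by blast
 have ex1: "0<=ex l x" "ex l x<=1" for x using l by auto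
 show ?thesis
 proof (rule renewal_bound[OF lap_nonneg C(1)])
  fix n :: nat assume "n>=1"
  have "real n * lap Sd l n = (\<Sum>j<n. \<integral>z. hit Sd (ex l) (n-j) z \<partial>kill \<nu> Sd j)"
   unfolding lap_def using Sd ex1 by (intro spitzer_real[where B = 1]) auto
  also have "... = (\<Sum>j<n. hit Sd (ex l) (n-j) 0 * lap Sd l j)"
  proof (intro sum.cong refl)
   fix j
   have "(\<integral>z. hit Sd (ex l) (n-j) z \<partial>kill \<nu> Sd j) = (\<integral>z. ex l z * hit Sd (ex l) (n-j) 0 \<partial>kill \<nu> Sd j)"
   proof (rule integral_cong_AE)
    show "AE z in kill \<nu> Sd j. hit Sd (ex l) (n-j) z = ex l z * hit Sd (ex l) (n-j) 0"
     using AE_kill_side[OF Sd] by eventually_elim (rule hit_ex[OF Sd])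
   qed (use hit_facts(2)[OF Sd' _ ex1] in auto)
   then show "(\<integral>z. hit Sd (ex l) (n-j) z \<partial>kill \<nu> Sd j) = hit Sd (ex l) (n-j) 0 * lap Sd l j"
    by (simp add: lap_def mult.commute)
  qed
  also have "... <= (\<Sum>j<n. C / c (n-j) * lap Sd l j)"
   by (intro sum_mono mult_right_mono C lap_nonneg) auto
  finally show "real n * lap Sd l n<=(\<Sum>j<n. C / c (n-j) * lap Sd l j)" .
 qed
qed

lemma c_shift_ratio: "(%n. c n / c (n-i)) ----> 1"
proof -
 have "(%n. c (n+i) / c n) ----> 1"
 proof (induction i)
  case 0
  show ?case by (rule tendsto_eventually) (auto intro!: eventually_sequentiallyI[of 1] dest: c_pos)
 next
  case (Suc i)
  have lim: "(%n. c (Suc (n+i)) / c (n+i)*(c (n+i) / c n)) ----> 1*1"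
   by (intro tendsto_mult Suc LIMSEQ_ignore_initial_segment[OF c_Suc_ratio])
  have ev: "eventually (%n. c (Suc (n+i)) / c (n+i)*(c (n+i) / c n) = c (n+Suc i) / c n) sequentially"
  proof (intro eventually_sequentiallyI[of 1])
   fix n :: nat assume "n>=1"
   then have "c (n+i) > 0" by (intro c_pos) auto
   then show "c (Suc (n+i)) / c (n+i)*(c (n+i) / c n) = c (n+Suc i) / c n" by simp
  qed
  from Lim_transform_eventually[OF lim ev] show ?case by simp
 qed
 then show ?thesis by - (rule LIMSEQ_offset[of _ i], simp)
qed

definition kill_lim :: "real set => (real => real) => nat => real" where
 "kill_lim Sd g k = (\<integral>z. g0*(\<integral>x. indicator Sd x * g (z+x) \<partial>lborel) \<partial>kill \<nu> Sd k)"

lemma kill_limit: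
 assumes Sd: "side Sd" and l: "l > 0" and [measurable]: "g \<in> bmeas borel"
  and g: "!!x. 0<=g x" "!!x. g x<=C * ex l x"
  and D: "finite D" "!!x. x \<notin> D ==> isCont g x"
 shows "(%n. (\<integral>x. g x \<partial>kill \<nu> Sd n)/w n) ----> (\<Sum>k. kill_lim Sd g k)" "summable (kill_lim Sd g)"
proof -
 note Sd' = side_sets[OF Sd]
 note Sd'[measurable]
 have C: "C>=0" using g(1)[of 0] g(2)[of 0] by simp
 have gB: "g x<=C" for x using g(2)[of x] C l mult_left_mono[of "ex l x" 1 C] by (auto intro: order_trans)
 obtain C1 where C1: "C1>=0" "!!k. k>=1 ==> hit Sd (ex l) k 0<=C1 / c k" using hit_ex_0_bound[OF Sd l] by blast
 obtain B where B: "B > 0" "!!n. lap Sd l n<=B * w n" using lap_bound[OF Sd l] by blast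
 have ex1: "0<=ex l x" "ex l x<=1" for x using l by auto
 have hit_le: "hit Sd g k z<=C * C1 / c k * ex l z" if "k>=1" "z \<in> Sd \<or> z = 0" for k z
 proof -
  interpret k: real_distribution "nu k" by (rule nu_distribution)
  have "hit Sd g k z<=(\<integral>x. C*(indicator Sd x * ex l (z+x)) \<partial>nu k)" unfolding hit_def
  proof (intro integral_mono)
   show "integrable (nu k) (%x. indicator Sd x * g (z+x))"
    using g gB C by (intro k.integrable_const_bound[of _ C]) (auto split: split_indicator)
   show "integrable (nu k) (%x. C*(indicator Sd x * ex l (z+x)))"
    using C ex1 by (intro k.integrable_const_bound[of _ C]) (auto split: split_indicator simp: mult_left_le)
   show "indicator Sd x * g (z+x)<=C*(indicator Sd x * ex l (z+x))" for x
    using g(2)[of "z+x"] by (auto split: split_indicator)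
  qed
  also have "... = C * hit Sd (ex l) k z" by (simp add: hit_def)
  also have "... = C*(ex l z * hit Sd (ex l) k 0)" using hit_ex[OF Sd that(2)] by simp
  also have "... <= C*(ex l z*(C1 / c k))" using C C1(2)[OF that(1)] by (intro mult_left_mono) auto
  finally show ?thesis by (simp add: ac_simps)
 qed
 define V where "V n i = (if i < n then c n*(\<integral>z. hit Sd g (n-i) z \<partial>kill \<nu> Sd i) else 0)" for n i
 have intlap: "integrable (kill \<nu> Sd i) (%z. ex l z)" for i
  using act_ennreal(2)[where m = "kill \<nu> Sd i" and g = "ex l" and B = 1 and x = 0] Sd' l by simp
 have Vb: "\<bar>V n i\<bar> <= (C * C1 * B)*(c n / c (n-i)) * w i" if i: "i < n" for n i
 proof -
  have cp: "c n > 0" "c (n-i) > 0" using i by (auto intro!: c_pos)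
  have "(\<integral>z. hit Sd g (n-i) z \<partial>kill \<nu> Sd i)<=(\<integral>z. C * C1 / c (n-i) * ex l z \<partial>kill \<nu> Sd i)"
  proof (intro integral_mono_AE)
   show "integrable (kill \<nu> Sd i) (hit Sd g (n-i))"
    using act_ennreal(2)[where m = "kill \<nu> Sd i" and g = "hit Sd g (n-i)" and B = C and x = 0]
     Sd' hit_facts(2-4)[where g = g and B = C, OF Sd' _ g(1) gB] by simp
   show "AE z in kill \<nu> Sd i. hit Sd g (n-i) z<=C * C1 / c (n-i) * ex l z"
    using AE_kill_side[OF Sd] by eventually_elim (rule hit_le, use i in auto)
  qed (intro integrable_mult_right intlap)
  also have "... = C * C1 / c (n-i) * lap Sd l i" by (simp add: lap_def)
  also have "... <= C * C1 / c (n-i)*(B * w i)" using B C C1 cp by (intro mult_left_mono) auto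
  finally have "c n*(\<integral>z. hit Sd g (n-i) z \<partial>kill \<nu> Sd i)<=c n*(C * C1 / c (n-i)*(B * w i))"
   using cp by (intro mult_left_mono) auto
  then have "V n i<=c n*(C * C1 / c (n-i)*(B * w i))" using i by (simp add: V_def)
  moreover have "V n i>=0" using i cp hit_facts(3)[OF Sd' _ g(1) gB]
   by (auto simp: V_def intro!: mult_nonneg_nonneg Bochner_Integration.integral_nonneg)
  ultimately show ?thesis by (simp add: ac_simps)
 qed
 have Vl: "(%n. V n i) ----> kill_lim Sd g i" for i
 proof -
  interpret fi: finite_measure "kill \<nu> Sd i" by (rule finite_measure_kill[OF Sd'])
  have hl: "(%k. c k * hit Sd g k z) ----> g0*(\<integral>x. indicator Sd x * g (z+x) \<partial>lborel)" for z
   unfolding hit_def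
  proof (rule local_limit_theorem[where C = "C * exp (l*\<bar>z\<bar>)" and l = l and D = "insert 0 ((%x. x-z) ` D)"])
   show "\<bar>indicator Sd x * g (z+x)\<bar> <= C * exp (l*\<bar>z\<bar>) * ex l x" for x
   proof -
    have "\<bar>indicator Sd x * g (z+x)\<bar> <= g (z+x)" using g(1)[of "z+x"] by (auto split: split_indicator)
    also have "... <= C * ex l (z+x)" by (rule g)
    also have "... <= C * exp (l*\<bar>z\<bar> - l*\<bar>x\<bar>)"
    proof (intro mult_left_mono C)
     have "l*\<bar>x\<bar> <= l*(\<bar>z\<bar>+\<bar>z+x\<bar>)" using l by (intro mult_left_mono) auto
     then show "ex l (z+x)<=exp (l*\<bar>z\<bar> - l*\<bar>x\<bar>)" by (simp add: algebra_simps)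
    qed
    also have "... = C * exp (l*\<bar>z\<bar>) * ex l x" by (simp add: exp_diff exp_minus field_simps)
    finally show ?thesis .
   qed
   fix x assume x: "x \<notin> insert 0 ((%x. x-z) ` D)"
   have "frontier Sd = {0}" using Sd by (auto simp: side_def)
   then have 1: "isCont (indicator Sd :: real => real) x" using x by (simp add: isCont_indicator)
   have "z+x \<notin> D" using x by (auto simp: image_iff)
   then have "isCont (%x. g (z+x)) x" by (intro isCont_o2[OF _ D(2)]) auto
   then show "isCont (%x. indicator Sd x * g (z+x)) x" using 1 by (intro continuous_intros)
  qed (use l D in auto)
  have "(%k. \<integral>z. c (Suc k) * hit Sd g (Suc k) z \<partial>kill \<nu> Sd i) ----> kill_lim Sd g i"
   unfolding kill_lim_def
  proof (rule integral_dominated_convergence[where w = "%_. C * C1"])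
   show "AE z in kill \<nu> Sd i. (%k. c (Suc k) * hit Sd g (Suc k) z) ----> g0*(\<integral>x. indicator Sd x * g (z+x) \<partial>lborel)"
    by (intro AE_I2 LIMSEQ_Suc hl)
   show "AE z in kill \<nu> Sd i. norm (c (Suc k) * hit Sd g (Suc k) z)<=C * C1" for k
    using AE_kill_side[OF Sd]
   proof eventually_elim
    fix z assume z: "z \<in> Sd \<or> z = 0"
    have cp: "c (Suc k) > 0" by (intro c_pos) auto
    have "c (Suc k) * hit Sd g (Suc k) z<=c (Suc k)*(C * C1 / c (Suc k) * ex l z)"
     using cp z by (intro mult_left_mono hit_le) auto
    also have "... = C * C1 * ex l z" using cp by simp
    also have "... <= C * C1" using C C1 l by (simp add: mult_left_le)
    finally show "norm (c (Suc k) * hit Sd g (Suc k) z)<=C * C1"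
     using cp hit_facts(3)[OF Sd' _ g(1) gB] by simp
   qed
  qed (use hit_facts(2)[OF Sd' _ g(1) gB] in auto)
  then have "(%k. c k*(\<integral>z. hit Sd g k z \<partial>kill \<nu> Sd i)) ----> kill_lim Sd g i"
   by - (rule LIMSEQ_imp_Suc, simp)
  then have "(%n. c (n-i)*(\<integral>z. hit Sd g (n-i) z \<partial>kill \<nu> Sd i)) ----> kill_lim Sd g i"
   by - (rule LIMSEQ_offset[of _ i], simp)
  from tendsto_mult[OF c_shift_ratio[of i] this]
  have lim: "(%n. c n / c (n-i)*(c (n-i)*(\<integral>z. hit Sd g (n-i) z \<partial>kill \<nu> Sd i))) ----> kill_lim Sd g i"
   by simp
  show ?thesis
  proof (rule Lim_transform_eventually[OF lim eventually_sequentiallyI[of "Suc i"]])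
   fix n assume n: "Suc i<=n"
   then have "c (n-i) > 0" by (intro c_pos) auto
   then show "c n / c (n-i)*(c (n-i)*(\<integral>z. hit Sd g (n-i) z \<partial>kill \<nu> Sd i)) = V n i"
    using n by (simp add: V_def)
  qed
 qed
 note T = spitzer_limit[OF Vl Vb]
 show "summable (kill_lim Sd g)" using T(2) C C1 B by simp
 have "(%n. \<Sum>i<n. V n i) ----> (\<Sum>k. kill_lim Sd g k)" using T(1) C C1 B by simp
 moreover have "eventually (%n. (\<Sum>i<n. V n i) = (\<integral>x. g x \<partial>kill \<nu> Sd n)/w n) sequentially"
 proof (intro eventually_sequentiallyI[of 1])
  fix n :: nat assume n: "n>=1"
  have "(\<Sum>i<n. V n i) = c n*(\<Sum>i<n. \<integral>z. hit Sd g (n-i) z \<partial>kill \<nu> Sd i)"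
   unfolding sum_distrib_left by (intro sum.cong) (auto simp: V_def)
  also have "... = c n*(real n*(\<integral>x. g x \<partial>kill \<nu> Sd n))"
   using spitzer_real[where g = g and B = C and n = n, OF Sd _ g(1) gB] by simp
  finally show "(\<Sum>i<n. V n i) = (\<integral>x. g x \<partial>kill \<nu> Sd n)/w n"
   using n c_pos[OF n] by (simp add: w_eq field_simps)
 qed
 ultimately show "(%n. (\<integral>x. g x \<partial>kill \<nu> Sd n)/w n) ----> (\<Sum>k. kill_lim Sd g k)"
  by (simp add: tendsto_cong)
qed

end

lemma exp_integral:
 fixes l b d :: real
 assumes l: "l > 0"
 shows "(\<integral>x. indicator {..b} x * exp (l*(x+d)) \<partial>lborel) = exp (l*(b+d))/l"
proof -
 have "(\<integral>\<^sup>+x. en (exponential_density l x) \<partial>lborel) = 1"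
  using prob_space.emeasure_space_1[OF prob_space_exponential_density[OF l]]
  by (simp add: emeasure_density exponential_density_def)
 then have "(\<integral>x. exponential_density l x \<partial>lborel) = 1"
  using l by (subst integral_eq_nn_integral) (auto simp: exponential_density_def)
 moreover have "(\<integral>x. indicator {..b} x * exp (l*(x+d)) \<partial>lborel)
   = \<bar>- 1\<bar> *\<^sub>R (\<integral>x. indicator {..b} (b+(- 1) * x) * exp (l*((b+(- 1) * x)+d)) \<partial>lborel)"
  by (rule lborel_integral_real_affine) simp
 moreover have "(\<integral>x. indicator {..b} (b+(- 1) * x) * exp (l*((b+(- 1) * x)+d)) \<partial>lborel)
   = (\<integral>x. exp (l*(b+d))/l * exponential_density l x \<partial>lborel)"
 proof (intro Bochner_Integration.integral_cong refl)
  fix x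
  show "indicator {..b} (b+(- 1) * x) * exp (l*((b+(- 1) * x)+d)) = exp (l*(b+d))/l * exponential_density l x"
   using l by (auto simp: exponential_density_def indicator_def exp_add[symmetric] algebra_simps)
 qed
 ultimately show ?thesis by simp
qed

context attracted
begin

lemma nu_pos: "\<exists>\<delta>>0. \<exists>n0. \<forall>n\<ge>n0. \<delta> <= measure (nu n) {0<..}"
proof -
 have "emeasure \<mu> {0} = 0" by (subst mu_density, subst emeasure_density) (auto simp: nn_integral_count_space_indicator)
 then have "measure \<mu> {0} = 0" by (simp add: measure_def)
 then have "isCont (cdf \<mu>) 0" by (simp add: mu.isCont_cdf)
 then have lim: "(%n. cdf (distr (nu n) borel (%x. x / c n)) 0) ----> cdf \<mu> 0"
  using conv by (simp add: weak_conv_m_def weak_conv_def)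
 have "cdf \<mu> 0 < 1"
 proof (rule ccontr)
  assume "\<not> cdf \<mu> 0 < 1"
  then have "mu.prob {..0} = 1" using mu.prob_le_1[of "{..0}"] by (simp add: cdf_def)
  then have "AE x in \<mu>. x \<in> {..0}" by (subst mu.prob_eq_1[symmetric]) auto
  then show False using two_sided unfolding two_sided_def by auto
 qed
 then obtain r where r: "cdf \<mu> 0 < r" "r < 1" using dense by blast
 have "eventually (%n. cdf (distr (nu n) borel (%x. x / c n)) 0 < r) sequentially"
  using lim r(1) by (rule order_tendstoD)
 then obtain n0 where n0: "!!n. n>=n0 ==> cdf (distr (nu n) borel (%x. x / c n)) 0 < r"
  by (auto simp: eventually_sequentially)
 have "1-r<=measure (nu n) {0<..}" if n: "n>=max n0 1" for n
 proof -
  interpret n: real_distribution "nu n" by (rule nu_distribution)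
  have cn: "c n > 0" using n by (intro c_pos) auto
  have "(%x. x / c n) -` {..0} \<inter> space (nu n) = {..0}" using cn by (auto simp: field_simps)
  then have "cdf (distr (nu n) borel (%x. x / c n)) 0 = n.prob {..0}"
   unfolding cdf_def by (subst measure_distr) auto
  moreover have "n.prob {0<..} = 1-n.prob {..0}"
  proof -
   have "space (nu n) - {..0} = {0<..}" by auto
   then show ?thesis using n.prob_compl[of "{..0}"] by simp
  qed
  ultimately show ?thesis using n0[of n] n by simp
 qed
 then show ?thesis using r by (intro exI[of _ "1-r"] conjI exI[of _ "max n0 1"]) auto
qed

lemma act_one: "act m (%_. 1) x = emeasure m (space m)"
 by (simp add: act_def)

lemma p_mass_0: "(%n. measure (p n) UNIV) ----> 0"
proof -
 interpret p: finite_measure "p n" for n by (rule finite_measure_kill) simp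
 interpret q: finite_measure "q n" for n by (rule finite_measure_kill) simp
 have sp[simp]: "space (kill \<nu> Sd n) = UNIV" for Sd n using sets_eq_imp_space_eq[OF sets_kill[of Sd n]] by simp
 obtain \<delta> n0 where \<delta>: "\<delta> > 0" "!!n. n>=n0 ==> \<delta> <= measure (nu n) {0<..}" using nu_pos by blast
 have one: "bdd_fun (%_. 1)" by (auto simp: bdd_fun_def intro!: exI[of _ 1])
 have dec: "measure (p (Suc n)) UNIV<=measure (p n) UNIV" for n
 proof -
  have "act \<nu> (act (p n) (%_. 1)) 0 = act (p (Suc n)) (%_. 1) 0+act (leave \<nu> {..0} n) (%_. 1) 0"
   by (rule act_kill_leave) auto
  then have "emeasure (p (Suc n)) UNIV<=emeasure (p n) UNIV"
   by (simp add: act_def emeasure_space_1[simplified] del: kill.simps)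
  then show ?thesis by (simp add: p.emeasure_eq_measure del: kill.simps)
 qed
 have dec': "decseq (%n. measure (p n) UNIV)" by (rule decseq_SucI) (rule dec)
 have prod: "measure (p n) UNIV*(\<Sum>k\<le>n. measure (q k) UNIV)<=1" for n
 proof -
  interpret n: real_distribution "nu n" by (rule nu_distribution)
  have "(\<Sum>k\<le>n. emeasure (p k) UNIV * emeasure (q (n-k)) UNIV) = act (nu n) (%_. 1) 0"
   unfolding nu_eq_pq[OF one] by (simp add: act_def mult.commute)
  also have "... = 1" using n.emeasure_space_1 by (simp add: act_def)
  finally have "en (\<Sum>k\<le>n. measure (p k) UNIV * measure (q (n-k)) UNIV) = 1"
   by (simp add: p.emeasure_eq_measure q.emeasure_eq_measure ennreal_mult[symmetric] sum_ennreal)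
  then have eq: "(\<Sum>k\<le>n. measure (p k) UNIV * measure (q (n-k)) UNIV) = 1" by simp
  have "measure (p n) UNIV*(\<Sum>k\<le>n. measure (q k) UNIV) = (\<Sum>k\<le>n. measure (p n) UNIV * measure (q (n-k)) UNIV)"
   unfolding sum_distrib_left by (rule sum.reindex_bij_witness[of _ "%k. n-k" "%k. n-k"]) auto
  also have "... <= (\<Sum>k\<le>n. measure (p k) UNIV * measure (q (n-k)) UNIV)"
   using dec' by (intro sum_mono mult_right_mono) (auto simp: decseq_def)
  finally show ?thesis using eq by simp
 qed
 have q: "\<delta>/real n<=measure (q n) UNIV" if n: "n>=max n0 1" for n
 proof -
  have Sd: "side {0<..}" by (simp add: side_def)
  have "real n*(\<integral>x. 1 \<partial>q n) = (\<Sum>j<n. \<integral>z. hit {0<..} (%_. 1) (n-j) z \<partial>q j)"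
   by (rule spitzer_real[OF Sd, where B = 1]) auto
  also have "... >= (\<Sum>j\<in>{0}. \<integral>z. hit {0<..} (%_. 1) (n-j) z \<partial>q j)"
   using n hit_facts(3)[where Sd = "{0<..}" and g = "%_. 1" and B = 1]
   by (intro sum_mono2 Bochner_Integration.integral_nonneg) auto
  also have "(\<Sum>j\<in>{0}. \<integral>z. hit {0<..} (%_. 1) (n-j) z \<partial>q j) = measure (nu n) {0<..}"
   using hit_facts(2)[where Sd = "{0<..}" and g = "%_. 1" and B = 1 and k = n]
   by (simp add: integral_return hit_def measure_return)
  also have "... >= \<delta>" using \<delta>(2) n by simp
  finally show ?thesis using n by (simp add: field_simps)
 qed
 have nsum: "\<not> summable (%n. measure (q n) UNIV)"
 proof
  assume "summable (%n. measure (q n) UNIV)"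
  then have "summable (%n. \<delta>*(1/real n))"
   by (rule summable_comparison_test'[of _ "max n0 1"]) (use q \<delta>(1) in auto)
  then have "summable (%n. 1/real n)" using \<delta>(1) by (subst (asm) summable_cmult_iff) auto
  then show False using not_summable_harmonic[where 'a = real] by (simp add: inverse_eq_divide)
 qed
 have "filterlim (%n. \<Sum>k\<le>n. measure (q k) UNIV) at_top sequentially"
 proof (rule ccontr)
  assume "\<not> ?thesis"
  then obtain B where B: "\<not> eventually (%n. B<=(\<Sum>k\<le>n. measure (q k) UNIV)) sequentially"
   by (auto simp: filterlim_at_top)
  have "(\<Sum>k<n. measure (q k) UNIV)<=B" for n
  proof (rule ccontr)
   assume a: "\<not> (\<Sum>k<n. measure (q k) UNIV)<=B"
   have "B<=(\<Sum>k\<le>m. measure (q k) UNIV)" if "m>=n" for m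
   proof -
    have "(\<Sum>k<n. measure (q k) UNIV)<=(\<Sum>k\<le>m. measure (q k) UNIV)" using that by (intro sum_mono2) auto
    then show ?thesis using a by linarith
   qed
   then show False using B by (auto simp: eventually_sequentially)
  qed
  then have "summable (%n. measure (q n) UNIV)" by (intro summableI_nonneg_bounded) auto
  then show False using nsum by simp
 qed
 then have lim: "(%n. 1/(\<Sum>k\<le>n. measure (q k) UNIV)) ----> 0"
  by (intro tendsto_divide_0[OF tendsto_const] filterlim_at_top_imp_at_infinity)
 show ?thesis
 proof (rule tendsto_sandwich[OF _ _ tendsto_const lim])
  show "eventually (%n. measure (p n) UNIV<=1/(\<Sum>k\<le>n. measure (q k) UNIV)) sequentially"
  proof (intro always_eventually allI)
   fix n
   have "measure (q 0) UNIV = 1" by (simp add: measure_return)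
   then have "0 < (\<Sum>k\<le>n. measure (q k) UNIV)"
    by (intro sum_pos2[of _ 0]) (auto simp del: kill.simps)
   then show "measure (p n) UNIV<=1/(\<Sum>k\<le>n. measure (q k) UNIV)" using prod[of n] by (simp add: field_simps)
  qed
 qed auto
qed

lemma leave_sums: "(%n. measure (leave \<nu> {..0} n) UNIV) sums 1"
proof -
 interpret p: finite_measure "p n" for n by (rule finite_measure_kill) simp
 have "finite_measure (leave \<nu> {..0} n)" for n using fin_leave[of "{..0}" n] by (simp add: fin_borel_def)
 then interpret r: finite_measure "leave \<nu> {..0} n" for n .
 have sp[simp]: "space (kill \<nu> Sd n) = UNIV" for Sd n using sets_eq_imp_space_eq[OF sets_kill[of Sd n]] by simp
 have sp'[simp]: "space (leave \<nu> {..0} n) = UNIV" for n by (simp add: leave_def)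
 have "measure (leave \<nu> {..0} n) UNIV = measure (p n) UNIV-measure (p (Suc n)) UNIV" for n
 proof -
  have "act \<nu> (act (p n) (%_. 1)) 0 = act (p (Suc n)) (%_. 1) 0+act (leave \<nu> {..0} n) (%_. 1) 0"
   by (rule act_kill_leave) auto
  then have "emeasure (p n) UNIV = emeasure (p (Suc n)) UNIV+emeasure (leave \<nu> {..0} n) UNIV"
   by (simp add: act_def emeasure_space_1[simplified] del: kill.simps)
  then have "measure (p n) UNIV = measure (p (Suc n)) UNIV+measure (leave \<nu> {..0} n) UNIV"
   unfolding p.emeasure_eq_measure r.emeasure_eq_measure
   by (subst (asm) ennreal_plus[symmetric]) (auto simp del: kill.simps ennreal_plus)
  then show ?thesis by simp
 qed
 moreover have "measure (p 0) UNIV = 1" by (simp add: measure_return)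
 ultimately show ?thesis using telescope_sums'[OF p_mass_0] by (simp del: kill.simps)
qed

lemma side_neg: "side {..0}" and side_pos: "side {0<..}"
 by (auto simp: side_def)

definition gs :: "real => real => real => real" where
 "gs l s t = (if t<=0 \<and> t+s<=0 then exp (l*(t+s)) else 0)"

lemma gs_measurable [measurable]: "gs l s \<in> bmeas borel"
 unfolding gs_def by measurable

lemma gs_measurable_pair [measurable]: "(%(s, t). gs l s t) \<in> bmeas (borel \<Otimes>\<^sub>M borel)"
 unfolding gs_def by measurable

lemma gs_bounds:
 assumes "l > 0"
 shows "0<=gs l s t" "gs l s t<=1" "gs l s t<=exp (l * s) * ex l t"
proof -
 show "0<=gs l s t" "gs l s t<=1" using assms by (auto simp: gs_def mult_nonneg_nonpos)
 show "gs l s t<=exp (l * s) * ex l t" by (auto simp: gs_def exp_add[symmetric] algebra_simps)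
qed

lemma isCont_gs:
 assumes "t \<notin> {0, - s}" shows "isCont (gs l s) t"
proof -
 have eq: "gs l s = (%t. (indicator {..0} t * indicator {..- s} t) * exp (l*(t+s)))"
  by (auto simp: gs_def indicator_def fun_eq_iff)
 have "isCont (indicator {..0} :: real => real) t" "isCont (indicator {..- s} :: real => real) t"
  using assms by (auto simp: isCont_indicator)
 then show ?thesis unfolding eq by (intro continuous_intros)
qed

lemma gs_limit:
 assumes l: "l > 0"
 shows "(%n. (\<integral>t. gs l s t \<partial>p n)/w n) ----> (\<Sum>k. kill_lim {..0} (gs l s) k)"
  "summable (kill_lim {..0} (gs l s))"
  "kill_lim {..0} (gs l s) k = g0/l*(\<integral>z. exp (l * min 0 (z+s)) \<partial>p k)"
proof -
 note L = kill_limit[OF side_neg l, where g = "gs l s" and C = "exp (l * s)" and D = "{0, - s}"]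
 show "(%n. (\<integral>t. gs l s t \<partial>p n)/w n) ----> (\<Sum>k. kill_lim {..0} (gs l s) k)"
  "summable (kill_lim {..0} (gs l s))"
  using L gs_bounds[OF l] isCont_gs by auto
 have *: "g0*(\<integral>x. indicator {..0} x * gs l s (z+x) \<partial>lborel) = g0/l * exp (l * min 0 (z+s))" if "z<=0" for z
 proof -
  have "(\<integral>x. indicator {..0} x * gs l s (z+x) \<partial>lborel)
    = (\<integral>x. indicator {..min 0 (- (z+s))} x * exp (l*(x+(z+s))) \<partial>lborel)"
   by (intro Bochner_Integration.integral_cong refl) (use that in \<open>auto simp: gs_def indicator_def algebra_simps\<close>)
  also have "... = exp (l*(min 0 (- (z+s))+(z+s)))/l" by (rule exp_integral[OF l])
  also have "min 0 (- (z+s))+(z+s) = min 0 (z+s)" by auto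
  finally show ?thesis by simp
 qed
 have "kill_lim {..0} (gs l s) k = (\<integral>z. g0/l * exp (l * min 0 (z+s)) \<partial>p k)"
  unfolding kill_lim_def
 proof (rule integral_cong_AE)
  show "AE z in p k. g0*(\<integral>x. indicator {..0} x * gs l s (z+x) \<partial>lborel) = g0/l * exp (l * min 0 (z+s))"
   using AE_p[of k] by eventually_elim (rule *)
 qed measurable
 then show "kill_lim {..0} (gs l s) k = g0/l*(\<integral>z. exp (l * min 0 (z+s)) \<partial>p k)" by simp
qed

definition U :: "real => real => real" where
 "U l s = (\<Sum>k. kill_lim {..0} (gs l s) k)"

lemma U_measurable [measurable]: "U l \<in> bmeas borel" if "l > 0"
proof -
 interpret p: finite_measure "p n" for n by (rule finite_measure_kill) simp
 show ?thesis unfolding U_def gs_limit(3)[OF that] by measurable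
qed

lemma U_nonneg: "l > 0 ==> U l s>=0"
 unfolding U_def using g0_pos
 by (intro suminf_nonneg gs_limit(2)) (auto simp: gs_limit(3) intro!: mult_nonneg_nonneg Bochner_Integration.integral_nonneg)

lemma lap_eq: "lap {..0} l k = (\<integral>z. exp (l * min 0 z) \<partial>p k)"
 unfolding lap_def by (rule integral_cong_AE) (use AE_p[of k] in \<open>auto elim!: eventually_mono\<close>)

lemma lap_summable: assumes l: "l > 0" and Sd: "side Sd" shows "summable (lap Sd l)"
proof -
 obtain B where B: "B > 0" "!!n. lap Sd l n<=B * w n" using lap_bound[OF Sd l] by blast
 show ?thesis
  by (rule summable_comparison_test'[OF summable_mult[OF summable_w, of B], of 0]) (use B lap_nonneg in auto)
qed

lemma U_0: "l > 0 ==> U l 0 = g0/l*(\<Sum>k. lap {..0} l k)"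
proof -
 assume l: "l > 0"
 have "kill_lim {..0} (gs l 0) = (%k. g0/l * lap {..0} l k)" by (simp add: gs_limit(3)[OF l] lap_eq fun_eq_iff)
 then show ?thesis unfolding U_def using suminf_mult[OF lap_summable[OF l side_neg], of "g0/l"] by simp
qed

text \<open>No mass escapes to \<open>-\<infinity>\<close>: this is where the walk has to be recurrent, in the form that the
 first strict ascending ladder epoch is finite almost surely.\<close>

lemma U_integral:
 assumes l: "l > 0"
 shows "integrable \<nu> (U l)" "(\<integral>s. U l s \<partial>\<nu>) = U l 0"
proof -
 interpret p: finite_measure "p n" for n by (rule finite_measure_kill) simp
 interpret pair_sigma_finite "p n" \<nu> for n ..
 note m[measurable] = U_measurable[OF l]
 let ?E = "%y. en (exp (l * min 0 y))"
 have leE: "exp (l * min 0 y)<=1" for y using l by (simp add: mult_nonneg_nonpos)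
 have r: "finite_measure (leave \<nu> {..0} k)" for k using fin_leave[of "{..0}" k] by (simp add: fin_borel_def)
 have spl: "space (leave \<nu> {..0} k) = UNIV" for k by (simp add: leave_def)
 have inner: "(\<integral>\<^sup>+s. en (\<integral>z. exp (l * min 0 (z+s)) \<partial>p k) \<partial>\<nu>) = en (lap {..0} l (Suc k)+measure (leave \<nu> {..0} k) UNIV)" for k
 proof -
  have "(\<integral>\<^sup>+s. en (\<integral>z. exp (l * min 0 (z+s)) \<partial>p k) \<partial>\<nu>) = act \<nu> (act (p k) ?E) 0"
   unfolding act_def[of \<nu>]
   by (intro nn_integral_cong, subst act_ennreal[where B = 1]) (use leE in \<open>auto simp: add.commute\<close>)
  also have "... = act (p (Suc k)) ?E 0+act (leave \<nu> {..0} k) ?E 0"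
   by (rule act_kill_leave) auto
  also have "act (p (Suc k)) ?E 0 = en (lap {..0} l (Suc k))"
   unfolding lap_eq by (subst act_ennreal[where B = 1]) (use leE in \<open>auto simp del: kill.simps\<close>)
  also have "act (leave \<nu> {..0} k) ?E 0 = act (leave \<nu> {..0} k) (%_. 1) 0"
   by (rule act_AE_cong, use AE_leave_p[of k] in eventually_elim) simp
  also have "... = en (measure (leave \<nu> {..0} k) UNIV)"
   by (simp add: act_one spl finite_measure.emeasure_eq_measure[OF r])
  finally show ?thesis using lap_nonneg by (simp del: kill.simps)
 qed
 have gl: "g0/l>=0" using g0_pos l by simp
 have kn: "0<=kill_lim {..0} (gs l s) k" for s k
  unfolding gs_limit(3)[OF l] using gl by (intro mult_nonneg_nonneg Bochner_Integration.integral_nonneg) auto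
 have "(\<integral>\<^sup>+s. en (U l s) \<partial>\<nu>) = (\<integral>\<^sup>+s. (\<Sum>k. en (kill_lim {..0} (gs l s) k)) \<partial>\<nu>)"
  unfolding U_def using gl
  by (intro nn_integral_cong suminf_ennreal2[symmetric] gs_limit(2)[OF l] kn)
 also have "... = (\<Sum>k. \<integral>\<^sup>+s. en (kill_lim {..0} (gs l s) k) \<partial>\<nu>)"
  by (rule nn_integral_suminf) (auto simp: gs_limit(3)[OF l])
 also have "... = (\<Sum>k. en (g0/l*(lap {..0} l (Suc k)+measure (leave \<nu> {..0} k) UNIV)))"
 proof (intro suminf_cong)
  fix k
  have "(\<integral>\<^sup>+s. en (kill_lim {..0} (gs l s) k) \<partial>\<nu>)
    = (\<integral>\<^sup>+s. en (g0/l) * en (\<integral>z. exp (l * min 0 (z+s)) \<partial>p k) \<partial>\<nu>)"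
   unfolding gs_limit(3)[OF l] using gl by (intro nn_integral_cong ennreal_mult) (auto intro!: Bochner_Integration.integral_nonneg)
  also have "... = en (g0/l) * en (lap {..0} l (Suc k)+measure (leave \<nu> {..0} k) UNIV)"
   by (subst nn_integral_cmult) (auto simp: inner)
  finally show "(\<integral>\<^sup>+s. en (kill_lim {..0} (gs l s) k) \<partial>\<nu>) = en (g0/l*(lap {..0} l (Suc k)+measure (leave \<nu> {..0} k) UNIV))"
   using gl lap_nonneg by (subst ennreal_mult) (auto simp del: kill.simps)
 qed
 also have "... = en (U l 0)"
 proof -
  have s1: "summable (%k. lap {..0} l (Suc k))"
   using lap_summable[OF l side_neg] by (subst summable_Suc_iff)
  have s2: "summable (%k. measure (leave \<nu> {..0} k) UNIV)" using leave_sums by (rule sums_summable)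
  have l0: "lap {..0} l 0 = 1" by (simp add: lap_def integral_return)
  have "(\<Sum>k. g0/l*(lap {..0} l (Suc k)+measure (leave \<nu> {..0} k) UNIV))
    = g0/l*((\<Sum>k. lap {..0} l (Suc k))+(\<Sum>k. measure (leave \<nu> {..0} k) UNIV))"
   using suminf_mult[OF summable_add[OF s1 s2], of "g0/l"] suminf_add[OF s1 s2] by (simp only:)
  also have "(\<Sum>k. measure (leave \<nu> {..0} k) UNIV) = lap {..0} l 0" using leave_sums by (simp add: sums_iff l0)
  also have "(\<Sum>k. lap {..0} l (Suc k))+lap {..0} l 0 = (\<Sum>k. lap {..0} l k)"
   using suminf_split_head[OF lap_summable[OF l side_neg]] by simp
  finally have "(\<Sum>k. g0/l*(lap {..0} l (Suc k)+measure (leave \<nu> {..0} k) UNIV)) = U l 0"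
   by (simp add: U_0[OF l])
  moreover have sm: "summable (%k. g0/l*(lap {..0} l (Suc k)+measure (leave \<nu> {..0} k) UNIV))"
   using s1 s2 by (intro summable_mult summable_add)
  moreover have nn: "0<=g0/l*(lap {..0} l (Suc k)+measure (leave \<nu> {..0} k) UNIV)" for k
   using gl lap_nonneg by (intro mult_nonneg_nonneg add_nonneg_nonneg) auto
  ultimately show ?thesis using suminf_ennreal2[OF nn sm] by (simp only:)
 qed
 finally have eq: "(\<integral>\<^sup>+s. en (U l s) \<partial>\<nu>) = en (U l 0)" .
 show int: "integrable \<nu> (U l)"
  by (rule integrableI_nonneg) (auto simp: eq U_nonneg[OF l])
 show "(\<integral>s. U l s \<partial>\<nu>) = U l 0"
  using eq U_nonneg[OF l] by (subst (asm) nn_integral_eq_integral[OF int]) auto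
qed

lemma lap_limit: "l > 0 ==> (%n. lap {..0} l n/w n) ----> U l 0"
proof -
 assume l: "l > 0"
 have "lap {..0} l n = (\<integral>t. gs l 0 t \<partial>p n)" for n
  unfolding lap_def by (rule integral_cong_AE) (use AE_p[of n] in \<open>auto elim!: eventually_mono simp: gs_def\<close>)
 then show ?thesis using gs_limit(1)[OF l, of 0] by (simp add: U_def)
qed

lemma U_0_pos: "l > 0 ==> U l 0 > 0"
proof -
 assume l: "l > 0"
 have "lap {..0} l 0 = 1" by (simp add: lap_def integral_return)
 then have "(\<Sum>k. lap {..0} l k) > 0"
  using lap_nonneg by (intro suminf_pos2[OF lap_summable[OF l side_neg], of 0]) auto
 then show ?thesis using l g0_pos by (simp add: U_0)
qed

definition un :: "real => nat => real => real" where "un l n s = (\<integral>t. gs l s t \<partial>p n)"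

lemma un_facts:
 assumes l: "l > 0"
 shows "un l n \<in> bmeas borel" "0<=un l n s" "un l n s<=1" "un l n s<=exp (l * s) * lap {..0} l n"
  "(\<integral>\<^sup>+s. en (un l n s) \<partial>\<nu>) = en (lap {..0} l (Suc n))"
proof -
 interpret p: finite_measure "p n" by (rule finite_measure_kill) simp
 interpret pair_sigma_finite "p n" \<nu> ..
 have sp: "space (p n) = UNIV" using sets_eq_imp_space_eq[OF sets_kill[of "{..0}" n]] by simp
 show [measurable]: "un l n \<in> bmeas borel" unfolding un_def by measurable
 have int: "integrable (p n) (gs l s)" for s
  using gs_bounds[OF l] by (intro p.integrable_const_bound[of _ 1]) auto
 show "0<=un l n s" unfolding un_def using gs_bounds[OF l] by (intro Bochner_Integration.integral_nonneg) auto
 have iex: "integrable (p n) (ex l)" using l by (intro p.integrable_const_bound[of _ 1]) auto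
 have "un l n s<=(\<integral>t. exp (l * s) * ex l t \<partial>p n)"
  unfolding un_def using gs_bounds[OF l] int iex by (intro integral_mono) auto
 then show "un l n s<=exp (l * s) * lap {..0} l n" by (simp add: lap_def)
 have "(\<integral>\<^sup>+s. en (un l n s) \<partial>\<nu>) = (\<integral>\<^sup>+s. \<integral>\<^sup>+t. en (gs l s t) \<partial>p n \<partial>\<nu>)"
  unfolding un_def using gs_bounds[OF l] int by (intro nn_integral_cong nn_integral_eq_integral[symmetric]) auto
 also have "... = (\<integral>\<^sup>+t. \<integral>\<^sup>+s. en (gs l s t) \<partial>\<nu> \<partial>p n)"
  by (rule Fubini') measurable
 also have "... = act (p n) (act \<nu> (%x. indicator {..0} x * en (exp (l * x)))) 0"
  unfolding act_def
 proof (rule nn_integral_cong_AE, use AE_p[of n] in eventually_elim)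
  fix t :: real assume "t<=0"
  then show "(\<integral>\<^sup>+s. en (gs l s t) \<partial>\<nu>) = (\<integral>\<^sup>+y. indicator {..0} (0+t+y) * en (exp (l*(0+t+y))) \<partial>\<nu>)"
   by (intro nn_integral_cong) (auto simp: gs_def indicator_def)
 qed
 also have "... = act (p (Suc n)) (%x. en (exp (l * x))) 0" by (rule act_kill_Suc[symmetric]) auto
 also have "... = act (p (Suc n)) (%x. en (ex l x)) 0"
  by (rule act_AE_cong, use AE_p[of "Suc n"] in eventually_elim) (simp del: kill.simps)
 also have "... = en (lap {..0} l (Suc n))"
  unfolding lap_def by (subst act_ennreal[where B = 1]) (use l in \<open>auto simp del: kill.simps\<close>)
 finally show "(\<integral>\<^sup>+s. en (un l n s) \<partial>\<nu>) = en (lap {..0} l (Suc n))" .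
 have "measure (p n) UNIV<=1"
 proof -
  have "emeasure (p n) UNIV = (\<Sum>k\<in>{n}. act (p k) (act (q (n-k)) (%_. 1)) 0)" by (simp add: act_def sp measure_return)
  also have "... <= (\<Sum>k\<le>n. act (p k) (act (q (n-k)) (%_. 1)) 0)" by (intro sum_mono2) auto
  also have "... = act (nu n) (%_. 1) 0" by (rule nu_eq_pq[symmetric]) (auto simp: bdd_fun_def intro!: exI[of _ 1])
  also have "... = 1" using prob_space.emeasure_space_1[OF real_distribution.axioms(1)[OF nu_distribution]] by (simp add: act_one)
  finally show ?thesis by (simp add: p.emeasure_eq_measure)
 qed
 moreover have "un l n s<=(\<integral>t. 1 \<partial>p n)"
  unfolding un_def using gs_bounds[OF l] int by (intro integral_mono) auto
 ultimately show "un l n s<=1" by (simp add: sp)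
qed

lemma jump_tail:
 assumes l: "l > 0" and e: "e > 0"
 shows "\<exists>M\<ge>0. eventually (%n. (\<integral>s. indicator {M<..} s * un l n s \<partial>\<nu>)<=e * w n) sequentially"
proof -
 note m[measurable] = U_measurable[OF l] un_facts(1)[OF l]
 note UI = U_integral[OF l]
 have "(%M. \<integral>s. indicator {..real M} s * U l s \<partial>\<nu>) ----> (\<integral>s. U l s \<partial>\<nu>)"
 proof (rule integral_dominated_convergence[where w = "U l"])
  show "AE s in \<nu>. (%M. indicator {..real M} s * U l s) ----> U l s"
  proof (intro AE_I2 tendsto_eventually)
   fix s :: real
   show "eventually (%M. indicator {..real M} s * U l s = U l s) sequentially"
    by (intro eventually_sequentiallyI[of "nat \<lceil>s\<rceil>"]) (auto simp: indicator_def; linarith)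
  qed
  show "AE s in \<nu>. norm (indicator {..real M} s * U l s)<=U l s" for M
   using U_nonneg[OF l] by (auto simp: indicator_def)
 qed (use UI in auto)
 then have "eventually (%M. (\<integral>s. indicator {..real M} s * U l s \<partial>\<nu>) > U l 0-e) sequentially"
  using e unfolding UI(2) by (intro order_tendstoD) auto
 then obtain M where M: "(\<integral>s. indicator {..real M} s * U l s \<partial>\<nu>) > U l 0-e"
  by (auto simp: eventually_sequentially)
 obtain B where B: "B > 0" "!!n. lap {..0} l n<=B * w n" using lap_bound[OF side_neg l] by blast
 have L1: "(%n. \<integral>s. indicator {..real M} s*(un l n s/w n) \<partial>\<nu>) ----> (\<integral>s. indicator {..real M} s * U l s \<partial>\<nu>)"
 proof (rule integral_dominated_convergence[where w = "%_. exp (l * real M) * B"])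
  show "AE s in \<nu>. (%n. indicator {..real M} s*(un l n s/w n)) ----> indicator {..real M} s * U l s"
   unfolding un_def U_def by (intro AE_I2 tendsto_intros gs_limit(1)[OF l])
  show "AE s in \<nu>. norm (indicator {..real M} s*(un l n s/w n))<=exp (l * real M) * B" for n
  proof (intro AE_I2)
   fix s
   show "norm (indicator {..real M} s*(un l n s/w n))<=exp (l * real M) * B"
   proof (cases "s<=real M")
    case True
    have "un l n s<=exp (l * s) * lap {..0} l n" by (rule un_facts[OF l])
    also have "... <= exp (l * real M)*(B * w n)"
     using True l B lap_nonneg by (intro mult_mono) auto
    finally show ?thesis using True w_pos[of n] un_facts(2)[OF l, of n s] by (simp add: field_simps)
   qed (use B in simp)
  qed
 qed auto
 have L2: "(%n. lap {..0} l (Suc n)/w n) ----> U l 0"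
 proof -
  have "(%n. lap {..0} l (Suc n)/w (Suc n)*(w (Suc n)/w n)) ----> U l 0*1"
   by (intro tendsto_mult LIMSEQ_Suc[OF lap_limit[OF l]] w_Suc_ratio)
  then show ?thesis by simp
 qed
 have int: "integrable \<nu> (un l n)" for n
  using un_facts[OF l] by (intro integrable_const_bound[of _ 1]) auto
 have eq: "(\<integral>s. indicator {real M<..} s * un l n s \<partial>\<nu>)/w n
   = lap {..0} l (Suc n)/w n-(\<integral>s. indicator {..real M} s*(un l n s/w n) \<partial>\<nu>)" for n
 proof -
  have i: "integrable \<nu> (%s. indicator A s * un l n s)" if "A \<in> sets borel" for A
   using integrable_mult_indicator[OF _ int[of n], of A] that by simp
  have "(\<integral>s. un l n s \<partial>\<nu>) = (\<integral>s. indicator {real M<..} s * un l n s+indicator {..real M} s * un l n s \<partial>\<nu>)"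
   by (intro Bochner_Integration.integral_cong refl) (auto simp: indicator_def)
  also have "... = (\<integral>s. indicator {real M<..} s * un l n s \<partial>\<nu>)+(\<integral>s. indicator {..real M} s * un l n s \<partial>\<nu>)"
   by (intro Bochner_Integration.integral_add i) auto
  also have "(\<integral>s. un l n s \<partial>\<nu>) = lap {..0} l (Suc n)"
   using un_facts(5)[OF l, of n] un_facts(2)[OF l] lap_nonneg
   by (subst (asm) nn_integral_eq_integral[OF int]) (auto simp del: kill.simps)
  finally show ?thesis using w_pos[of n] by (simp add: field_simps)
 qed
 have "(%n. (\<integral>s. indicator {real M<..} s * un l n s \<partial>\<nu>)/w n) ----> U l 0-(\<integral>s. indicator {..real M} s * U l s \<partial>\<nu>)"
  unfolding eq by (intro tendsto_diff L1 L2)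
 then have "eventually (%n. (\<integral>s. indicator {real M<..} s * un l n s \<partial>\<nu>)/w n < e) sequentially"
  using M by (intro order_tendstoD) auto
 then have "eventually (%n. (\<integral>s. indicator {real M<..} s * un l n s \<partial>\<nu>)<=e * w n) sequentially"
  by eventually_elim (use w_pos in \<open>simp add: field_simps less_imp_le\<close>)
 then show ?thesis by (intro exI[of _ "real M"]) auto
qed

end

abbreviation E :: "real => real => ennreal" where "E l \<equiv> %t. en (exp (l * t))"

context walk
begin

lemma R_mono: "(!!t. t<=ka ==> f t<=g t) ==> R ka f x<=R ka g x"
 unfolding R_def by (rule act_mono) (auto split: split_indicator)

lemma R_pow_mono:
 assumes "!!t. t<=ka ==> f t<=g t" "x<=ka"
 shows "(R ka^^n) f x<=(R ka^^n) g x"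
 using assms(2) by (induction n arbitrary: x) (auto intro!: R_mono assms(1))

lemma R_pow_cong:
 assumes "!!t. t<=ka ==> f t = g t" "x<=ka"
 shows "(R ka^^n) f x = (R ka^^n) g x"
 using assms by (intro antisym R_pow_mono) auto

lemma R_add:
 assumes [measurable]: "f \<in> bmeas borel" "g \<in> bmeas borel"
 shows "R ka (%t. f t+g t) x = R ka f x+R ka g x"
 unfolding R_def by (subst act_add[symmetric]) (auto simp: distrib_left)

lemma R_pow_add:
 assumes [measurable]: "f \<in> bmeas borel" "g \<in> bmeas borel"
 shows "(R ka^^n) (%t. f t+g t) x = (R ka^^n) f x+(R ka^^n) g x"
proof (induction n arbitrary: x)
 case (Suc n)
 have "(R ka^^n) (%t. f t+g t) = (%x. (R ka^^n) f x+(R ka^^n) g x)" using Suc by auto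
 then show ?case by (simp add: R_add)
qed simp

lemma R_cmult:
 assumes [measurable]: "f \<in> bmeas borel"
 shows "R ka (%t. b * f t) x = b * R ka f x"
 unfolding R_def by (subst act_cmult[symmetric]) (auto simp: mult.left_commute)

lemma R_pow_cmult:
 assumes [measurable]: "f \<in> bmeas borel"
 shows "(R ka^^n) (%t. b * f t) x = b*(R ka^^n) f x"
proof (induction n arbitrary: x)
 case (Suc n)
 have "(R ka^^n) (%t. b * f t) = (%x. b*(R ka^^n) f x)" using Suc by auto
 then show ?case by (simp add: R_cmult)
qed simp

lemma R_shift: "R ka f x = R 0 (%y. f (y+ka)) (x-ka)"
 unfolding R_def act_def by (intro nn_integral_cong) (auto simp: indicator_def algebra_simps)

lemma R_pow_shift: "(R ka^^n) f x = (R 0^^n) (%y. f (y+ka)) (x-ka)"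
proof (induction n arbitrary: x)
 case (Suc n)
 show ?case using R_shift[of ka "(R ka^^n) f" x] by (simp add: Suc)
qed simp

end

context attracted
begin

lemma R_exp_bound:
 assumes l: "l > 0" and e: "e > 0"
 shows "\<exists>C>0. \<forall>n ka t. t<=ka --> (R ka^^n) (E l) t<=en (C * exp (l*ka) * exp (e*(ka - t)) * w n)"
proof -
 obtain B1 where B1: "B1 > 0" "!!n. lap {..0} l n<=B1 * w n" using lap_bound[OF side_neg l] by blast
 obtain B2 where B2: "B2 > 0" "!!n. lap {0<..} e n<=B2 * w n" using lap_bound[OF side_pos e] by blast
 define W where "W = (\<Sum>k. w k)"
 have W: "W>=0" unfolding W_def using summable_w w_pos by (intro suminf_nonneg) (auto simp: less_imp_le)
 define C where "C = B1 * B2*(4 * Dbl * W)+1"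
 have C: "C > 0" using B1 B2 W Dbl(1) by (simp add: C_def add_nonneg_pos)
 let ?f = "%t. en (exp (l * min 0 t))"
 have leE: "exp (l * min 0 y)<=1" for y using l by (simp add: mult_nonneg_nonpos)
 have f: "bdd_fun ?f" by (rule bdd_fun_ennreal[where B = 1]) (use leE in auto)
 have main: "(R 0^^n) (E l) y<=en (C * exp (e*(- y)) * w n)" if y: "y<=0" for n y
 proof -
  have "(R 0^^n) (E l) y = (R 0^^n) ?f y" using y by (intro R_pow_cong) auto
  also have "... = (\<Sum>k\<le>n. act (q k) (%v. indicator {..0} v * act (p (n-k)) ?f v) y)" by (rule R_pow_eq[OF f y])
  also have "... <= (\<Sum>k\<le>n. en (B1 * w (n-k)) * en (exp (e*(- y))*(B2 * w k)))"
  proof (intro sum_mono)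
   fix k
   have 1: "indicator {..0} v * act (p j) ?f v<=en (B1 * w j) * indicator {..0} v" for v j
   proof (cases "v<=0")
    case True
    have "act (p j) ?f v<=act (p j) (%x. en (ex l x)) 0"
     unfolding act_def
    proof (rule nn_integral_mono_AE, use AE_p[of j] in eventually_elim)
     fix x :: real assume "x<=0"
     then show "en (exp (l * min 0 (v+x)))<=en (ex l (0+x))"
      using True l by (intro ennreal_leI) auto
    qed
    also have "... = en (lap {..0} l j)"
     unfolding lap_def by (subst act_ennreal[where B = 1]) (use l in auto)
    also have "... <= en (B1 * w j)" by (intro ennreal_leI B1)
    finally show ?thesis using True by simp
   qed simp
   have "act (q k) (%v. indicator {..0} v * act (p (n-k)) ?f v) y<=act (q k) (%v. en (B1 * w (n-k)) * indicator {..0} v) y"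
    by (intro act_mono 1)
   also have "... = en (B1 * w (n-k)) * act (q k) (indicator {..0}) y" by (rule act_cmult) auto
   also have "act (q k) (indicator {..0}) y<=en (exp (e*(- y))*(B2 * w k))"
   proof -
    have "act (q k) (indicator {..0}) y<=act (q k) (%z. en (exp (e*(- y))) * en (ex e z)) 0"
     unfolding act_def
    proof (rule nn_integral_mono_AE, use AE_q[of k] in eventually_elim)
     fix z :: real assume z: "0<=z"
     have "1<=exp (e*(- y)-e * z)" if "y+z<=0"
      using e that mult_left_mono[of "y+z" 0 e] by (simp add: algebra_simps)
     then show "indicator {..0} (y+z)<=en (exp (e*(- y))) * en (ex e (0+z))"
      using z by (auto simp: indicator_def ennreal_mult[symmetric] exp_add[symmetric] algebra_simps ennreal_1[symmetric] simp del: ennreal_1 intro!: ennreal_leI)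
    qed
    also have "... = en (exp (e*(- y))) * act (q k) (%z. en (ex e z)) 0" by (rule act_cmult) auto
    also have "act (q k) (%z. en (ex e z)) 0 = en (lap {0<..} e k)"
     unfolding lap_def by (subst act_ennreal[where B = 1]) (use e in auto)
    also have "en (exp (e*(- y))) * en (lap {0<..} e k)<=en (exp (e*(- y))) * en (B2 * w k)"
     by (intro mult_left_mono ennreal_leI B2) auto
    finally show ?thesis by (subst ennreal_mult) (use B2 w_pos in \<open>auto simp: less_imp_le\<close>)
   qed
   finally show "act (q k) (%v. indicator {..0} v * act (p (n-k)) ?f v) y<=en (B1 * w (n-k)) * en (exp (e*(- y))*(B2 * w k))"
    by (simp add: mult_left_mono)
  qed
  also have "... = en (\<Sum>k\<le>n. B1 * w (n-k)*(exp (e*(- y))*(B2 * w k)))"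
   using B1 B2 w_pos by (simp add: ennreal_mult[symmetric] sum_ennreal less_imp_le)
  also have "... <= en (C * exp (e*(- y)) * w n)"
  proof (intro ennreal_leI)
   have "(\<Sum>k\<le>n. B1 * w (n-k)*(exp (e*(- y))*(B2 * w k))) = (B1 * B2 * exp (e*(- y)))*(\<Sum>k=0..n-0. w k * w (n-k))"
    unfolding sum_distrib_left by (intro sum.cong) auto
   also have "... <= (B1 * B2 * exp (e*(- y)))*(4 * Dbl * w n*(\<Sum>k. w (k+0)))"
    using B1 B2 by (intro mult_left_mono w_conv_sum) auto
   also have "... = (B1 * B2*(4 * Dbl * W)) * exp (e*(- y)) * w n" by (simp add: W_def)
   also have "... <= C * exp (e*(- y)) * w n" using w_pos[of n] by (intro mult_right_mono) (auto simp: C_def)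
   finally show "(\<Sum>k\<le>n. B1 * w (n-k)*(exp (e*(- y))*(B2 * w k)))<=C * exp (e*(- y)) * w n" .
  qed
  finally show ?thesis .
 qed
 have "(R ka^^n) (E l) t<=en (C * exp (l*ka) * exp (e*(ka - t)) * w n)" if "t<=ka" for n ka t
 proof -
  have "(%y. E l (y+ka)) = (%y. en (exp (l*ka)) * E l y)"
   by (simp add: ennreal_mult[symmetric] exp_add[symmetric] algebra_simps)
  then have "(R ka^^n) (E l) t = en (exp (l*ka))*(R 0^^n) (E l) (t-ka)"
   by (simp add: R_pow_shift[where ka = ka] R_pow_cmult)
  also have "... <= en (exp (l*ka)) * en (C * exp (e*(- (t-ka))) * w n)"
   using that by (intro mult_left_mono main) auto
  also have "... = en (C * exp (l*ka) * exp (e*(ka - t)) * w n)"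
   using C w_pos[of n] by (simp add: ennreal_mult[symmetric] less_imp_le ac_simps)
  finally show ?thesis .
 qed
 then show ?thesis using C by blast
qed

lemma w_shift_ratio': "(%n. w (n-k)/w n) ----> 1"
proof (rule LIMSEQ_offset[of _ k])
 have "(%n. inverse (w (n+k)/w n)) ----> inverse 1" by (intro tendsto_inverse w_shift_ratio) auto
 then show "(%n. w (n+k-k)/w (n+k)) ----> 1" by simp
qed

lemma R_limit:
 fixes g :: "real => real"
 assumes l: "l > 0" and cont: "!!t. isCont g t" and g: "!!t. 0<=g t" "!!t. g t<=C * exp (l * t)" and y: "y<=0"
 shows "\<exists>L\<ge>0. (%n. en (1/w n)*(R 0^^n) (%t. en (g t)) y) ----> ennreal L"
proof -
 have C: "C>=0" using g(1)[of 0] g(2)[of 0] by simp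
 define g1 where "g1 t = g (min t 0)" for t
 have contg1: "isCont g1 t" for t
  unfolding g1_def[abs_def] by (rule isCont_o2[OF _ cont]) (intro continuous_intros)
 have [measurable]: "g1 \<in> bmeas borel"
  using contg1 by (intro borel_measurable_continuous_onI continuous_at_imp_continuous_on ballI)
 have g1: "0<=g1 t" "g1 t<=C" for t
 proof -
  show "0<=g1 t" using g by (simp add: g1_def)
  have "g1 t<=C * exp (l * min t 0)" by (simp add: g1_def g)
  also have "... <= C*1" using C l by (intro mult_left_mono) (auto simp: mult_nonneg_nonpos)
  finally show "g1 t<=C" by simp
 qed
 have g1e: "g1 (v+x)<=C * ex l x" if "v<=0" "x<=0" for v x
 proof -
  have "g1 (v+x)<=C * exp (l*(v+x))" using that g(2)[of "v+x"] by (simp add: g1_def)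
  also have "... <= C * ex l x" using C l that by (intro mult_left_mono) auto
  finally show ?thesis .
 qed
 let ?f = "%t. en (g1 t)"
 have f: "bdd_fun ?f" by (rule bdd_fun_ennreal[where B = C]) (use g1 in auto)
 interpret p: finite_measure "p n" for n by (rule finite_measure_kill) simp
 interpret q: finite_measure "q n" for n by (rule finite_measure_kill) simp
 obtain B1 where B1: "B1 > 0" "!!n. lap {..0} l n<=B1 * w n" using lap_bound[OF side_neg l] by blast
 obtain B2 where B2: "B2 > 0" "!!n. lap {0<..} l n<=B2 * w n" using lap_bound[OF side_pos l] by blast
 define H where "H i v = (\<integral>x. g1 (v+x) \<partial>p i)" for i v
 have Hact: "act (p i) ?f v = en (H i v)" for i v
  unfolding H_def by (rule act_ennreal[where B = C]) (use g1 in auto)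
 have Hint: "integrable (p i) (%x. g1 (v+x))" for i v
  by (rule act_ennreal(2)[where B = C]) (use g1 in auto)
 have H0: "0<=H i v" for i v unfolding H_def using g1 by (intro Bochner_Integration.integral_nonneg) auto
 have iex: "integrable (p i) (ex l)" for i using l by (intro p.integrable_const_bound[of _ 1]) auto
 have H1: "H i v<=C * lap {..0} l i" if "v<=0" for i v
 proof -
  have "H i v<=(\<integral>x. C * ex l x \<partial>p i)" unfolding H_def
  proof (intro integral_mono_AE Hint)
   show "AE x in p i. g1 (v+x)<=C * ex l x"
    using AE_p[of i] by eventually_elim (use g1e[OF that] in simp)
  qed (use iex in simp)
  then show ?thesis by (simp add: lap_def)
 qed
 have Hw: "H i v<=C * B1 * w i" if "v<=0" for i v
  using H1[OF that, of i] mult_left_mono[OF B1(2)[of i] C] by (simp add: ac_simps)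
 have [measurable]: "H i \<in> bmeas borel" for i unfolding H_def by measurable
 have Hcont: "isCont (H i) v" for i v
  unfolding continuous_at_sequentially comp_def H_def
 proof (intro allI impI)
  fix x assume x: "x ----> v"
  show "(%n. \<integral>z. g1 (x n+z) \<partial>p i) ----> (\<integral>z. g1 (v+z) \<partial>p i)"
  proof (rule integral_dominated_convergence[where w = "%_. C"])
   show "AE z in p i. (%n. g1 (x n+z)) ----> g1 (v+z)"
    using x by (intro AE_I2 isCont_tendsto_compose[OF contg1] tendsto_intros)
  qed (use g1 in auto)
 qed
 define Uf where "Uf k i = (\<integral>z. indicator {..0} (y+z) * H i (y+z) \<partial>q k)" for k i
 have bnd: "indicator {..0} v * H i v<=C * B1 * w i" for v i
  using Hw C B1 w_pos[of i] by (auto simp: indicator_def)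
 have Uint: "integrable (q k) (%z. indicator {..0} (y+z) * H i (y+z))" for k i
  using H0 bnd by (intro q.integrable_const_bound[of _ "C * B1 * w i"]) auto
 have Uact: "act (q k) (%v. indicator {..0} v * act (p i) ?f v) y = en (Uf k i)" for k i
 proof -
  have "(%v. indicator {..0} v * act (p i) ?f v) = (%v. en (indicator {..0} v * H i v))"
   unfolding Hact using H0 by (auto simp: indicator_def)
  then show ?thesis unfolding Uf_def
   by (simp only:) (rule act_ennreal(1)[where B = "C * B1 * w i"], use H0 bnd in auto)
 qed
 have U0: "0<=Uf k i" for k i unfolding Uf_def using H0 by (intro Bochner_Integration.integral_nonneg) auto
 have iexq: "integrable (q i) (ex l)" for i using l by (intro q.integrable_const_bound[of _ 1]) auto
 have Ub: "\<bar>Uf k i\<bar> <= (C * B1 * exp (l*(- y)) * B2) * w k * w i" for k i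
 proof -
  have "Uf k i<=(\<integral>z. (C * B1 * w i)*(exp (l*(- y)) * ex l z) \<partial>q k)" unfolding Uf_def
  proof (intro integral_mono_AE Uint)
   show "AE z in q k. indicator {..0} (y+z) * H i (y+z)<=(C * B1 * w i)*(exp (l*(- y)) * ex l z)"
    using AE_q[of k]
   proof eventually_elim
    fix z :: real assume z: "0<=z"
    show "indicator {..0} (y+z) * H i (y+z)<=(C * B1 * w i)*(exp (l*(- y)) * ex l z)"
    proof (cases "y+z<=0")
     case True
     have "1<=exp (l*(- y)-l * z)"
      using l True mult_left_mono[of "y+z" 0 l] by (simp add: algebra_simps)
     then have "1<=exp (l*(- y)) * ex l z" using z by (simp add: exp_add[symmetric])
     then have "(C * B1 * w i)*1<=(C * B1 * w i)*(exp (l*(- y)) * ex l z)"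
      using C B1 w_pos[of i] by (intro mult_left_mono) auto
     then show ?thesis using Hw[OF True, of i] True by simp
    qed (use C B1 w_pos[of i] in auto)
   qed
  qed (use iexq in auto)
  also have "... = (C * B1 * w i)*(exp (l*(- y)) * lap {0<..} l k)" by (simp add: lap_def)
  also have "... <= (C * B1 * w i)*(exp (l*(- y))*(B2 * w k))"
   using C B1 w_pos[of i] by (intro mult_left_mono B2) auto
  finally show ?thesis using U0 by (simp add: ac_simps)
 qed
 define Lm where "Lm v = (if v<=0 then lim (%m. H m v/w m) else 0)" for v
 have [measurable]: "Lm \<in> bmeas borel" unfolding Lm_def by measurable
 have Hl: "(%m. H m v/w m) ----> Lm v" if v: "v<=0" for v
 proof -
  let ?g = "%x. indicator {..0} x * g1 (v+x)"
  have "(%n. (\<integral>x. ?g x \<partial>p n)/w n) ----> (\<Sum>k. kill_lim {..0} ?g k)"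
  proof (rule kill_limit(1)[OF side_neg l, where C = C and D = "{0}"])
   show "0<=?g x" for x using g1 by (auto simp: indicator_def)
   show "?g x<=C * ex l x" for x using g1e[OF v, of x] C by (auto simp: indicator_def)
   fix x :: real assume "x \<notin> {0}"
   then have "isCont (indicator {..0} :: real => real) x" by (simp add: isCont_indicator)
   moreover have "isCont (%x. g1 (v+x)) x" by (rule isCont_o2[OF _ contg1]) (intro continuous_intros)
   ultimately show "isCont ?g x" by (rule continuous_mult)
  qed auto
  moreover have "(\<integral>x. ?g x \<partial>p n) = H n v" for n
   unfolding H_def by (rule integral_cong_AE) (use AE_p[of n] in \<open>auto elim!: eventually_mono\<close>)
  ultimately have "convergent (%m. H m v/w m)" by (auto simp: convergent_def)
  then show ?thesis using v by (simp add: Lm_def convergent_LIMSEQ_iff)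
 qed
 have "(%n. (\<Sum>k\<le>n. Uf k (n-k))/w n) ----> (\<Sum>k. \<integral>z. indicator {..0} (y+z) * Lm (y+z) \<partial>q k)
   + (\<Sum>i. \<Sum>k. kill_lim {0<..} (%z. if 0<=z \<and> z <= - y then H i (y+z) else 0) k)"
 proof (rule conv_limit[OF Ub])
  show "0<=C * B1 * exp (l*(- y)) * B2" using C B1 B2 by simp
  fix k
  have "(%m. \<integral>z. indicator {..0} (y+z)*(H m (y+z)/w m) \<partial>q k) ----> (\<integral>z. indicator {..0} (y+z) * Lm (y+z) \<partial>q k)"
  proof (rule integral_dominated_convergence[where w = "%_. C * B1"])
   show "AE z in q k. (%m. indicator {..0} (y+z)*(H m (y+z)/w m)) ----> indicator {..0} (y+z) * Lm (y+z)"
    by (intro AE_I2) (auto simp: indicator_def intro: Hl)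
   show "AE z in q k. norm (indicator {..0} (y+z)*(H m (y+z)/w m))<=C * B1" for m
    using Hw H0 w_pos[of m] C B1 by (intro AE_I2) (auto simp: indicator_def field_simps)
  qed auto
  then have "(%m. Uf k m/w m) ----> (\<integral>z. indicator {..0} (y+z) * Lm (y+z) \<partial>q k)"
   by (simp add: Uf_def)
  then have "(%n. Uf k (n-k)/w (n-k)) ----> (\<integral>z. indicator {..0} (y+z) * Lm (y+z) \<partial>q k)"
   by - (rule LIMSEQ_offset[of _ k], simp)
  from tendsto_mult[OF this w_shift_ratio'[of k]]
  show "(%n. Uf k (n-k)/w n) ----> (\<integral>z. indicator {..0} (y+z) * Lm (y+z) \<partial>q k)" by simp
 next
  fix i
  let ?g = "%z. if 0<=z \<and> z <= - y then H i (y+z) else 0"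
  have "(%n. (\<integral>z. ?g z \<partial>q n)/w n) ----> (\<Sum>k. kill_lim {0<..} ?g k)"
  proof (rule kill_limit(1)[OF side_pos l, where C = "(C * B1 * w i) * exp (l*(- y))" and D = "{0, - y}"])
   show "0<=?g z" for z using H0 by auto
   show "?g z<=(C * B1 * w i) * exp (l*(- y)) * ex l z" for z
   proof (cases "0<=z \<and> z <= - y")
    case True
    have "1<=exp (l*(- y)-l * z)" using l True mult_left_mono[of "y+z" 0 l] by (simp add: algebra_simps)
    then have "1<=exp (l*(- y)) * ex l z" using True by (simp add: exp_add[symmetric])
    then have "(C * B1 * w i)*1<=(C * B1 * w i)*(exp (l*(- y)) * ex l z)"
     using C B1 w_pos[of i] by (intro mult_left_mono) auto
    then show ?thesis using Hw[of "y+z" i] True by (simp add: mult.assoc)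
   qed (use C B1 w_pos[of i] in auto)
   fix z :: real assume z: "z \<notin> {0, - y}"
   have eq: "?g = (%z. (indicator {0..} z * indicator {..- y} z) * H i (y+z))" by (auto simp: indicator_def)
   have "isCont (indicator {0..} :: real => real) z" "isCont (indicator {..- y} :: real => real) z"
    using z by (auto simp: isCont_indicator)
   moreover have "isCont (%z. H i (y+z)) z" by (rule isCont_o2[OF _ Hcont]) (intro continuous_intros)
   ultimately show "isCont ?g z" unfolding eq by (intro continuous_mult)
  qed auto
  moreover have "(\<integral>z. ?g z \<partial>q n) = Uf n i" for n
   unfolding Uf_def by (rule integral_cong_AE) (use AE_q[of n] in \<open>auto elim!: eventually_mono simp: indicator_def\<close>)
  ultimately have "(%m. Uf m i/w m) ----> (\<Sum>k. kill_lim {0<..} ?g k)" by simp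
  then have "(%n. Uf (n-i) i/w (n-i)) ----> (\<Sum>k. kill_lim {0<..} ?g k)"
   by - (rule LIMSEQ_offset[of _ i], simp)
  from tendsto_mult[OF this w_shift_ratio'[of i]]
  show "(%n. Uf (n-i) i/w n) ----> (\<Sum>k. kill_lim {0<..} ?g k)" by simp
 qed
 then obtain L where L: "(%n. (\<Sum>k\<le>n. Uf k (n-k))/w n) ----> L" by blast
 have "L>=0"
  by (rule LIMSEQ_le_const[OF L]) (auto intro!: divide_nonneg_pos sum_nonneg U0 w_pos)
 moreover have "en (1/w n)*(R 0^^n) (%t. en (g t)) y = en ((\<Sum>k\<le>n. Uf k (n-k))/w n)" for n
 proof -
  have "(R 0^^n) (%t. en (g t)) y = (R 0^^n) ?f y" using y by (intro R_pow_cong) (auto simp: g1_def)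
  also have "... = en (\<Sum>k\<le>n. Uf k (n-k))"
   unfolding R_pow_eq[OF f y] Uact using U0 by simp
  finally show ?thesis using w_pos[of n] U0 by (simp add: ennreal_mult[symmetric] sum_nonneg less_imp_le)
 qed
 ultimately show ?thesis using L by (intro exI[of _ L]) (auto intro: tendsto_ennrealI)
qed

definition T :: "real => real => real => real => ennreal" where
 "T l M ka t = (\<integral>\<^sup>+s. indicator {M<..} s*(indicator {..ka} (t+s) * E l (t+s)) \<partial>\<nu>)"

lemma T_measurable [measurable]: "T l M ka \<in> bmeas borel"
 unfolding T_def by measurable

lemma p_pos: "\<exists>i. act (p i) (%t. indicator {..y} t * E 1 t) 0 > 0"
proof -
 let ?g = "%t. indicator {..min y 0} t * exp t"
 interpret p: finite_measure "p n" for n by (rule finite_measure_kill) simp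
 have L: "(%n. (\<integral>x. ?g x \<partial>p n)/w n) ----> (\<Sum>k. kill_lim {..0} ?g k)" "summable (kill_lim {..0} ?g)"
 proof -
  have a: "isCont ?g x" if "x \<notin> {min y 0}" for x
  proof -
   have "isCont (indicator {..min y 0} :: real => real) x" using that by (auto simp: isCont_indicator)
   then show ?thesis by (intro continuous_intros)
  qed
  show "(%n. (\<integral>x. ?g x \<partial>p n)/w n) ----> (\<Sum>k. kill_lim {..0} ?g k)"
   by (rule kill_limit(1)[OF side_neg zero_less_one, where C = 1 and D = "{min y 0}"]) (use a in \<open>auto simp: indicator_def\<close>)
  show "summable (kill_lim {..0} ?g)"
   by (rule kill_limit(2)[OF side_neg zero_less_one, where C = 1 and D = "{min y 0}"]) (use a in \<open>auto simp: indicator_def\<close>)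
 qed
 have "kill_lim {..0} ?g 0 = g0*(\<integral>x. indicator {..0} x*?g (0+x) \<partial>lborel)"
  by (simp add: kill_lim_def integral_return)
 also have "(\<integral>x. indicator {..0} x*?g (0+x) \<partial>lborel) = (\<integral>x. indicator {..min y 0} x * exp (1*(x+0)) \<partial>lborel)"
  by (intro Bochner_Integration.integral_cong) (auto simp: indicator_def)
 also have "... = exp (1*(min y 0+0))/1" by (rule exp_integral) simp
 finally have "kill_lim {..0} ?g 0 > 0" using g0_pos by simp
 moreover have "0<=kill_lim {..0} ?g k" for k
  unfolding kill_lim_def using g0_pos
  by (intro Bochner_Integration.integral_nonneg mult_nonneg_nonneg) (auto simp: indicator_def)
 ultimately have "(\<Sum>k. kill_lim {..0} ?g k) > 0" by (intro suminf_pos2[OF L(2), of 0])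
 with L(1) have "eventually (%n. 0 < (\<integral>x. ?g x \<partial>p n)/w n) sequentially" by (rule order_tendstoD)
 then obtain i where "0 < (\<integral>x. ?g x \<partial>p i)/w i" by (auto simp: eventually_sequentially)
 then have pos: "0 < (\<integral>x. ?g x \<partial>p i)" using w_pos[of i] by (simp add: zero_less_divide_iff)
 have "en (\<integral>x. ?g x \<partial>p i) = act (p i) (%t. en (?g t)) 0"
  by (subst act_ennreal[where B = 1]) (auto simp: indicator_def)
 also have "... <= act (p i) (%t. indicator {..y} t * E 1 t) 0"
  by (intro act_mono) (auto simp: indicator_def)
 finally have "en (\<integral>x. ?g x \<partial>p i)<=act (p i) (%t. indicator {..y} t * E 1 t) 0" .
 moreover have "0 < en (\<integral>x. ?g x \<partial>p i)" using pos by simp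
 ultimately show ?thesis using less_le_trans by blast
qed

lemma jump_tail_R:
 assumes l: "l > 0" and e: "e > 0" and t0: "t0<=ka"
 shows "\<exists>M\<ge>0. eventually (%n. (R ka^^n) (T l M ka) t0<=en (e * w n)) sequentially"
proof -
 define y where "y = t0-ka"
 have y: "y<=0" using t0 by (simp add: y_def)
 obtain i where i: "act (p i) (%t. indicator {..y} t * E 1 t) 0 > 0" using p_pos by blast
 define K where "K = act (p i) (%t. indicator {..y} t * en (exp (- l*(y-t)))) 0"
 have Kpos: "K > 0"
 proof (rule ccontr)
  have sp: "sets (p i) = sets borel" by simp
  assume "\<not> K > 0"
  then have "K = 0" by simp
  then have "AE t in p i. indicator {..y} (0+t) * en (exp (- l*(y-(0+t)))) = 0"
   unfolding K_def act_def by (subst (asm) nn_integral_0_iff_AE) auto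
  then have "act (p i) (%t. indicator {..y} t * E 1 t) 0 = 0"
   by (intro act_AE_0) (auto elim!: eventually_mono simp: indicator_def split: if_splits)
  then show False using i by simp
 qed
 have Kfin: "K < \<top>"
 proof -
  have "bdd_fun (%t. indicator {..y} t * en (exp (- l*(y-t))))"
   unfolding bdd_fun_def using l by (auto intro!: exI[of _ 1] simp: indicator_def)
  then show ?thesis unfolding K_def by (intro bdd_fun_finite bdd_fun_act) auto
 qed
 define k where "k = enn2real K"
 have k: "k > 0" "K = ennreal k" using Kpos Kfin by (auto simp: k_def enn2real_positive_iff)
 define e' where "e' = e * k/exp (l*ka)"
 have e': "e' > 0" using e k by (simp add: e'_def)
 obtain M where M: "M>=0" "eventually (%n. (\<integral>s. indicator {M<..} s * un l n s \<partial>\<nu>)<=e' * w n) sequentially"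
  using jump_tail[OF l e'] by blast
 have base: "(R 0^^n) (T l M 0) 0 = en (\<integral>s. indicator {M<..} s * un l n s \<partial>\<nu>)" for n
 proof -
  interpret p: finite_measure "p n" by (rule finite_measure_kill) simp
  interpret pair_sigma_finite "p n" \<nu> ..
  note [measurable] = un_facts(1)[OF l]
  have int: "integrable (p n) (gs l s)" for s
   using gs_bounds[OF l] by (intro p.integrable_const_bound[of _ 1]) auto
  have "(R 0^^n) (T l M 0) 0 = act (p n) (T l M 0) 0" by (rule act_p_eq_R_pow[symmetric]) simp
  also have "... = (\<integral>\<^sup>+t. \<integral>\<^sup>+s. indicator {M<..} s * en (gs l s t) \<partial>\<nu> \<partial>p n)"
   unfolding act_def T_def
  proof (rule nn_integral_cong_AE, use AE_p[of n] in eventually_elim)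
   fix t :: real assume "t<=0"
   then show "(\<integral>\<^sup>+s. indicator {M<..} s*(indicator {..0} (0+t+s) * E l (0+t+s)) \<partial>\<nu>)
     = (\<integral>\<^sup>+s. indicator {M<..} s * en (gs l s t) \<partial>\<nu>)"
    by (intro nn_integral_cong) (auto simp: gs_def indicator_def)
  qed
  also have "... = (\<integral>\<^sup>+s. \<integral>\<^sup>+t. indicator {M<..} s * en (gs l s t) \<partial>p n \<partial>\<nu>)"
   by (rule Fubini'[symmetric]) measurable
  also have "... = (\<integral>\<^sup>+s. en (indicator {M<..} s * un l n s) \<partial>\<nu>)"
  proof (intro nn_integral_cong)
   fix s
   have "(\<integral>\<^sup>+t. indicator {M<..} s * en (gs l s t) \<partial>p n) = indicator {M<..} s*(\<integral>\<^sup>+t. en (gs l s t) \<partial>p n)"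
    by (rule nn_integral_cmult) auto
   also have "(\<integral>\<^sup>+t. en (gs l s t) \<partial>p n) = en (un l n s)"
    unfolding un_def using gs_bounds[OF l] int by (intro nn_integral_eq_integral) auto
   finally show "(\<integral>\<^sup>+t. indicator {M<..} s * en (gs l s t) \<partial>p n) = en (indicator {M<..} s * un l n s)"
    by (auto simp: indicator_def)
  qed
  also have "... = en (\<integral>s. indicator {M<..} s * un l n s \<partial>\<nu>)"
   using un_facts(2,3)[OF l]
   by (intro nn_integral_eq_integral integrable_const_bound[of _ 1]) (auto simp: indicator_def)
  finally show ?thesis .
 qed
 have scale: "(R 0^^n) (T l M 0) t<=en (exp (l * d))*(R 0^^n) (T l M 0) (t-d)" if "d>=0" for n t d
 proof (induction n arbitrary: t)
  case 0
  have "T l M 0 t<=(\<integral>\<^sup>+s. en (exp (l * d))*(indicator {M<..} s*(indicator {..0} (t-d+s) * E l (t-d+s))) \<partial>\<nu>)"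
   unfolding T_def
  proof (intro nn_integral_mono)
   fix s
   have "E l (t+s) = en (exp (l * d)) * E l (t-d+s)"
    by (simp add: ennreal_mult[symmetric] exp_add[symmetric] algebra_simps)
   then show "indicator {M<..} s*(indicator {..0} (t+s) * E l (t+s))
    <= en (exp (l * d))*(indicator {M<..} s*(indicator {..0} (t-d+s) * E l (t-d+s)))"
    using that by (auto simp: indicator_def)
  qed
  also have "... = en (exp (l * d)) * T l M 0 (t-d)" unfolding T_def by (rule nn_integral_cmult) measurable
  finally show ?case by simp
 next
  case (Suc n)
  have "(R 0^^Suc n) (T l M 0) t = (\<integral>\<^sup>+s. indicator {..0} (t+s)*(R 0^^n) (T l M 0) (t+s) \<partial>\<nu>)"
   by (simp add: R_def act_def)
  also have "... <= (\<integral>\<^sup>+s. en (exp (l * d))*(indicator {..0} (t-d+s)*(R 0^^n) (T l M 0) (t-d+s)) \<partial>\<nu>)"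
  proof (intro nn_integral_mono)
   fix s
   show "indicator {..0} (t+s)*(R 0^^n) (T l M 0) (t+s)
    <= en (exp (l * d))*(indicator {..0} (t-d+s)*(R 0^^n) (T l M 0) (t-d+s))"
    using Suc.IH[of "t+s"] that by (auto simp: indicator_def algebra_simps)
  qed
  also have "... = en (exp (l * d))*(R 0^^Suc n) (T l M 0) (t-d)"
   by (subst nn_integral_cmult) (auto simp: R_def act_def)
  finally show ?case .
 qed
 have trans: "K*(R 0^^n) (T l M 0) y<=(R 0^^(i+n)) (T l M 0) 0" for n
 proof -
  have "K*(R 0^^n) (T l M 0) y = act (p i) (%t. (R 0^^n) (T l M 0) y*(indicator {..y} t * en (exp (- l*(y-t))))) 0"
   unfolding K_def by (subst act_cmult) (auto simp: mult.commute)
  also have "... <= act (p i) ((R 0^^n) (T l M 0)) 0"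
  proof (intro act_mono)
   fix t
   show "(R 0^^n) (T l M 0) y*(indicator {..y} t * en (exp (- l*(y-t))))<=(R 0^^n) (T l M 0) t"
   proof (cases "t<=y")
    case True
    have "(R 0^^n) (T l M 0) y * en (exp (- l*(y-t)))
      <= (en (exp (l*(y-t)))*(R 0^^n) (T l M 0) (y-(y-t))) * en (exp (- l*(y-t)))"
     using True by (intro mult_right_mono scale) auto
    also have "... = (en (exp (l*(y-t))) * en (exp (- l*(y-t))))*(R 0^^n) (T l M 0) t"
     by (simp add: ac_simps)
    also have "en (exp (l*(y-t))) * en (exp (- l*(y-t))) = 1"
     by (simp add: ennreal_mult[symmetric] exp_add[symmetric])
    finally show ?thesis using True by simp
   qed simp
  qed
  also have "... = (R 0^^(i+n)) (T l M 0) 0"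
   by (subst act_p_eq_R_pow) (auto simp: funpow_add)
  finally show ?thesis .
 qed
 have shift: "(R ka^^n) (T l M ka) t0 = en (exp (l*ka))*(R 0^^n) (T l M 0) y" for n
 proof -
  have "T l M ka (x+ka) = en (exp (l*ka)) * T l M 0 x" for x
  proof -
   have "T l M ka (x+ka) = (\<integral>\<^sup>+s. en (exp (l*ka))*(indicator {M<..} s*(indicator {..0} (x+s) * E l (x+s))) \<partial>\<nu>)"
    unfolding T_def
    by (intro nn_integral_cong) (auto simp: indicator_def ennreal_mult[symmetric] exp_add[symmetric] algebra_simps)
   then show ?thesis unfolding T_def by (subst (asm) nn_integral_cmult) auto
  qed
  then show ?thesis by (simp add: R_pow_shift[where ka = ka] R_pow_cmult y_def)
 qed
 from M(2) have "eventually (%n. (\<integral>s. indicator {M<..} s * un l (n+i) s \<partial>\<nu>)<=e' * w (n+i)) sequentially"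
  by (subst eventually_sequentially_seg)
 then have "eventually (%n. (R ka^^n) (T l M ka) t0<=en (e * w n)) sequentially"
 proof eventually_elim
  case (elim n)
  have "ennreal k*(R 0^^n) (T l M 0) y<=en (e' * w (n+i))"
   using trans[of n] base[of "i+n"] elim unfolding k(2) by (auto simp: add.commute intro: order_trans ennreal_leI)
  also have "... <= en (e' * w n)" using e' by (intro ennreal_leI mult_left_mono w_antimono) auto
  finally have "en (1/k)*(ennreal k*(R 0^^n) (T l M 0) y)<=en (1/k) * en (e' * w n)"
   by (intro mult_left_mono) auto
  moreover have "en (1/k)*(ennreal k*(R 0^^n) (T l M 0) y) = (R 0^^n) (T l M 0) y"
   using k(1) by (simp add: mult.assoc[symmetric] ennreal_mult[symmetric])
  ultimately have "(R 0^^n) (T l M 0) y<=en (1/k*(e' * w n))"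
   using k(1) e' w_pos[of n] by (simp add: ennreal_mult[symmetric])
  then have "(R ka^^n) (T l M ka) t0<=en (exp (l*ka)) * en (1/k*(e' * w n))"
   unfolding shift by (intro mult_left_mono) auto
  also have "... = en (e * w n)"
   using k(1) e e' w_pos[of n] by (subst ennreal_mult[symmetric]) (auto simp: e'_def)
  finally show ?case .
 qed
 then show ?thesis using M(1) by blast
qed

end

definition meas2 :: "(real => real => ennreal) => bool" where
 "meas2 h \<longleftrightarrow> (%(t, a). h t a) \<in> bmeas (borel \<Otimes>\<^sub>M borel)"

lemma meas2D:
 assumes "meas2 h" and [measurable]: "f \<in> bmeas M" "g \<in> bmeas M"
 shows "(%x. h (f x) (g x)) \<in> bmeas M"
proof -
 have [measurable]: "(%(t, a). h t a) \<in> bmeas (borel \<Otimes>\<^sub>M borel)" using assms by (simp add: meas2_def)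
 have "(%x. (%(t, a). h t a) (f x, g x)) \<in> bmeas M" by measurable
 then show ?thesis by simp
qed

definition soft :: "real => real => real" where "soft ka x = max 0 (min 1 (ka+1-x))"

lemma soft_measurable [measurable]: "soft ka \<in> bmeas borel"
 unfolding soft_def by measurable

lemma soft_facts: "0<=soft ka x" "soft ka x<=1" "x<=ka ==> soft ka x = 1" "x>=ka+1 ==> soft ka x = 0"
 by (auto simp: soft_def)

lemma isCont_soft: "isCont (soft ka) x"
 unfolding soft_def by (intro continuous_intros)

context walk
begin

definition Kop :: "(real => ennreal) => (real => real => ennreal) => real => real => ennreal" where
 "Kop g h t a = (\<integral>\<^sup>+x. g (t+x) * h (t+x) (a+exp t) \<partial>\<nu>)"

lemma meas2_Kop:
 assumes [measurable]: "g \<in> bmeas borel" and h: "meas2 h"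
 shows "meas2 (Kop g h)"
proof -
 have [measurable]: "(%(t, a). h t a) \<in> bmeas (borel \<Otimes>\<^sub>M borel)" using h by (simp add: meas2_def)
 have "(%p. \<integral>\<^sup>+x. g (fst p+x)*(%(t, a). h t a) (fst p+x, snd p+exp (fst p)) \<partial>\<nu>) \<in> bmeas (borel \<Otimes>\<^sub>M borel)"
  by measurable
 then show ?thesis by (simp add: meas2_def Kop_def case_prod_beta)
qed

lemma meas2_Kop_pow: "g \<in> bmeas borel ==> meas2 h ==> meas2 ((Kop g^^n) h)"
 by (induction n) (auto intro: meas2_Kop)

lemma Kop_mono: "(!!t. g t<=g' t) ==> (!!t a. h t a<=h' t a) ==> Kop g h t a<=Kop g' h' t a"
 unfolding Kop_def by (intro nn_integral_mono mult_mono) auto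

lemma Kop_pow_mono: "(!!t. g t<=g' t) ==> (!!t a. h t a<=h' t a) ==> (Kop g^^n) h t a<=(Kop g'^^n) h' t a"
 by (induction n arbitrary: t a) (auto intro!: Kop_mono)

lemma Kop_add:
 assumes [measurable]: "g \<in> bmeas borel" and h: "meas2 h" "meas2 h'"
 shows "Kop g (%t a. h t a+h' t a) t a = Kop g h t a+Kop g h' t a"
proof -
 note [measurable] = meas2D[OF h(1)] meas2D[OF h(2)]
 show ?thesis unfolding Kop_def distrib_left by (intro nn_integral_add) measurable
qed

lemma Kop_pow_add:
 assumes g: "g \<in> bmeas borel" and h: "meas2 h" "meas2 h'"
 shows "(Kop g^^n) (%t a. h t a+h' t a) t a = (Kop g^^n) h t a+(Kop g^^n) h' t a"
proof (induction n arbitrary: t a)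
 case (Suc n)
 have "(Kop g^^n) (%t a. h t a+h' t a) = (%t a. (Kop g^^n) h t a+(Kop g^^n) h' t a)"
  using Suc by (intro ext) auto
 then show ?case by (simp add: Kop_add[OF g meas2_Kop_pow[OF g h(1)] meas2_Kop_pow[OF g h(2)]])
qed simp

lemma Kop_cmult:
 assumes [measurable]: "g \<in> bmeas borel" and h: "meas2 h"
 shows "Kop g (%t a. b * h t a) t a = b * Kop g h t a"
proof -
 note [measurable] = meas2D[OF h]
 show ?thesis unfolding Kop_def mult.left_commute[of _ b] by (intro nn_integral_cmult) measurable
qed

lemma Kop_pow_cmult:
 assumes g: "g \<in> bmeas borel" and h: "meas2 h"
 shows "(Kop g^^n) (%t a. b * h t a) t a = b*(Kop g^^n) h t a"
proof (induction n arbitrary: t a)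
 case (Suc n)
 have "(Kop g^^n) (%t a. b * h t a) = (%t a. b*(Kop g^^n) h t a)" using Suc by (intro ext) auto
 then show ?case by (simp add: Kop_cmult[OF g meas2_Kop_pow[OF g h]])
qed simp

abbreviation "hard ka \<equiv> (indicator {..ka} :: real => ennreal)"

lemma Kop_hard_const: "Kop (hard ka) (%t a. f t) t a = R ka f t"
 by (simp add: Kop_def R_def act_def)

lemma Kop_pow_hard_const: "(Kop (hard ka)^^n) (%t a. f t) t a = (R ka^^n) f t"
proof (induction n arbitrary: t a)
 case (Suc n)
 have "(Kop (hard ka)^^n) (%t a. f t) = (%t a. (R ka^^n) f t)" using Suc by (intro ext) auto
 then show ?case by (simp add: Kop_hard_const)
qed simp

definition anti :: "(real => real => ennreal) => bool" where
 "anti h \<longleftrightarrow> (\<forall>t a a'. a<=a' --> h t a'<=h t a)"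

lemma anti_Kop_pow: "anti h ==> anti ((Kop g^^n) h)"
proof (induction n)
 case (Suc n)
 then show ?case unfolding anti_def by (auto simp: Kop_def intro!: nn_integral_mono mult_left_mono)
qed simp

lemma Kop_le_R_pow:
 assumes "anti h" "!!t. g t<=hard ka t"
 shows "(Kop g^^m) h t a<=(R ka^^m) (%s. h s a) t"
proof (induction m arbitrary: t a)
 case (Suc m)
 have an: "anti ((Kop g^^m) h)" by (rule anti_Kop_pow[OF assms(1)])
 have "(Kop g^^Suc m) h t a = (\<integral>\<^sup>+x. g (t+x)*(Kop g^^m) h (t+x) (a+exp t) \<partial>\<nu>)" by (simp add: Kop_def)
 also have "... <= (\<integral>\<^sup>+x. hard ka (t+x)*(R ka^^m) (%s. h s a) (t+x) \<partial>\<nu>)"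
 proof (intro nn_integral_mono mult_mono assms(2))
  fix x
  have "(Kop g^^m) h (t+x) (a+exp t)<=(Kop g^^m) h (t+x) a" using an by (simp add: anti_def)
  also have "... <= (R ka^^m) (%s. h s a) (t+x)" by (rule Suc.IH)
  finally show "(Kop g^^m) h (t+x) (a+exp t)<=(R ka^^m) (%s. h s a) (t+x)" .
 qed auto
 also have "... = (R ka^^Suc m) (%s. h s a) t" by (simp add: R_def act_def)
 finally show ?case .
qed simp

primrec Z :: "real => (real => ennreal) => nat => real => ennreal" where
 "Z ka W 0 t = 0"
| "Z ka W (Suc m) t = R ka (Z ka W m) t+E 1 t*(R ka^^Suc m) W t"

lemma Z_0: "Z ka W 0 = (%t. 0)" by auto

lemma Z_measurable [measurable]: "W \<in> bmeas borel ==> Z ka W m \<in> bmeas borel"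
proof (induction m)
 case (Suc m)
 then have [measurable]: "W \<in> bmeas borel" "Z ka W m \<in> bmeas borel" by auto
 have "(%t. R ka (Z ka W m) t+E 1 t*(R ka^^Suc m) W t) \<in> bmeas borel" by measurable
 then show ?case by simp
qed (simp add: Z_0)

lemma R_pow_Z:
 assumes [measurable]: "W \<in> bmeas borel"
 shows "(R ka^^i) (Z ka W m) t = (\<Sum>j<m. (R ka^^(i+j)) (%s. E 1 s*(R ka^^(m-j)) W s) t)"
proof (induction m arbitrary: i)
 case 0
 have "(R ka^^i) (Z ka W 0) t = (R ka^^i) (%s. 0*0) t" by (simp add: Z_0)
 also have "... = 0" by (subst R_pow_cmult) auto
 finally show ?case by (simp only: lessThan_0 sum.empty)
next
 case (Suc m)
 have "Z ka W (Suc m) = (%t. R ka (Z ka W m) t+E 1 t*(R ka^^Suc m) W t)" by auto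
 then have "(R ka^^i) (Z ka W (Suc m)) t
   = (R ka^^i) (R ka (Z ka W m)) t+(R ka^^i) (%t. E 1 t*(R ka^^Suc m) W t) t"
  by (simp only:) (rule R_pow_add, auto)
 also have "(R ka^^i) (R ka (Z ka W m)) t = (R ka^^Suc i) (Z ka W m) t" by (simp add: funpow_swap1)
 also have "... = (\<Sum>j<m. (R ka^^(i+Suc j)) (%s. E 1 s*(R ka^^(Suc m-Suc j)) W s) t)"
  unfolding Suc.IH by simp
 finally show ?case unfolding sum.lessThan_Suc_shift by (simp add: add.commute)
qed

definition Lip :: "(real => real => ennreal) => (real => ennreal) => bool" where
 "Lip h W \<longleftrightarrow> (\<forall>t a \<delta>. \<delta> >= 0 --> h t a<=h t (a+\<delta>)+en (2*\<delta>) * W t)"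

lemma Lip_Kop:
 assumes L: "Lip h W" and h: "meas2 h" and [measurable]: "W \<in> bmeas borel"
 shows "Lip (Kop (hard ka) h) (R ka W)"
 unfolding Lip_def
proof (intro allI impI)
 fix t a \<delta> :: real assume \<delta>: "\<delta> >= 0"
 note [measurable] = meas2D[OF h]
 have "Kop (hard ka) h t a<=(\<integral>\<^sup>+x. hard ka (t+x) * h (t+x) (a+\<delta>+exp t)+en (2*\<delta>)*(hard ka (t+x) * W (t+x)) \<partial>\<nu>)"
  unfolding Kop_def
 proof (intro nn_integral_mono)
  fix x
  have "h (t+x) (a+exp t)<=h (t+x) (a+exp t+\<delta>)+en (2*\<delta>) * W (t+x)"
   using L \<delta> by (auto simp: Lip_def)
  then show "hard ka (t+x) * h (t+x) (a+exp t)
    <= hard ka (t+x) * h (t+x) (a+\<delta>+exp t)+en (2*\<delta>)*(hard ka (t+x) * W (t+x))"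
   by (auto simp: indicator_def ac_simps)
 qed
 also have "... = Kop (hard ka) h t (a+\<delta>)+en (2*\<delta>) * R ka W t"
  unfolding Kop_def R_def act_def by (subst nn_integral_add) (auto simp: nn_integral_cmult)
 finally show "Kop (hard ka) h t a<=Kop (hard ka) h t (a+\<delta>)+en (2*\<delta>) * R ka W t" .
qed

lemma Lip_Kop_pow:
 assumes "Lip h W" "meas2 h" and [measurable]: "W \<in> bmeas borel"
 shows "Lip ((Kop (hard ka)^^n) h) ((R ka^^n) W)"
proof (induction n)
 case (Suc n)
 show ?case using Lip_Kop[OF Suc meas2_Kop_pow[OF _ assms(2)]] by simp
qed (use assms in simp)

lemma R_le_Kop:
 assumes L: "Lip h W" and h: "meas2 h" and [measurable]: "W \<in> bmeas borel"
 shows "R ka (%s. h s a) t<=Kop (hard ka) h t a+ennreal 2*(E 1 t * R ka W t)"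
proof -
 note [measurable] = meas2D[OF h]
 have "R ka (%s. h s a) t<=(\<integral>\<^sup>+x. hard ka (t+x) * h (t+x) (a+exp t)+(en (2 * exp t))*(hard ka (t+x) * W (t+x)) \<partial>\<nu>)"
  unfolding R_def act_def
 proof (intro nn_integral_mono)
  fix x
  have "h (t+x) a<=h (t+x) (a+exp t)+en (2 * exp t) * W (t+x)"
   using L by (auto simp: Lip_def)
  then show "hard ka (t+x) * h (t+x) a
    <= hard ka (t+x) * h (t+x) (a+exp t)+en (2 * exp t)*(hard ka (t+x) * W (t+x))"
   by (auto simp: indicator_def)
 qed
 also have "... = Kop (hard ka) h t a+en (2 * exp t) * R ka W t"
  unfolding Kop_def R_def act_def by (subst nn_integral_add) (auto simp: nn_integral_cmult)
 also have "en (2 * exp t) * R ka W t = ennreal 2*(E 1 t * R ka W t)"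
  by (subst ennreal_mult) (auto simp: ac_simps)
 finally show ?thesis .
qed

lemma R_pow_le_Kop:
 assumes L: "Lip h W" and h: "meas2 h" and [measurable]: "W \<in> bmeas borel"
 shows "(R ka^^m) (%s. h s a) t<=(Kop (hard ka)^^m) h t a+ennreal 2 * Z ka W m t"
proof (induction m arbitrary: t)
 case (Suc m)
 let ?h = "(Kop (hard ka)^^m) h"
 have mh: "meas2 ?h" by (rule meas2_Kop_pow[OF _ h]) simp
 have [measurable]: "(%s. ?h s a) \<in> bmeas borel" by (rule meas2D[OF mh]) auto
 have "(R ka^^Suc m) (%s. h s a) t = R ka ((R ka^^m) (%s. h s a)) t" by simp
 also have "... <= R ka (%s. ?h s a+ennreal 2 * Z ka W m s) t" by (intro R_mono Suc)
 also have "... = R ka (%s. ?h s a) t+ennreal 2 * R ka (Z ka W m) t"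
  by (subst R_add) (auto simp: R_cmult)
 also have "... <= (Kop (hard ka) ?h t a+ennreal 2*(E 1 t * R ka ((R ka^^m) W) t))+ennreal 2 * R ka (Z ka W m) t"
  by (intro add_right_mono R_le_Kop[OF Lip_Kop_pow[OF L h] mh]) auto
 also have "... = (Kop (hard ka)^^Suc m) h t a+ennreal 2 * Z ka W (Suc m) t"
  by (simp add: distrib_left ac_simps)
 finally show ?case .
qed simp

lemma Kop_pow_linear:
 assumes [measurable]: "W \<in> bmeas borel" and a: "a>=0"
 shows "(Kop (hard ka)^^m) (%t a. W t * ennreal a) t a<=ennreal a*(R ka^^m) W t+Z ka W m t"
 using a
proof (induction m arbitrary: t a)
 case 0
 then show ?case by (simp add: mult.commute)
next
 case (Suc m)
 have "(Kop (hard ka)^^Suc m) (%t a. W t * ennreal a) t a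
   <= (\<integral>\<^sup>+x. hard ka (t+x)*(en (a+exp t)*(R ka^^m) W (t+x)+Z ka W m (t+x)) \<partial>\<nu>)"
  unfolding funpow.simps o_def Kop_def[of _ "(Kop (hard ka)^^m) _"] using Suc.prems
  by (intro nn_integral_mono mult_left_mono Suc.IH) auto
 also have "... = (\<integral>\<^sup>+x. en (a+exp t)*(hard ka (t+x)*(R ka^^m) W (t+x))+hard ka (t+x) * Z ka W m (t+x) \<partial>\<nu>)"
  by (intro nn_integral_cong) (simp add: distrib_left mult.left_commute)
 also have "... = en (a+exp t) * R ka ((R ka^^m) W) t+R ka (Z ka W m) t"
  unfolding R_def[of _ "(R ka^^m) W"] R_def[of _ "Z ka W m"] act_def
  by (subst nn_integral_add) (auto simp: nn_integral_cmult)
 also have "... = ennreal a*(R ka^^Suc m) W t+Z ka W (Suc m) t"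
  using Suc.prems by (simp add: distrib_right ac_simps)
 finally show ?case .
qed

end

locale weak = attracted \<nu> c \<rho> \<mu> for \<nu> :: "real measure" and c \<rho> \<mu> +
 fixes \<beta> :: real
 assumes beta: "0 < \<beta>" "\<beta> < 1"
  and exp_moment: "(\<integral>\<^sup>+x. en (exp (- \<beta> * x)) \<partial>\<nu>) < \<top>"
begin

abbreviation "lam \<equiv> 1-\<beta>"

definition fr :: "real => real => real => real" where
 "fr v t a = exp (lam * t)/((max 1 a+exp t * v) * max 1 a)"

definition f :: "real => real => real => ennreal" where "f v t a = en (fr v t a)"

lemma fr_den: "(v::real)>=1 ==> (max 1 a+exp t * v) * max 1 a>=1"
proof -
 assume "(v::real)>=1"
 then have "0<=exp t * v" by simp
 then have "1*1<=(max 1 a+exp t * v) * max 1 a" by (intro mult_mono) linarith+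
 then show ?thesis by simp
qed

lemma fr_bounds:
 assumes v: "v>=1"
 shows "0 < fr v t a" "fr v t a<=exp (lam * t)" "fr v t a<=exp (lam * t)/(max 1 a+exp t)" "fr v t a<=1"
proof -
 show "0 < fr v t a" unfolding fr_def using fr_den[OF v, of a t] by (intro divide_pos_pos) auto
 show "fr v t a<=exp (lam * t)" unfolding fr_def using fr_den[OF v, of a t] by (subst divide_le_eq) auto
 have "(max 1 a+exp t)*1<=(max 1 a+exp t * v) * max 1 a" using v by (intro mult_mono) auto
 then show 3: "fr v t a<=exp (lam * t)/(max 1 a+exp t)"
  unfolding fr_def by (intro divide_left_mono) (auto intro!: mult_pos_pos add_pos_pos simp: add_pos_nonneg v order_less_le_trans[OF zero_less_one])
 have "exp (lam * t)<=max 1 a+exp t"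
 proof (cases "t>=0")
  case True
  then have "lam * t<=1 * t" using beta by (intro mult_right_mono) auto
  then have "exp (lam * t)<=exp t" by simp
  moreover have "0<=max 1 a" by simp
  ultimately show ?thesis by linarith
 next
  case False
  then have "lam * t<=0" using beta by (intro mult_nonneg_nonpos) auto
  then have "exp (lam * t)<=1" by simp
  then show ?thesis using exp_ge_zero[of t] by linarith
 qed
 then have "exp (lam * t)/(max 1 a+exp t)<=1" by (simp add: divide_le_eq_1 add_pos_pos)
 with 3 show "fr v t a<=1" by linarith
qed

lemma isCont_fr: "v>=1 ==> isCont (%p. fr v (fst p) (snd p)) z"
 unfolding fr_def using fr_den[of v "snd z" "fst z"] by (intro continuous_intros) auto

lemma meas2_f: "meas2 (f v)"
 unfolding meas2_def f_def fr_def by measurable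

lemma anti_f: "v>=1 ==> anti (f v)"
 unfolding anti_def f_def fr_def
proof (intro allI impI ennreal_leI divide_left_mono)
 fix t a a' :: real assume v: "v>=1" and a: "a<=a'"
 show "(max 1 a+exp t * v) * max 1 a<=(max 1 a'+exp t * v) * max 1 a'"
  using a v by (intro mult_mono) (auto simp: add_nonneg_nonneg)
 show "0 < (max 1 a'+exp t * v) * max 1 a'*((max 1 a+exp t * v) * max 1 a)"
  by (rule mult_pos_pos) (use fr_den[OF v, of a t] fr_den[OF v, of a' t] in linarith)+
qed auto

lemma Lip_f: "v>=1 ==> Lip (f v) (E lam)"
 unfolding Lip_def
proof (intro allI impI)
 fix t a \<delta> :: real assume v: "v>=1" and \<delta>: "0<=\<delta>"
 define x where "x = max 1 a"
 define y where "y = max 1 (a+\<delta>)"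
 define b where "b = exp t * v"
 have xy: "1<=x" "x<=y" "y<=x+\<delta>" "b>=0" using \<delta> v by (auto simp: x_def y_def b_def)
 have p: "(x+b) * x>=1" "(y+b) * y>=1" using fr_den[OF v] by (auto simp: x_def y_def b_def)
 have "1/((x+b) * x)-1/((y+b) * y) = ((y+b) * y-(x+b) * x)/(((x+b) * x)*((y+b) * y))"
 proof -
  have ne: "(x+b) * x ~= 0" "(y+b) * y ~= 0" using p by linarith+
  show ?thesis using diff_frac_eq[OF ne, of 1 1] by simp
 qed
 also have "(y+b) * y-(x+b) * x = (y-x)*(x+y+b)" by (simp add: algebra_simps)
 also have "... <= \<delta>*(2*(((x+b) * x)*((y+b) * y)))"
 proof (intro mult_mono)
  have "x+y+b<=2*(y+b)" using xy by simp
  also have "... <= 2*((y+b) * y)" using xy mult_left_mono[of 1 y "y+b"] by linarith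
  also have "... <= 2*(((x+b) * x)*((y+b) * y))" using p mult_right_mono[of 1 "(x+b) * x" "(y+b) * y"] by simp
  finally show "x+y+b<=2*(((x+b) * x)*((y+b) * y))" .
 qed (use xy \<delta> in auto)
 then have "(y-x)*(x+y+b)/(((x+b) * x)*((y+b) * y))<=\<delta>*2"
  using xy by (subst pos_divide_le_eq) (auto intro!: mult_pos_pos simp: ac_simps)
 finally have d: "1/((x+b) * x)<=1/((y+b) * y)+2*\<delta>" by linarith
 have "fr v t a = exp (lam * t)*(1/((x+b) * x))" by (simp add: fr_def x_def b_def)
 also have "... <= exp (lam * t)*(1/((y+b) * y)+2*\<delta>)" using d by (intro mult_left_mono) auto
 also have "... = fr v t (a+\<delta>)+2*\<delta> * exp (lam * t)" by (simp add: fr_def y_def b_def algebra_simps)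
 finally have "en (fr v t a)<=en (fr v t (a+\<delta>)+2*\<delta> * exp (lam * t))" by (rule ennreal_leI)
 also have "... = f v t (a+\<delta>)+en (2*\<delta>) * E lam t"
  unfolding f_def using fr_bounds(1)[OF v, of t "a+\<delta>"] \<delta> by (subst ennreal_plus) (auto simp: ennreal_mult[symmetric])
 finally show "f v t a<=f v t (a+\<delta>)+en (2*\<delta>) * E lam t" by (simp add: f_def)
qed

lemma lam_pos: "lam > 0" using beta by simp

text \<open>Contribution of the middle part of a path to the exponential functional.\<close>

lemma Z_bound:
 "\<exists>C>0. \<forall>n m l. n = m+2 * l -->
   (R ka^^l) (Z ka ((R ka^^l) (E lam)) m) 0<=en (C * w n*(\<Sum>k. w (k+l)))" if ka: "ka >= 0"
proof -
 obtain C1 where C1: "C1 > 0" "!!n ka t. t<=ka ==> (R ka^^n) (E lam) t<=en (C1 * exp (lam*ka) * exp ((1/2)*(ka - t)) * w n)"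
  using R_exp_bound[OF lam_pos, of "1/2"] by auto
 obtain C2 where C2: "C2 > 0" "!!n ka t. t<=ka ==> (R ka^^n) (E (1/2)) t<=en (C2 * exp ((1/2)*ka) * exp ((1/2)*(ka - t)) * w n)"
  using R_exp_bound[of "1/2" "1/2"] by auto
 define A1 where "A1 = C1 * exp (lam*ka) * exp ((1/2)*ka)"
 define A2 where "A2 = C2 * exp ((1/2)*ka) * exp ((1/2)*ka)"
 have A: "A1 > 0" "A2 > 0" using C1 C2 by (auto simp: A1_def A2_def)
 have "(R ka^^l) (Z ka ((R ka^^l) (E lam)) m) 0<=en ((A1 * A2*(4 * Dbl)) * w n*(\<Sum>k. w (k+l)))"
  if n: "n = m+2 * l" for n m l
 proof -
  have "(R ka^^l) (Z ka ((R ka^^l) (E lam)) m) 0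
    = (\<Sum>j<m. (R ka^^(l+j)) (%s. E 1 s*(R ka^^(m-j)) ((R ka^^l) (E lam)) s) 0)"
   by (rule R_pow_Z) auto
  also have "... <= (\<Sum>j<m. en (A1 * A2*(w (l+j) * w (n-(l+j)))))"
  proof (intro sum_mono)
   fix j assume "j \<in> {..<m}"
   then have j: "j < m" by simp
   have "(R ka^^(m-j)) ((R ka^^l) (E lam)) = (R ka^^(n-(l+j))) (E lam)"
   proof -
    have "n-(l+j) = (m-j)+l" using n j by simp
    then show ?thesis by (simp add: funpow_add)
   qed
   then have "(R ka^^(l+j)) (%s. E 1 s*(R ka^^(m-j)) ((R ka^^l) (E lam)) s) 0
     = (R ka^^(l+j)) (%s. E 1 s*(R ka^^(n-(l+j))) (E lam) s) 0" by simp
   also have "... <= (R ka^^(l+j)) (%s. en (A1 * w (n-(l+j))) * E (1/2) s) 0"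
   proof (intro R_pow_mono)
    fix t assume t: "t<=ka"
    have "E 1 t*(R ka^^(n-(l+j))) (E lam) t<=E 1 t * en (C1 * exp (lam*ka) * exp ((1/2)*(ka - t)) * w (n-(l+j)))"
     by (intro mult_left_mono C1 t) auto
    also have "... = en (exp (1 * t)*(C1 * exp (lam*ka) * exp ((1/2)*(ka - t)) * w (n-(l+j))))"
     using C1(1) w_pos by (subst ennreal_mult) (auto simp: less_imp_le)
    also have "exp (1 * t)*(C1 * exp (lam*ka) * exp ((1/2)*(ka - t)) * w (n-(l+j)))
      = A1 * w (n-(l+j)) * exp ((1/2) * t)"
    proof -
     have "exp (1 * t) * exp ((1/2)*(ka - t)) = exp ((1/2)*ka) * exp ((1/2) * t)"
      by (simp add: exp_add[symmetric] field_simps)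
     then have "(C1 * exp (lam*ka) * w (n-(l+j)))*(exp (1 * t) * exp ((1/2)*(ka - t)))
      = (C1 * exp (lam*ka) * w (n-(l+j)))*(exp ((1/2)*ka) * exp ((1/2) * t))" by (simp only:)
     then show ?thesis unfolding A1_def by (simp only: ac_simps)
    qed
    finally show "E 1 t*(R ka^^(n-(l+j))) (E lam) t<=en (A1 * w (n-(l+j))) * E (1/2) t"
     using A w_pos by (simp add: ennreal_mult less_imp_le)
   qed (rule ka)
   also have "... = en (A1 * w (n-(l+j)))*(R ka^^(l+j)) (E (1/2)) 0"
    by (rule R_pow_cmult) auto
   also have "... <= en (A1 * w (n-(l+j))) * en (A2 * w (l+j))"
    using C2(2)[OF ka, of "l+j"] by (intro mult_left_mono) (auto simp: A2_def)
   also have "... = en (A1 * A2*(w (l+j) * w (n-(l+j))))"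
    using A w_pos by (simp add: ennreal_mult[symmetric] less_imp_le ac_simps)
   finally show "(R ka^^(l+j)) (%s. E 1 s*(R ka^^(m-j)) ((R ka^^l) (E lam)) s) 0
     <= en (A1 * A2*(w (l+j) * w (n-(l+j))))" .
  qed
  also have "... = en (A1 * A2*(\<Sum>j<m. w (l+j) * w (n-(l+j))))"
   using A w_pos by (subst sum_ennreal) (auto simp: less_imp_le sum_distrib_left)
  also have "... <= en ((A1 * A2*(4 * Dbl)) * w n*(\<Sum>k. w (k+l)))"
  proof (intro ennreal_leI)
   have "(\<Sum>j<m. w (l+j) * w (n-(l+j))) = (\<Sum>i\<in>(%j. l+j) ` {..<m}. w i * w (n-i))"
    by (subst sum.reindex) (auto simp: inj_on_def)
   also have "... <= (\<Sum>i=l..n-l. w i * w (n-i))"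
    using n w_pos by (intro sum_mono2) (auto simp: less_imp_le)
   also have "... <= 4 * Dbl * w n*(\<Sum>k. w (k+l))" by (rule w_conv_sum)
   finally have "A1 * A2*(\<Sum>j<m. w (l+j) * w (n-(l+j)))<=A1 * A2*(4 * Dbl * w n*(\<Sum>k. w (k+l)))"
    using A by (intro mult_left_mono) auto
   then show "A1 * A2*(\<Sum>j<m. w (l+j) * w (n-(l+j)))<=(A1 * A2*(4 * Dbl)) * w n*(\<Sum>k. w (k+l))"
    by (simp only: ac_simps)
  qed
  finally show ?thesis .
 qed
 moreover have "A1 * A2*(4 * Dbl) > 0" using A Dbl(1) by simp
 ultimately show ?thesis by blast
qed

lemma Kop_high:
 assumes v: "v>=1" and a: "a>=0" and s: "exp s<=max (max 1 a) (exp t)"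
 shows "(Kop (hard ka)^^n) (f v) t a<=en (exp (- s))*(R ka^^n) (E lam) t"
 using a s
proof (induction n arbitrary: t a)
 case 0
 have "fr v t a<=exp (lam * t)/(max 1 a+exp t)" by (rule fr_bounds[OF v])
 also have "... <= exp (lam * t)/exp s"
 proof (intro divide_left_mono)
  have "max (max 1 a) (exp t)<=max 1 a+exp t" by (auto simp: max_def)
  then show "exp s<=max 1 a+exp t" using 0 by linarith
 qed (auto intro!: add_pos_pos mult_pos_pos simp: less_max_iff_disj)
 also have "... = exp (- s) * exp (lam * t)" by (simp add: exp_minus field_simps)
 finally show ?case unfolding f_def by (simp add: ennreal_mult[symmetric] ennreal_leI)
next
 case (Suc n)
 have "(Kop (hard ka)^^Suc n) (f v) t a = (\<integral>\<^sup>+x. hard ka (t+x)*(Kop (hard ka)^^n) (f v) (t+x) (a+exp t) \<partial>\<nu>)"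
  by (simp add: Kop_def)
 also have "... <= (\<integral>\<^sup>+x. hard ka (t+x)*(en (exp (- s))*(R ka^^n) (E lam) (t+x)) \<partial>\<nu>)"
 proof (intro nn_integral_mono mult_left_mono Suc.IH)
  fix x
  show "0<=a+exp t" using Suc.prems by simp
  have "max (max 1 a) (exp t)<=max 1 (a+exp t)" using Suc.prems(1) exp_ge_zero[of t] by linarith
  then show "exp s<=max (max 1 (a+exp t)) (exp (t+x))" using Suc.prems(2) by linarith
 qed auto
 also have "... = en (exp (- s))*(R ka^^Suc n) (E lam) t"
  unfolding mult.left_commute[of _ "en (exp (- s))"] by (subst nn_integral_cmult) (auto simp: R_def act_def)
 finally show ?case .
qed

lemma Kop_level:
 assumes v: "v>=1" and a: "a>=0"
 shows "(Kop (hard (real (Suc N)))^^n) (f v) t a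
  <= (Kop (hard (real N))^^n) (f v) t a+en (exp (- real N))*(R (real (Suc N))^^n) (E lam) t"
 using a
proof (induction n arbitrary: t a)
 case (Suc n)
 let ?K = "(Kop (hard (real N))^^n) (f v)" and ?R = "(R (real (Suc N))^^n) (E lam)"
 have mK: "meas2 ?K" by (rule meas2_Kop_pow[OF _ meas2_f]) simp
 note [measurable] = meas2D[OF mK]
 have "(Kop (hard (real (Suc N)))^^Suc n) (f v) t a
   = (\<integral>\<^sup>+x. hard (real (Suc N)) (t+x)*(Kop (hard (real (Suc N)))^^n) (f v) (t+x) (a+exp t) \<partial>\<nu>)"
  by (simp add: Kop_def)
 also have "... <= (\<integral>\<^sup>+x. hard (real N) (t+x)*?K (t+x) (a+exp t)
    + en (exp (- real N))*(hard (real (Suc N)) (t+x)*?R (t+x)) \<partial>\<nu>)"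
 proof (intro nn_integral_mono)
  fix x
  have a': "0<=a+exp t" using Suc.prems by simp
  consider "t+x<=real N" | "real N < t+x" "t+x<=real (Suc N)" | "t+x > real (Suc N)" by linarith
  then show "hard (real (Suc N)) (t+x)*(Kop (hard (real (Suc N)))^^n) (f v) (t+x) (a+exp t)
   <= hard (real N) (t+x)*?K (t+x) (a+exp t)+en (exp (- real N))*(hard (real (Suc N)) (t+x)*?R (t+x))"
  proof cases
   case 1
   then have "hard (real (Suc N)) (t+x) = 1" "hard (real N) (t+x) = 1" by (auto simp: indicator_def)
   then show ?thesis using Suc.IH[OF a', of "t+x"] by (simp only: mult_1)
  next
   case 2
   have "(Kop (hard (real (Suc N)))^^n) (f v) (t+x) (a+exp t)<=en (exp (- real N))*?R (t+x)"
    by (rule Kop_high[OF v a']) (use 2 in \<open>auto simp: le_max_iff_disj\<close>)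
   then show ?thesis using 2 by (simp add: indicator_def)
  qed (simp add: indicator_def)
 qed
 also have "... = (Kop (hard (real N))^^Suc n) (f v) t a+en (exp (- real N))*(R (real (Suc N))^^Suc n) (E lam) t"
  by (subst nn_integral_add) (auto simp: nn_integral_cmult Kop_def R_def act_def)
 finally show ?case .
qed simp

lemma Kop_hard_limit: "(%i. (Kop (hard (real i))^^n) (f v) t a) ----> (Kop (%_. 1)^^n) (f v) t a"
proof (induction n arbitrary: t a)
 case (Suc n)
 let ?K = "%i. (Kop (hard (real i))^^n) (f v)"
 have mK: "meas2 (?K i)" for i by (rule meas2_Kop_pow[OF _ meas2_f]) simp
 have [measurable]: "(%x. ?K i (t+x) (a+exp t)) \<in> bmeas borel" for i by (rule meas2D[OF mK]) auto
 have "(%i. \<integral>\<^sup>+x. hard (real i) (t+x)*?K i (t+x) (a+exp t) \<partial>\<nu>)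
   ----> (\<integral>\<^sup>+x. (Kop (%_. 1)^^n) (f v) (t+x) (a+exp t) \<partial>\<nu>)"
 proof (rule nn_integral_LIMSEQ)
  show "incseq (%i x. hard (real i) (t+x)*?K i (t+x) (a+exp t))"
  proof (intro incseq_SucI le_funI mult_mono Kop_pow_mono)
  qed (auto simp: indicator_def)
  show "(%i. hard (real i) (t+x)*?K i (t+x) (a+exp t)) ----> (Kop (%_. 1)^^n) (f v) (t+x) (a+exp t)" for x
  proof (rule Lim_transform_eventually[OF Suc[of "t+x" "a+exp t"]])
   show "eventually (%i. ?K i (t+x) (a+exp t) = hard (real i) (t+x)*?K i (t+x) (a+exp t)) sequentially"
    by (intro eventually_sequentiallyI[of "nat \<lceil>t+x\<rceil>"]) (auto simp: indicator_def; linarith)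
  qed
 qed measurable
 then show ?case by (simp add: Kop_def[of _ "(Kop _^^n) (f v)" t a])
qed simp

lemma Kop_tail:
 assumes v: "v>=1"
 shows "\<exists>C>0. \<forall>N n. (Kop (%_. 1)^^n) (f v) 0 0
   <= (Kop (hard (real N))^^n) (f v) 0 0+en (C * exp (- (\<beta>/2) * real N) * w n)"
proof -
 have b2: "\<beta>/2 > 0" using beta by simp
 obtain C1 where C1: "C1 > 0" "!!n ka t. t<=ka ==> (R ka^^n) (E lam) t<=en (C1 * exp (lam*ka) * exp ((\<beta>/2)*(ka - t)) * w n)"
  using R_exp_bound[OF lam_pos b2] by auto
 define r where "r = exp (- (\<beta>/2))"
 have r: "0 < r" "r < 1" using beta by (auto simp: r_def)
 define C where "C = C1 * exp 1/(1-r)"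
 have C: "C > 0" using C1 r by (simp add: C_def)
 have step: "en (exp (- real j))*(R (real (Suc j))^^n) (E lam) 0<=en (C1 * exp 1 * r^j * w n)" for j n
 proof -
  have "(R (real (Suc j))^^n) (E lam) 0<=en (C1 * exp (lam * real (Suc j)) * exp ((\<beta>/2)*(real (Suc j)-0)) * w n)"
   by (rule C1) simp
  then have "en (exp (- real j))*(R (real (Suc j))^^n) (E lam) 0
    <= en (exp (- real j)) * en (C1 * exp (lam * real (Suc j)) * exp ((\<beta>/2)*(real (Suc j)-0)) * w n)"
   by (intro mult_left_mono) auto
  also have "... = en (C1*(exp (- real j) * exp (lam * real (Suc j)) * exp ((\<beta>/2) * real (Suc j))) * w n)"
   using C1(1) w_pos[of n] by (subst ennreal_mult[symmetric]) (auto simp: less_imp_le ac_simps)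
  also have "exp (- real j) * exp (lam * real (Suc j)) * exp ((\<beta>/2) * real (Suc j)) = exp (1-\<beta>/2) * r^j"
  proof -
   have "exp (- real j) * exp (lam * real (Suc j)) * exp ((\<beta>/2) * real (Suc j)) = exp (1-\<beta>/2+real j*(- (\<beta>/2)))"
    unfolding exp_add[symmetric] by (rule arg_cong[where f = exp]) (simp add: field_simps)
   also have "... = exp (1-\<beta>/2) * r^j" unfolding exp_add exp_of_nat_mult r_def ..
   finally show ?thesis .
  qed
  also have "en (C1*(exp (1-\<beta>/2) * r^j) * w n)<=en (C1 * exp 1 * r^j * w n)"
  proof (intro ennreal_leI)
   have "exp (1-\<beta>/2) * r^j<=exp 1 * r^j" using beta r by (intro mult_right_mono) auto
   then have "C1*(exp (1-\<beta>/2) * r^j) * w n<=C1*(exp 1 * r^j) * w n"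
    using C1(1) w_pos[of n] by (intro mult_right_mono[OF mult_left_mono]) auto
   then show "C1*(exp (1-\<beta>/2) * r^j) * w n<=C1 * exp 1 * r^j * w n" by (simp only: ac_simps)
  qed
  finally show ?thesis .
 qed
 have tele: "(Kop (hard (real (N+i)))^^n) (f v) 0 0
   <= (Kop (hard (real N))^^n) (f v) 0 0+en (C1 * exp 1 * w n*(\<Sum>j<i. r^(N+j)))" for N n i
 proof (induction i)
  case (Suc i)
  have "(Kop (hard (real (N+Suc i)))^^n) (f v) 0 0
    <= (Kop (hard (real (N+i)))^^n) (f v) 0 0+en (exp (- real (N+i)))*(R (real (Suc (N+i)))^^n) (E lam) 0"
   using Kop_level[OF v, where a = 0 and N = "N+i" and n = n and t = 0] by simp
  also have "... <= ((Kop (hard (real N))^^n) (f v) 0 0+en (C1 * exp 1 * w n*(\<Sum>j<i. r^(N+j))))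
    + en (C1 * exp 1 * r^(N+i) * w n)"
   by (intro add_mono Suc step)
  also have "... = (Kop (hard (real N))^^n) (f v) 0 0+en (C1 * exp 1 * w n*(\<Sum>j<Suc i. r^(N+j)))"
  proof -
   have "C1 * exp 1 * w n*(\<Sum>j<Suc i. r^(N+j)) = C1 * exp 1 * w n*(\<Sum>j<i. r^(N+j))+C1 * exp 1 * r^(N+i) * w n"
    by (simp add: algebra_simps)
   moreover have "0<=C1 * exp 1 * w n*(\<Sum>j<i. r^(N+j))" "0<=C1 * exp 1 * r^(N+i) * w n"
    using C1 r w_pos[of n] by (auto intro!: mult_nonneg_nonneg sum_nonneg simp: less_imp_le)
   ultimately show ?thesis by (simp add: add.assoc)
  qed
  finally show ?case .
 qed simp
 have geo: "C1 * exp 1 * w n*(\<Sum>j<i. r^(N+j))<=C * exp (- (\<beta>/2) * real N) * w n" for N n i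
 proof -
  have "(\<Sum>j<i. r^(N+j)) = r^N*(\<Sum>j<i. r^j)" by (simp add: power_add sum_distrib_left)
  also have "(\<Sum>j<i. r^j)<=(\<Sum>j. r^j)" using r by (intro sum_le_suminf summable_geometric) auto
  also have "(\<Sum>j. r^j) = 1/(1-r)" using r by (intro suminf_geometric) auto
  finally have "(\<Sum>j<i. r^(N+j))<=r^N*(1/(1-r))" using r by (simp add: mult_left_mono)
  then have "C1 * exp 1 * w n*(\<Sum>j<i. r^(N+j))<=C1 * exp 1 * w n*(r^N*(1/(1-r)))"
   using C1 w_pos[of n] by (intro mult_left_mono) auto
  also have "... = C * r^N * w n" by (simp add: C_def)
  also have "r^N = exp (- (\<beta>/2) * real N)" by (simp add: r_def exp_of_nat_mult[symmetric] mult.commute)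
  finally show ?thesis .
 qed
 have "(Kop (%_. 1)^^n) (f v) 0 0<=(Kop (hard (real N))^^n) (f v) 0 0+en (C * exp (- (\<beta>/2) * real N) * w n)" for N n
 proof (rule LIMSEQ_le_const2)
  show "(%i. (Kop (hard (real (i+N)))^^n) (f v) 0 0) ----> (Kop (%_. 1)^^n) (f v) 0 0"
   by (rule LIMSEQ_ignore_initial_segment[OF Kop_hard_limit])
  show "\<exists>M. \<forall>i\<ge>M. (Kop (hard (real (i+N)))^^n) (f v) 0 0<=(Kop (hard (real N))^^n) (f v) 0 0+en (C * exp (- (\<beta>/2) * real N) * w n)"
  proof (intro exI[of _ 0] allI impI)
   fix i :: nat
   show "(Kop (hard (real (i+N)))^^n) (f v) 0 0<=(Kop (hard (real N))^^n) (f v) 0 0+en (C * exp (- (\<beta>/2) * real N) * w n)"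
    unfolding add.commute[of i] by (rule order_trans[OF tele add_left_mono[OF ennreal_leI[OF geo]]])
  qed
 qed
 then show ?thesis using C by blast
qed

end

context walk
begin

lemma meas2_R_pow: "meas2 h ==> meas2 (%t a. (R ka^^m) (%s. h s a) t)"
proof (induction m)
 case (Suc m)
 let ?g = "%t a. (R ka^^m) (%s. h s a) t"
 have [measurable]: "(%(t, a). ?g t a) \<in> bmeas (borel \<Otimes>\<^sub>M borel)" using Suc by (simp add: meas2_def)
 have "(%p. \<integral>\<^sup>+x. hard ka (fst p+x)*(%(t, a). ?g t a) (fst p+x, snd p) \<partial>\<nu>) \<in> bmeas (borel \<Otimes>\<^sub>M borel)"
  by measurable
 then show ?case by (simp add: meas2_def R_def[of _ "(R _^^_) _"] act_def case_prod_beta)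
qed simp

lemma Kop_dominated:
 fixes g :: "nat => real => real => ennreal"
 assumes b: "b > 0" and mom: "(\<integral>\<^sup>+x. en (exp (- b * x)) \<partial>\<nu>) < \<top>"
  and phi [measurable]: "\<phi> \<in> bmeas borel" and phi1: "!!t. \<phi> t<=hard ka t"
  and g: "!!m. meas2 (g m)" and lim: "!!t a. t<=ka ==> (%m. g m t a) ----> G t a"
  and C: "C>=0" "!!m t a. t<=ka ==> g m t a<=en (C * exp (b*(ka - t)))"
  and "t<=ka"
 shows "(%m. (Kop \<phi>^^l) (g m) t a) ----> (Kop \<phi>^^l) G t a
   \<and> (\<forall>m. (Kop \<phi>^^l) (g m) t a<=en (C * enn2real (\<integral>\<^sup>+x. en (exp (- b * x)) \<partial>\<nu>)^l * exp (b*(ka - t))))"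
 using \<open>t \<le> ka\<close>
proof (induction l arbitrary: t a)
 case 0
 then show ?case using lim C(2) by simp
next
 case (Suc l)
 define I where "I = enn2real (\<integral>\<^sup>+x. en (exp (- b * x)) \<partial>\<nu>)"
 have I: "(\<integral>\<^sup>+x. en (exp (- b * x)) \<partial>\<nu>) = ennreal I" using mom by (simp add: I_def)
 have I0: "I>=0" by (simp add: I_def)
 let ?B = "%x. en (C * I^l * exp (b*(ka - t))) * en (exp (- b * x))"
 let ?u = "%m x. \<phi> (t+x)*(Kop \<phi>^^l) (g m) (t+x) (a+exp t)"
 have phi0: "\<phi> s = 0" if "s > ka" for s using phi1[of s] that by simp
 have mu: "?u m \<in> bmeas \<nu>" for m
 proof -
  have [measurable]: "(%x. (Kop \<phi>^^l) (g m) (t+x) (a+exp t)) \<in> bmeas \<nu>"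
   by (rule meas2D[OF meas2_Kop_pow[OF phi g]]) auto
  show ?thesis by measurable
 qed
 have dom: "?u m x<=?B x" for m x
 proof (cases "t+x<=ka")
  case True
  have "?u m x<=1 * en (C * I^l * exp (b*(ka - (t+x))))"
   using Suc.IH[OF True, of "a+exp t"] phi1[of "t+x"] True by (intro mult_mono) (auto simp: I_def)
  also have "... = ?B x"
   using C I0 by (subst ennreal_mult[symmetric]) (auto simp: exp_add[symmetric] algebra_simps)
  finally show ?thesis .
 qed (simp add: phi0)
 have int: "(\<integral>\<^sup>+x. ?B x \<partial>\<nu>) = en (C * I^Suc l * exp (b*(ka - t)))"
  using C(1) I0 by (subst nn_integral_cmult) (simp, simp only: I, simp add: ennreal_mult[symmetric] ac_simps)
 have lim': "(%m. ?u m x) ----> \<phi> (t+x)*(Kop \<phi>^^l) G (t+x) (a+exp t)" for x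
 proof (cases "t+x<=ka")
  case True
  have "\<phi> (t+x)<=1" using order_trans[OF phi1, of "t+x" 1] by (simp add: indicator_def)
  then have "\<phi> (t+x) < \<top>" by (rule le_less_trans) simp
  then show ?thesis using Suc.IH[OF True, of "a+exp t"] by (intro ennreal_tendsto_cmult) auto
 qed (simp add: phi0)
 have "(%m. \<integral>\<^sup>+x. ?u m x \<partial>\<nu>) ----> (\<integral>\<^sup>+x. \<phi> (t+x)*(Kop \<phi>^^l) G (t+x) (a+exp t) \<partial>\<nu>)"
 proof (rule nn_integral_dominated_convergence[where w = ?B])
  show "(%x. \<phi> (t+x)*(Kop \<phi>^^l) G (t+x) (a+exp t)) \<in> bmeas \<nu>"
   by (rule borel_measurable_LIMSEQ_order[OF lim' mu])
  show "(\<integral>\<^sup>+x. ?B x \<partial>\<nu>) < \<infinity>" unfolding int by simp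
 qed (use mu dom lim' in auto)
 moreover have "(\<integral>\<^sup>+x. ?u m x \<partial>\<nu>)<=en (C * I^Suc l * exp (b*(ka - t)))" for m
  unfolding int[symmetric] by (intro nn_integral_mono dom)
 ultimately show ?case by (simp add: Kop_def[of _ "(Kop _^^_) _" t a] I_def)
qed

end

context weak
begin

abbreviation "scut ka \<equiv> (%t. en (soft ka t))"

lemma cut_le_hard: "scut ka t<=hard (ka+1) t"
 using soft_facts[of ka t] by (auto simp: indicator_def ennreal_le_1 split: if_splits)

lemma hard_le_cut: "hard ka t<=scut ka t"
 using soft_facts(3)[of t ka] by (auto simp: indicator_def)

text \<open>Off a set of large upward jumps, the killed kernel preserves continuity and the bound by
 a multiple of \<open>exp ((1 - \<beta>) t)\<close>.\<close>

lemma Kop_regular: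
 assumes v: "v>=1" and k: "ka >= 0" and e: "\<epsilon> > 0"
 shows "\<exists>b C e. (\<forall>z. isCont (%p. b (fst p) (snd p)) z) \<and> C>=0 \<and> (\<forall>t a. 0<=b t a \<and> b t a<=C * exp (lam * t))
  \<and> e \<in> bmeas borel
  \<and> (\<forall>t a. en (b t a)<=(Kop (scut ka)^^l) (f v) t a \<and> (Kop (scut ka)^^l) (f v) t a<=en (b t a)+e t)
  \<and> eventually (%n. (R (ka+1)^^n) e 0<=en (\<epsilon> * w n)) sequentially"
 using e
proof (induction l arbitrary: \<epsilon>)
 case 0
 have "(R (ka+1)^^n) (%_. 0) 0 = 0" for n
  using R_pow_cmult[where b = 0 and f = "%_. 0" and ka = "ka+1" and n = n and x = 0] by simp
 then show ?case using isCont_fr[OF v] fr_bounds[OF v] 0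
  by (intro exI[of _ "fr v"] exI[of _ 1] exI[of _ "%_. 0"]) (auto simp: f_def less_imp_le)
next
 case (Suc l)
 let ?ka = "ka+1"
 obtain b C e where IH: "!!z. isCont (%p. b (fst p) (snd p)) z" "C>=0" "!!t a. 0<=b t a" "!!t a. b t a<=C * exp (lam * t)"
  "e \<in> bmeas borel" "!!t a. en (b t a)<=(Kop (scut ka)^^l) (f v) t a"
  "!!t a. (Kop (scut ka)^^l) (f v) t a<=en (b t a)+e t"
  "eventually (%n. (R ?ka^^n) e 0<=en (\<epsilon>/2 * w n)) sequentially"
  using Suc.IH[OF half_gt_zero[OF Suc.prems]] by blast
 note [measurable] = IH(5)
 have e2: "\<epsilon>/2/(C+1) > 0" using Suc.prems IH(2) by simp
 obtain M where M: "eventually (%n. (R ?ka^^n) (T lam M ?ka) 0<=en (\<epsilon>/2/(C+1) * w n)) sequentially"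
  using jump_tail_R[OF lam_pos e2, of 0 ?ka] k by auto
 define r where "r x t a = indicat_real {..M} x * soft ka (t+x) * b (t+x) (a+exp t)" for x t a
 define b' where "b' t a = (\<integral>x. r x t a \<partial>\<nu>)" for t a
 define B where "B = C * exp (lam*?ka)"
 define e' where "e' t = R ?ka e t+ennreal C * T lam M ?ka t" for t
 have b_cont: "continuous_on UNIV (%p. b (fst p) (snd p))"
  using IH(1) by (simp add: continuous_on_eq_continuous_at)
 have bm [measurable]: "(%p. b (fst p) (snd p)) \<in> bmeas borel"
  by (rule borel_measurable_continuous_onI[OF b_cont])
 have bm2: "(%x. b (g x) (h x)) \<in> bmeas borel"
  if [measurable]: "g \<in> bmeas borel" "h \<in> bmeas borel" for g h :: "real => real"
 proof -
  have "(%x. (%p. b (fst p) (snd p)) (g x, h x)) \<in> bmeas borel" by measurable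
  then show ?thesis by simp
 qed
 have rm: "(%x. r x t a) \<in> bmeas borel" for t a
 proof -
  have [measurable]: "(%x. b (t+x) (a+exp t)) \<in> bmeas borel" by (rule bm2) auto
  show ?thesis unfolding r_def by measurable
 qed
 have r0: "0<=r x t a" for x t a unfolding r_def using soft_facts(1) IH(3) by auto
 have rb: "r x t a<=indicat_real {..M} x*(C * exp (lam*(t+x)))" for x t a
 proof -
  have "soft ka (t+x) * b (t+x) (a+exp t)<=1*(C * exp (lam*(t+x)))"
   by (intro mult_mono IH(3,4) soft_facts) (use IH(2) in auto)
  then show ?thesis by (auto simp: r_def indicator_def)
 qed
 have rB: "\<bar>r x t a\<bar> <= B" for x t a
 proof (cases "t+x<=?ka")
  case True
  have "r x t a<=C * exp (lam*(t+x))" using rb[of x t a] IH(2) by (cases "x<=M") (auto intro: order_trans[OF _ mult_nonneg_nonneg])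
  also have "... <= B" unfolding B_def using True IH(2) lam_pos by (intro mult_left_mono) auto
  finally show ?thesis using r0[of x t a] by simp
 next
  case False
  then show ?thesis using soft_facts(4)[of ka "t+x"] IH(2) by (simp add: r_def B_def)
 qed
 have ri: "integrable \<nu> (%x. r x t a)" for t a
  by (rule integrable_const_bound[where B = B]) (use rB rm in \<open>auto\<close>)
 have nn: "en (b' t a) = (\<integral>\<^sup>+x. en (r x t a) \<partial>\<nu>)" for t a
  unfolding b'_def by (rule nn_integral_eq_integral[symmetric]) (use ri r0 in auto)
 have "isCont (%p. b' (fst p) (snd p)) z" for z
 proof -
  have "((%p. \<integral>x. r x (fst p) (snd p) \<partial>\<nu>) \<longlongrightarrow> (\<integral>x. r x (fst z) (snd z) \<partial>\<nu>)) (at z)"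
   unfolding tendsto_at_iff_sequentially o_def
  proof (intro allI impI)
   fix zs assume zs: "\<forall>i. zs i \<in> UNIV - {z}" "zs ----> z"
   show "(%i. \<integral>x. r x (fst (zs i)) (snd (zs i)) \<partial>\<nu>) ----> (\<integral>x. r x (fst z) (snd z) \<partial>\<nu>)"
   proof (rule integral_dominated_convergence[where w = "%_. B"])
    show "AE x in \<nu>. (%i. r x (fst (zs i)) (snd (zs i))) ----> r x (fst z) (snd z)"
    proof (rule AE_I2)
     fix x
     have s: "(%i. soft ka (fst (zs i)+x)) ----> soft ka (fst z+x)"
      by (intro isCont_tendsto_compose[OF isCont_soft] tendsto_intros zs(2))
     have "(%i. (fst (zs i)+x, snd (zs i)+exp (fst (zs i)))) ----> (fst z+x, snd z+exp (fst z))"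
      by (intro tendsto_intros zs(2))
     from isCont_tendsto_compose[OF IH(1) this]
     show "(%i. r x (fst (zs i)) (snd (zs i))) ----> r x (fst z) (snd z)"
      unfolding r_def by (intro tendsto_mult tendsto_const s) simp
    qed
   qed (use rm rB in auto)
  qed
  then show ?thesis by (simp add: isCont_def b'_def)
 qed
 moreover have "0<=b' t a \<and> b' t a<=C * exp (lam * M) * exp (lam * t)" for t a
 proof
  show "0<=b' t a" unfolding b'_def by (rule Bochner_Integration.integral_nonneg) (rule r0)
  have "b' t a<=(\<integral>x. C * exp (lam * M) * exp (lam * t) \<partial>\<nu>)" unfolding b'_def
  proof (rule integral_mono[OF ri])
   fix x
   show "r x t a<=C * exp (lam * M) * exp (lam * t)"
   proof (cases "x<=M")
    case True
    have "r x t a<=C * exp (lam*(t+x))" using rb[of x t a] IH(2) True by auto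
    also have "... <= C * exp (lam*(t+M))" using True IH(2) lam_pos by (intro mult_left_mono) auto
    finally show ?thesis by (simp add: exp_add distrib_left mult.commute mult.left_commute)
   qed (use IH(2) in \<open>simp add: r_def\<close>)
  qed simp
  then show "b' t a<=C * exp (lam * M) * exp (lam * t)" using prob_space by simp
 qed
 moreover have "e' \<in> bmeas borel" unfolding e'_def by measurable
 moreover have "en (b' t a)<=(Kop (scut ka)^^Suc l) (f v) t a" for t a
 proof -
  have "en (b' t a)<=Kop (scut ka) ((Kop (scut ka)^^l) (f v)) t a" unfolding nn Kop_def[of _ _ t a]
  proof (rule nn_integral_mono)
   fix x
   have "en (r x t a)<=en (soft ka (t+x) * b (t+x) (a+exp t))"
    by (rule ennreal_leI) (auto simp: r_def indicator_def soft_facts IH(3))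
   also have "... <= scut ka (t+x)*(Kop (scut ka)^^l) (f v) (t+x) (a+exp t)"
    by (subst ennreal_mult) (auto simp: soft_facts IH(3) intro!: mult_left_mono IH(6))
   finally show "en (r x t a)<=scut ka (t+x)*(Kop (scut ka)^^l) (f v) (t+x) (a+exp t)" .
  qed
  then show ?thesis by simp
 qed
 moreover have "(Kop (scut ka)^^Suc l) (f v) t a<=en (b' t a)+e' t" for t a
 proof -
  have "(Kop (scut ka)^^Suc l) (f v) t a = (\<integral>\<^sup>+x. scut ka (t+x)*(Kop (scut ka)^^l) (f v) (t+x) (a+exp t) \<partial>\<nu>)"
   by (simp add: Kop_def[of _ "(Kop _^^_) _" t a])
  also have "... <= (\<integral>\<^sup>+x. en (r x t a)+(hard ?ka (t+x) * e (t+x)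
    + ennreal C*(indicator {M<..} x*(hard ?ka (t+x) * E lam (t+x)))) \<partial>\<nu>)"
  proof (intro nn_integral_mono)
   fix x
   let ?b = "b (t+x) (a+exp t)"
   have "scut ka (t+x)*(Kop (scut ka)^^l) (f v) (t+x) (a+exp t)
     <= scut ka (t+x) * ennreal ?b+scut ka (t+x) * e (t+x)"
    unfolding distrib_left[symmetric] by (intro mult_left_mono IH(7)) auto
   also have "scut ka (t+x) * e (t+x)<=hard ?ka (t+x) * e (t+x)" by (intro mult_right_mono cut_le_hard) auto
   also have "scut ka (t+x) * ennreal ?b<=en (r x t a)+ennreal C*(indicator {M<..} x*(hard ?ka (t+x) * E lam (t+x)))"
   proof (cases "x<=M")
    case True
    then show ?thesis by (simp add: r_def ennreal_mult soft_facts IH(3))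
   next
    case False
    have "scut ka (t+x) * ennreal ?b<=hard ?ka (t+x) * en (C * exp (lam*(t+x)))"
     by (intro mult_mono cut_le_hard ennreal_leI IH(4)) auto
    also have "... = ennreal C*(hard ?ka (t+x) * E lam (t+x))"
     using IH(2) by (simp add: ennreal_mult ac_simps)
    finally show ?thesis using False by (simp add: add_increasing)
   qed
   finally show "scut ka (t+x)*(Kop (scut ka)^^l) (f v) (t+x) (a+exp t)
    <= en (r x t a)+(hard ?ka (t+x) * e (t+x)+ennreal C*(indicator {M<..} x*(hard ?ka (t+x) * E lam (t+x))))"
    by (simp add: ac_simps add_right_mono)
  qed
  also have "... = en (b' t a)+e' t"
   unfolding nn e'_def R_def[of _ e] act_def T_def using rm
   by (subst nn_integral_add, simp, simp, subst nn_integral_add) (auto simp: nn_integral_cmult)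
  finally show ?thesis .
 qed
 moreover have "eventually (%n. (R ?ka^^n) e' 0<=en (\<epsilon> * w n)) sequentially"
  using M IH(8)[THEN eventually_sequentially_Suc[THEN iffD2]]
 proof eventually_elim
  case (elim n)
  have "(R ?ka^^n) e' 0 = (R ?ka^^Suc n) e 0+ennreal C*(R ?ka^^n) (T lam M ?ka) 0"
   unfolding e'_def by (subst R_pow_add) (auto simp: R_pow_cmult funpow_swap1)
  also have "... <= en (\<epsilon>/2 * w n)+ennreal C * en (\<epsilon>/2/(C+1) * w n)"
  proof (intro add_mono mult_left_mono elim(1))
   have "\<epsilon>/2 * w (Suc n)<=\<epsilon>/2 * w n" using Suc.prems by (intro mult_left_mono w_antimono) auto
   then show "(R ?ka^^Suc n) e 0<=en (\<epsilon>/2 * w n)" using elim(2) by (meson ennreal_leI order_trans)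
  qed auto
  also have "... = en (\<epsilon>/2 * w n+C*(\<epsilon>/2/(C+1) * w n))"
   using IH(2) e2 w_pos[of n] Suc.prems by (simp add: ennreal_mult[symmetric] ennreal_plus[symmetric] less_imp_le del: ennreal_plus)
  also have "... <= en (\<epsilon> * w n)"
  proof (rule ennreal_leI)
   have "C/(C+1)<=1" using IH(2) by simp
   then have "\<epsilon>/2 * w n*(C/(C+1))<=\<epsilon>/2 * w n*1" using Suc.prems w_pos[of n] by (intro mult_left_mono) auto
   then show "\<epsilon>/2 * w n+C*(\<epsilon>/2/(C+1) * w n)<=\<epsilon> * w n" by (simp add: field_simps)
  qed
  finally show ?case .
 qed
 ultimately show ?case
  using IH(2) by (intro exI[of _ b'] exI[of _ "C * exp (lam * M)"] exI[of _ e']) auto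
qed

end

lemma convergent_approx:
 fixes x :: "nat => real"
 assumes "!!e. e > 0 ==> \<exists>y. convergent y \<and> eventually (%n. \<bar>x n-y n\<bar> <= e) sequentially"
 shows "convergent x"
proof (rule Cauchy_convergent, rule metric_CauchyI)
 fix e :: real assume e: "e > 0"
 obtain y where y: "convergent y" "eventually (%n. \<bar>x n-y n\<bar> <= e/4) sequentially" using assms[of "e/4"] e by auto
 obtain n1 where n1: "!!n. n>=n1 ==> \<bar>x n-y n\<bar> <= e/4" using y(2) by (auto simp: eventually_sequentially)
 obtain n2 where n2: "!!m n. m>=n2 ==> n>=n2 ==> dist (y m) (y n) < e/4"
  using metric_CauchyD[OF convergent_Cauchy[OF y(1)], of "e/4"] e by auto
 have "dist (x m) (x n) < e" if mn: "m>=max n1 n2" "n>=max n1 n2" for m n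
 proof -
  have "\<bar>x m-x n\<bar> <= \<bar>x m-y m\<bar>+\<bar>y m-y n\<bar>+\<bar>x n-y n\<bar>" by linarith
  then show ?thesis using n1[of m] n1[of n] n2[of m n] mn e by (auto simp: dist_real_def)
 qed
 then show "\<exists>M. \<forall>m\<ge>M. \<forall>n\<ge>M. dist (x m) (x n) < e" by blast
qed

context weak
begin

lemma frozen_limit:
 assumes cont: "!!z. isCont (%p. b (fst p) (snd p)) z" and C: "C>=0" "!!t a. 0<=b t a" "!!t a. b t a<=C * exp (lam * t)"
  and k: "ka >= 0"
 shows "\<exists>G. (%m. en (1/w m)*(Kop (scut ka)^^l) (%t a. (R (ka+1)^^m) (%s. en (b s a)) t) 0 0) ----> ennreal G"
proof -
 let ?ka = "ka+1"
 define h where "h m t a = (R ?ka^^m) (%s. en (b s a)) t" for m t a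
 define g where "g m t a = en (1/w m) * h m t a" for m t a
 have "continuous_on UNIV (%p. b (fst p) (snd p))" using cont by (simp add: continuous_on_eq_continuous_at)
 then have [measurable]: "(%p. b (fst p) (snd p)) \<in> bmeas borel" by (rule borel_measurable_continuous_onI)
 have mb: "meas2 (%t a. en (b t a))"
  unfolding meas2_def borel_prod case_prod_beta by measurable
 have mh: "meas2 (h m)" for m using meas2_R_pow[OF mb] unfolding h_def[abs_def] .
 have mg: "meas2 (g m)" for m
 proof -
  have [measurable]: "(%(t, a). h m t a) \<in> bmeas (borel \<Otimes>\<^sub>M borel)" using mh by (simp add: meas2_def)
  show ?thesis unfolding meas2_def g_def[abs_def] by measurable
 qed
 have b_cont: "isCont (%s. b (s+?ka) a) t" for t a
 proof -
  have "isCont (%s. (%p. b (fst p) (snd p)) (s+?ka, a)) t"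
   by (rule isCont_o2[OF _ cont]) (intro continuous_intros)
  then show ?thesis by simp
 qed
 have "\<exists>L. (%m. g m t a) ----> L" if t: "t<=?ka" for t a
 proof -
  have "\<exists>L\<ge>0. (%n. en (1/w n)*(R 0^^n) (%s. en (b (s+?ka) a)) (t-?ka)) ----> ennreal L"
  proof (rule R_limit[OF lam_pos b_cont C(2)])
   show "b (s+?ka) a<=(C * exp (lam*?ka)) * exp (lam * s)" for s
    using C(3)[of "s+?ka" a] by (simp add: exp_add[symmetric] algebra_simps)
  qed (use t in simp)
  then show ?thesis unfolding g_def h_def R_pow_shift[where ka = ?ka] by blast
 qed
 then obtain G where G: "!!t a. t<=?ka ==> (%m. g m t a) ----> G t a" by metis
 obtain C1 where C1: "C1 > 0" "!!n ka t. t<=ka ==> (R ka^^n) (E lam) t<=en (C1 * exp (lam*ka) * exp (\<beta>*(ka - t)) * w n)"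
  using R_exp_bound[OF lam_pos beta(1)] by auto
 have bound: "g m t a<=en (C * C1 * exp (lam*?ka) * exp (\<beta>*(?ka - t)))" if t: "t<=?ka" for m t a
 proof -
  have "h m t a<=(R ?ka^^m) (%s. ennreal C * E lam s) t"
   unfolding h_def by (rule R_pow_mono[OF _ t]) (use C in \<open>auto simp: ennreal_mult[symmetric] intro!: ennreal_leI\<close>)
  also have "... = ennreal C*(R ?ka^^m) (E lam) t" by (rule R_pow_cmult) auto
  also have "... <= ennreal C * en (C1 * exp (lam*?ka) * exp (\<beta>*(?ka - t)) * w m)" by (intro mult_left_mono C1 t) auto
  finally have "g m t a<=en (1/w m)*(ennreal C * en (C1 * exp (lam*?ka) * exp (\<beta>*(?ka - t)) * w m))"
   unfolding g_def by (intro mult_left_mono) auto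
  also have "... = en (1/w m*(C*(C1 * exp (lam*?ka) * exp (\<beta>*(?ka - t)) * w m)))"
   using C(1) C1(1) w_pos[of m] by (simp add: ennreal_mult[symmetric] less_imp_le)
  also have "1/w m*(C*(C1 * exp (lam*?ka) * exp (\<beta>*(?ka - t)) * w m)) = C * C1 * exp (lam*?ka) * exp (\<beta>*(?ka - t))"
   using w_pos[of m] by simp
  finally show ?thesis .
 qed
 have C': "C * C1 * exp (lam*?ka)>=0" using C C1 by auto
 have mc: "scut ka \<in> bmeas borel" by measurable
 have k0: "0<=?ka" using k by simp
 note dom = Kop_dominated[where l = l and a = 0, OF beta(1) exp_moment mc cut_le_hard mg G C' bound k0]
 let ?H = "(Kop (scut ka)^^l) G 0 0"
 have lim: "(%m. (Kop (scut ka)^^l) (g m) 0 0) ----> ?H" using dom by blast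
 have "?H<=en (C * C1 * exp (lam*?ka) * enn2real (\<integral>\<^sup>+x. en (exp (- \<beta> * x)) \<partial>\<nu>)^l * exp (\<beta>*(?ka - 0)))"
  by (rule LIMSEQ_le_const2[OF lim]) (use dom in blast)
 then have "?H < \<top>" by (rule le_less_trans) simp
 then have "?H = en (enn2real ?H)" by simp
 moreover have "(Kop (scut ka)^^l) (g m) 0 0 = en (1/w m)*(Kop (scut ka)^^l) (h m) 0 0" for m
  unfolding g_def[abs_def] by (rule Kop_pow_cmult[OF mc mh])
 ultimately show ?thesis using lim unfolding h_def[abs_def] by (intro exI[of _ "enn2real ?H"]) simp
qed

definition kn :: "real => nat => real" where
 "kn v n = enn2real ((Kop (%_. 1)^^n) (f v) 0 0)"

lemma Kop_pow_le_1: "v>=1 ==> (Kop (%_. 1)^^n) (f v) t a<=1"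
proof (induction n arbitrary: t a)
 case 0
 then show ?case using fr_bounds(4)[of v t a] by (simp add: f_def ennreal_le_1)
next
 case (Suc n)
 have "(Kop (%_. 1)^^Suc n) (f v) t a<=(\<integral>\<^sup>+x. 1 \<partial>\<nu>)"
  unfolding funpow.simps o_def Kop_def[of _ "(Kop _^^n) _"] mult_1 by (intro nn_integral_mono Suc)
 then show ?case using emeasure_space_1 by simp
qed

lemma ennreal_kn: "v>=1 ==> (Kop (%_. 1)^^n) (f v) 0 0 = en (kn v n)"
 unfolding kn_def using le_less_trans[OF Kop_pow_le_1 ennreal_one_less_top] by simp

lemma kn_nonneg: "kn v n>=0" by (simp add: kn_def)

lemma kn_approx:
 assumes v: "v>=1" and e: "\<epsilon> > 0"
 shows "\<exists>y. convergent y \<and> eventually (%n. \<bar>kn v n/w n-y n\<bar> <= \<epsilon>) sequentially"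
proof -
 obtain C where C: "C > 0" "!!N n. (Kop (%_. 1)^^n) (f v) 0 0
   <= (Kop (hard (real N))^^n) (f v) 0 0+en (C * exp (- (\<beta>/2) * real N) * w n)" using Kop_tail[OF v] by blast
 have "(%N. C * exp (- (\<beta>/2))^N) ----> C*0" using beta by (intro tendsto_intros LIMSEQ_realpow_zero) auto
 then have "eventually (%N. C * exp (- (\<beta>/2))^N < \<epsilon>/2) sequentially" using e by (intro order_tendstoD(2)[where y = "C*0"]) auto
 then obtain N where "C * exp (- (\<beta>/2))^N < \<epsilon>/2" by (auto simp: eventually_sequentially)
 then have N: "C * exp (- (\<beta>/2) * real N)<=\<epsilon>/2" by (simp add: exp_of_nat_mult[symmetric] mult.commute)
 define ka where "ka = real N"
 have k: "ka >= 0" "ka+1>=0" by (auto simp: ka_def)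
 obtain C2 where C2: "C2 > 0" "!!n m l. n = m+2 * l ==>
   (R (ka+1)^^l) (Z (ka+1) ((R (ka+1)^^l) (E lam)) m) 0<=en (C2 * w n*(\<Sum>k. w (k+l)))" using Z_bound[OF k(2)] by blast
 obtain l where "norm (\<Sum>k. w (k+l)) < \<epsilon>/(2 * C2)"
  using suminf_exist_split[OF _ summable_w, of "\<epsilon>/(2 * C2)"] e C2(1) by auto
 then have "(\<Sum>k. w (k+l)) < \<epsilon>/(2 * C2)" by simp
 then have l: "2 * C2*(\<Sum>k. w (k+l))<=\<epsilon>" using C2(1) by (simp add: field_simps)
 have e4: "\<epsilon>/4 > 0" using e by simp
 obtain b B e where b: "!!z. isCont (%p. b (fst p) (snd p)) z" "B>=0" "!!t a. 0<=b t a" "!!t a. b t a<=B * exp (lam * t)"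
  "e \<in> bmeas borel" "!!t a. en (b t a)<=(Kop (scut ka)^^l) (f v) t a"
  "!!t a. (Kop (scut ka)^^l) (f v) t a<=en (b t a)+e t"
  "eventually (%n. (R (ka+1)^^n) e 0<=en (\<epsilon>/4 * w n)) sequentially"
  using Kop_regular[OF v k(1) e4, of l] by blast
 note [measurable] = b(5)
 let ?ka = "ka+1"
 have "continuous_on UNIV (%p. b (fst p) (snd p))" using b(1) by (simp add: continuous_on_eq_continuous_at)
 then have [measurable]: "(%p. b (fst p) (snd p)) \<in> bmeas borel" by (rule borel_measurable_continuous_onI)
 have mb: "meas2 (%t a. en (b t a))" unfolding meas2_def borel_prod case_prod_beta by measurable
 have mc: "scut ka \<in> bmeas borel" by measurable
 define h where "h m t a = (R ?ka^^m) (%s. en (b s a)) t" for m t a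
 have mh: "meas2 (h m)" for m using meas2_R_pow[OF mb] unfolding h_def[abs_def] .
 have mt: "meas2 (%t a. g t)" if [measurable]: "g \<in> bmeas borel" for g :: "real => ennreal"
  unfolding meas2_def by measurable
 define Ym where "Ym m = (Kop (scut ka)^^l) (h m) 0 0" for m
 obtain G where G: "(%m. en (1/w m) * Ym m) ----> ennreal G"
  using frozen_limit[OF b(1-4) k(1), of l] unfolding Ym_def h_def[abs_def] by blast
 have lower: "Ym m<=en (kn v (m+2 * l))+en (\<epsilon> * w (m+2 * l))" for m
 proof -
  let ?n = "m+2 * l"
  let ?W = "(R ?ka^^l) (E lam)" and ?h = "(Kop (hard ?ka)^^l) (f v)"
  have mh': "meas2 ?h" by (rule meas2_Kop_pow[OF _ meas2_f]) simp
  have L: "Lip ?h ?W" by (rule Lip_Kop_pow[OF Lip_f[OF v] meas2_f]) simp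
  have bh: "en (b s a)<=?h s a" for s a
   by (rule order_trans[OF b(6)]) (intro Kop_pow_mono cut_le_hard order_refl)
  have "Ym m<=(Kop (hard ?ka)^^l) (%t a. (Kop (hard ?ka)^^m) ?h t a+ennreal 2 * Z ?ka ?W m t) 0 0"
   unfolding Ym_def
  proof (intro Kop_pow_mono cut_le_hard)
   fix t a
   have "h m t a<=(R ?ka^^m) (%s. ?h s a) t" unfolding h_def
   proof (induction m arbitrary: t)
    case (Suc m)
    then show ?case by (auto intro!: R_mono)
   qed (simp add: bh)
   also have "... <= (Kop (hard ?ka)^^m) ?h t a+ennreal 2 * Z ?ka ?W m t" by (rule R_pow_le_Kop[OF L mh']) simp
   finally show "h m t a<=(Kop (hard ?ka)^^m) ?h t a+ennreal 2 * Z ?ka ?W m t" .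
  qed
  also have "... = (Kop (hard ?ka)^^l) ((Kop (hard ?ka)^^m) ?h) 0 0+(Kop (hard ?ka)^^l) (%t a. ennreal 2 * Z ?ka ?W m t) 0 0"
   by (rule Kop_pow_add[OF _ meas2_Kop_pow[OF _ mh'] mt]) auto
  also have "(Kop (hard ?ka)^^l) (%t a. ennreal 2 * Z ?ka ?W m t) 0 0 = ennreal 2*(R ?ka^^l) (Z ?ka ?W m) 0"
   unfolding Kop_pow_hard_const by (rule R_pow_cmult) auto
  also have "(Kop (hard ?ka)^^l) ((Kop (hard ?ka)^^m) ?h) = (Kop (hard ?ka)^^?n) (f v)"
  proof -
   have "?n = l+(m+l)" by simp
   then show ?thesis by (simp only: funpow_add o_apply)
  qed
  also have "(Kop (hard ?ka)^^?n) (f v) 0 0<=(Kop (%_. 1)^^?n) (f v) 0 0"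
   by (intro Kop_pow_mono) (auto simp: indicator_def)
  also have "(R ?ka^^l) (Z ?ka ?W m) 0<=en (C2 * w ?n*(\<Sum>k. w (k+l)))" by (rule C2) simp
  also have "ennreal 2 * en (C2 * w ?n*(\<Sum>k. w (k+l))) = en ((2 * C2*(\<Sum>k. w (k+l))) * w ?n)"
   by (subst ennreal_mult'[symmetric]) (auto simp: ac_simps)
  also have "... <= en (\<epsilon> * w ?n)" using l w_pos[of ?n] by (intro ennreal_leI mult_right_mono) auto
  finally show ?thesis unfolding ennreal_kn[OF v] by (auto simp: mult_left_mono add_mono)
 qed
 have fin: "Ym m < \<top>" for m by (rule le_less_trans[OF lower]) simp
 define ym where "ym m = enn2real (Ym m)" for m
 have ym: "Ym m = en (ym m)" "ym m>=0" for m using fin by (auto simp: ym_def)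
 have upper: "en (kn v (m+2 * l))<=Ym m+(R ?ka^^(m+l)) e 0+en (\<epsilon>/2 * w (m+2 * l))" for m
 proof -
  let ?n = "m+2 * l"
  have "en (kn v ?n)<=(Kop (hard ka)^^?n) (f v) 0 0+en (C * exp (- (\<beta>/2) * real N) * w ?n)"
   unfolding ennreal_kn[OF v, symmetric] ka_def by (rule C)
  also have "(Kop (hard ka)^^?n) (f v) 0 0<=(Kop (scut ka)^^?n) (f v) 0 0" by (intro Kop_pow_mono hard_le_cut order_refl)
  also have "(Kop (scut ka)^^?n) (f v) = (Kop (scut ka)^^l) ((Kop (scut ka)^^m) ((Kop (scut ka)^^l) (f v)))"
  proof -
   have "?n = l+(m+l)" by simp
   then show ?thesis by (simp only: funpow_add o_apply)
  qed
  also have "... 0 0<=(Kop (scut ka)^^l) (%t a. h m t a+(R ?ka^^m) e t) 0 0"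
  proof (intro Kop_pow_mono order_refl)
   fix t a
   have "(Kop (scut ka)^^m) ((Kop (scut ka)^^l) (f v)) t a<=(R ?ka^^m) (%s. (Kop (scut ka)^^l) (f v) s a) t"
    by (rule Kop_le_R_pow[OF anti_Kop_pow[OF anti_f[OF v]] cut_le_hard])
   also have "... <= (R ?ka^^m) (%s. en (b s a)+e s) t"
   proof (induction m arbitrary: t)
    case (Suc m)
    then show ?case by (auto intro!: R_mono)
   qed (simp add: b(7))
   also have "... = h m t a+(R ?ka^^m) e t"
    unfolding h_def by (rule R_pow_add) (auto intro!: meas2D[OF mb])
   finally show "(Kop (scut ka)^^m) ((Kop (scut ka)^^l) (f v)) t a<=h m t a+(R ?ka^^m) e t" .
  qed
  also have "... = Ym m+(Kop (scut ka)^^l) (%t a. (R ?ka^^m) e t) 0 0"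
   unfolding Ym_def by (rule Kop_pow_add[OF mc mh mt]) auto
  also have "(Kop (scut ka)^^l) (%t a. (R ?ka^^m) e t) 0 0<=(Kop (hard ?ka)^^l) (%t a. (R ?ka^^m) e t) 0 0"
   by (intro Kop_pow_mono cut_le_hard order_refl)
  also have "... = (R ?ka^^(m+l)) e 0" unfolding Kop_pow_hard_const by (simp add: funpow_add add.commute[of m])
  also have "C * exp (- (\<beta>/2) * real N) * w ?n<=\<epsilon>/2 * w ?n" using N w_pos[of ?n] by (intro mult_right_mono) auto
  finally show ?thesis by (simp add: add_mono ennreal_leI)
 qed
 define y where "y n = ym (n-2 * l)/w n" for n
 have "(%m. enn2real (en (1/w m) * Ym m)) ----> enn2real (ennreal G)"
  by (rule tendsto_enn2real) (use G in auto)
 then have "(%m. ym m/w m) ----> enn2real (ennreal G)"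
  using w_pos by (auto simp: ym enn2real_mult less_imp_le)
 from tendsto_mult[OF filterlim_compose[OF this filterlim_minus_const_nat_at_top] w_shift_ratio', of "2 * l" "2 * l"]
 have "y ----> enn2real (ennreal G)*1"
  using w_pos by (simp add: y_def[abs_def] less_imp_neq[OF w_pos, symmetric])
 then have "convergent y" by (rule convergentI)
 moreover have "eventually (%n. \<bar>kn v n/w n-y n\<bar> <= \<epsilon>) sequentially"
 proof -
  have "eventually (%n. w (n-l)/w n < 2) sequentially" by (rule order_tendstoD(2)[OF w_shift_ratio']) simp
  moreover have "eventually (%n. (R ?ka^^(n-l)) e 0<=en (\<epsilon>/4 * w (n-l))) sequentially"
   by (rule eventually_compose_filterlim[OF b(8) filterlim_minus_const_nat_at_top])
  moreover have "eventually (%n. n>=2 * l) sequentially" by simp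
  ultimately show ?thesis
  proof eventually_elim
   case (elim n)
   define m where "m = n-2 * l"
   have n: "n = m+2 * l" "n-l = m+l" using elim by (auto simp: m_def)
   have wn: "w n > 0" by (rule w_pos)
   have "en (ym m)<=en (kn v n+\<epsilon> * w n)"
    using lower[of m] kn_nonneg e wn by (simp add: n(1)[symmetric] ym)
   then have lo: "ym m<=kn v n+\<epsilon> * w n" using e wn kn_nonneg[of v n] by (subst (asm) ennreal_le_iff) auto
   have "en (kn v n)<=en (ym m)+en (\<epsilon>/4 * w (n-l))+en (\<epsilon>/2 * w n)"
    by (rule order_trans[OF upper[of m, folded n(1)]]) (use elim(2) in \<open>auto simp: n(2) ym intro!: add_mono\<close>)
   also have "... = en (ym m+\<epsilon>/4 * w (n-l)+\<epsilon>/2 * w n)"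
    using e wn ym(2)[of m] w_pos[of "n-l"] by (simp add: less_imp_le)
   finally have "kn v n<=ym m+\<epsilon>/4 * w (n-l)+\<epsilon>/2 * w n"
    using e wn ym(2)[of m] w_pos[of "n-l"] by (subst (asm) ennreal_le_iff) auto
   moreover have "\<epsilon>/4 * w (n-l)<=\<epsilon>/4*(2 * w n)" using elim(1) wn e by (intro mult_left_mono) (auto simp: field_simps)
   ultimately have up: "kn v n<=ym m+\<epsilon> * w n" by (simp add: field_simps)
   have "\<bar>kn v n-ym m\<bar> <= \<epsilon> * w n" using lo up by linarith
   then have "\<bar>kn v n-ym m\<bar>/w n<=\<epsilon>" using wn by (simp add: divide_le_eq)
   then show ?case using wn by (simp add: y_def m_def[symmetric] abs_divide[symmetric] diff_divide_distrib[symmetric] abs_of_pos)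
  qed
 qed
 ultimately show ?thesis by blast
qed

lemma ennreal_lap: "en (lap {..0} l n) = (R 0^^n) (E l) 0" if l: "l > 0"
proof -
 have "(R 0^^n) (E l) 0 = (\<integral>\<^sup>+x. E l x \<partial>p n)" by (subst act_p_eq_R_pow[symmetric]) (auto simp: act_def)
 also have "... = (\<integral>\<^sup>+x. en (ex l x) \<partial>p n)"
  by (rule nn_integral_cong_AE, use AE_p in eventually_elim) (simp add: abs_of_nonpos)
 also have "... = en (lap {..0} l n)" unfolding lap_def
 proof (rule nn_integral_eq_integral)
  interpret finite_measure "p n" by (rule finite_measure_kill) simp
  show "integrable (p n) (ex l)" using l by (intro integrable_const_bound[where B = 1]) auto
 qed auto
 finally show ?thesis ..
qed

lemma lap_le_kn:
 assumes v: "v>=1"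
 shows "\<exists>C>0. \<forall>n. \<forall>\<Lambda>\<ge>1. lap {..0} lam n<=(1/\<Lambda>)*(lap {..0} lam n+C * w n)+\<Lambda>^2*(1+v) * kn v n"
proof -
 obtain C where C: "C > 0" "!!n m l. n = m+2 * l ==>
   (R 0^^l) (Z 0 ((R 0^^l) (E lam)) m) 0<=en (C * w n*(\<Sum>k. w (k+l)))" using Z_bound[of 0] by auto
 define S1 where "S1 = (\<Sum>k. w k)"
 have S1: "S1 > 0" unfolding S1_def using summable_w w_pos by (intro suminf_pos) auto
 have "lap {..0} lam n<=(1/\<Lambda>)*(lap {..0} lam n+C * S1 * w n)+\<Lambda>^2*(1+v) * kn v n" if L: "\<Lambda> >= 1" for n \<Lambda>
 proof -
  define K where "K = \<Lambda>^2*(1+v)"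
  have K: "K > 0" using L v by (auto simp: K_def)
  have [measurable]: "(%t. hard 0 t * E lam t) \<in> bmeas borel" by measurable
  have m1: "meas2 (%t a. E lam t)" "meas2 (%t a. E lam t * ennreal a)" unfolding meas2_def by measurable
  have m2: "meas2 (%t a. E lam t+E lam t * ennreal a)" unfolding meas2_def by measurable
  have m3: "meas2 (%t a. en (1/\<Lambda>)*(E lam t+E lam t * ennreal a))" unfolding meas2_def by measurable
  have m4: "meas2 (%t a. ennreal K * f v t a)" unfolding meas2_def f_def fr_def by measurable
  have pt: "hard 0 t * E lam t<=en (1/\<Lambda>)*(E lam t+E lam t * ennreal a)+ennreal K * f v t a" for t a
  proof (cases "t<=0")
   case True
   show ?thesis
   proof (cases "1+a>=\<Lambda>")
    case big: True
    have "exp (lam * t)<=1/\<Lambda>*(exp (lam * t)+exp (lam * t) * a)"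
    proof -
     have "\<Lambda> * exp (lam * t)<=(1+a) * exp (lam * t)" using big by (intro mult_right_mono) auto
     then show ?thesis using L by (simp add: field_simps)
    qed
    then have "E lam t<=en (1/\<Lambda>*(exp (lam * t)+exp (lam * t) * a))" by (rule ennreal_leI)
    also have "... = en (1/\<Lambda>)*(E lam t+E lam t * ennreal a)"
     using big L by (subst ennreal_mult) (auto simp: ennreal_mult[symmetric] add_nonneg_nonneg)
    finally show ?thesis using True by (auto intro: add_increasing2)
   next
    case False
    define x where "x = max 1 a"
    have x: "1<=x" "x<=\<Lambda>" using False L by (auto simp: x_def)
    have "exp t * v<=1 * v" using v True by (intro mult_right_mono) auto
    then have xv: "x+exp t * v<=\<Lambda>+v" using x by simp
    also have "... <= \<Lambda>*(1+v)" using L v mult_right_mono[of 1 \<Lambda> v] by (simp add: algebra_simps)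
    finally have "(x+exp t * v) * x<=(\<Lambda>*(1+v))*\<Lambda>" using x v L by (intro mult_mono) auto
    then have den: "(x+exp t * v) * x<=K" by (simp add: K_def power2_eq_square ac_simps)
    have den0: "0 < (x+exp t * v) * x" using x v by (intro mult_pos_pos add_pos_nonneg) auto
    have "exp (lam * t)*((x+exp t * v) * x)<=exp (lam * t) * K" using den by (intro mult_left_mono) auto
    then have "exp (lam * t)<=K * fr v t a" using den0 by (simp add: fr_def x_def[symmetric] pos_le_divide_eq mult.commute[of K])
    then have "E lam t<=ennreal K * f v t a" unfolding f_def using K by (subst ennreal_mult'[symmetric]) (auto intro: ennreal_leI)
    then show ?thesis using True by (auto intro: add_increasing)
   qed
  qed simp
  have "en (lap {..0} lam n) = (R 0^^n) (%t. hard 0 t * E lam t) 0"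
   unfolding ennreal_lap[OF lam_pos] by (rule R_pow_cong) auto
  also have "... = (Kop (hard 0)^^n) (%t a. hard 0 t * E lam t) 0 0" unfolding Kop_pow_hard_const ..
  also have "... <= (Kop (hard 0)^^n) (%t a. en (1/\<Lambda>)*(E lam t+E lam t * ennreal a)+ennreal K * f v t a) 0 0"
   by (intro Kop_pow_mono pt order_refl)
  also have "... = en (1/\<Lambda>)*((Kop (hard 0)^^n) (%t a. E lam t) 0 0+(Kop (hard 0)^^n) (%t a. E lam t * ennreal a) 0 0)
    + ennreal K*(Kop (hard 0)^^n) (f v) 0 0"
   by (subst Kop_pow_add[OF _ m3 m4], simp, subst Kop_pow_cmult[OF _ m2], simp, subst Kop_pow_add[OF _ m1], simp,
     subst Kop_pow_cmult[OF _ meas2_f]) simp_all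
  also have "... <= en (1/\<Lambda>)*(en (lap {..0} lam n)+en (C * S1 * w n))+ennreal K * en (kn v n)"
  proof (intro add_mono mult_left_mono)
   show "(Kop (hard 0)^^n) (%t a. E lam t) 0 0<=en (lap {..0} lam n)"
    unfolding Kop_pow_hard_const ennreal_lap[OF lam_pos] by simp
   have "(Kop (hard 0)^^n) (%t a. E lam t * ennreal a) 0 0<=ennreal 0*(R 0^^n) (E lam) 0+Z 0 (E lam) n 0"
    by (rule Kop_pow_linear) auto
   also have "... <= en (C * S1 * w n)" using C(2)[of n n 0] by (simp add: S1_def ac_simps)
   finally show "(Kop (hard 0)^^n) (%t a. E lam t * ennreal a) 0 0<=en (C * S1 * w n)" .
   show "(Kop (hard 0)^^n) (f v) 0 0<=en (kn v n)"
    unfolding ennreal_kn[OF v, symmetric] by (intro Kop_pow_mono) (auto simp: indicator_def)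
  qed auto
  also have "... = en (1/\<Lambda>*(lap {..0} lam n+C * S1 * w n)+K * kn v n)"
  proof -
   have nn: "0<=lap {..0} lam n" "0<=C * S1 * w n" "0<=kn v n" "0<=1/\<Lambda>" "0<=K"
    using lap_nonneg C S1 w_pos[of n] kn_nonneg L K by (auto simp: less_imp_le)
   show ?thesis using nn by (simp add: ennreal_mult[symmetric] ennreal_plus[symmetric] del: ennreal_plus)
  qed
  finally show ?thesis
   using lap_nonneg[of "{..0}" lam n] C S1 w_pos[of n] kn_nonneg[of v n] L K
   by (subst (asm) ennreal_le_iff) (auto simp: K_def less_imp_le)
 qed
 then show ?thesis using C(1) S1 by (intro exI[of _ "C * S1"]) auto
qed

theorem kn_limit:
 assumes v: "v>=1"
 shows "\<exists>L>0. (%n. kn v n/w n) ----> L"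
proof -
 have "convergent (%n. kn v n/w n)" by (rule convergent_approx) (rule kn_approx[OF v])
 then obtain L where L: "(%n. kn v n/w n) ----> L" by (auto simp: convergent_def)
 obtain C where C: "C > 0" "!!n \<Lambda>. \<Lambda> >= 1 ==> lap {..0} lam n<=(1/\<Lambda>)*(lap {..0} lam n+C * w n)+\<Lambda>^2*(1+v) * kn v n"
  using lap_le_kn[OF v] by blast
 define u where "u = U lam 0"
 have u: "u > 0" unfolding u_def by (rule U_0_pos[OF lam_pos])
 have lim: "(%n. lap {..0} lam n/w n) ----> u" unfolding u_def by (rule lap_limit[OF lam_pos])
 define \<Lambda> where "\<Lambda> = 2*(u+C)/u"
 have Lam: "\<Lambda> >= 1" using u C by (simp add: \<Lambda>_def field_simps)
 have "u<=(1/\<Lambda>)*(u+C)+\<Lambda>^2*(1+v) * L"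
 proof (rule LIMSEQ_le[OF lim])
  show "(%n. (1/\<Lambda>)*(lap {..0} lam n/w n+C)+\<Lambda>^2*(1+v)*(kn v n/w n)) ----> (1/\<Lambda>)*(u+C)+\<Lambda>^2*(1+v) * L"
   by (intro tendsto_intros lim L)
  show "\<exists>N. \<forall>n\<ge>N. lap {..0} lam n/w n<=(1/\<Lambda>)*(lap {..0} lam n/w n+C)+\<Lambda>^2*(1+v)*(kn v n/w n)"
  proof (intro exI[of _ 0] allI impI)
   fix n
   have "lap {..0} lam n/w n<=((1/\<Lambda>)*(lap {..0} lam n+C * w n)+\<Lambda>^2*(1+v) * kn v n)/w n"
    using C(2)[OF Lam] w_pos[of n] by (intro divide_right_mono) auto
   also have "... = (1/\<Lambda>)*(lap {..0} lam n/w n+C)+\<Lambda>^2*(1+v)*(kn v n/w n)"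
    using w_pos[of n] by (simp add: add_divide_distrib)
   finally show "lap {..0} lam n/w n<=(1/\<Lambda>)*(lap {..0} lam n/w n+C)+\<Lambda>^2*(1+v)*(kn v n/w n)" .
  qed
 qed
 moreover have "(1/\<Lambda>)*(u+C) = u/2" using u C by (simp add: \<Lambda>_def field_simps)
 ultimately have "0 < \<Lambda>^2*(1+v) * L" using u by linarith
 moreover have "0 < \<Lambda>^2*(1+v)" using Lam v by (intro mult_pos_pos) auto
 ultimately have "L > 0" using zero_less_mult_pos by blast
 then show ?thesis using L by blast
qed

end

definition ss :: "nat => real stream => real" where "ss n om = (\<Sum>k<n. om !! k)"

lemma ss_0 [simp]: "ss 0 om = 0" by (simp add: ss_def)

lemma ss_Suc [simp]: "ss (Suc m) (x ## om) = x+ss m om"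
 unfolding ss_def sum.lessThan_Suc_shift by simp

lemma ss_add: "ss (m+j) om = ss m om+ss j (sdrop m om)"
 by (induction j) (simp_all add: ss_def sdrop_snth add.commute)

definition As :: "nat => real stream => real" where "As m om = (\<Sum>j<m. exp (ss j om))"
definition Vs :: "nat => real stream => real" where "Vs i om = (\<Sum>j\<le>i. exp (ss j om))"

lemma As_Suc: "(\<Sum>j<Suc m. exp (t+ss j (x ## om))) = exp t+(\<Sum>j<m. exp (t+x+ss j om))"
 unfolding sum.lessThan_Suc_shift by (simp add: add.assoc)

lemma Vs_ge_1: "Vs i om >= 1"
proof -
 have "exp (ss 0 om)<=Vs i om" unfolding Vs_def by (rule member_le_sum) auto
 then show ?thesis by simp
qed

definition f0 :: "real => real => real => ennreal" where
 "f0 v t a = en (exp t/((max 1 a+exp t * v) * max 1 a))"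

context walk
begin

abbreviation "Str \<equiv> stream_space \<nu>"

lemma snth_measurable [measurable]: "(%om. om !! k) \<in> bmeas Str"
 using measurable_snth[of k \<nu>] by simp

lemma ss_measurable [measurable]: "ss n \<in> bmeas Str" unfolding ss_def[abs_def] by measurable

lemma Vs_measurable [measurable]: "Vs n \<in> bmeas Str" unfolding Vs_def[abs_def] by measurable

lemma stream_Kop:
 assumes h: "meas2 h"
 shows "(\<integral>\<^sup>+om. h (t+ss m om) (a+(\<Sum>j<m. exp (t+ss j om))) \<partial>Str) = (Kop (%_. 1)^^m) h t a"
proof (induction m arbitrary: t a)
 case 0
 interpret S: prob_space Str by (rule prob_space_stream_space)
 show ?case by (simp add: S.emeasure_space_1)
next
 case (Suc m)
 have [measurable]: "(%om. h (t+ss (Suc m) om) (a+(\<Sum>j<Suc m. exp (t+ss j om)))) \<in> bmeas Str"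
  by (rule meas2D[OF h]) measurable
 have "(\<integral>\<^sup>+om. h (t+ss (Suc m) om) (a+(\<Sum>j<Suc m. exp (t+ss j om))) \<partial>Str)
   = (\<integral>\<^sup>+x. \<integral>\<^sup>+om. h (t+x+ss m om) (a+exp t+(\<Sum>j<m. exp (t+x+ss j om))) \<partial>Str \<partial>\<nu>)"
  by (subst nn_integral_stream_space) (auto simp: As_Suc add.assoc simp del: sum.lessThan_Suc)
 also have "... = (Kop (%_. 1)^^Suc m) h t a" unfolding Suc by (simp add: Kop_def[of _ "(Kop _^^_) _" t a])
 finally show ?case .
qed

lemma stream_split:
 "(\<integral>\<^sup>+om. f0 (Vs i (sdrop m om)) (t+ss m om) (a+(\<Sum>j<m. exp (t+ss j om))) \<partial>Str)
  = (\<integral>\<^sup>+om'. \<integral>\<^sup>+om. f0 (Vs i om') (t+ss m om) (a+(\<Sum>j<m. exp (t+ss j om))) \<partial>Str \<partial>Str)"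
proof (induction m arbitrary: t a)
 case 0
 interpret S: prob_space Str by (rule prob_space_stream_space)
 show ?case by (simp add: S.emeasure_space_1)
next
 case (Suc m)
 interpret S: prob_space Str by (rule prob_space_stream_space)
 interpret P: pair_sigma_finite \<nu> Str ..
 have [measurable]: "(%om. Vs i (sdrop k om)) \<in> bmeas Str" for k
  by (rule measurable_compose[OF measurable_sdrop Vs_measurable])
 have m1: "(%om. f0 (Vs i (sdrop (Suc m) om)) (t+ss (Suc m) om) (a+(\<Sum>j<Suc m. exp (t+ss j om)))) \<in> bmeas Str"
  unfolding f0_def by measurable
 have m2: "(%om. f0 v (t+ss (Suc m) om) (a+(\<Sum>j<Suc m. exp (t+ss j om)))) \<in> bmeas Str" for v
  unfolding f0_def by measurable
 have "(\<integral>\<^sup>+om. f0 (Vs i (sdrop (Suc m) om)) (t+ss (Suc m) om) (a+(\<Sum>j<Suc m. exp (t+ss j om))) \<partial>Str)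
  = (\<integral>\<^sup>+x. \<integral>\<^sup>+om. f0 (Vs i (sdrop m om)) (t+x+ss m om) (a+exp t+(\<Sum>j<m. exp (t+x+ss j om))) \<partial>Str \<partial>\<nu>)"
  by (subst nn_integral_stream_space[OF m1]) (simp add: As_Suc add.assoc del: sum.lessThan_Suc)
 also have "... = (\<integral>\<^sup>+x. \<integral>\<^sup>+om'. \<integral>\<^sup>+om. f0 (Vs i om') (t+x+ss m om) (a+exp t+(\<Sum>j<m. exp (t+x+ss j om))) \<partial>Str \<partial>Str \<partial>\<nu>)"
  unfolding Suc ..
 also have "... = (\<integral>\<^sup>+om'. \<integral>\<^sup>+x. \<integral>\<^sup>+om. f0 (Vs i om') (t+x+ss m om) (a+exp t+(\<Sum>j<m. exp (t+x+ss j om))) \<partial>Str \<partial>\<nu> \<partial>Str)"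
  by (rule P.Fubini'[symmetric]) (unfold f0_def, measurable)
 also have "... = (\<integral>\<^sup>+om'. \<integral>\<^sup>+om. f0 (Vs i om') (t+ss (Suc m) om) (a+(\<Sum>j<Suc m. exp (t+ss j om))) \<partial>Str \<partial>Str)"
 proof (intro nn_integral_cong)
  fix om'
  show "(\<integral>\<^sup>+x. \<integral>\<^sup>+om. f0 (Vs i om') (t+x+ss m om) (a+exp t+(\<Sum>j<m. exp (t+x+ss j om))) \<partial>Str \<partial>\<nu>)
   = (\<integral>\<^sup>+om. f0 (Vs i om') (t+ss (Suc m) om) (a+(\<Sum>j<Suc m. exp (t+ss j om))) \<partial>Str)"
   by (subst nn_integral_stream_space[OF m2]) (simp add: As_Suc add.assoc del: sum.lessThan_Suc)
 qed
 finally show ?case .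
qed

lemma meas2_f0: "meas2 (f0 v)" unfolding meas2_def f0_def by measurable

lemma stream_f0:
 assumes m: "m>=1"
 shows "(\<integral>\<^sup>+om. en (exp (ss m om)/((\<Sum>j\<le>m+i. exp (ss j om)) * As m om)) \<partial>Str)
  = (\<integral>\<^sup>+om. (Kop (%_. 1)^^m) (f0 (Vs i om)) 0 0 \<partial>Str)"
proof -
 have "en (exp (ss m om)/((\<Sum>j\<le>m+i. exp (ss j om)) * As m om)) = f0 (Vs i (sdrop m om)) (0+ss m om) (0+(\<Sum>j<m. exp (0+ss j om)))" for om
 proof -
  have "exp (ss 0 om)<=As m om" unfolding As_def by (rule member_le_sum) (use m in auto)
  then have A: "max 1 (As m om) = As m om" by simp
  have "{..m+i} = {..<m} \<union> (%j. m+j) ` {..i}"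
  proof (intro set_eqI iffI)
   fix x assume "x \<in> {..m+i}"
   then show "x \<in> {..<m} \<union> (%j. m+j) ` {..i}" by (cases "x < m") (auto intro!: image_eqI[of _ _ "x-m"])
  qed auto
  then have "(\<Sum>j\<le>m+i. exp (ss j om)) = As m om+(\<Sum>j\<in>(%j. m+j) ` {..i}. exp (ss j om))"
   unfolding As_def by (simp only:) (rule sum.union_disjoint, auto)
  also have "(\<Sum>j\<in>(%j. m+j) ` {..i}. exp (ss j om)) = exp (ss m om) * Vs i (sdrop m om)"
   by (subst sum.reindex) (auto simp: inj_on_def ss_add exp_add Vs_def sum_distrib_left)
  finally show ?thesis unfolding f0_def by (simp add: As_def[symmetric] A)
 qed
 then have "(\<integral>\<^sup>+om. en (exp (ss m om)/((\<Sum>j\<le>m+i. exp (ss j om)) * As m om)) \<partial>Str)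
   = (\<integral>\<^sup>+om. f0 (Vs i (sdrop m om)) (0+ss m om) (0+(\<Sum>j<m. exp (0+ss j om))) \<partial>Str)" by simp
 then show ?thesis unfolding stream_split stream_Kop[OF meas2_f0] .
qed

lemma Kop_act: "(Kop (%_. 1)^^n) (%t a. g t) t a = act (nu n) g t" if [measurable]: "g \<in> bmeas borel"
 using that
proof (induction n arbitrary: g t a)
 case 0
 then show ?case by (simp add: act_def nn_integral_return)
next
 case (Suc n)
 have "(Kop (%_. 1)^^Suc n) (%t a. g t) t a = (Kop (%_. 1)^^n) (Kop (%_. 1) (%t a. g t)) t a" by (simp add: funpow_swap1)
 also have "Kop (%_. 1) (%t a. g t) = (%t a. act \<nu> g t)" by (intro ext) (simp add: Kop_def act_def)
 also have "(Kop (%_. 1)^^n) (%t a. act \<nu> g t) t a = act (nu n) (act \<nu> g) t" by (rule Suc.IH) (use Suc.prems in simp)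
 also have "... = act (nu (Suc n)) g t" unfolding nu_Suc by (rule act_convolution[symmetric]) (use Suc.prems in \<open>auto simp del: kill.simps\<close>)
 finally show ?case .
qed

end

lemma Kop_tilt:
 assumes "real_distribution \<nu>0" "real_distribution \<nu>" and g: "\<gamma> > 0"
  and d: "\<nu> = density \<nu>0 (%x. en (exp (\<beta> * x)/\<gamma>))" and h: "meas2 h"
 shows "(walk.Kop \<nu> (%_. 1)^^m) (%t a. en (exp (- \<beta> * t)) * h t a) t a
   = en (exp (- \<beta> * t)/\<gamma>^m)*(walk.Kop \<nu>0 (%_. 1)^^m) h t a"
proof -
 interpret w0: walk \<nu>0 using assms(1) by (simp add: walk_def)
 interpret w1: walk \<nu> using assms(2) by (simp add: walk_def)
 show ?thesis
 proof (induction m arbitrary: t a)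
  case (Suc m)
  let ?h = "(w0.Kop (%_. 1)^^m) h"
  have mh: "meas2 ?h" by (rule w0.meas2_Kop_pow[OF _ h]) simp
  have [measurable]: "(%x. ?h (t+x) (a+exp t)) \<in> bmeas borel" by (rule meas2D[OF mh]) auto
  have "(w1.Kop (%_. 1)^^Suc m) (%t a. en (exp (- \<beta> * t)) * h t a) t a
    = (\<integral>\<^sup>+x. en (exp (- \<beta>*(t+x))/\<gamma>^m)*?h (t+x) (a+exp t) \<partial>\<nu>)"
   unfolding funpow.simps o_def w1.Kop_def[of _ _ t a] Suc by simp
  also have "... = (\<integral>\<^sup>+x. en (exp (\<beta> * x)/\<gamma>)*(en (exp (- \<beta>*(t+x))/\<gamma>^m)*?h (t+x) (a+exp t)) \<partial>\<nu>0)"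
   unfolding d by (rule nn_integral_density) auto
  also have "... = (\<integral>\<^sup>+x. en (exp (- \<beta> * t)/\<gamma>^Suc m)*?h (t+x) (a+exp t) \<partial>\<nu>0)"
  proof (intro nn_integral_cong)
   fix x
   have "exp (\<beta> * x)/\<gamma>*(exp (- \<beta>*(t+x))/\<gamma>^m) = exp (- \<beta> * t)/\<gamma>^Suc m"
    using g by (simp add: field_simps exp_add[symmetric])
   then show "en (exp (\<beta> * x)/\<gamma>)*(en (exp (- \<beta>*(t+x))/\<gamma>^m)*?h (t+x) (a+exp t))
     = en (exp (- \<beta> * t)/\<gamma>^Suc m)*?h (t+x) (a+exp t)"
    using g by (simp add: mult.assoc[symmetric] ennreal_mult[symmetric])
  qed
  also have "... = en (exp (- \<beta> * t)/\<gamma>^Suc m)*(w0.Kop (%_. 1)^^Suc m) h t a"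
   by (subst nn_integral_cmult) (auto simp: w0.Kop_def[of _ ?h])
  finally show ?case .
 qed simp
qed

context bpire
begin

definition \<nu>0 :: "real measure" where "\<nu>0 = distr M borel (X F 1)"

lemma X_measurable: assumes n: "n>=1" shows "X F n \<in> bmeas M"
proof -
 note [measurable] = env_M[OF measure_F_measurable[OF n]]
 show ?thesis unfolding X_def[abs_def] mean_offspring_def by measurable
qed

lemma S_measurable [measurable]: "S F j \<in> bmeas M"
 unfolding S_def[abs_def] by (rule borel_measurable_sum) (auto intro: X_measurable)

lemma nu0_dist: "real_distribution \<nu>0"
 unfolding \<nu>0_def using X_measurable[of 1] by (simp add: real_distribution_distr)

lemma X_law: assumes n: "n>=1" shows "distr M borel (X F n) = \<nu>0" and "indep_vars (%_. borel) (X F) {1..}"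
proof -
 have mm [measurable]: "(%f. measure f {j}) \<in> bmeas offspring_laws" for j
 proof -
  have "(%f. measure f {j}) \<in> bmeas (subprob_algebra (count_space UNIV))" by (rule measurable_measure_subprob_algebra) simp
  then show ?thesis unfolding prob_algebra_def by (rule measurable_restrict_space1)
 qed
 have L: "(%f. ln (mean_offspring f)) \<in> bmeas offspring_laws" unfolding mean_offspring_def by measurable
 have e: "distr M borel (X F k) = distr (distr M offspring_laws (F k)) borel (%f. ln (mean_offspring f))" if "k>=1" for k
  by (subst distr_distr[OF L F_measurable[OF that]]) (simp add: X_def[abs_def] comp_def)
 show "distr M borel (X F n) = \<nu>0" unfolding \<nu>0_def e[OF n] e[OF order_refl] env_ident[OF n] ..
 show "indep_vars (%_. borel) (X F) {1..}"
  using indep_vars_compose2[OF env_indep, of "%_ f. ln (mean_offspring f)" "%_. borel"] L by (simp add: X_def[abs_def])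
qed

lemma stream_law:
 assumes \<Psi>: "\<Psi> \<in> bmeas (PiM {..<n} (%_. borel))"
 shows "(\<integral>\<^sup>+om. \<Psi> (\<lambda>j\<in>{..<n}. X F (n-j) om) \<partial>M) = (\<integral>\<^sup>+om. \<Psi> (\<lambda>j\<in>{..<n}. om !! j) \<partial>stream_space \<nu>0)"
proof -
 interpret w0: walk \<nu>0 using nu0_dist by (simp add: walk_def)
 interpret S0: prob_space "stream_space \<nu>0" by (rule w0.prob_space_stream_space)
 show ?thesis
 proof (cases "n = 0")
  case True
  have "restrict x {} = (%_. undefined)" for x :: "nat => real" by (auto simp: restrict_def)
  then show ?thesis by (simp add: True emeasure_space_1 S0.emeasure_space_1)
 next
  case False
  let ?P = "PiM {..<n} (%_. \<nu>0)" and ?K = "PiM {1..n} (%_. \<nu>0)"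
  have sK: "sets ?K = sets (PiM {1..n} (%_. borel))" and sP: "sets ?P = sets (PiM {..<n} (%_. borel :: real measure))"
   by (rule sets_PiM_cong; simp)+
  have iv: "indep_vars (%_. borel) (X F) {1..n}" by (rule indep_vars_subset[OF X_law(2)[of 1]]) auto
  have XK: "(%om. \<lambda>i\<in>{1..n}. X F i om) \<in> measurable M (PiM {1..n} (%_. borel))"
   by (rule measurable_restrict) (auto intro: X_measurable)
  have "distr M (PiM {1..n} (%_. borel)) (%om. \<lambda>i\<in>{1..n}. X F i om) = PiM {1..n} (%i. distr M borel (X F i))"
   using iv False by (subst (asm) indep_vars_iff_distr_eq_PiM') (auto intro: X_measurable)
  also have "... = ?K" by (rule PiM_cong) (auto simp: X_law)
  finally have dK: "distr M ?K (%om. \<lambda>i\<in>{1..n}. X F i om) = ?K" using sK by (simp cong: distr_cong)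
  have XK': "(%om. \<lambda>i\<in>{1..n}. X F i om) \<in> measurable M ?K" using XK measurable_cong_sets[OF refl sK] by blast
  have r1: "distr ?K ?P (%om. \<lambda>j\<in>{..<n}. om (n-j)) = ?P"
   by (rule distr_PiM_reindex[where M = "%_. \<nu>0" and f = "%j. n-j"]) (auto simp: inj_on_def w0.prob_space_axioms)
  have rm: "(%om. \<lambda>j\<in>{..<n}. om (n-j)) \<in> measurable ?K ?P"
   by (rule measurable_restrict) (rule measurable_component_singleton, auto)
  have "distr M ?P (%om. \<lambda>j\<in>{..<n}. X F (n-j) om) = distr (distr M ?K (%om. \<lambda>i\<in>{1..n}. X F i om)) ?P (%om. \<lambda>j\<in>{..<n}. om (n-j))"
   by (subst distr_distr[OF rm XK']) (auto intro!: distr_cong simp: fun_eq_iff restrict_def)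
  then have 1: "distr M ?P (%om. \<lambda>j\<in>{..<n}. X F (n-j) om) = ?P" unfolding dK r1 .
  have r2: "distr (PiM UNIV (%_. \<nu>0)) ?P (%om. \<lambda>j\<in>{..<n}. om j) = ?P"
   using distr_PiM_reindex[where M = "%_. \<nu>0" and f = "%j. j" and K = UNIV and I = "{..<n}"] by (simp add: w0.prob_space_axioms)
  have sm: "(%om. \<lambda>j\<in>{..<n}. om !! j) \<in> measurable (stream_space \<nu>0) ?P"
   by (rule measurable_restrict) (rule measurable_snth)
  have "distr (stream_space \<nu>0) ?P (%om. \<lambda>j\<in>{..<n}. om !! j)
    = distr (distr (PiM UNIV (%_. \<nu>0)) (stream_space \<nu>0) to_stream) ?P (%om. \<lambda>j\<in>{..<n}. om !! j)"
   unfolding stream_space_eq_distr[symmetric] ..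
  also have "... = distr (PiM UNIV (%_. \<nu>0)) ?P (%om. \<lambda>j\<in>{..<n}. om j)"
  proof -
   have "(\<lambda>j\<in>{..<n}. to_stream x !! j) = (\<lambda>j\<in>{..<n}. x j)" for x :: "nat => real" by (auto simp: restrict_def to_stream_def)
   then show ?thesis by (subst distr_distr[OF sm measurable_to_stream]) (simp add: comp_def)
  qed
  finally have 2: "distr (stream_space \<nu>0) ?P (%om. \<lambda>j\<in>{..<n}. om !! j) = ?P" unfolding r2 .
  have \<Psi>': "\<Psi> \<in> bmeas ?P" using \<Psi> measurable_cong_sets[OF sP refl] by blast
  have Xm: "(%om. \<lambda>j\<in>{..<n}. X F (n-j) om) \<in> measurable M ?P"
  proof (rule measurable_restrict)
   fix j assume "j \<in> {..<n}"
   then show "X F (n-j) \<in> measurable M \<nu>0" using X_measurable[of "n-j"] by simp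
  qed
  have "(\<integral>\<^sup>+om. \<Psi> (\<lambda>j\<in>{..<n}. X F (n-j) om) \<partial>M) = (\<integral>\<^sup>+x. \<Psi> x \<partial>?P)"
   by (subst 1[symmetric], subst nn_integral_distr[OF Xm]) (use \<Psi>' in auto)
  also have "... = (\<integral>\<^sup>+om. \<Psi> (\<lambda>j\<in>{..<n}. om !! j) \<partial>stream_space \<nu>0)"
   by (subst 2[symmetric], subst nn_integral_distr[OF sm]) (use \<Psi>' in auto)
  finally show ?thesis .
 qed
qed

lemma rev_walk: "j<=n ==> (\<Sum>k<j. X F (n-k) om) = S F n om - S F (n-j) om"
proof (induction j)
 case (Suc j)
 then obtain i where "n-j = Suc i" by (cases "n-j") auto
 moreover have "n-Suc j = i" using calculation Suc.prems by simp
 ultimately show ?case using Suc S_Suc[of i om] by simp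
qed simp

lemma only_clan_stream:
 assumes geo: "AE om in M. geometric_law (F 1 om)" and i: "i < n"
 shows "emeasure M (only_clan_survives M \<xi> i n) = (\<integral>\<^sup>+om. (walk.Kop \<nu>0 (%_. 1)^^(n-i)) (f0 (Vs i om)) 0 0 \<partial>stream_space \<nu>0)"
proof -
 interpret w0: walk \<nu>0 using nu0_dist by (simp add: walk_def)
 define m where "m = n-i"
 define sx :: "(nat => real) => nat => real" where "sx x j = (\<Sum>k<j. x k)" for x j
 define \<Psi> where "\<Psi> x = en (exp (sx x m)/((\<Sum>j\<le>n. exp (sx x j))*(\<Sum>j<m. exp (sx x j))))" for x
 have sxm: "(%x. sx x j) \<in> bmeas (PiM {..<n} (%_. borel))" if "j<=n" for j
  unfolding sx_def by (rule borel_measurable_sum) (rule measurable_component_singleton, use that in auto)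
 have \<Psi>: "\<Psi> \<in> bmeas (PiM {..<n} (%_. borel))"
  unfolding \<Psi>_def[abs_def]
  by (intro measurable_compose[OF _ measurable_ennreal] borel_measurable_divide borel_measurable_times borel_measurable_sum
    measurable_compose[OF sxm borel_measurable_exp]) (auto simp: m_def)
 have "exp (- S F i om - S F n om)/(Bs n 0 om * Bs n (Suc i) om) = exp (sx x m)/((\<Sum>j\<le>n. exp (sx x j))*(\<Sum>j<m. exp (sx x j)))"
  if x: "x = (\<lambda>j\<in>{..<n}. X F (n-j) om)" for om x
 proof -
  have sx: "sx x j = S F n om - S F (n-j) om" if "j<=n" for j
   unfolding rev_walk[OF that, symmetric] sx_def x using that by (intro sum.cong) auto
  have B: "Bs n l om = exp (- S F n om)*(\<Sum>j\<le>n-l. exp (sx x j))" if "l<=n" for l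
  proof -
   have "(\<Sum>j\<le>n-l. exp (sx x j)) = (\<Sum>j\<le>n-l. exp (S F n om) * exp (- S F (n-j) om))"
    by (intro sum.cong) (auto simp: sx exp_diff exp_minus divide_inverse)
   also have "... = (\<Sum>j=l..n. exp (S F n om) * exp (- S F j om))"
    by (rule sum.reindex_bij_witness[of _ "%j. n-j" "%j. n-j"]) (use that in auto)
   finally show ?thesis by (simp add: Bs_def sum_distrib_left[symmetric] exp_minus)
  qed
  have nm: "n-Suc i = m-1" "{..m-1} = {..<m}" using i by (auto simp: m_def)
  have "exp (- S F i om - S F n om) = exp (- S F n om) * exp (- S F n om) * exp (sx x m)"
   using sx[of m] i by (simp add: m_def exp_add[symmetric])
  moreover have "Bs n 0 om * Bs n (Suc i) om = exp (- S F n om) * exp (- S F n om)*((\<Sum>j\<le>n. exp (sx x j))*(\<Sum>j<m. exp (sx x j)))"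
   using B[of 0] B[of "Suc i"] i unfolding nm by (simp only: diff_zero ac_simps le0 Suc_leI)
  ultimately show ?thesis by (simp only: mult_divide_mult_cancel_left_if) simp
 qed
 then have "emeasure M (only_clan_survives M \<xi> i n) = (\<integral>\<^sup>+om. \<Psi> (\<lambda>j\<in>{..<n}. X F (n-j) om) \<partial>M)"
  unfolding prob_only_clan(1)[OF geo i] \<Psi>_def by (intro nn_integral_cong) (rule arg_cong[where f = ennreal], simp only:)
 also have "... = (\<integral>\<^sup>+om. \<Psi> (\<lambda>j\<in>{..<n}. om !! j) \<partial>stream_space \<nu>0)" by (rule stream_law[OF \<Psi>])
 also have "... = (\<integral>\<^sup>+om. en (exp (ss m om)/((\<Sum>j\<le>m+i. exp (ss j om)) * As m om)) \<partial>stream_space \<nu>0)"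
 proof (intro nn_integral_cong)
  fix om
  have "sx (\<lambda>j\<in>{..<n}. om !! j) j = ss j om" if "j<=n" for j
   unfolding sx_def ss_def using that by (intro sum.cong) auto
  moreover have "m+i = n" "m<=n" using i by (auto simp: m_def)
  ultimately show "\<Psi> (\<lambda>j\<in>{..<n}. om !! j) = en (exp (ss m om)/((\<Sum>j\<le>m+i. exp (ss j om)) * As m om))"
   unfolding \<Psi>_def As_def by simp
 qed
 also have "... = (\<integral>\<^sup>+om. (w0.Kop (%_. 1)^^m) (f0 (Vs i om)) 0 0 \<partial>stream_space \<nu>0)"
  by (rule w0.stream_f0) (use i in \<open>simp add: m_def\<close>)
 finally show ?thesis unfolding m_def .
qed

lemma tilted_law:
 assumes g: "\<gamma> > 0" and nu: "real_distribution \<nu>" and d: "\<nu> = density \<nu>0 (%x. en (exp (\<beta> * x)/\<gamma>))"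
 shows "distr (tilted M F \<beta> \<gamma> n) borel (S F n) = kill \<nu> UNIV n"
proof -
 interpret w0: walk \<nu>0 using nu0_dist by (simp add: walk_def)
 interpret w1: walk \<nu> using nu by (simp add: walk_def)
 show ?thesis
 proof (rule measure_eqI)
  fix A assume "A \<in> sets (distr (tilted M F \<beta> \<gamma> n) borel (S F n))"
  then have A [measurable]: "A \<in> sets borel" by simp
  define h :: "real => real => ennreal" where "h t a = en (exp (\<beta> * t)) * indicator A t" for t a
  have mh: "meas2 h" unfolding meas2_def h_def by measurable
  have sm [measurable]: "(%x::nat => real. \<Sum>k<n. x k) \<in> bmeas (PiM {..<n} (%_. borel))"
   by (rule borel_measurable_sum) (rule measurable_component_singleton, auto)
  have S: "S F n \<in> measurable (tilted M F \<beta> \<gamma> n) borel" unfolding tilted_def by simp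
  have "emeasure (distr (tilted M F \<beta> \<gamma> n) borel (S F n)) A = (\<integral>\<^sup>+om. indicator A (S F n om) \<partial>tilted M F \<beta> \<gamma> n)"
   by (subst nn_integral_distr[OF S, symmetric]) auto
  also have "... = (\<integral>\<^sup>+om. en (exp (\<beta> * S F n om)/\<gamma>^n) * indicator A (S F n om) \<partial>M)"
   unfolding tilted_def by (rule nn_integral_density) auto
  also have "... = (\<integral>\<^sup>+om. (%x. en (exp (\<beta>*(\<Sum>k<n. x k))/\<gamma>^n) * indicator A (\<Sum>k<n. x k)) (\<lambda>j\<in>{..<n}. X F (n-j) om) \<partial>M)"
   by (intro nn_integral_cong) (use rev_walk[OF order_refl, of n] in \<open>simp add: S_def\<close>)
  also have "... = (\<integral>\<^sup>+om. (%x. en (exp (\<beta>*(\<Sum>k<n. x k))/\<gamma>^n) * indicator A (\<Sum>k<n. x k)) (\<lambda>j\<in>{..<n}. om !! j) \<partial>stream_space \<nu>0)"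
   by (rule stream_law) measurable
  also have "... = (\<integral>\<^sup>+om. en (1/\<gamma>^n) * h (0+ss n om) (0+(\<Sum>j<n. exp (0+ss j om))) \<partial>stream_space \<nu>0)"
   using g by (intro nn_integral_cong) (simp add: h_def ss_def ennreal_mult[symmetric] mult.assoc[symmetric])
  also have "... = en (1/\<gamma>^n)*(w0.Kop (%_. 1)^^n) h 0 0"
   unfolding w0.stream_Kop[OF mh, symmetric] by (rule nn_integral_cmult) (rule meas2D[OF mh], auto)
  also have "... = (w1.Kop (%_. 1)^^n) (%t a. en (exp (- \<beta> * t)) * h t a) 0 0"
   unfolding Kop_tilt[OF nu0_dist nu g d mh] by simp
  also have "(%t a. en (exp (- \<beta> * t)) * h t a) = (%t a. indicator A t)"
   by (intro ext) (simp add: h_def mult.assoc[symmetric] ennreal_mult[symmetric] exp_add[symmetric])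
  also have "(w1.Kop (%_. 1)^^n) (%t a. indicator A t) 0 0 = act (kill \<nu> UNIV n) (indicator A) 0" by (rule w1.Kop_act) simp
  also have "... = emeasure (kill \<nu> UNIV n) A"
   unfolding act_def using w1.sets_kill[of UNIV n] by (simp del: kill.simps)
  finally show "emeasure (distr (tilted M F \<beta> \<gamma> n) borel (S F n)) A = emeasure (kill \<nu> UNIV n) A" .
 qed (simp del: kill.simps)
qed

end

lemma (in prob_space) expectation_pos:
 assumes "integrable M f" "!!x. f x > (0::real)"
 shows "expectation f > 0"
proof -
 have "expectation f>=0" using assms(2) by (intro Bochner_Integration.integral_nonneg) (auto simp: less_imp_le)
 moreover have "expectation f ~= 0"
 proof
  assume "expectation f = 0"
  then have "AE x in M. f x = 0" using integral_nonneg_eq_0_iff_AE[OF assms(1)] assms(2) by (auto simp: less_imp_le)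
  then have "AE x in M. False" using assms(2) by (auto simp: less_imp_neq[symmetric])
  then show False by simp
 qed
 ultimately show ?thesis by simp
qed

lemma (in prob_space) averaged_limits:
 fixes V :: "nat => 'a => real" and k :: "nat => real => real"
 assumes V [measurable]: "!!i. V i \<in> bmeas M" "V' \<in> bmeas M"
  and conv: "AE x in M. (%i. V i x) ----> V' x"
  and k: "!!m v. 0 < k m v" "!!m v. k m v<=C" "!!m v v'. \<bar>k m v-k m v'\<bar> <= C*\<bar>v-v'\<bar>"
  and G: "!!v. (%m. k m v) ----> G v" "!!v. G v > 0"
 shows "\<exists>r>0. (%i. \<integral>x. k m (V i x) \<partial>M) ----> r"
  and "\<exists>r>0. (%m. \<integral>x. k m (V i x) \<partial>M) ----> r"
  and "\<exists>r>0. \<forall>e>0. \<exists>n. \<forall>i\<ge>n. \<forall>m\<ge>n. \<bar>(\<integral>x. k m (V i x) \<partial>M)-r\<bar> < e"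
proof -
 have C: "C>=0" using k(1)[of 0 0] k(2)[of 0 0] by linarith
 have kl: "(%i. k m (u i)) ----> k m u'" if "u ----> u'" for m u u'
 proof (rule metric_tendsto_imp_tendsto[where f = "%i. C*\<bar>u i-u'\<bar>" and a = 0 and F = sequentially])
  have "(%i. C*\<bar>u i-u'\<bar>) ----> C*\<bar>u'-u'\<bar>" by (intro tendsto_intros that)
  then show "(%i. C*\<bar>u i-u'\<bar>) ----> 0" by simp
  show "\<forall>\<^sub>F i in sequentially. dist (k m (u i)) (k m u')<=dist (C*\<bar>u i-u'\<bar>) 0"
   using k(3) C by (auto simp: dist_real_def abs_mult)
 qed
 have "isCont (k m) v" for m v unfolding continuous_at_sequentially o_def using kl by auto
 then have km [measurable]: "k m \<in> bmeas borel" for m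
  by (intro borel_measurable_continuous_onI) (simp add: continuous_at_imp_continuous_on)
 have Gm [measurable]: "G \<in> bmeas borel" by (rule borel_measurable_LIMSEQ_real[OF G(1) km])
 have Gb: "G v<=C" for v by (rule LIMSEQ_le_const2[OF G(1)]) (use k(2) in auto)
 have ki: "integrable M (%x. k m (u x))" if [measurable]: "u \<in> bmeas M" for m u
  by (rule integrable_const_bound[where B = C]) (use k(1,2) in \<open>auto simp: abs_of_pos\<close>)
 have Gi: "integrable M (%x. G (u x))" if [measurable]: "u \<in> bmeas M" for u
  by (rule integrable_const_bound[where B = C]) (use G(2) Gb in \<open>auto simp: abs_of_pos\<close>)
 have mlim: "(%m. \<integral>x. k m (u x) \<partial>M) ----> (\<integral>x. G (u x) \<partial>M)" if [measurable]: "u \<in> bmeas M" for u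
  by (rule integral_dominated_convergence[where w = "%_. C"]) (use k(1,2) G(1) in \<open>auto simp: abs_of_pos\<close>)
 have "(%i. \<integral>x. k m (V i x) \<partial>M) ----> (\<integral>x. k m (V' x) \<partial>M)"
 proof (rule integral_dominated_convergence[where w = "%_. C"])
  show "AE x in M. (%i. k m (V i x)) ----> k m (V' x)" using conv by eventually_elim (rule kl)
 qed (use k(1,2) in \<open>auto simp: abs_of_pos\<close>)
 then show "\<exists>r>0. (%i. \<integral>x. k m (V i x) \<partial>M) ----> r" using expectation_pos[OF ki[OF V(2)] k(1)] by blast
 show "\<exists>r>0. (%m. \<integral>x. k m (V i x) \<partial>M) ----> r" using mlim[OF V(1)] expectation_pos[OF Gi[OF V(1)] G(2)] by blast
 define r where "r = (\<integral>x. G (V' x) \<partial>M)"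
 define \<delta> where "\<delta> i = (\<integral>x. min C (C*\<bar>V i x-V' x\<bar>) \<partial>M)" for i
 have di: "integrable M (%x. min C (C*\<bar>V i x-V' x\<bar>))" for i
  by (rule integrable_const_bound[where B = C]) (use C in auto)
 have "\<delta> ----> (\<integral>x. 0 \<partial>M)" unfolding \<delta>_def
 proof (rule integral_dominated_convergence[where w = "%_. C"])
  show "AE x in M. (%i. min C (C*\<bar>V i x-V' x\<bar>)) ----> 0" using conv
  proof eventually_elim
   case (elim x)
   have "(%i. min C (C*\<bar>V i x-V' x\<bar>)) ----> min C (C*\<bar>V' x-V' x\<bar>)" by (intro tendsto_intros elim)
   then show ?case using C by simp
  qed
 qed (use C in auto)
 then have d0: "\<delta> ----> 0" by simp
 have bd: "\<bar>(\<integral>x. k m (V i x) \<partial>M)-(\<integral>x. k m (V' x) \<partial>M)\<bar> <= \<delta> i" for i m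
 proof -
  have "\<bar>(\<integral>x. k m (V i x) \<partial>M)-(\<integral>x. k m (V' x) \<partial>M)\<bar> = \<bar>\<integral>x. k m (V i x)-k m (V' x) \<partial>M\<bar>"
   by (subst Bochner_Integration.integral_diff) (auto intro: ki)
  also have "... <= (\<integral>x. \<bar>k m (V i x)-k m (V' x)\<bar> \<partial>M)" by (rule integral_abs_bound)
  also have "... <= \<delta> i" unfolding \<delta>_def
  proof (rule integral_mono[OF _ di])
   show "integrable M (%x. \<bar>k m (V i x)-k m (V' x)\<bar>)" by (intro integrable_abs Bochner_Integration.integrable_diff ki V)
   fix x
   show "\<bar>k m (V i x)-k m (V' x)\<bar> <= min C (C*\<bar>V i x-V' x\<bar>)"
    using k(1)[of m "V i x"] k(1)[of m "V' x"] k(2)[of m "V i x"] k(2)[of m "V' x"] k(3)[of m "V i x" "V' x"] by (intro min.boundedI) linarith+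
  qed
  finally show ?thesis .
 qed
 have "\<exists>n. \<forall>i\<ge>n. \<forall>m\<ge>n. \<bar>(\<integral>x. k m (V i x) \<partial>M)-r\<bar> < e" if e: "e > 0" for e
 proof -
  have "eventually (%m. \<bar>(\<integral>x. k m (V' x) \<partial>M)-r\<bar> < e/2) sequentially"
   using tendstoD[OF mlim[OF V(2)], of "e/2"] e by (simp add: dist_real_def r_def)
  then obtain n1 where n1: "!!m. m>=n1 ==> \<bar>(\<integral>x. k m (V' x) \<partial>M)-r\<bar> < e/2" by (auto simp: eventually_sequentially)
  have "eventually (%i. \<delta> i < e/2) sequentially" by (rule order_tendstoD(2)[OF d0]) (use e in simp)
  then obtain n2 where n2: "!!i. i>=n2 ==> \<delta> i < e/2" by (auto simp: eventually_sequentially)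
  have "\<bar>(\<integral>x. k m (V i x) \<partial>M)-r\<bar> < e" if "i>=max n1 n2" "m>=max n1 n2" for i m
  proof -
   have "m>=n1" "i>=n2" using that by auto
   then show ?thesis using bd[of m i] n1[of m] n2[of i] by linarith
  qed
  then show ?thesis by blast
 qed
 moreover have "r > 0" unfolding r_def by (rule expectation_pos[OF Gi[OF V(2)] G(2)])
 ultimately show "\<exists>r>0. \<forall>e>0. \<exists>n. \<forall>i\<ge>n. \<forall>m\<ge>n. \<bar>(\<integral>x. k m (V i x) \<partial>M)-r\<bar> < e" by blast
qed

context weak
begin

lemma kn_antimono:
 assumes v: "1<=v" "v<=v'" shows "kn v' n<=kn v n" "kn v n<=kn v' n+(v'-v) * kn 1 n"
proof -
 have fr: "fr v' t a<=fr v t a" "fr v t a<=fr v' t a+(v'-v) * fr 1 t a" for t a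
 proof -
  define x where "x = max 1 a"
  have x: "x>=1" by (simp add: x_def)
  have e: "exp t > 0" by simp
  have p: "x+exp t * v > 0" "x+exp t * v' > 0" "x+exp t*1 > 0" using x v by (auto intro!: add_pos_nonneg)
  have ee: "exp t * v<=exp t * v'" "exp t*1<=exp t * v" using v by (intro mult_left_mono; simp)+
  show 1: "fr v' t a<=fr v t a" unfolding fr_def x_def[symmetric] by (intro divide_left_mono mult_right_mono mult_pos_pos) (use p ee x in \<open>(linarith | simp)\<close>)+
  have "1/(x+exp t * v)-1/(x+exp t * v') = (exp t/(x+exp t * v'))*(v'-v)*(1/(x+exp t * v))"
   using p by (simp add: divide_simps) (simp add: algebra_simps)
  also have "... <= 1*(v'-v)*(1/(x+exp t*1))"
  proof (intro mult_mono)
   have "exp t<=x+exp t * v'" using ee x by linarith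
   then show "exp t/(x+exp t * v')<=1" using p by (simp add: divide_le_eq_1)
   show "1/(x+exp t * v)<=1/(x+exp t*1)" by (intro divide_left_mono mult_pos_pos) (use p ee in \<open>(linarith | simp)\<close>)+
  qed (use p v in \<open>auto intro!: divide_nonneg_pos\<close>)
  finally have "1/(x+exp t * v)<=1/(x+exp t * v')+(v'-v)*(1/(x+exp t*1))" by simp
  then have "exp (lam * t)/x*(1/(x+exp t * v))<=exp (lam * t)/x*(1/(x+exp t * v')+(v'-v)*(1/(x+exp t*1)))"
   using x by (intro mult_left_mono) auto
  moreover have "fr u t a = exp (lam * t)/x*(1/(x+exp t * u))" for u by (simp add: fr_def x_def[symmetric] mult.commute)
  ultimately show "fr v t a<=fr v' t a+(v'-v) * fr 1 t a" by (simp only: distrib_left mult.left_commute)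
 qed
 have v': "v'>=1" using v by simp
 have "(Kop (%_. 1)^^n) (f v') 0 0<=(Kop (%_. 1)^^n) (f v) 0 0"
  by (intro Kop_pow_mono order_refl) (simp add: f_def ennreal_leI fr)
 then show "kn v' n<=kn v n" unfolding ennreal_kn[OF v(1)] ennreal_kn[OF v'] using kn_nonneg by (simp add: ennreal_le_iff)
 have m: "meas2 (%t a. en (v'-v) * f 1 t a)" unfolding meas2_def f_def fr_def by measurable
 have "(Kop (%_. 1)^^n) (f v) 0 0<=(Kop (%_. 1)^^n) (%t a. f v' t a+en (v'-v) * f 1 t a) 0 0"
 proof (intro Kop_pow_mono order_refl)
  fix t a
  have "en (fr v t a)<=en (fr v' t a+(v'-v) * fr 1 t a)" by (rule ennreal_leI) (rule fr)
  also have "... = f v' t a+en (v'-v) * f 1 t a"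
   using v fr_bounds(1)[OF v', of t a] fr_bounds(1)[of 1 t a] by (simp add: f_def ennreal_mult less_imp_le)
  finally show "f v t a<=f v' t a+en (v'-v) * f 1 t a" by (simp add: f_def)
 qed
 also have "... = (Kop (%_. 1)^^n) (f v') 0 0+en (v'-v)*(Kop (%_. 1)^^n) (f 1) 0 0"
  by (subst Kop_pow_add[OF _ meas2_f m], simp, subst Kop_pow_cmult[OF _ meas2_f]) simp_all
 also have "... = en (kn v' n+(v'-v) * kn 1 n)"
  unfolding ennreal_kn[OF v'] ennreal_kn[OF order_refl] using v kn_nonneg by (simp add: ennreal_mult)
 finally show "kn v n<=kn v' n+(v'-v) * kn 1 n"
  unfolding ennreal_kn[OF v(1)] using v kn_nonneg[of v' n] kn_nonneg[of 1 n] by (subst (asm) ennreal_le_iff) auto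
qed

lemma kn_pos: assumes v: "v>=1" shows "kn v n > 0"
proof -
 have "(Kop (%_. 1)^^n) (f v) t a > 0" for t a
 proof (induction n arbitrary: t a)
  case 0
  show ?case using fr_bounds(1)[OF v] by (simp add: f_def)
 next
  case (Suc n)
  have m [measurable]: "(%x. (Kop (%_. 1)^^n) (f v) (t+x) (a+exp t)) \<in> bmeas \<nu>"
   by (rule meas2D[OF meas2_Kop_pow[OF _ meas2_f]]) auto
  have "(\<integral>\<^sup>+x. (Kop (%_. 1)^^n) (f v) (t+x) (a+exp t) \<partial>\<nu>) ~= 0"
  proof
   assume "(\<integral>\<^sup>+x. (Kop (%_. 1)^^n) (f v) (t+x) (a+exp t) \<partial>\<nu>) = 0"
   then have "AE x in \<nu>. (Kop (%_. 1)^^n) (f v) (t+x) (a+exp t) = 0" by (subst (asm) nn_integral_0_iff_AE) auto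
   then have "AE x in \<nu>. False" using Suc by (auto simp: less_imp_neq[symmetric])
   then show False by simp
  qed
  then show ?case by (simp add: Kop_def[of _ "(Kop _^^n) _" t a] zero_less_iff_neq_zero)
 qed
 from this[of 0 0] show ?thesis unfolding ennreal_kn[OF v] by (simp add: kn_nonneg order.strict_iff_order)
qed

lemma kn_averaged:
 assumes Q: "prob_space Q" and V: "!!i. V i \<in> bmeas Q" "V' \<in> bmeas Q" "AE x in Q. (%i. V i x) ----> V' x"
  and V1: "!!i x. V i x>=1"
 shows "\<exists>r>0. (%i. \<integral>x. kn (V i x) m/w m \<partial>Q) ----> r"
  and "\<exists>r>0. (%m. \<integral>x. kn (V i x) m/w m \<partial>Q) ----> r"
  and "\<exists>r>0. \<forall>e>0. \<exists>n. \<forall>i\<ge>n. \<forall>m\<ge>n. \<bar>(\<integral>x. kn (V i x) m/w m \<partial>Q)-r\<bar> < e"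
proof -
 define k where "k m v = kn (max 1 v) m/w m" for m v
 have "\<exists>L>0. (%m. k m v) ----> L" for v unfolding k_def by (rule kn_limit) simp
 then obtain G where G: "!!v. G v > 0" "!!v. (%m. k m v) ----> G v" by metis
 have "Bseq (%m. k m 1)" using G(2)[of 1] by (auto intro!: convergent_imp_Bseq simp: convergent_def)
 then obtain C where "!!m. norm (k m 1)<=C" by (auto simp: Bseq_def)
 then have C: "k m 1<=C" for m by (metis abs_le_D1 real_norm_def)
 have k0: "0 < k m v" for m v unfolding k_def using kn_pos w_pos by simp
 have k1: "k m v<=C" for m v
  by (rule order_trans[OF _ C[of m]]) (auto simp: k_def intro!: divide_right_mono kn_antimono less_imp_le[OF w_pos])
 have lip: "k m v<=k m v'+C*(v'-v)" if "v<=v'" for m v v'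
 proof -
  have "kn (max 1 v) m<=kn (max 1 v') m+(max 1 v'-max 1 v) * kn 1 m" by (rule kn_antimono(2)) (use that in auto)
  also have "... <= kn (max 1 v') m+(v'-v) * kn 1 m" using that kn_nonneg by (intro add_left_mono mult_right_mono) auto
  finally have "k m v<=(kn (max 1 v') m+(v'-v) * kn 1 m)/w m" unfolding k_def using w_pos[of m] by (intro divide_right_mono) auto
  also have "... = k m v'+(v'-v) * k m 1" by (simp add: k_def add_divide_distrib)
  also have "... <= k m v'+(v'-v) * C" using that C by (intro add_left_mono mult_left_mono) auto
  finally show ?thesis by (simp add: mult.commute)
 qed
 have mono: "k m v'<=k m v" if "v<=v'" for m v v'
  unfolding k_def using that by (intro divide_right_mono kn_antimono less_imp_le[OF w_pos]) auto
 have k2: "\<bar>k m v-k m v'\<bar> <= C*\<bar>v-v'\<bar>" for m v v'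
  using lip[of v v' m] lip[of v' v m] mono[of v v' m] mono[of v' v m] by (cases "v<=v'") (auto simp: abs_if)
 have eq: "kn (V i x) m/w m = k m (V i x)" for i x m using V1[of i x] by (simp add: k_def max_def)
 interpret Q: prob_space Q by (rule Q)
 note A = Q.averaged_limits[where k = k, OF V k0 k1 k2 G(2,1), folded eq]
 show "\<exists>r>0. (%i. \<integral>x. kn (V i x) m/w m \<partial>Q) ----> r" by (rule A(1))
 show "\<exists>r>0. (%m. \<integral>x. kn (V i x) m/w m \<partial>Q) ----> r" by (rule A(2))
 show "\<exists>r>0. \<forall>e>0. \<exists>n. \<forall>i\<ge>n. \<forall>m\<ge>n. \<bar>(\<integral>x. kn (V i x) m/w m \<partial>Q)-r\<bar> < e" by (rule A(3))
qed

end

lemma exp_tilt_ge: "exp u*(1-u)<=(1::real)" "exp u*(1-u) = 1 ==> u = 0"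
proof -
 have e: "exp u*(1-u) = (1-u)/exp (- u)" by (simp add: exp_minus field_simps)
 show "exp u*(1-u)<=1" unfolding e using exp_ge_add_one_self[of "- u"] by (simp add: divide_le_eq)
 assume "exp u*(1-u) = 1"
 then have "exp (- u) = 1-u" unfolding e by (simp add: divide_eq_1_iff)
 then have "ln (exp (- u)) = exp (- u)-1" using ln_exp[of "- u"] by linarith
 then have "exp (- u) = 1" by (intro ln_eq_minus_one) auto
 then show "u = 0" by simp
qed

context bpire
begin

lemma gamma_facts:
 assumes mean: "integrable M (X F 1)" "(\<integral>om. X F 1 om \<partial>M) < 0" and b: "0 < \<beta>"
  and bx: "integrable M (%om. X F 1 om * exp (\<beta> * X F 1 om))" "(\<integral>om. X F 1 om * exp (\<beta> * X F 1 om) \<partial>M) = 0"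
  and g: "\<gamma> = (\<integral>om. exp (\<beta> * X F 1 om) \<partial>M)"
 shows "integrable M (%om. exp (\<beta> * X F 1 om))" "0 < \<gamma>" "\<gamma> < 1"
proof -
 have X1 [measurable]: "X F 1 \<in> bmeas M" by (rule X_measurable) simp
 note [measurable] = X1[unfolded One_nat_def]
 show int: "integrable M (%om. exp (\<beta> * X F 1 om))"
 proof (rule Bochner_Integration.integrable_bound)
  show "integrable M (%om. exp \<beta>+\<bar>X F 1 om * exp (\<beta> * X F 1 om)\<bar>)" using bx(1) by auto
  have "norm (exp (\<beta> * x))<=norm (exp \<beta>+\<bar>x * exp (\<beta> * x)\<bar>)" for x
  proof (cases "x<=1")
   case True
   then have "exp (\<beta> * x)<=exp \<beta>" using b mult_left_mono[of x 1 \<beta>] by simp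
   then have "exp (\<beta> * x)<=exp \<beta>+\<bar>x * exp (\<beta> * x)\<bar>" by linarith
   then show ?thesis by simp
  next
   case False
   then have "1 * exp (\<beta> * x)<=x * exp (\<beta> * x)" by (intro mult_right_mono) auto
   then have "exp (\<beta> * x)<=exp \<beta>+\<bar>x * exp (\<beta> * x)\<bar>" using exp_ge_zero[of \<beta>] by linarith
   then show ?thesis by simp
  qed
  then show "AE om in M. norm (exp (\<beta> * X F 1 om))<=norm (exp \<beta>+\<bar>X F 1 om * exp (\<beta> * X F 1 om)\<bar>)" by blast
 qed measurable
 show "0 < \<gamma>" unfolding g by (rule expectation_pos[OF int]) simp
 define \<phi> where "\<phi> om = 1-exp (\<beta> * X F 1 om)+\<beta>*(X F 1 om * exp (\<beta> * X F 1 om))" for om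
 have phi: "\<phi> om = 1-exp (\<beta> * X F 1 om)*(1-\<beta> * X F 1 om)" for om by (simp add: \<phi>_def algebra_simps)
 have pi: "integrable M \<phi>" unfolding \<phi>_def using int bx(1) by auto
 have p0: "\<phi> om >= 0" for om unfolding phi using exp_tilt_ge(1) by simp
 have pe: "(\<integral>om. \<phi> om \<partial>M) = 1-\<gamma>" unfolding \<phi>_def using int bx by (simp add: g prob_space)
 have "\<gamma> ~= 1"
 proof
  assume "\<gamma> = 1"
  then have "AE om in M. \<phi> om = 0" using integral_nonneg_eq_0_iff_AE[OF pi] p0 pe by simp
  then have "AE om in M. X F 1 om = 0"
  proof eventually_elim
   case (elim om)
   then have "\<beta> * X F 1 om = 0" unfolding phi by (intro exp_tilt_ge(2)) simp
   then show ?case using b by simp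
  qed
  then have "(\<integral>om. X F 1 om \<partial>M) = (\<integral>om. 0 \<partial>M)" by (intro integral_cong_AE) auto
  then show False using mean(2) by simp
 qed
 moreover have "1-\<gamma> >= 0" unfolding pe[symmetric] by (rule Bochner_Integration.integral_nonneg) (rule p0)
 ultimately show "\<gamma> < 1" by simp
qed

end

lemma (in walk) stream_summable:
 assumes b: "0 < b" "b < 1" and g: "0<=g" "g < 1" and e: "(\<integral>\<^sup>+x. en (exp (b * x)) \<partial>\<nu>) = ennreal g"
 shows "AE om in Str. (%i. Vs i om) ----> (\<Sum>j. exp (ss j om))"
proof -
 have K: "(Kop (%_. 1)^^j) (%t a. en (exp (b * t))) t a = en (g^j * exp (b * t))" for j t a
 proof (induction j arbitrary: t a)
  case (Suc j)
  have "(Kop (%_. 1)^^Suc j) (%t a. en (exp (b * t))) t a = (\<integral>\<^sup>+x. en (g^j * exp (b*(t+x))) \<partial>\<nu>)"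
   unfolding funpow.simps o_def Kop_def[of _ _ t a] Suc by simp
  also have "... = (\<integral>\<^sup>+x. en (g^j * exp (b * t)) * en (exp (b * x)) \<partial>\<nu>)"
   using g by (simp add: ennreal_mult[symmetric] distrib_left exp_add mult.assoc)
  also have "... = en (g^j * exp (b * t)) * ennreal g" by (subst nn_integral_cmult) (auto simp: e)
  also have "... = en (g^Suc j * exp (b * t))" using g by (simp add: ennreal_mult[symmetric] ac_simps)
  finally show ?case .
 qed simp
 have m2: "meas2 (%t a. en (exp (b * t)))" unfolding meas2_def by measurable
 have "(\<integral>\<^sup>+om. en (exp (b * ss j om)) \<partial>Str) = en (g^j)" for j
  using stream_Kop[OF m2, of 0 j 0] K[of j 0 0] by simp
 then have "(\<integral>\<^sup>+om. (\<Sum>j. en (exp (b * ss j om))) \<partial>Str) = (\<Sum>j. en (g^j))" by (subst nn_integral_suminf) auto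
 also have "... = en (1/(1-g))" using g by (intro sums_unique[symmetric] sums_ennreal[THEN iffD2] geometric_sums) auto
 finally have "(\<integral>\<^sup>+om. (\<Sum>j. en (exp (b * ss j om))) \<partial>Str) ~= \<infinity>" by simp
 then have "AE om in Str. (\<Sum>j. en (exp (b * ss j om))) ~= \<infinity>" by (intro nn_integral_PInf_AE) measurable
 then show ?thesis
 proof eventually_elim
  case (elim om)
  have sm: "summable (%j. exp (b * ss j om))" by (rule summable_suminf_not_top) (use elim in auto)
  have "eventually (%j. exp (b * ss j om) < 1) sequentially" by (rule order_tendstoD(2)[OF summable_LIMSEQ_zero[OF sm]]) simp
  then have "eventually (%j. norm (exp (ss j om))<=exp (b * ss j om)) sequentially"
  proof eventually_elim
   case (elim j)
   then have "b * ss j om < 0" by simp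
   then have "ss j om < 0" using b by (simp add: mult_less_0_iff)
   then have "1 * ss j om <= b * ss j om" using b by (intro mult_right_mono_neg) auto
   then show ?case by simp
  qed
  then have "summable (%j. exp (ss j om))" by (rule summable_comparison_test_ev[OF _ sm])
  then show ?case unfolding Vs_def by (rule summable_LIMSEQ')
 qed
qed

theorem theorem3:
  fixes M :: "'w measure"
    and F :: "nat \<Rightarrow> 'w \<Rightarrow> nat measure"
    and \<xi> :: "nat \<Rightarrow> nat \<Rightarrow> 'w \<Rightarrow> nat"
    and \<alpha> \<beta> \<gamma> :: real
    and \<mu> :: "real measure"
    and c :: "nat \<Rightarrow> real"
    and l\<^sub>1 :: "real \<Rightarrow> real"
  assumes bpire: "bpire M F \<xi>"
    and geometric: "AE \<omega> in M. geometric_law (F 1 \<omega>)"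
    and mean: "integrable M (X F 1)" "(\<integral>\<omega>. X F 1 \<omega> \<partial>M) < 0"
    and beta: "0 < \<beta>" "\<beta> < 1"
      "integrable M (\<lambda>\<omega>. X F 1 \<omega> * exp (\<beta> * X F 1 \<omega>))"
      "(\<integral>\<omega>. X F 1 \<omega> * exp (\<beta> * X F 1 \<omega>) \<partial>M) = 0"
    and gamma: "\<gamma> = (\<integral>\<omega>. exp (\<beta> * X F 1 \<omega>) \<partial>M)"
    and nonlattice: "nonlattice (distr (tilted M F \<beta> \<gamma> 1) borel (X F 1))"
    and alpha: "1 < \<alpha>" "\<alpha> \<le> 2"
    and stable: "stable_law \<alpha> \<mu>" "two_sided \<mu>"
    and attraction: "in_domain_of_attraction (distr (tilted M F \<beta> \<gamma> 1) borel (X F 1)) \<mu>"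
    and c_pos: "\<And>n. n \<ge> 1 \<Longrightarrow> c n > 0"
    and c_incr: "mono_on {1..} c"
    and c_form: "slowly_varying l\<^sub>1" "\<And>n. n \<ge> 1 \<Longrightarrow> c n = real n powr (1 / \<alpha>) * l\<^sub>1 (real n)"
    and c_conv: "weak_conv_m (\<lambda>n. distr (tilted M F \<beta> \<gamma> n) borel (\<lambda>\<omega>. S F n \<omega> / c n)) \<mu>"
  shows "(\<forall>N\<ge>1. \<exists>r>0.
            (\<lambda>n. measure M (only_clan_survives M \<xi> (n - N) n)) \<longlonglongrightarrow> r)
       \<and> (\<forall>i. \<exists>R\<^sub>i>0.
            (\<lambda>n. inverse (\<gamma> ^ (n - i)) * real (n - i) * c (n - i)
                   * measure M (only_clan_survives M \<xi> i n)) \<longlonglongrightarrow> R\<^sub>i)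
       \<and> (\<exists>R>0.
            ((\<lambda>(i, n). inverse (\<gamma> ^ (n - i)) * real (n - i) * c (n - i)
                   * measure M (only_clan_survives M \<xi> i n)) \<longlongrightarrow> R)
            (filtercomap (\<lambda>(i, n). min i (n - i)) at_top))"
proof -
 interpret bpire M F \<xi> by (rule bpire)
 note g = gamma_facts[OF mean beta(1,3,4) gamma]
 have X1 [measurable]: "X F 1 \<in> bmeas M" by (rule X_measurable) simp
 note [measurable] = X1[unfolded One_nat_def]
 interpret w0: walk \<nu>0 using nu0_dist by (simp add: walk_def)
 define \<nu> where "\<nu> = density \<nu>0 (%x. en (exp (\<beta> * x)/\<gamma>))"
 have e0: "(\<integral>\<^sup>+x. en (exp (\<beta> * x)) \<partial>\<nu>0) = ennreal \<gamma>"
  unfolding \<nu>0_def gamma by (subst nn_integral_distr) (auto intro!: nn_integral_eq_integral g(1)[unfolded One_nat_def])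
 have nu_eq: "\<nu> = distr (tilted M F \<beta> \<gamma> 1) borel (X F 1)"
  unfolding \<nu>_def \<nu>0_def tilted_def by (subst density_distr) (auto simp: S_def)
 have nu_dist: "real_distribution \<nu>"
 proof (intro real_distribution.intro real_distribution_axioms.intro prob_spaceI)
  have "emeasure \<nu> (space \<nu>) = (\<integral>\<^sup>+x. en (1/\<gamma>) * en (exp (\<beta> * x)) \<partial>\<nu>0)"
   unfolding \<nu>_def using g(2) by (subst emeasure_density) (auto intro!: nn_integral_cong simp: ennreal_mult[symmetric])
  also have "... = 1" using g(2) by (subst nn_integral_cmult) (auto simp: e0 ennreal_mult[symmetric])
  finally show "emeasure \<nu> (space \<nu>) = 1" .
 qed (simp_all add: \<nu>_def)
 have walk: "walk \<nu>" using nu_dist by (simp add: walk_def)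
 have mu: "real_distribution \<mu>" using stable(1) by (simp add: stable_law_def)
 have norming: "norming c (1/\<alpha>)"
 proof (rule norming.intro)
  show "c m<=c n" if "1<=m" "m<=n" for m n by (rule mono_onD[OF c_incr]) (use that in auto)
  fix k :: nat assume k: "k>=1"
  have "((%x. l\<^sub>1 (real k * x)/l\<^sub>1 x) \<longlongrightarrow> 1) at_top" using c_form(1) k by (simp add: slowly_varying_def)
  from tendsto_mult[OF tendsto_const[of "real k powr (1/\<alpha>)"] filterlim_compose[OF this filterlim_real_sequentially]]
  have "(%n. real k powr (1/\<alpha>)*(l\<^sub>1 (real k * real n)/l\<^sub>1 (real n))) ----> real k powr (1/\<alpha>)" by simp
  then show "(%n. c (k * n) / c n) ----> real k powr (1/\<alpha>)"
  proof (rule Lim_transform_eventually)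
   show "eventually (%n. real k powr (1/\<alpha>)*(l\<^sub>1 (real k * real n)/l\<^sub>1 (real n)) = c (k * n) / c n) sequentially"
   proof (rule eventually_sequentiallyI[of 1])
    fix n :: nat assume n: "n>=1"
    have kn: "k * n>=1" using k n by (simp add: Suc_le_eq)
    show "real k powr (1/\<alpha>)*(l\<^sub>1 (real k * real n)/l\<^sub>1 (real n)) = c (k * n) / c n"
     unfolding c_form(2)[OF n] c_form(2)[OF kn] using n by (simp add: powr_mult)
   qed
  qed
 qed (use c_pos alpha in auto)
 have nonlattice': "nonlattice \<nu>" using nonlattice by (simp add: nu_eq)
 have conv': "weak_conv_m (%n. distr (kill \<nu> UNIV n) borel (%x. x / c n)) \<mu>"
 proof -
  have "distr (kill \<nu> UNIV n) borel (%x. x / c n) = distr (tilted M F \<beta> \<gamma> n) borel (%om. S F n om / c n)" for n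
   unfolding tilted_law[OF g(2) nu_dist \<nu>_def, symmetric] by (subst distr_distr) (auto simp: tilted_def comp_def)
  then show ?thesis using c_conv by simp
 qed
 have att: "attracted \<nu> c (1/\<alpha>) \<mu>"
  by (intro attracted.intro attracted_axioms.intro walk norming mu nonlattice' stable(2) conv')
 have mom: "(\<integral>\<^sup>+x. en (exp (- \<beta> * x)) \<partial>\<nu>) < \<top>"
 proof -
  have "(\<integral>\<^sup>+x. en (exp (- \<beta> * x)) \<partial>\<nu>) = (\<integral>\<^sup>+x. en (exp (\<beta> * x)/\<gamma>) * en (exp (- \<beta> * x)) \<partial>\<nu>0)"
   unfolding \<nu>_def by (rule nn_integral_density) auto
  also have "... = (\<integral>\<^sup>+x. en (1/\<gamma>) \<partial>\<nu>0)"
   using g(2) by (intro nn_integral_cong) (simp add: ennreal_mult[symmetric] exp_minus)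
  also have "... < \<top>" using w0.emeasure_space_1 by simp
  finally show ?thesis .
 qed
 have "weak \<nu> c (1/\<alpha>) \<mu> \<beta>" by (intro weak.intro weak_axioms.intro att beta mom)
 then interpret wk: weak \<nu> c "1/\<alpha>" \<mu> \<beta> .
 let ?Q = "stream_space \<nu>0"
 interpret Q: prob_space ?Q by (rule w0.prob_space_stream_space)
 define J where "J i m = (\<integral>om. wk.kn (Vs i om) m/wk.w m \<partial>?Q)" for i m
 have P: "measure M (only_clan_survives M \<xi> i n) = \<gamma>^(n-i) * wk.w (n-i) * J i (n-i)" if i: "i < n" for i n
 proof -
  define m where "m = n-i"
  have K: "(w0.Kop (%_. 1)^^m) (f0 v) 0 0 = en (\<gamma>^m * wk.kn v m)" if v: "v>=1" for v
  proof -
   have "wk.f v = (%t a. en (exp (- \<beta> * t)) * f0 v t a)"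
    unfolding wk.f_def[abs_def] wk.fr_def f0_def by (simp add: ennreal_mult'[symmetric] exp_add[symmetric] algebra_simps)
   then have "en (wk.kn v m) = en (exp (- \<beta>*0)/\<gamma>^m)*(w0.Kop (%_. 1)^^m) (f0 v) 0 0"
    unfolding wk.ennreal_kn[OF v, symmetric] using Kop_tilt[OF nu0_dist nu_dist g(2) \<nu>_def w0.meas2_f0, of m v 0 0] by simp
   then have "en (\<gamma>^m * wk.kn v m) = en (\<gamma>^m)*(en (1/\<gamma>^m)*(w0.Kop (%_. 1)^^m) (f0 v) 0 0)"
    using g(2) by (simp add: ennreal_mult wk.kn_nonneg)
   also have "... = (w0.Kop (%_. 1)^^m) (f0 v) 0 0"
    using g(2) by (simp add: mult.assoc[symmetric] ennreal_mult[symmetric])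
   finally show ?thesis ..
  qed
  have "mono (%v. - wk.kn (max 1 v) m)" by (intro monoI) (auto intro!: wk.kn_antimono)
  from borel_measurable_uminus[OF borel_measurable_mono[OF this]]
  have [measurable]: "(%v. wk.kn (max 1 v) m) \<in> bmeas borel" by simp
  have "(%om. wk.kn (max 1 (Vs i om)) m) \<in> bmeas ?Q" by measurable
  then have [measurable]: "(%om. wk.kn (Vs i om) m) \<in> bmeas ?Q" by (simp add: max_absorb2 Vs_ge_1)
  have "emeasure M (only_clan_survives M \<xi> i n) = (\<integral>\<^sup>+om. en (\<gamma>^m * wk.kn (Vs i om) m) \<partial>?Q)"
   unfolding only_clan_stream[OF geometric i] m_def[symmetric] K[OF Vs_ge_1] ..
  then have "measure M (only_clan_survives M \<xi> i n) = (\<integral>om. \<gamma>^m * wk.kn (Vs i om) m \<partial>?Q)"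
   unfolding measure_def using g(2) wk.kn_nonneg by (subst integral_eq_nn_integral) auto
  also have "... = (\<integral>om. \<gamma>^m * wk.w m*(wk.kn (Vs i om) m/wk.w m) \<partial>?Q)"
   using wk.w_pos[of m] by simp
  also have "... = \<gamma>^m * wk.w m * J i m" unfolding J_def by simp
  finally show ?thesis unfolding m_def .
 qed
 have scaled: "inverse (\<gamma>^(n-i)) * real (n-i) * c (n-i) * measure M (only_clan_survives M \<xi> i n) = J i (n-i)" if i: "i < n" for i n
 proof -
  have w: "wk.w (n-i) = 1/(real (n-i) * c (n-i))" by (rule wk.w_eq) (use i in simp)
  have "c (n-i) > 0" "real (n-i) > 0" using c_pos[of "n-i"] i by auto
  then show ?thesis unfolding P[OF i] w using g(2) by simp
 qed
 have V': "(%om. \<Sum>j. exp (ss j om)) \<in> bmeas ?Q" by measurable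
 note A = wk.kn_averaged[OF Q.prob_space_axioms w0.Vs_measurable V' w0.stream_summable[OF beta(1,2) less_imp_le[OF g(2)] g(3) e0] Vs_ge_1, folded J_def]
 show ?thesis
 proof (intro conjI allI impI)
  fix N :: nat assume N: "N>=1"
  obtain r where r: "r > 0" "(%i. J i N) ----> r" using A(1) by blast
  have "(%n. \<gamma>^N * wk.w N * J (n-N) N) ----> \<gamma>^N * wk.w N * r"
   by (intro tendsto_mult tendsto_const filterlim_compose[OF r(2) filterlim_minus_const_nat_at_top])
  then have "(%n. measure M (only_clan_survives M \<xi> (n-N) n)) ----> \<gamma>^N * wk.w N * r"
  proof (rule Lim_transform_eventually)
   show "eventually (%n. \<gamma>^N * wk.w N * J (n-N) N = measure M (only_clan_survives M \<xi> (n-N) n)) sequentially"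
    by (rule eventually_sequentiallyI[of N]) (use N in \<open>simp add: P\<close>)
  qed
  moreover have "\<gamma>^N * wk.w N * r > 0" using g(2) wk.w_pos[of N] r(1) by simp
  ultimately show "\<exists>r>0. (%n. measure M (only_clan_survives M \<xi> (n-N) n)) ----> r" by blast
 next
  fix i
  obtain r where r: "r > 0" "(%m. J i m) ----> r" using A(2) by blast
  have "(%n. inverse (\<gamma>^(n-i)) * real (n-i) * c (n-i) * measure M (only_clan_survives M \<xi> i n)) ----> r"
  proof (rule Lim_transform_eventually[OF filterlim_compose[OF r(2) filterlim_minus_const_nat_at_top[of i]]])
   show "eventually (%n. J i (n-i) = inverse (\<gamma>^(n-i)) * real (n-i) * c (n-i) * measure M (only_clan_survives M \<xi> i n)) sequentially"
    by (rule eventually_sequentiallyI[of "Suc i"]) (simp only: scaled Suc_le_eq)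
  qed
  then show "\<exists>R\<^sub>i>0. (%n. inverse (\<gamma>^(n-i)) * real (n-i) * c (n-i) * measure M (only_clan_survives M \<xi> i n)) ----> R\<^sub>i"
   using r(1) by blast
 next
  obtain r where r: "r > 0" "!!e. e > 0 ==> \<exists>n. \<forall>i\<ge>n. \<forall>m\<ge>n. \<bar>J i m-r\<bar> < e" using A(3) by blast
  have "((%(i, n). inverse (\<gamma>^(n-i)) * real (n-i) * c (n-i) * measure M (only_clan_survives M \<xi> i n)) \<longlongrightarrow> r)
      (filtercomap (%(i, n). min i (n-i)) at_top)"
  proof (rule tendstoI)
   fix e :: real assume "e > 0"
   then obtain n0 where n0: "!!i m. i>=n0 ==> m>=n0 ==> \<bar>J i m-r\<bar> < e" using r(2) by blast
   show "eventually (%x. dist (case x of (i, n) => inverse (\<gamma>^(n-i)) * real (n-i) * c (n-i) * measure M (only_clan_survives M \<xi> i n)) r < e)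
     (filtercomap (%(i, n). min i (n-i)) at_top)"
    unfolding eventually_filtercomap_at_top_linorder
   proof (intro exI[of _ "max n0 1"] allI impI)
    fix x :: "nat \<times> nat" assume x: "max n0 1<=(case x of (i, n) => min i (n-i))"
    obtain i n where [simp]: "x = (i, n)" by (cases x)
    have "i < n" "n0<=i" "n0<=n-i" using x by auto
    then show "dist (case x of (i, n) => inverse (\<gamma>^(n-i)) * real (n-i) * c (n-i) * measure M (only_clan_survives M \<xi> i n)) r < e"
     using scaled[of i n] n0[of i "n-i"] by (simp add: dist_real_def)
   qed
  qed
  then show "\<exists>R>0. ((%(i, n). inverse (\<gamma>^(n-i)) * real (n-i) * c (n-i) * measure M (only_clan_survives M \<xi> i n)) \<longlongrightarrow> R)
      (filtercomap (%(i, n). min i (n-i)) at_top)" using r(1) by blast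
 qed
qed

end
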